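(* Consider the sequence of $n$-server queueing systems described in the context, and assume the following. (1a) $\lambda^n/n\to\lambda$ for some $\lambda\in[0,\infty)$, and $\bar E^n\Rightarrow \lambda\,\cdot$ (the path $t\mapsto\lambda t$) in $D([0,\infty),\mathbb{R}_+)$. (1b) There is a probability measure $\nu$ on $\mathbb{R}_+$ with a bounded, Lipschitz continuous density $g:\mathbb{R}_+\to\mathbb{R}_+$ such that $\nu^n\to\nu$ weakly as $n\to\infty$. (1c) $(\bar{\mathcal{Z}}^n_0,\bar Q^n_0)\Rightarrow(\mathcal{Z}_0,Q_0)$ in $\mathcal{M}\times\mathbb{R}_+$, where $(\mathcal{Z}_0,Q_0)$ is a deterministic element of $\mathcal{M}\times\mathbb{R}_+$ and the function $F(x)=\mathcal{Z}_0([x,\infty))$ is Lipschitz continuous on $\mathbb{R}_+$. (2) There is a bounded, Lipschitz continuous map $k:\mathbb{R}_+\to\mathbb{R}_+$ such that $k^n\to k$ uniformly on compact subsets of $\mathbb{R}_+$. Let $G^c(x)=1-\nu([0,x])$. Then, as $n\to\infty$, $(\bar{\mathcal{Z}}^n,\bar Q^n)\Rightarrow(\mathcal{Z},Q)$ in $D([0,\infty),\mathcal{M}\times\mathbb{R}_+)$, where $(\mathcal{Z},Q)$ is the unique (deterministic) element of $D([0,\infty),\mathcal{M}\times\mathbb{R}_+)$ with initial value $(\mathcal{Z}_0,Q_0)$ satisfying: (i) for all $t\ge 0$, writing $Z_t=\mathcal{Z}_t((0,\infty))$ and $X_t=Q_t+Z_t$, one has $Q_t=[X_t-1]^+$; (ii)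 for all $t\ge 0$ and $x\ge 0$, $$\mathcal{Z}_t([x,\infty))=F(x+S(0,t))+\int_0^tG^c(x+S(s,t))\,dB_s,$$ where $S(s,t)=\int_s^tk(X_u)\,du$ and $B_t=\lambda t-Q_t$ (the integral being a Lebesgue–Stieltjes integral, $B$ being of locally bounded variation).
   Context: Notation. $\mathbb{R}_+=[0,\infty)$, $a^+=\max(a,0)$. $\mathcal{M}$ is the set of non-negative finite Borel measures on $[0,\infty)$ with the topology of weak convergence, metrized by the Prohorov metric $\rho(\mu_1,\mu_2)=\inf\{\epsilon>0:\mu_1(A)\le\mu_2(A^\epsilon)+\epsilon,\ \mu_2(A)\le\mu_1(A^\epsilon)+\epsilon\text{ for all closed }A\subset[0,\infty)\}$, where $A^\epsilon=\{x\ge0:\inf_{a\in A}|x-a|<\epsilon\}$. For a Polish space $E$, $D([0,\infty),E)$ is the space of right-continuous functions with left limits, with the Skorohod $J_1$ topology; $\Rightarrow$ is convergence in distribution. Model. For each $n$, all random variables are defined on a probability space $(\Omega_n,\mathcal{F}_n,\mathbb{P}_n)$. The $n$-th system has $n$ identical servers, served first-come-first-served, work conserving (all servers are busy whenever there is a queue), with no abandonment; customers leave on completing service. Customers arrive according to a renewal process $E^n_t$ with mean inter-arrival time $1/\lambda^n$, $\lambda^n>0$. Service requirements $\{v^n_i\}_{i=-\infty}^{\infty}$ are positive i.i.d. random variables with law $\nu^n$. $X^n_t$ is the number of customers in the system at time $t$, $Q^n_t$ the number waiting in the queue, and $\bar X^n_t=X^n_t/n$. At time $t$ every server works at rate $k^n(\bar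 X^n_t)$, where $k^n:\mathbb{R}_+\to\mathbb{R}_+$ is bounded and Borel measurable. Customers present at time $0$ have indices $-X^n_0+1,\dots,0$; those in service at time $0$ are $i=-X^n_0+1,\dots,-Q^n_0$, with (random) remaining service requirements $\tilde v^n_i$, and those in the queue at time $0$ are $i=-Q^n_0+1,\dots,0$, with requirements $v^n_i$; the $i$-th arrival after time $0$ has index $i\ge1$. Let $B^n_t=E^n_t-Q^n_t$ (so $B^n_t+1$ is the index of the customer at the head of the queue), $\tau^n_i$ the time at which customer $i$ starts service, and $S^n(s,t)=\int_s^tk^n(\bar X^n_u)\,du$. The measure $\mathcal{Z}^n_t$ counts customers in service by remaining service requirement: for Borel $C\subset(0,\infty)$, $$\mathcal{Z}^n_t(C)=\sum_{i=-X^n_0+1}^{-Q^n_0}\delta_{\tilde v^n_i}(C+S^n(0,t))+\sum_{i=-Q^n_0+1}^{B^n_t}\delta_{v^n_i}(C+S^n(\tau^n_i,t)),$$ and $\mathcal{Z}^n_t(\{0\})=0$. With $Z^n_t=\mathcal{Z}^n_t((0,\infty))$ one has $X^n_t=Q^n_t+Z^n_t$ and $Q^n_t=[X^n_t-n]^+$ for all $t\ge0$. Fluid scaling: $\bar{\mathcal{Z}}^n_t=\frac1n\mathcal{Z}^n_t$, $\bar Q^n_t=\frac1nQ^n_t$, $\bar Z^n_t=\frac1nZ^n_t$, $\bar E^n_t=\frac1nE^n_t$. *)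

theory Defs
  imports "HOL-Probability.Probability"
begin

section \<open>Finite measures on the half-line\<close>

text \<open>A measure on \<open>[0,\<infinity>)\<close> is represented by the Borel measure on the real line that gives no
  mass to the negative numbers.\<close>

definition halfline_measures :: "real measure set" where
  "halfline_measures = {\<mu>. finite_borel_measure \<mu> \<and> measure \<mu> {..<0} = 0}"

text \<open>The \<open>\<epsilon>\<close>-neighbourhood is written with an existential quantifier rather than
  \<^const>\<open>infdist\<close>, because \<open>infdist x {} = 0\<close>.\<close>

definition halfline_nbhd :: "real set \<Rightarrow> real \<Rightarrow> real set" where
  "halfline_nbhd A \<epsilon> = {x. 0 \<le> x \<and> (\<exists>a\<in>A. \<bar>x - a\<bar> < \<epsilon>)}"

definition prohorov_dist :: "real measure \<Rightarrow> real measure \<Rightarrow> real" where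
  "prohorov_dist \<mu> \<mu>' =
     Inf {\<epsilon>. 0 < \<epsilon> \<and> (\<forall>A. closed A \<and> A \<subseteq> {0..} \<longrightarrow>
            measure \<mu> A \<le> measure \<mu>' (halfline_nbhd A \<epsilon>) + \<epsilon> \<and>
            measure \<mu>' A \<le> measure \<mu> (halfline_nbhd A \<epsilon>) + \<epsilon>)}"

definition state_space :: "(real measure \<times> real) set" where
  "state_space = halfline_measures \<times> {0..}"

definition state_dist :: "real measure \<times> real \<Rightarrow> real measure \<times> real \<Rightarrow> real" where
  "state_dist = prod_dist prohorov_dist dist"


section \<open>Skorohod space\<close>

text \<open>Paths indexed by \<open>[0,\<infinity>)\<close> with values in the metric space \<open>(S, r)\<close>; as elements of
  \<^const>\<open>PiE\<close> they are \<^const>\<open>undefined\<close> at negative times.\<close>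

definition cadlag_paths :: "'a set \<Rightarrow> ('a \<Rightarrow> 'a \<Rightarrow> real) \<Rightarrow> (real \<Rightarrow> 'a) set" where
  "cadlag_paths S r =
     {x \<in> {0..} \<rightarrow>\<^sub>E S.
        (\<forall>t\<ge>0. limitin (Metric_space.mtopology S r) x (x t) (at_right t)) \<and>
        (\<forall>t>0. \<exists>l. limitin (Metric_space.mtopology S r) x l (at_left t))}"

text \<open>The topology \<open>J\<^sub>1\<close> is given by the metric of Ethier and Kurtz (Markov Processes,
  Section 3.5), whose time changes have bounded logarithmic slopes.\<close>

definition log_slopes :: "(real \<Rightarrow> real) \<Rightarrow> real set" where
  "log_slopes l = {\<bar>ln ((l t - l s) / (t - s))\<bar> | s t. 0 \<le> s \<and> s < t}"

definition time_changes :: "(real \<Rightarrow> real) set" where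
  "time_changes = {l. strict_mono_on {0..} l \<and> l ` {0..} = {0..} \<and> bdd_above (log_slopes l)}"

definition stopped_dist ::
  "('a \<Rightarrow> 'a \<Rightarrow> real) \<Rightarrow> (real \<Rightarrow> 'a) \<Rightarrow> (real \<Rightarrow> 'a) \<Rightarrow> (real \<Rightarrow> real) \<Rightarrow> real \<Rightarrow> real" where
  "stopped_dist r x y l u = (SUP t\<in>{0..}. min (r (x (min t u)) (y (min (l t) u))) 1)"

definition skorohod_dist ::
  "('a \<Rightarrow> 'a \<Rightarrow> real) \<Rightarrow> (real \<Rightarrow> 'a) \<Rightarrow> (real \<Rightarrow> 'a) \<Rightarrow> real" where
  "skorohod_dist r x y =
     (INF l\<in>time_changes.
        max (Sup (log_slopes l)) (LINT u:{0..}|lborel. exp (- u) * stopped_dist r x y l u))"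

definition skorohod_topology :: "'a set \<Rightarrow> ('a \<Rightarrow> 'a \<Rightarrow> real) \<Rightarrow> (real \<Rightarrow> 'a) topology" where
  "skorohod_topology S r = Metric_space.mtopology (cadlag_paths S r) (skorohod_dist r)"


section \<open>Convergence in distribution\<close>

definition borel_of_topology :: "'a topology \<Rightarrow> 'a measure" where
  "borel_of_topology T = sigma (topspace T) {U. openin T U}"

text \<open>The random elements \<open>X n\<close>, \<open>n \<ge> 1\<close>, live on their own probability spaces \<open>P n\<close>;
  \<open>L\<close> is the limit law.\<close>

definition converges_in_distribution ::
  "'a topology \<Rightarrow> (nat \<Rightarrow> 'w measure) \<Rightarrow> (nat \<Rightarrow> 'w \<Rightarrow> 'a) \<Rightarrow> 'a measure \<Rightarrow> bool" where
  "converges_in_distribution T P X L \<longleftrightarrow>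
     (\<forall>n\<ge>1. prob_space (P n) \<and> X n \<in> P n \<rightarrow>\<^sub>M borel_of_topology T) \<and>
     prob_space L \<and> sets L = sets (borel_of_topology T) \<and>
     (\<forall>f. continuous_map T euclideanreal f \<and> bounded (f ` topspace T) \<longrightarrow>
        (\<lambda>n. \<integral>\<omega>. f (X n \<omega>) \<partial>P n) \<longlonglongrightarrow> (\<integral>x. f x \<partial>L))"

abbreviation converges_to_constant ::
  "'a topology \<Rightarrow> (nat \<Rightarrow> 'w measure) \<Rightarrow> (nat \<Rightarrow> 'w \<Rightarrow> 'a) \<Rightarrow> 'a \<Rightarrow> bool" where
  "converges_to_constant T P X x \<equiv>
     x \<in> topspace T \<and> converges_in_distribution T P X (return (borel_of_topology T) x)"


section \<open>Lebesgue--Stieltjes integration\<close>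

definition locally_bounded_variation :: "(real \<Rightarrow> real) \<Rightarrow> bool" where
  "locally_bounded_variation B \<longleftrightarrow>
     (\<forall>t\<ge>0. \<exists>C. \<forall>m (s :: nat \<Rightarrow> real).
        mono_on {..m} s \<and> s ` {..m} \<subseteq> {0..t} \<longrightarrow> (\<Sum>i<m. \<bar>B (s (Suc i)) - B (s i)\<bar>) \<le> C)"

text \<open>The integral of \<open>f\<close> over \<open>(a,b]\<close> with respect to \<open>B\<close> is \<open>I\<close>.  The value does not depend on
  the decomposition of \<open>B\<close> into nondecreasing right-continuous functions.\<close>

definition has_stieltjes_integral ::
  "(real \<Rightarrow> real) \<Rightarrow> (real \<Rightarrow> real) \<Rightarrow> real \<Rightarrow> real \<Rightarrow> real \<Rightarrow> bool" where
  "has_stieltjes_integral f B a b I \<longleftrightarrow>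
     (\<exists>B1 B2. mono B1 \<and> (\<forall>s. continuous (at_right s) B1) \<and>
              mono B2 \<and> (\<forall>s. continuous (at_right s) B2) \<and>
              (\<forall>s\<in>{a..b}. B s = B1 s - B2 s) \<and>
              set_integrable (interval_measure B1) {a<..b} f \<and>
              set_integrable (interval_measure B2) {a<..b} f \<and>
              I = (LINT s:{a<..b}|interval_measure B1. f s)
                  - (LINT s:{a<..b}|interval_measure B2. f s))"


section \<open>Many-server queues with state-dependent service rate\<close>

definition (in prob_space) renewal_process :: "real \<Rightarrow> (real \<Rightarrow> 'a \<Rightarrow> nat) \<Rightarrow> bool" where
  "renewal_process lam E \<longleftrightarrow>
     (\<exists>\<xi> :: nat \<Rightarrow> 'a \<Rightarrow> real.
        indep_vars (\<lambda>_. borel) \<xi> UNIV \<and>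
        (\<forall>j. distr M borel (\<xi> j) = distr M borel (\<xi> 0)) \<and>
        (\<forall>j. \<forall>\<omega>\<in>space M. 0 < \<xi> j \<omega>) \<and>
        integrable M (\<xi> 0) \<and> expectation (\<xi> 0) = 1 / lam \<and>
        (\<forall>\<omega>\<in>space M. \<forall>t\<ge>0.
           finite {j. (\<Sum>i\<le>j. \<xi> i \<omega>) \<le> t} \<and> E t \<omega> = card {j. (\<Sum>i\<le>j. \<xi> i \<omega>) \<le> t}))"

text \<open>In what follows \<open>E\<close>, \<open>X\<close> and \<open>Q\<close> are the arrival, head count and queue length processes,
  \<open>v i\<close> is the service requirement of customer \<open>i\<close>, \<open>w i\<close> the remaining requirement at time 0 of
  a customer \<open>i\<close> who is then in service (meaningful only for such \<open>i\<close>), and \<open>k\<close> is the service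
  rate as a function of \<open>X / n\<close>.\<close>

definition last_started ::
  "(real \<Rightarrow> 'w \<Rightarrow> nat) \<Rightarrow> (real \<Rightarrow> 'w \<Rightarrow> nat) \<Rightarrow> real \<Rightarrow> 'w \<Rightarrow> int" where
  "last_started E Q t \<omega> = int (E t \<omega>) - int (Q t \<omega>)"

text \<open>Only used for customers \<open>i\<close> that have started service, so the set is nonempty.\<close>

definition start_time ::
  "(real \<Rightarrow> 'w \<Rightarrow> nat) \<Rightarrow> (real \<Rightarrow> 'w \<Rightarrow> nat) \<Rightarrow> int \<Rightarrow> 'w \<Rightarrow> real" where
  "start_time E Q i \<omega> = Inf {t. 0 \<le> t \<and> i \<le> last_started E Q t \<omega>}"

definition attained_service ::
  "nat \<Rightarrow> (real \<Rightarrow> real) \<Rightarrow> (real \<Rightarrow> 'w \<Rightarrow> nat) \<Rightarrow> real \<Rightarrow> real \<Rightarrow> 'w \<Rightarrow> real" where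
  "attained_service n k X s t \<omega> = (LINT u:{s..t}|lborel. k (real (X u \<omega>) / real n))"

definition in_service ::
  "nat \<Rightarrow> (real \<Rightarrow> 'w \<Rightarrow> nat) \<Rightarrow> (int \<Rightarrow> 'w \<Rightarrow> real) \<Rightarrow> (int \<Rightarrow> 'w \<Rightarrow> real) \<Rightarrow> (real \<Rightarrow> real) \<Rightarrow>
   (real \<Rightarrow> 'w \<Rightarrow> nat) \<Rightarrow> (real \<Rightarrow> 'w \<Rightarrow> nat) \<Rightarrow> real \<Rightarrow> 'w \<Rightarrow> real measure" where
  "in_service n E v w k X Q t \<omega> =
     measure_of UNIV (sets borel) (\<lambda>C.
       (\<Sum>i\<in>{- int (X 0 \<omega>) + 1 .. - int (Q 0 \<omega>)}.
          indicator ((\<lambda>y. y + attained_service n k X 0 t \<omega>) ` (C \<inter> {0<..})) (w i \<omega>)) +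
       (\<Sum>i\<in>{- int (Q 0 \<omega>) + 1 .. last_started E Q t \<omega>}.
          indicator ((\<lambda>y. y + attained_service n k X (start_time E Q i \<omega>) t \<omega>) ` (C \<inter> {0<..}))
            (v i \<omega>)))"

lemma sets_in_service [simp]: "sets (in_service n E v w k X Q t \<omega>) = sets borel"
proof -
  have "sigma_sets UNIV (sets borel) = sets (borel :: real measure)"
    using sets.sigma_sets_eq[of "borel :: real measure"] by simp
  then show ?thesis
    unfolding in_service_def by (subst sets_measure_of) auto
qed

lemma emeasure_in_service:
  assumes "C \<in> sets borel"
  shows "emeasure (in_service n E v w k X Q t \<omega>) C =
       (\<Sum>i\<in>{- int (X 0 \<omega>) + 1 .. - int (Q 0 \<omega>)}.
          indicator ((\<lambda>y. y + attained_service n k X 0 t \<omega>) ` (C \<inter> {0<..})) (w i \<omega>)) +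
       (\<Sum>i\<in>{- int (Q 0 \<omega>) + 1 .. last_started E Q t \<omega>}.
          indicator ((\<lambda>y. y + attained_service n k X (start_time E Q i \<omega>) t \<omega>) ` (C \<inter> {0<..}))
            (v i \<omega>))"
    (is "_ = ?\<mu> C")
proof -
  have ind: "indicator ((\<lambda>y. y + s) ` (A \<inter> {0<..})) x = (indicator A (x - s) * indicator {0<..} (x - s) :: ennreal)"
    for A :: "real set" and s x
    by (force simp: indicator_def image_iff algebra_simps)
  have "countably_additive (sets borel) ?\<mu>"
  proof (rule countably_additiveI)
    fix A :: "nat \<Rightarrow> real set" assume "disjoint_family A"
    then have *: "(\<Sum>j. indicator (A j) y) = (indicator (\<Union>j. A j) y :: ennreal)" for y
      by (rule suminf_indicator)
    then have part: "(\<Sum>j. \<Sum>i\<in>I. indicator (A j) (a i) * indicator {0<..} (a i)) =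
        (\<Sum>i\<in>I. indicator (\<Union>j. A j) (a i) * indicator {0<..} (a i) :: ennreal)"
      for I :: "int set" and a :: "int \<Rightarrow> real"
      by (subst suminf_sum[OF summableI]) (simp only: ennreal_suminf_multc * )
    show "(\<Sum>j. ?\<mu> (A j)) = ?\<mu> (\<Union>j. A j)"
      unfolding ind by (subst suminf_add[symmetric, OF summableI summableI]) (simp only: part)
  qed
  moreover have "positive (sets borel) ?\<mu>"
    by (simp add: positive_def)
  ultimately show ?thesis
    by (intro emeasure_measure_of[OF in_service_def])
       (use assms in auto)
qed

definition scaled_state ::
  "nat \<Rightarrow> (real \<Rightarrow> 'w \<Rightarrow> nat) \<Rightarrow> (int \<Rightarrow> 'w \<Rightarrow> real) \<Rightarrow> (int \<Rightarrow> 'w \<Rightarrow> real) \<Rightarrow> (real \<Rightarrow> real) \<Rightarrow>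
   (real \<Rightarrow> 'w \<Rightarrow> nat) \<Rightarrow> (real \<Rightarrow> 'w \<Rightarrow> nat) \<Rightarrow> real \<Rightarrow> 'w \<Rightarrow> real measure \<times> real" where
  "scaled_state n E v w k X Q t \<omega> =
     (scale_measure (ennreal (1 / real n)) (in_service n E v w k X Q t \<omega>),
      real (Q t \<omega>) / real n)"

locale many_server_queue = prob_space P
  for P :: "'w measure" +
  fixes n :: nat
    and lam :: real
    and E :: "real \<Rightarrow> 'w \<Rightarrow> nat"
    and \<nu> :: "real measure"
    and v w :: "int \<Rightarrow> 'w \<Rightarrow> real"
    and k :: "real \<Rightarrow> real"
    and X Q :: "real \<Rightarrow> 'w \<Rightarrow> nat"
  assumes rate_pos: "0 < lam"
    and arrivals: "renewal_process lam E"
    and requirements_pos: "\<And>i \<omega>. \<omega> \<in> space P \<Longrightarrow> 0 < v i \<omega>"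
    and requirements_indep: "indep_vars (\<lambda>_. borel) v UNIV"
    and requirements_law: "\<And>i. distr P borel (v i) = \<nu>"
    and residuals_measurable: "\<And>i. w i \<in> borel_measurable P"
    and residuals_pos:
      "\<And>i \<omega>. \<omega> \<in> space P \<Longrightarrow> i \<in> {- int (X 0 \<omega>) + 1 .. - int (Q 0 \<omega>)} \<Longrightarrow> 0 < w i \<omega>"
    and rate_function_nonneg: "\<And>x. 0 \<le> x \<Longrightarrow> 0 \<le> k x"
    and rate_function_bounded: "bounded (k ` {0..})"
    and rate_function_measurable: "set_borel_measurable borel {0..} k"
    and head_count_measurable: "\<And>t. 0 \<le> t \<Longrightarrow> X t \<in> P \<rightarrow>\<^sub>M count_space UNIV"
    and head_count_cadlag:
      "\<And>\<omega>. \<omega> \<in> space P \<Longrightarrow> (\<lambda>t\<in>{0..}. real (X t \<omega>)) \<in> cadlag_paths {0..} dist"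
    and first_come_first_served:
      "\<And>\<omega>. \<omega> \<in> space P \<Longrightarrow> mono_on {0..} (\<lambda>t. last_started E Q t \<omega>)"
    and work_conserving:
      "\<And>t \<omega>. 0 \<le> t \<Longrightarrow> \<omega> \<in> space P \<Longrightarrow>
         real (Q t \<omega>) = max (real (X t \<omega>) - real n) 0"
    and head_count:
      "\<And>t \<omega>. 0 \<le> t \<Longrightarrow> \<omega> \<in> space P \<Longrightarrow>
         real (X t \<omega>) = real (Q t \<omega>) + measure (in_service n E v w k X Q t \<omega>) {0<..}"


section \<open>Fluid limit\<close>

definition fluid_head_count :: "(real \<Rightarrow> real measure \<times> real) \<Rightarrow> real \<Rightarrow> real" where
  "fluid_head_count z t = snd (z t) + measure (fst (z t)) {0<..}"

definition fluid_service ::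
  "(real \<Rightarrow> real) \<Rightarrow> (real \<Rightarrow> real measure \<times> real) \<Rightarrow> real \<Rightarrow> real \<Rightarrow> real" where
  "fluid_service k z s t = (LINT u:{s..t}|lborel. k (fluid_head_count z u))"

text \<open>A path \<open>z\<close> consists of the measure-valued component \<open>fst \<circ> z\<close> and the queue \<open>snd \<circ> z\<close>.\<close>

definition fluid_solution ::
  "real \<Rightarrow> real measure \<Rightarrow> (real \<Rightarrow> real) \<Rightarrow> real measure \<Rightarrow> real \<Rightarrow>
   (real \<Rightarrow> real measure \<times> real) \<Rightarrow> bool" where
  "fluid_solution lam \<nu> k Z0 Q0 z \<longleftrightarrow>
     z \<in> cadlag_paths state_space state_dist \<and> z 0 = (Z0, Q0) \<and>
     (\<forall>t\<ge>0. snd (z t) = max (fluid_head_count z t - 1) 0) \<and>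
     locally_bounded_variation (\<lambda>s. lam * s - snd (z s)) \<and>
     (\<forall>t\<ge>0. \<forall>x\<ge>0.
        \<exists>I. has_stieltjes_integral
              (\<lambda>s. 1 - measure \<nu> {0 .. x + fluid_service k z s t})
              (\<lambda>s. lam * s - snd (z s)) 0 t I \<and>
            measure (fst (z t)) {x..} = measure Z0 {x + fluid_service k z 0 t ..} + I)"

end

theory Submission
  imports Defs
begin

text \<open>Write \<open>D\<^sub>t = \<lambda>t + Q\<^sub>0 - (X\<^sub>t - 1)\<^sup>+\<close> for the mass that has started service.  Integrating (ii) by parts turns
  it into \<open>Z\<^sub>t((y,\<infinity>)) = F(y + S(0,t)) + G\<^sup>c(y) D\<^sub>t - \<integral>\<^sub>0\<^sup>t D\<^sub>u g(y + S(u,t)) k(X\<^sub>u) du\<close>, in which no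
  regularity of \<open>D\<close> is needed.  At \<open>y = 0\<close> the terms \<open>(X\<^sub>t - 1)\<^sup>+\<close> cancel, and what remains is
  a Volterra equation \<open>X\<^sub>t = \<lambda>t + Q\<^sub>0 + F(S(0,t)) - \<integral>\<^sub>0\<^sup>t D\<^sub>u g(S(u,t)) k(X\<^sub>u) du\<close> with Lipschitz data.  By
  Gronwall, paths that satisfy it up to an error \<open>e\<close> on \<open>[0,T]\<close> are within \<open>O(e)\<close> of each other; this gives
  uniqueness, and existence as soon as approximate solutions exist for every \<open>e\<close>.

  The scaled queues provide them.  By Hoeffding's inequality, with probability tending to one the number
  of requirements larger than \<open>y\<close> among any consecutive customers is its mean up to \<open>o(n)\<close>, uniformly in
  \<open>y\<close>.  Splitting \<open>[0,T]\<close> into short blocks, within which the customers starting service receive nearly the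
  same amount of work, shows that the tails of the measure-valued state satisfy the equation up to \<open>o(1)\<close>.
  So the path is uniformly close on \<open>[0,T]\<close> to the fluid solution, hence close in \<open>J\<^sub>1\<close>.  The tails are
  compared pointwise; since the limit measures have no atoms and tight tails, this controls the Prohorov distance.\<close>

section \<open>The Prohorov distance\<close>

text \<open>The integration by parts is forced by the noise. The scaled number of customers that
  have started service is uniformly close to \<open>D\<close>, but nothing controls the variation of
  the difference, so \<open>D\<close> may enter only as a bounded factor under an ordinary integral.
  The price is a derivative of the kernel, the density \<open>g\<close>, whose Lipschitz constant
  makes the equation stable under perturbations of the service rate.

  Existence is a by-product of probability: an event whose probability tends to one is eventually
  nonempty, and each of its points gives a sample path that solves the equation up to the prescribed
  error.

  A good part of the work concerns the path space. The Ethier-Kurtz distance has to be shown to be a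
  metric, and the scaled queue to be a random element for its Borel sets. For the latter the state
  at a fixed time is coded by finitely many integers, so that a path observed on a finite grid
  becomes a map into a countable set.

  The constant \<open>K\<close> exceeds a bound of the limiting rate by one, so that the prelimit
  rates obey it too once they are within one of the limit.\<close>

definition prohorov_close :: "real measure \<Rightarrow> real measure \<Rightarrow> real \<Rightarrow> bool" where
  "prohorov_close \<mu> \<mu>' e \<longleftrightarrow> (\<forall>A. closed A \<and> A \<subseteq> {0..} \<longrightarrow>
     measure \<mu> A \<le> measure \<mu>' (halfline_nbhd A e) + e \<and>
     measure \<mu>' A \<le> measure \<mu> (halfline_nbhd A e) + e)"

lemma prohorov_dist_eq: "prohorov_dist \<mu> \<mu>' = Inf {e. 0 < e \<and> prohorov_close \<mu> \<mu>' e}"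
  by (simp add: prohorov_dist_def prohorov_close_def)

lemma prohorov_close_commute: "prohorov_close \<mu> \<mu>' e \<longleftrightarrow> prohorov_close \<mu>' \<mu> e"
  by (auto simp: prohorov_close_def)

lemma halfline_nbhd_borel [measurable, simp]: "halfline_nbhd A e \<in> sets borel"
proof -
  have "halfline_nbhd A e = {0..} \<inter> (\<Union>a\<in>A. ball a e)"
    by (auto simp: halfline_nbhd_def dist_real_def abs_minus_commute)
  moreover have "open (\<Union>a\<in>A. ball a e)" by auto
  ultimately show ?thesis by auto
qed

lemma halfline_nbhd_mono: "e \<le> e' \<Longrightarrow> halfline_nbhd A e \<subseteq> halfline_nbhd A e'"
  by (force simp: halfline_nbhd_def)

lemma halfline_measures_sets: "\<mu> \<in> halfline_measures \<Longrightarrow> sets \<mu> = sets borel"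
  by (simp add: halfline_measures_def finite_borel_measure_def finite_borel_measure_axioms_def)

lemma halfline_measures_finite: "\<mu> \<in> halfline_measures \<Longrightarrow> finite_measure \<mu>"
  by (simp add: halfline_measures_def finite_borel_measure_def)

lemma halfline_measure_mono:
  "\<mu> \<in> halfline_measures \<Longrightarrow> A \<subseteq> B \<Longrightarrow> B \<in> sets borel \<Longrightarrow> measure \<mu> A \<le> measure \<mu> B"
  using finite_measure.finite_measure_mono[OF halfline_measures_finite] halfline_measures_sets
  by metis

lemma prohorov_close_mono:
  assumes "\<mu> \<in> halfline_measures" "\<mu>' \<in> halfline_measures" "prohorov_close \<mu> \<mu>' e" "e \<le> e'"
  shows "prohorov_close \<mu> \<mu>' e'"
  using assms(3,4) halfline_measure_mono[OF assms(1) halfline_nbhd_mono[OF assms(4)]]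
    halfline_measure_mono[OF assms(2) halfline_nbhd_mono[OF assms(4)]]
  unfolding prohorov_close_def by (smt (verit) halfline_nbhd_borel)

text \<open>Above the sum of the total masses the inequalities are trivial. So the set whose infimum
  is the distance is nonempty; the infimum of an empty set of reals would carry no
  information.\<close>

lemma prohorov_close_exists:
  assumes "\<mu> \<in> halfline_measures" "\<mu>' \<in> halfline_measures"
  shows "prohorov_close \<mu> \<mu>' (measure \<mu> UNIV + measure \<mu>' UNIV + 1)"
  unfolding prohorov_close_def
proof (intro allI impI conjI)
  fix A :: "real set" assume "closed A \<and> A \<subseteq> {0..}"
  have "measure \<mu> A \<le> measure \<mu> UNIV" "measure \<mu>' A \<le> measure \<mu>' UNIV"
    using assms by (auto intro: halfline_measure_mono)
  then show "measure \<mu> A \<le> measure \<mu>' (halfline_nbhd A (measure \<mu> UNIV + measure \<mu>' UNIV + 1)) + (measure \<mu> UNIV + measure \<mu>' UNIV + 1)"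
    "measure \<mu>' A \<le> measure \<mu> (halfline_nbhd A (measure \<mu> UNIV + measure \<mu>' UNIV + 1)) + (measure \<mu> UNIV + measure \<mu>' UNIV + 1)"
    by (smt (verit) measure_nonneg)+
qed

lemma prohorov_close_set_nonempty:
  assumes "\<mu> \<in> halfline_measures" "\<mu>' \<in> halfline_measures"
  shows "{e. 0 < e \<and> prohorov_close \<mu> \<mu>' e} \<noteq> {}"
  using prohorov_close_exists[OF assms] by (smt (verit) empty_iff measure_nonneg mem_Collect_eq)

lemma prohorov_dist_nonneg:
  assumes "\<mu> \<in> halfline_measures" "\<mu>' \<in> halfline_measures"
  shows "0 \<le> prohorov_dist \<mu> \<mu>'"
  unfolding prohorov_dist_eq
  by (rule cInf_greatest[OF prohorov_close_set_nonempty[OF assms]]) auto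

lemma prohorov_dist_le:
  assumes "0 < e" "prohorov_close \<mu> \<mu>' e"
  shows "prohorov_dist \<mu> \<mu>' \<le> e"
  unfolding prohorov_dist_eq using assms by (auto intro!: cInf_lower bdd_belowI[of _ 0])

text \<open>The infimum need not be attained, hence the strict inequality; monotonicity of closeness
  in \<open>e\<close> carries the bound up from a smaller admissible value.\<close>

lemma prohorov_dist_less:
  assumes "\<mu> \<in> halfline_measures" "\<mu>' \<in> halfline_measures" "prohorov_dist \<mu> \<mu>' < e"
  shows "prohorov_close \<mu> \<mu>' e"
proof -
  obtain e' where "e' < e" "prohorov_close \<mu> \<mu>' e'"
    using cInf_lessD[OF prohorov_close_set_nonempty[OF assms(1,2)]] assms(3)
    unfolding prohorov_dist_eq by auto
  then show ?thesis using prohorov_close_mono assms by (meson less_imp_le)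
qed

lemma prohorov_dist_commute: "prohorov_dist \<mu> \<mu>' = prohorov_dist \<mu>' \<mu>"
  by (simp add: prohorov_dist_eq prohorov_close_commute)

lemma prohorov_close_trans:
  assumes "prohorov_close \<mu>1 \<mu>2 a" "prohorov_close \<mu>2 \<mu>3 b"
    and H: "\<mu>1 \<in> halfline_measures" "\<mu>2 \<in> halfline_measures" "\<mu>3 \<in> halfline_measures"
  shows "prohorov_close \<mu>1 \<mu>3 (a + b)"
proof -
  \<comment> \<open>Test sets are closed, and the \<open>a\<close>-neighbourhood of \<open>A\<close>
    is not. Its closure costs nothing: the strict inequality in the second neighbourhood leaves room
    to move from a limit point to a nearby point of the \<open>a\<close>-neighbourhood.\<close>
  have nb: "halfline_nbhd (closure (halfline_nbhd A a)) b \<subseteq> halfline_nbhd A (a + b)" for A a b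
  proof
    fix x assume "x \<in> halfline_nbhd (closure (halfline_nbhd A a)) b"
    then obtain c where c: "0 \<le> x" "c \<in> closure (halfline_nbhd A a)" "\<bar>x - c\<bar> < b"
      by (auto simp: halfline_nbhd_def)
    from c(2) obtain c' where c': "c' \<in> halfline_nbhd A a" "dist c' c < b - \<bar>x - c\<bar>"
      unfolding closure_approachable using c(3) by (meson diff_gt_0_iff_gt)
    then obtain y where "y \<in> A" "\<bar>c' - y\<bar> < a" by (auto simp: halfline_nbhd_def)
    then show "x \<in> halfline_nbhd A (a + b)"
      using c c'(2) by (auto simp: halfline_nbhd_def dist_real_def intro!: bexI[of _ y])
  qed
  have one: "measure \<mu>1 A \<le> measure \<mu>3 (halfline_nbhd A (a + b)) + (a + b)"
    if A: "closed A" "A \<subseteq> {0..}"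
      and "prohorov_close \<mu>1 \<mu>2 a" "prohorov_close \<mu>2 \<mu>3 b"
      and H: "\<mu>1 \<in> halfline_measures" "\<mu>2 \<in> halfline_measures" "\<mu>3 \<in> halfline_measures"
    for A \<mu>1 \<mu>2 \<mu>3 a b
  proof -
    let ?C = "closure (halfline_nbhd A a)"
    have sub: "?C \<subseteq> {0..}"
      by (rule closure_minimal) (auto simp: halfline_nbhd_def)
    have "measure \<mu>1 A \<le> measure \<mu>2 (halfline_nbhd A a) + a"
      using that unfolding prohorov_close_def by auto
    also have "measure \<mu>2 (halfline_nbhd A a) \<le> measure \<mu>2 ?C"
      by (rule halfline_measure_mono[OF H(2) closure_subset]) auto
    also have "measure \<mu>2 ?C \<le> measure \<mu>3 (halfline_nbhd ?C b) + b"
      using that sub unfolding prohorov_close_def by auto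
    also have "measure \<mu>3 (halfline_nbhd ?C b) \<le> measure \<mu>3 (halfline_nbhd A (a + b))"
      by (rule halfline_measure_mono[OF H(3) nb]) auto
    finally show ?thesis by simp
  qed
  show ?thesis
    unfolding prohorov_close_def
    using one[OF _ _ assms(1,2) H]
      one[of _ \<mu>3 \<mu>2 b \<mu>1 a, OF _ _ assms(2)[unfolded prohorov_close_commute[of \<mu>2]]
        assms(1)[unfolded prohorov_close_commute[of \<mu>1]] H(3,2,1)]
    by (auto simp: add.commute)
qed

lemma prohorov_dist_refl:
  assumes "\<mu> \<in> halfline_measures" shows "prohorov_dist \<mu> \<mu> = 0"
proof (rule antisym[OF _ prohorov_dist_nonneg[OF assms assms]], rule field_le_epsilon)
  fix e :: real assume e: "0 < e"
  have "measure \<mu> A \<le> measure \<mu> (halfline_nbhd A e) + e" if "A \<subseteq> {0..}" for A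
  proof -
    have "A \<subseteq> halfline_nbhd A e" using that e by (force simp: halfline_nbhd_def)
    then have "measure \<mu> A \<le> measure \<mu> (halfline_nbhd A e)"
      by (rule halfline_measure_mono[OF assms]) auto
    then show ?thesis using e by linarith
  qed
  then show "prohorov_dist \<mu> \<mu> \<le> 0 + e"
    using e by (auto intro!: prohorov_dist_le simp: prohorov_close_def)
qed

lemma halfline_measure_eqI:
  assumes "\<mu> \<in> halfline_measures" "\<mu>' \<in> halfline_measures"
    and "\<And>y. 0 \<le> y \<Longrightarrow> measure \<mu> {0..y} = measure \<mu>' {0..y}"
  shows "\<mu> = \<mu>'"
proof (rule cdf_unique')
  have split: "measure m {..y} = (if y < 0 then 0 else measure m {0..y})"
    if m: "m \<in> halfline_measures" for m y
  proof -
    have z: "measure m {..<0} = 0" using m by (simp add: halfline_measures_def)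
    show ?thesis
    proof (cases "y < 0")
      case True
      then have "measure m {..y} \<le> measure m {..<0}"
        using m by (intro halfline_measure_mono) auto
      then show ?thesis using True z measure_nonneg[of m "{..y}"] by auto
    next
      case False
      then have "{..y} = {..<0} \<union> {0..y}" "{..<0} \<inter> {0..y} = {}" by auto
      then have "measure m {..y} = measure m {..<0} + measure m {0..y}"
        using finite_measure.finite_measure_Union[OF halfline_measures_finite[OF m], of "{..<0}" "{0..y}"]
        by (simp add: halfline_measures_sets[OF m])
      then show ?thesis using False z by auto
    qed
  qed
  show "cdf \<mu> = cdf \<mu>'"
    using split[OF assms(1)] split[OF assms(2)] assms(3) by (auto simp: cdf_def fun_eq_iff)
qed (use assms in \<open>auto simp: halfline_measures_def\<close>)

text \<open>The neighbourhoods of radius \<open>1 / (j + 1)\<close> of the closed interval from 0 to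
  \<open>y\<close> shrink to the interval itself, so continuity from above compares the distribution
  functions, in both directions by symmetry.\<close>

lemma prohorov_dist_zero_imp_eq:
  assumes H: "\<mu> \<in> halfline_measures" "\<mu>' \<in> halfline_measures" and z: "prohorov_dist \<mu> \<mu>' = 0"
  shows "\<mu> = \<mu>'"
proof (rule halfline_measure_eqI[OF H])
  fix y :: real assume y: "0 \<le> y"
  have le: "measure m {0..y} \<le> measure m' {0..y}"
    if H: "m \<in> halfline_measures" "m' \<in> halfline_measures" "prohorov_dist m m' = 0" for m m'
  proof -
    have fin: "finite_measure m'" using H by (simp add: halfline_measures_finite)
    have lim: "(\<lambda>j. measure m' {0..<y + 1 / Suc j}) \<longlonglongrightarrow> measure m' (\<Inter>j. {0..<y + 1 / Suc j})"
      by (rule finite_measure.finite_Lim_measure_decseq[OF fin])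
        (auto simp: halfline_measures_sets[OF H(2)] decseq_def field_simps intro: order_trans less_le_trans)
    have "(\<Inter>j. {0..<y + 1 / real (Suc j)}) = {0..y}"
    proof safe
      fix x assume x: "x \<in> (\<Inter>j. {0..<y + 1 / real (Suc j)})"
      show "x \<in> {0..y}"
      proof (rule ccontr)
        assume "x \<notin> {0..y}"
        then have "x - y > 0" using x by auto
        then obtain j where "1 / real (Suc j) < x - y" using nat_approx_posE by (metis)
        then show False using x by (auto dest!: spec[of _ j])
      qed
    qed (use y in \<open>auto simp: add_strict_increasing2 intro: le_less_trans\<close>)
    with lim have lim2: "(\<lambda>j. measure m' {0..<y + 1 / Suc j} + 1 / Suc j) \<longlonglongrightarrow> measure m' {0..y} + 0"
      by (intro tendsto_add LIMSEQ_inverse_real_of_nat[unfolded inverse_eq_divide]) simp_all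
    have "measure m {0..y} \<le> measure m' {0..<y + 1 / Suc j} + 1 / Suc j" for j
    proof -
      have "prohorov_close m m' (1 / Suc j)"
        by (rule prohorov_dist_less[OF H(1,2)]) (use H(3) in auto)
      then have "measure m {0..y} \<le> measure m' (halfline_nbhd {0..y} (1 / Suc j)) + 1 / Suc j"
        unfolding prohorov_close_def by auto
      also have "measure m' (halfline_nbhd {0..y} (1 / Suc j)) \<le> measure m' {0..<y + 1 / Suc j}"
        by (rule halfline_measure_mono[OF H(2)]) (auto simp: halfline_nbhd_def)
      finally show ?thesis by simp
    qed
    then show ?thesis using LIMSEQ_le_const[OF lim2] by auto
  qed
  show "measure \<mu> {0..y} = measure \<mu>' {0..y}"
    using le[OF H z] le[OF H(2,1)] z by (simp add: prohorov_dist_commute)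
qed

text \<open>\<open>Metric_space\<close> asks for nonnegativity on the whole type, whereas outside
  \<open>halfline_measures\<close> the distance may be the infimum of an empty set. The absolute
  value repairs this, and the product distance, which squares its components, does not see
  it.\<close>

lemma Metric_space_prohorov: "Metric_space halfline_measures (\<lambda>\<mu> \<mu>'. \<bar>prohorov_dist \<mu> \<mu>'\<bar>)"
proof
  fix x y z assume H: "x \<in> halfline_measures" "y \<in> halfline_measures" "z \<in> halfline_measures"
  have "prohorov_dist x z \<le> prohorov_dist x y + prohorov_dist y z"
  proof (rule field_le_epsilon)
    fix e :: real assume e: "0 < e"
    have "prohorov_close x z ((prohorov_dist x y + e / 2) + (prohorov_dist y z + e / 2))"
      using e H by (intro prohorov_close_trans[where ?\<mu>2.0 = y] prohorov_dist_less) auto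
    moreover have "0 < (prohorov_dist x y + e / 2) + (prohorov_dist y z + e / 2)"
      using prohorov_dist_nonneg[OF H(1,2)] prohorov_dist_nonneg[OF H(2,3)] e by linarith
    ultimately show "prohorov_dist x z \<le> prohorov_dist x y + prohorov_dist y z + e"
      using prohorov_dist_le by fastforce
  qed
  then show "\<bar>prohorov_dist x z\<bar> \<le> \<bar>prohorov_dist x y\<bar> + \<bar>prohorov_dist y z\<bar>"
    using H by (simp add: prohorov_dist_nonneg)
qed (use prohorov_dist_refl prohorov_dist_zero_imp_eq prohorov_dist_commute in auto)

lemma state_dist_eq: "state_dist = prod_dist (\<lambda>\<mu> \<mu>'. \<bar>prohorov_dist \<mu> \<mu>'\<bar>) dist"
  by (simp add: state_dist_def prod_dist_def fun_eq_iff)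

lemma Metric_space_nonneg_reals: "Metric_space {0::real..} dist"
  by standard (auto simp: dist_commute dist_triangle)

interpretation State: Metric_space state_space state_dist
  unfolding state_dist_eq state_space_def
  by (rule Metric_space12.prod_metric)
    (simp add: Metric_space12_def Metric_space_prohorov Metric_space_nonneg_reals)

lemma state_dist_le:
  assumes "\<bar>prohorov_dist m m'\<bar> \<le> a" "\<bar>q - q'\<bar> \<le> b"
  shows "state_dist (m, q) (m', q') \<le> a + b"
proof -
  have "sqrt ((prohorov_dist m m')\<^sup>2 + (dist q q')\<^sup>2) \<le> \<bar>prohorov_dist m m'\<bar> + \<bar>dist q q'\<bar>"
    by (rule sqrt_sum_squares_le_sum_abs)
  then show ?thesis using assms by (simp add: state_dist_def prod_dist_def dist_real_def)
qed

lemma state_dist_ge: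
  "\<bar>prohorov_dist m m'\<bar> \<le> state_dist (m, q) (m', q')" "\<bar>q - q'\<bar> \<le> state_dist (m, q) (m', q')"
  by (auto simp: state_dist_def prod_dist_def dist_real_def intro!: real_le_rsqrt)

lemma halfline_measure_split:
  assumes m: "m \<in> halfline_measures" and "a \<le> b"
  shows "measure m {a<..} = measure m {a<..b} + measure m {b<..}"
proof -
  have "{a<..} = {a<..b} \<union> {b<..}" "{a<..b} \<inter> {b<..} = {}" using assms by auto
  then show ?thesis
    using finite_measure.finite_measure_Union[OF halfline_measures_finite[OF m], of "{a<..b}" "{b<..}"]
    by (simp add: halfline_measures_sets[OF m])
qed

text \<open>The interval \<open>(0, N a]\<close> is cut into cells of length \<open>a\<close>; a closed set that meets a cell has
  that cell in its neighbourhood.\<close>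

lemma prohorov_close_of_tails:
  assumes H: "m \<in> halfline_measures" "m' \<in> halfline_measures"
    and zero: "measure m {0} = 0" "measure m' {0} = 0"
    and tails: "\<And>y. 0 \<le> y \<Longrightarrow> \<bar>measure m {y<..} - measure m' {y<..}\<bar> \<le> d"
    and far: "measure m' {real N * a<..} \<le> c"
    and a: "0 < a" "a < e" and e: "2 * real N * d + d + c \<le> e"
  shows "prohorov_close m m' e"
proof -
  let ?I = "\<lambda>j. {real j * a <.. real (Suc j) * a}"
  have d: "0 \<le> d" using tails[of 0] by auto
  have one: "measure m1 A \<le> measure m2 (halfline_nbhd A e) + e"
    if H: "m1 \<in> halfline_measures" "m2 \<in> halfline_measures" and z: "measure m1 {0} = 0"
      and t: "\<And>y. 0 \<le> y \<Longrightarrow> \<bar>measure m1 {y<..} - measure m2 {y<..}\<bar> \<le> d"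
      and far: "measure m1 {real N * a<..} \<le> c + d" and A: "A \<subseteq> {0..}" "closed A" for m1 m2 A
  proof -
    have fin: "finite_measure m1" "finite_measure m2" using H halfline_measures_finite by auto
    note s = halfline_measures_sets[OF H(1)] halfline_measures_sets[OF H(2)]
    define J where "J = {j. j < N \<and> A \<inter> ?I j \<noteq> {}}"
    have J: "finite J" "J \<subseteq> {..<N}" by (auto simp: J_def)
    have cover: "A \<subseteq> {0} \<union> (\<Union>j\<in>J. ?I j) \<union> {real N * a<..}"
    proof
      fix x assume x: "x \<in> A"
      show "x \<in> {0} \<union> (\<Union>j\<in>J. ?I j) \<union> {real N * a<..}"
      proof (cases "x = 0 \<or> real N * a < x")
        case False
        then have x0: "0 < x" "x \<le> real N * a" using A x by auto
        \<comment> \<open>The cells are open on the left and closed on the right, hence the ceiling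
          minus one.\<close>
        define j where "j = nat (\<lceil>x / a\<rceil> - 1)"
        have "1 \<le> \<lceil>x / a\<rceil>" using x0 a by (simp add: one_le_ceiling)
        then have rj: "real j = of_int \<lceil>x / a\<rceil> - 1" by (simp add: j_def)
        have "real j < x / a" "x / a \<le> real (Suc j)" unfolding of_nat_Suc rj by linarith+
        then have xi: "x \<in> ?I j" using a by (auto simp: field_simps)
        then have "real j * a < real N * a" using x0 by auto
        then have "j < N" using a by auto
        then have "j \<in> J" using xi x unfolding J_def by blast
        then show ?thesis using xi by blast
      qed auto
    qed
    have dm: "disjoint_family_on ?I J"
    proof (unfold disjoint_family_on_def, intro ballI impI)
      have aux: "?I i \<inter> ?I j = {}" if "i < j" for i j
      proof -
        have "real (Suc i) * a \<le> real j * a" using that a by (intro mult_right_mono) auto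
        then show ?thesis by (auto simp del: of_nat_Suc)
      qed
      fix i j :: nat assume "i \<noteq> j" then show "?I i \<inter> ?I j = {}"
        using aux[of i j] aux[of j i] by (cases "i < j") (auto simp del: of_nat_Suc)
    qed
    have sub: "?I j \<subseteq> halfline_nbhd A e" if "j \<in> J" for j
    proof
      fix x assume x: "x \<in> ?I j"
      obtain y where y: "y \<in> A" "y \<in> ?I j" using \<open>j \<in> J\<close> unfolding J_def by blast
      have "\<bar>x - y\<bar> \<le> a" "0 \<le> x" using x y a by (auto simp: field_simps abs_le_iff intro: order_trans[of 0 "real j * a"])
      then show "x \<in> halfline_nbhd A e" using a y(1) unfolding halfline_nbhd_def by force
    qed
    \<comment> \<open>A cell is a difference of two tails, and each of them is off by at most
      \<open>d\<close>.\<close>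
    have step: "measure m1 (?I j) \<le> measure m2 (?I j) + 2 * d" for j
    proof -
      have "real j * a \<le> real (Suc j) * a" "0 \<le> real j * a" using a by (auto intro!: mult_right_mono)
      then show ?thesis
        using halfline_measure_split[OF H(1), of "real j * a" "real (Suc j) * a"]
          halfline_measure_split[OF H(2), of "real j * a" "real (Suc j) * a"]
          t[of "real j * a"] t[of "real (Suc j) * a"] by (smt (verit))
    qed
    have "measure m1 A \<le> measure m1 ({0} \<union> (\<Union>j\<in>J. ?I j) \<union> {real N * a<..})"
      by (rule halfline_measure_mono[OF H(1) cover]) (auto intro!: sets.finite_UN J)
    also have "\<dots> \<le> measure m1 ({0} \<union> (\<Union>j\<in>J. ?I j)) + measure m1 {real N * a<..}"
      by (rule measure_Un_le) (auto simp: s intro!: sets.finite_UN J)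
    also have "measure m1 ({0} \<union> (\<Union>j\<in>J. ?I j)) \<le> measure m1 {0} + measure m1 (\<Union>j\<in>J. ?I j)"
      by (rule measure_Un_le) (auto simp: s intro!: sets.finite_UN J)
    also have "measure m1 (\<Union>j\<in>J. ?I j) = (\<Sum>j\<in>J. measure m1 (?I j))"
      by (rule finite_measure.finite_measure_finite_Union[OF fin(1) J(1) _ dm]) (auto simp: s)
    also have "\<dots> \<le> (\<Sum>j\<in>J. measure m2 (?I j) + 2 * d)" by (intro sum_mono step)
    also have "\<dots> = (\<Sum>j\<in>J. measure m2 (?I j)) + real (card J) * (2 * d)" by (simp add: sum.distrib)
    also have "(\<Sum>j\<in>J. measure m2 (?I j)) = measure m2 (\<Union>j\<in>J. ?I j)"
      by (rule finite_measure.finite_measure_finite_Union[OF fin(2) J(1) _ dm, symmetric]) (auto simp: s)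
    also have "\<dots> \<le> measure m2 (halfline_nbhd A e)"
      by (rule halfline_measure_mono[OF H(2)]) (use sub in auto)
    also have "real (card J) * (2 * d) \<le> real N * (2 * d)"
      using card_mono[OF _ J(2)] d by (intro mult_right_mono) auto
    finally show ?thesis using z far e by (simp add: algebra_simps)
  qed
  \<comment> \<open>The far tail is assumed small for \<open>m'\<close> only; comparing the tails at
    \<open>N * a\<close> passes this on to \<open>m\<close>, at the cost of the single
    \<open>d\<close> in the bound for \<open>e\<close>.\<close>
  have farm: "measure m {real N * a<..} \<le> c + d" "measure m' {real N * a<..} \<le> c + d"
    using far tails[of "real N * a"] a d by (auto simp: abs_le_iff)
  show ?thesis
    unfolding prohorov_close_def
    using one[OF H zero(1) tails farm(1)] one[OF H(2,1) zero(2) _ farm(2)] tails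
    by (auto simp: abs_minus_commute)
qed

lemma prohorov_close_tail_le:
  assumes H: "m \<in> halfline_measures" "m' \<in> halfline_measures" and c: "prohorov_close m m' e"
    and y: "0 \<le> y"
  shows "measure m {y..} \<le> measure m' {y - e<..} + e"
proof -
  have "measure m {y..} \<le> measure m' (halfline_nbhd {y..} e) + e"
    using c y unfolding prohorov_close_def by auto
  also have "measure m' (halfline_nbhd {y..} e) \<le> measure m' {y - e<..}"
    by (rule halfline_measure_mono[OF H(2)]) (auto simp: halfline_nbhd_def)
  finally show ?thesis by simp
qed

section \<open>Finite sums of atoms of mass 1/n\<close>

text \<open>Pushing a point measure on the index set forward counts indices with equal positions
  with multiplicity, and keeps the labels by which the atoms of two such measures are
  matched.\<close>

definition atoms :: "nat \<Rightarrow> 'i set \<Rightarrow> ('i \<Rightarrow> real) \<Rightarrow> real measure" where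
  "atoms n I p = distr (point_measure I (\<lambda>_. ennreal (1 / real n))) borel p"

lemma sets_atoms [simp]: "sets (atoms n I p) = sets borel"
  by (simp add: atoms_def)

lemma emeasure_atoms:
  assumes "finite I" "A \<in> sets borel"
  shows "emeasure (atoms n I p) A = ennreal (1 / real n) * of_nat (card {i \<in> I. p i \<in> A})"
proof -
  have "emeasure (atoms n I p) A = emeasure (point_measure I (\<lambda>_. ennreal (1 / real n))) (p -` A \<inter> I)"
    unfolding atoms_def using assms
    by (subst emeasure_distr) (auto simp: space_point_measure measurable_point_measure_eq1)
  also have "\<dots> = (\<Sum>i\<in>p -` A \<inter> I. ennreal (1 / real n))"
    using assms by (subst emeasure_point_measure_finite) auto
  also have "p -` A \<inter> I = {i \<in> I. p i \<in> A}" by auto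
  finally show ?thesis by (simp add: mult.commute)
qed

lemma measure_atoms:
  assumes "finite I" "A \<in> sets borel"
  shows "measure (atoms n I p) A = real (card {i \<in> I. p i \<in> A}) / real n"
  using emeasure_atoms[OF assms, of n p] unfolding measure_def
  by (simp add: enn2real_mult)

lemma atoms_halfline:
  assumes "finite I" "\<And>i. i \<in> I \<Longrightarrow> 0 \<le> p i"
  shows "atoms n I p \<in> halfline_measures"
proof -
  have "finite_measure (atoms n I p)"
    by (rule finite_measureI) (use assms in \<open>simp add: emeasure_atoms atoms_def[THEN arg_cong[where f=space]] ennreal_mult_eq_top_iff flip: ennreal_of_nat_eq_real_of_nat\<close>)
  moreover have none: "{i \<in> I. p i \<in> {..<0}} = {}" using assms(2) by force
  have "measure (atoms n I p) {..<0} = 0"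
    using measure_atoms[OF assms(1), of "{..<0}" n p] unfolding none by simp
  ultimately show ?thesis
    by (simp add: halfline_measures_def finite_borel_measure_def finite_borel_measure_axioms_def)
qed

text \<open>Every atom is matched with the atom of the same index, so the largest displacement
  bounds the distance, whatever the number of atoms.\<close>

lemma prohorov_close_atoms:
  assumes I: "finite I" and pos: "\<And>i. i \<in> I \<Longrightarrow> 0 \<le> p i" "\<And>i. i \<in> I \<Longrightarrow> 0 \<le> p' i"
    and e: "0 < e" "\<And>i. i \<in> I \<Longrightarrow> \<bar>p i - p' i\<bar> < e"
  shows "prohorov_close (atoms n I p) (atoms n I p') e"
proof -
  have "measure (atoms n I p) A \<le> measure (atoms n I p') (halfline_nbhd A e) + e"
    if "closed A" "\<And>i. i \<in> I \<Longrightarrow> 0 \<le> p' i" "\<And>i. i \<in> I \<Longrightarrow> \<bar>p i - p' i\<bar> < e" for A p p'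
  proof -
    have "card {i \<in> I. p i \<in> A} \<le> card {i \<in> I. p' i \<in> halfline_nbhd A e}"
      using I that(2,3) by (intro card_mono) (force simp: halfline_nbhd_def abs_minus_commute[of "p _"])+
    then have "real (card {i \<in> I. p i \<in> A}) / real n \<le> real (card {i \<in> I. p' i \<in> halfline_nbhd A e}) / real n"
      by (intro divide_right_mono) auto
    then show ?thesis using e I that(1) by (simp add: measure_atoms borel_closed)
  qed
  then show ?thesis unfolding prohorov_close_def using pos e by (simp add: abs_minus_commute)
qed

section \<open>The Skorohod metric\<close>

lemma time_change_zero:
  assumes "l \<in> time_changes" shows "l 0 = 0"
proof -
  have m: "strict_mono_on {0..} l" and im: "l ` {0..} = {0..}"
    using assms by (auto simp: time_changes_def)
  obtain s where s: "0 \<le> s" "l s = 0" using im by (metis atLeast_iff image_iff order_refl)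
  have "0 \<le> l 0" using im by auto
  then show ?thesis using s strict_mono_onD[OF m, of 0 s] by (cases "s = 0") auto
qed

lemma time_change_less:
  assumes "l \<in> time_changes" "0 \<le> s" "s < t" shows "l s < l t"
  using assms strict_mono_onD[of "{0..}" l s t] by (auto simp: time_changes_def)

lemma time_change_mono:
  assumes "l \<in> time_changes" "0 \<le> s" "s \<le> t" shows "l s \<le> l t"
  using time_change_less[OF assms(1,2), of t] assms(3) by (cases "s = t") auto

lemma time_change_nonneg:
  assumes "l \<in> time_changes" "0 \<le> t" shows "0 \<le> l t"
  using assms by (auto simp: time_changes_def)

lemma time_change_slope:
  assumes "l \<in> time_changes" "0 \<le> s" "s < t"
  shows "\<bar>ln ((l t - l s) / (t - s))\<bar> \<le> Sup (log_slopes l)"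
proof (rule cSup_upper)
  show "\<bar>ln ((l t - l s) / (t - s))\<bar> \<in> log_slopes l" using assms by (auto simp: log_slopes_def)
qed (use assms in \<open>auto simp: time_changes_def\<close>)

lemma log_slopes_nonempty: "log_slopes l \<noteq> {}"
proof -
  have "\<bar>ln ((l 1 - l 0) / (1 - 0))\<bar> \<in> log_slopes l"
    unfolding log_slopes_def by (intro CollectI exI[of _ 0] exI[of _ 1] conjI refl; simp)
  then show ?thesis by auto
qed

lemma Sup_log_slopes_nonneg:
  assumes "l \<in> time_changes" shows "0 \<le> Sup (log_slopes l)"
  using time_change_slope[OF assms, of 0 1] by auto

lemma time_change_bounds:
  assumes l: "l \<in> time_changes" "Sup (log_slopes l) \<le> c" and s: "0 \<le> s" "s \<le> t"
  shows "l t - l s \<le> exp c * (t - s)" "exp (- c) * (t - s) \<le> l t - l s"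
proof -
  have "l t - l s \<le> exp c * (t - s) \<and> exp (- c) * (t - s) \<le> l t - l s"
  proof (cases "s = t")
    case False
    then have st: "s < t" using s by auto
    have p: "0 < (l t - l s) / (t - s)" using time_change_less[OF l(1) s(1) st] st by auto
    have "\<bar>ln ((l t - l s) / (t - s))\<bar> \<le> c" using time_change_slope[OF l(1) s(1) st] l(2) by simp
    then have "(l t - l s) / (t - s) \<le> exp c" "exp (- c) \<le> (l t - l s) / (t - s)"
      using p by (metis abs_le_D1 exp_le_cancel_iff exp_ln, metis abs_le_D2 exp_le_cancel_iff exp_ln minus_le_iff)
    then show ?thesis using st by (simp add: field_simps)
  qed auto
  then show "l t - l s \<le> exp c * (t - s)" "exp (- c) * (t - s) \<le> l t - l s" by auto
qed

lemma time_change_approx: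
  assumes l: "l \<in> time_changes" "Sup (log_slopes l) \<le> c" and t: "0 \<le> t"
  shows "\<bar>l t - t\<bar> \<le> (exp c - 1) * t"
proof -
  have c: "0 \<le> c" using Sup_log_slopes_nonneg[OF l(1)] l(2) by simp
  \<comment> \<open>This makes the possible delay \<open>1 - exp (- c)\<close> no larger than the
    possible advance \<open>exp c - 1\<close>, so one bound serves both signs.\<close>
  have "exp c + exp (- c) \<ge> 2"
    using sum_squares_ge_zero[of "exp (c/2) - exp (- c/2)" 0]
    by (simp add: power2_eq_square algebra_simps flip: exp_add)
  then have "(2 - exp c) * t \<le> exp (- c) * t" using t by (intro mult_right_mono) auto
  then show ?thesis
    using time_change_bounds[OF l, of 0 t] t time_change_zero[OF l(1)] by (auto simp: algebra_simps abs_le_iff)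
qed

text \<open>Two-sided slope bounds are all that has to be checked: the lower one gives strict
  monotonicity and unboundedness, the upper one continuity, and together they give surjectivity by
  the intermediate value theorem.\<close>

lemma time_changeI:
  assumes z: "l 0 = 0"
    and b: "\<And>s t. 0 \<le> s \<Longrightarrow> s < t \<Longrightarrow> exp (- c) * (t - s) \<le> l t - l s \<and> l t - l s \<le> exp c * (t - s)"
  shows "l \<in> time_changes" "Sup (log_slopes l) \<le> c"
proof -
  have less: "l s < l t" if "0 \<le> s" "s < t" for s t
  proof -
    have "0 < exp (- c) * (t - s)" using that by simp
    then show ?thesis using b[OF that] by linarith
  qed
  have bound: "\<bar>ln ((l t - l s) / (t - s))\<bar> \<le> c" if st: "0 \<le> s" "s < t" for s t
  proof -
    have "exp (- c) \<le> (l t - l s) / (t - s)" "(l t - l s) / (t - s) \<le> exp c" "0 < (l t - l s) / (t - s)"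
      using b[OF st] less[OF st] st by (auto simp: field_simps)
    then have "- c \<le> ln ((l t - l s) / (t - s))" "ln ((l t - l s) / (t - s)) \<le> c"
      by (metis exp_gt_zero ln_exp ln_le_cancel_iff)+
    then show ?thesis by auto
  qed
  then have le: "a \<le> c" if "a \<in> log_slopes l" for a using that by (auto simp: log_slopes_def)
  then show "Sup (log_slopes l) \<le> c" by (intro cSup_least log_slopes_nonempty) auto
  have cont: "continuous_on {0..r} l" for r
  proof (rule continuous_on_subset[of "{0..}"])
    have "(exp c)-lipschitz_on {0..} l"
    proof (rule lipschitz_onI)
      fix x y :: real assume "x \<in> {0..}" "y \<in> {0..}"
      then show "dist (l x) (l y) \<le> exp c * dist x y"
        using b[of x y] b[of y x] less[of x y] less[of y x]
        by (cases x y rule: linorder_cases) (auto simp: dist_real_def abs_if)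
    qed auto
    then show "continuous_on {0..} l" by (rule lipschitz_on_continuous_on)
  qed auto
  have "l ` {0..} = {0..}"
  proof (intro equalityI subsetI)
    fix y assume "y \<in> l ` {0..}"
    then obtain t where "0 \<le> t" "y = l t" by auto
    then show "y \<in> {0..}" using less[of 0 t] z by (cases "t = 0") auto
  next
    fix y :: real assume y: "y \<in> {0..}"
    \<comment> \<open>By the lower slope bound \<open>l ?r\<close> is at least
      \<open>y + exp (- c)\<close>, so the value \<open>y\<close> is passed before
      \<open>?r\<close>.\<close>
    let ?r = "exp c * y + 1"
    have "0 < ?r" using y by (simp add: add_nonneg_pos)
    moreover have "exp (- c) * (?r - 0) = y + exp (- c)" by (simp add: algebra_simps flip: exp_add)
    ultimately have "0 < ?r" "y \<le> l ?r" using b[of 0 ?r] z exp_gt_zero[of "- c"] by linarith+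
    then obtain t where "0 \<le> t" "l t = y"
      using IVT'[of l 0 y ?r] cont[of ?r] y z by auto
    then show "y \<in> l ` {0..}" by auto
  qed
  moreover have "bdd_above (log_slopes l)" using le by (rule bdd_aboveI)
  ultimately show "l \<in> time_changes"
    using less by (auto simp: time_changes_def strict_mono_on_def)
qed

lemma time_change_continuous:
  assumes "l \<in> time_changes" shows "continuous_on {0..} l"
proof (rule lipschitz_on_continuous_on)
  show "(exp (Sup (log_slopes l)))-lipschitz_on {0..} l"
  proof (rule lipschitz_onI)
    fix x y :: real assume "x \<in> {0..}" "y \<in> {0..}"
    then show "dist (l x) (l y) \<le> exp (Sup (log_slopes l)) * dist x y"
      using time_change_bounds[OF assms order_refl, of x y] time_change_bounds[OF assms order_refl, of y x]
        time_change_mono[OF assms, of x y] time_change_mono[OF assms, of y x]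
      by (cases "x \<le> y") (auto simp: dist_real_def abs_if)
  qed auto
qed

lemma id_time_change: "(\<lambda>t. t) \<in> time_changes" "Sup (log_slopes (\<lambda>t. t)) \<le> 0"
  by (rule time_changeI[of _ 0]; simp)+

lemma time_change_comp:
  assumes l: "l \<in> time_changes" "l' \<in> time_changes"
  shows "l' \<circ> l \<in> time_changes" "Sup (log_slopes (l' \<circ> l)) \<le> Sup (log_slopes l) + Sup (log_slopes l')"
proof -
  let ?a = "Sup (log_slopes l)" and ?b = "Sup (log_slopes l')"
  have z: "(l' \<circ> l) 0 = 0" using time_change_zero[OF l(1)] time_change_zero[OF l(2)] by simp
  have "exp (- (?a + ?b)) * (t - s) \<le> (l' \<circ> l) t - (l' \<circ> l) s \<and>
      (l' \<circ> l) t - (l' \<circ> l) s \<le> exp (?a + ?b) * (t - s)" if st: "0 \<le> s" "s < t" for s t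
  proof -
  have p: "0 \<le> l s" "l s \<le> l t" using l st time_change_nonneg time_change_mono by auto
  note b1 = time_change_bounds[OF l(1) order_refl, of s t]
  note b2 = time_change_bounds[OF l(2) order_refl p]
  have "exp (- ?b) * (exp (- ?a) * (t - s)) \<le> exp (- ?b) * (l t - l s)"
    "exp ?b * (l t - l s) \<le> exp ?b * (exp ?a * (t - s))"
    using b1 st by (auto intro!: mult_left_mono)
  then show ?thesis
  proof -
    have "exp (- (?a + ?b)) = exp (- ?b) * exp (- ?a)" "exp (?a + ?b) = exp ?b * exp ?a" by (simp_all add: add.commute flip: exp_add)
    then show ?thesis
      using b2 \<open>exp (- ?b) * (exp (- ?a) * (t - s)) \<le> exp (- ?b) * (l t - l s)\<close>
        \<open>exp ?b * (l t - l s) \<le> exp ?b * (exp ?a * (t - s))\<close> by (simp only: mult.assoc comp_def) linarith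
  qed
qed
  then show "l' \<circ> l \<in> time_changes" "Sup (log_slopes (l' \<circ> l)) \<le> ?a + ?b"
    using time_changeI[of "l' \<circ> l" "?a + ?b"] z by auto
qed

text \<open>Inversion changes the sign of the logarithmic slopes and keeps their absolute
  values.\<close>

lemma time_change_inverse:
  assumes l: "l \<in> time_changes"
  defines "l' \<equiv> inv_into {0..} l"
  shows "l' \<in> time_changes" "Sup (log_slopes l') \<le> Sup (log_slopes l)"
    "\<And>t. 0 \<le> t \<Longrightarrow> l (l' t) = t" "\<And>t. 0 \<le> t \<Longrightarrow> l' (l t) = t" "\<And>t. 0 \<le> t \<Longrightarrow> 0 \<le> l' t"
proof -
  let ?c = "Sup (log_slopes l)"
  have im: "l ` {0..} = {0..}" and inj: "inj_on l {0..}"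
    using l by (auto simp: time_changes_def intro: strict_mono_on_imp_inj_on)
  show r: "l (l' t) = t" if "0 \<le> t" for t using f_inv_into_f[of t l "{0..}"] im that by (simp add: l'_def)
  show q: "l' (l t) = t" if "0 \<le> t" for t using inj that by (simp add: l'_def)
  show p: "0 \<le> l' t" if "0 \<le> t" for t using inv_into_into[of t l "{0..}"] im that by (simp add: l'_def)
  have z: "l' 0 = 0" using q[of 0] time_change_zero[OF l] by simp
  have b: "exp (- ?c) * (t - s) \<le> l' t - l' s \<and> l' t - l' s \<le> exp ?c * (t - s)" if st: "0 \<le> s" "s < t" for s t
  proof -
    have le: "l' s \<le> l' t"
    proof (rule ccontr)
      assume "\<not> l' s \<le> l' t"
      then have "l (l' t) < l (l' s)" using time_change_less[OF l, of "l' t" "l' s"] p st by auto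
      then show False using r st by simp
    qed
    have "t - s \<le> exp ?c * (l' t - l' s)" "exp (- ?c) * (l' t - l' s) \<le> t - s"
      using time_change_bounds[OF l order_refl p[OF st(1)] le] r st by auto
    then show ?thesis by (auto simp: exp_minus field_simps)
  qed
  show "l' \<in> time_changes" "Sup (log_slopes l') \<le> ?c" using time_changeI[of l' ?c] z b by auto
qed

section \<open>Measurability and integrability of the stopped distance\<close>

text \<open>Sampling \<open>f\<close> at the next grid point gives functions of an integer,
  measurable whatever \<open>f\<close> is. The sample points lie strictly to the right of
  \<open>u\<close>, so right continuity alone makes the samples converge; \<open>max u 0\<close>
  extends the function from the half-line.\<close>

lemma right_continuous_measurable:
  fixes f :: "real \<Rightarrow> real"
  assumes "\<And>u. 0 \<le> u \<Longrightarrow> (f \<longlongrightarrow> f u) (at_right u)"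
  shows "(\<lambda>u. f (max u 0)) \<in> borel_measurable borel"
proof (rule borel_measurable_LIMSEQ_real)
  fix u :: real
  define w where "w = max u 0"
  let ?p = "\<lambda>m. (of_int \<lfloor>w * real (Suc m)\<rfloor> + 1) / real (Suc m)"
  have gt: "?p m > w" and le: "?p m \<le> w + 1 / real (Suc m)" for m
  proof -
    have a: "w * real (Suc m) < of_int \<lfloor>w * real (Suc m)\<rfloor> + 1"
      "of_int \<lfloor>w * real (Suc m)\<rfloor> \<le> w * real (Suc m)" by linarith+
    have "?p m \<le> (w * real (Suc m) + 1) / real (Suc m)"
      by (intro divide_right_mono add_right_mono a) simp
    also have "\<dots> = w + 1 / real (Suc m)"
      by (simp add: add_divide_distrib del: of_nat_Suc)
    finally show "?p m \<le> w + 1 / real (Suc m)" .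
    show "?p m > w" by (rule pos_less_divide_eq[THEN iffD2, OF _ a(1)]) simp
  qed
  have "(\<lambda>m. w + 1 / real (Suc m)) \<longlonglongrightarrow> w + 0"
    by (rule tendsto_add[OF tendsto_const LIMSEQ_inverse_real_of_nat[unfolded inverse_eq_divide]])
  then have lim: "(\<lambda>m. w + 1 / real (Suc m)) \<longlonglongrightarrow> w"
    by (simp only: add_0_right)
  have "?p \<longlonglongrightarrow> w"
  proof (rule tendsto_sandwich[OF _ _ tendsto_const lim])
    show "\<forall>\<^sub>F m in sequentially. w \<le> ?p m" by (intro always_eventually allI less_imp_le gt)
    show "\<forall>\<^sub>F m in sequentially. ?p m \<le> w + 1 / real (Suc m)" by (intro always_eventually allI le)
  qed
  moreover have "?p m \<in> {w<..} \<and> ?p m \<noteq> w" for m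
    unfolding greaterThan_iff using gt[of m] by (intro conjI less_imp_neq[symmetric])
  ultimately have "filterlim ?p (at_right w) sequentially"
    unfolding filterlim_at by (intro conjI always_eventually) blast+
  then have "(\<lambda>m. f (?p m)) \<longlonglongrightarrow> f w"
    by (rule filterlim_compose[OF assms, rotated]) (simp add: w_def)
  then show "(\<lambda>m. f ((of_int \<lfloor>max u 0 * real (Suc m)\<rfloor> + 1) / real (Suc m))) \<longlonglongrightarrow> f (max u 0)"
    by (simp only: w_def)
next
  fix m
  have "(\<lambda>u. \<lfloor>max u 0 * real (Suc m)\<rfloor>) \<in> borel \<rightarrow>\<^sub>M count_space UNIV" by measurable
  then show "(\<lambda>u. f ((of_int \<lfloor>max u 0 * real (Suc m)\<rfloor> + 1) / real (Suc m))) \<in> borel_measurable borel"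
    by (rule measurable_compose) auto
qed

lemma nn_integral_exp_atLeast: "(\<integral>\<^sup>+u. ennreal (exp (- u)) * indicator {c::real..} u \<partial>lborel) = ennreal (exp (- c))"
proof -
  have "((\<lambda>u::real. - exp (- u)) \<longlongrightarrow> - 0) at_top"
    by (intro tendsto_minus filterlim_compose[OF exp_at_bot] filterlim_uminus_at_bot_at_top)
  moreover have "DERIV (\<lambda>u. - exp (- u)) x :> exp (- x)" for x :: real
    by (auto intro!: derivative_eq_intros)
  ultimately show ?thesis
    using nn_integral_FTC_atLeast[of "\<lambda>u. exp (- u)" c "\<lambda>u. - exp (- u)" 0] by auto
qed

lemma exp_integrable_atLeast: "set_integrable lborel {c::real..} (\<lambda>u. exp (- u))"
  unfolding set_integrable_def
  by (rule integrableI_nonneg)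
    (auto simp: nn_integral_exp_atLeast ennreal_mult'' ennreal_indicator mult.commute
       intro!: le_less_trans[OF eq_refl[OF nn_integral_exp_atLeast[of c, unfolded mult.commute[of "ennreal _"]]]])

lemma exp_integral_atLeast: "(LINT u:{c::real..}|lborel. exp (- u)) = exp (- c)"
  unfolding set_lebesgue_integral_def
  using nn_integral_exp_atLeast[of c]
  by (subst integral_eq_nn_integral) (auto simp: ennreal_mult'' ennreal_indicator mult.commute)

context Metric_space
begin

lemma mdist_triangle_diff:
  assumes "a \<in> M" "b \<in> M" "a' \<in> M" "b' \<in> M"
  shows "\<bar>d a b - d a' b'\<bar> \<le> d a a' + d b b'"
  using triangle[of a a' b] triangle[of a' b' b] triangle[of a' a b'] triangle[of a b b'] assms
    commute[of a' a] commute[of b' b] by linarith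

lemma cadlag_in: "x \<in> cadlag_paths M d \<Longrightarrow> 0 \<le> t \<Longrightarrow> x t \<in> M"
  by (auto simp: cadlag_paths_def)

lemma cadlag_right:
  assumes "x \<in> cadlag_paths M d" "0 \<le> t" "0 < e"
  obtains h where "0 < h" "\<And>s. t \<le> s \<Longrightarrow> s < t + h \<Longrightarrow> d (x s) (x t) < e"
proof -
  have "limitin mtopology x (x t) (at_right t)" using assms by (auto simp: cadlag_paths_def)
  then have "\<forall>\<^sub>F s in at_right t. d (x s) (x t) < e"
    using assms(3) by (auto simp: limitin_metric elim!: eventually_mono)
  then obtain b where b: "t < b" "\<And>s. t < s \<Longrightarrow> s < b \<Longrightarrow> d (x s) (x t) < e"
    using eventually_at_right[of t "t + 1"] by auto
  show thesis
  proof (rule that[of "b - t"])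
    fix s assume "t \<le> s" "s < t + (b - t)"
    then show "d (x s) (x t) < e" using b cadlag_in[OF assms(1,2)] assms(3) by (cases "s = t") auto
  qed (use b in auto)
qed

lemma cadlag_left:
  assumes "x \<in> cadlag_paths M d" "0 < t" "0 < e"
  obtains h where "0 < h" "h \<le> t" "\<And>s s'. t - h < s \<Longrightarrow> s < t \<Longrightarrow> t - h < s' \<Longrightarrow> s' < t \<Longrightarrow> d (x s) (x s') < e"
proof -
  obtain l where l: "limitin mtopology x l (at_left t)" using assms by (auto simp: cadlag_paths_def)
  then have lM: "l \<in> M" by (simp add: limitin_metric)
  have "0 < e / 2" using assms(3) by simp
  then have "\<forall>\<^sub>F s in at_left t. x s \<in> M \<and> d (x s) l < e / 2"
    using l unfolding limitin_metric by blast
  then have "\<forall>\<^sub>F s in at_left t. d (x s) l < e / 2" by (rule eventually_mono) auto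
  then obtain b where b: "b < t" "\<And>s. b < s \<Longrightarrow> s < t \<Longrightarrow> d (x s) l < e / 2"
    using eventually_at_left[of "t - 1" t] by auto
  show thesis
  proof (rule that[of "min (t - b) t"])
    fix s s' assume s: "t - min (t - b) t < s" "s < t" "t - min (t - b) t < s'" "s' < t"
    then have "0 \<le> s" "0 \<le> s'" by auto
    then have "d (x s) (x s') \<le> d (x s) l + d (x s') l"
      using triangle[of "x s" l "x s'"] commute lM cadlag_in[OF assms(1)] by auto
    also have "\<dots> < e / 2 + e / 2" by (intro add_strict_mono b(2)) (use s in linarith)+
    finally show "d (x s) (x s') < e" by simp
  qed (use b assms in auto)
qed

lemma stopped_dist_bounds:
  assumes "l \<in> time_changes"
  shows "0 \<le> stopped_dist d x y l u" "stopped_dist d x y l u \<le> 1"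
    "0 \<le> t \<Longrightarrow> min (d (x (min t u)) (y (min (l t) u))) 1 \<le> stopped_dist d x y l u"
    "(\<And>t. 0 \<le> t \<Longrightarrow> d (x (min t u)) (y (min (l t) u)) \<le> e) \<Longrightarrow> stopped_dist d x y l u \<le> e"
proof -
  have bdd: "bdd_above ((\<lambda>t. min (d (x (min t u)) (y (min (l t) u))) 1) ` {0..})"
    by (auto intro!: bdd_aboveI[of _ 1])
  show up: "min (d (x (min t u)) (y (min (l t) u))) 1 \<le> stopped_dist d x y l u" if "0 \<le> t" for t
    unfolding stopped_dist_def using that by (intro cSUP_upper bdd) auto
  show "0 \<le> stopped_dist d x y l u" using up[of 0] by (smt (verit) nonneg)
  show "stopped_dist d x y l u \<le> 1" unfolding stopped_dist_def by (intro cSUP_least) auto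
  show "stopped_dist d x y l u \<le> e" if "\<And>t. 0 \<le> t \<Longrightarrow> d (x (min t u)) (y (min (l t) u)) \<le> e"
    unfolding stopped_dist_def using that by (intro cSUP_least) (auto intro: min.coboundedI1)
qed

lemma cadlag_dist_right_continuous:
  assumes x: "x \<in> cadlag_paths M d" "y \<in> cadlag_paths M d"
    and p: "0 \<le> p u" "(p \<longlongrightarrow> p u) (at_right u)" "\<And>v. u < v \<Longrightarrow> p u \<le> p v"
    and q: "0 \<le> q u" "(q \<longlongrightarrow> q u) (at_right u)" "\<And>v. u < v \<Longrightarrow> q u \<le> q v"
  shows "((\<lambda>v::real. d (x (p v)) (y (q v))) \<longlongrightarrow> d (x (p u)) (y (q u))) (at_right u)"
  unfolding tendsto_iff
proof (intro allI impI)
  fix e :: real assume e: "0 < e"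
  have one: "\<forall>\<^sub>F v in at_right u. x (p v) \<in> M \<and> d (x (p v)) (x (p u)) < e / 2"
    if x: "x \<in> cadlag_paths M d" and p: "0 \<le> p u" "(p \<longlongrightarrow> p u) (at_right u)" "\<And>v. u < v \<Longrightarrow> p u \<le> p v" for x p
  proof -
    obtain h where h: "0 < h" "\<And>s. p u \<le> s \<Longrightarrow> s < p u + h \<Longrightarrow> d (x s) (x (p u)) < e / 2"
      using cadlag_right[OF x p(1), of "e / 2"] e by auto
    have "\<forall>\<^sub>F v in at_right u. dist (p v) (p u) < h" using p(2) h(1) by (auto simp: tendsto_iff)
    moreover have "\<forall>\<^sub>F v in at_right u. u < v" by (auto simp: eventually_at_filter)
    ultimately show ?thesis
    proof eventually_elim
      case (elim v)
      then have "p u \<le> p v" using p(3) by auto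
      then show ?case using h(2)[of "p v"] elim p(1) cadlag_in[OF x] by (auto simp: dist_real_def)
    qed
  qed
  show "\<forall>\<^sub>F v in at_right u. dist (d (x (p v)) (y (q v))) (d (x (p u)) (y (q u))) < e"
    using one[OF x(1) p(1,2) p(3), simplified] one[OF x(2) q(1,2) q(3), simplified]
  proof eventually_elim
    case (elim v)
    have "x (p u) \<in> M" "y (q u) \<in> M" using cadlag_in x p(1) q(1) by auto
    then show ?case using mdist_triangle_diff[of "x (p v)" "y (q v)" "x (p u)" "y (q u)"] elim
      by (simp add: dist_real_def)
  qed
qed

text \<open>Right continuity in \<open>t\<close> reduces an uncountable supremum to a countable one,
  from which measurability in the level \<open>u\<close> follows.\<close>

lemma stopped_dist_rational:
  assumes x: "x \<in> cadlag_paths M d" "y \<in> cadlag_paths M d" and l: "l \<in> time_changes" and u: "0 \<le> u"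
  shows "stopped_dist d x y l u = (SUP t\<in>{0..} \<inter> \<rat>. min (d (x (min t u)) (y (min (l t) u))) 1)" (is "_ = ?R")
proof (rule antisym)
  let ?f = "\<lambda>t. min (d (x (min t u)) (y (min (l t) u))) 1"
  have bdd: "bdd_above (?f ` A)" for A by (auto intro!: bdd_aboveI[of _ 1])
  have ne: "(0::real) \<in> {0..} \<inter> \<rat>" by auto
  show "?R \<le> stopped_dist d x y l u"
    by (rule cSUP_least) (use ne stopped_dist_bounds(3)[OF l] in auto)
  show "stopped_dist d x y l u \<le> ?R"
    unfolding stopped_dist_def
  proof (rule cSUP_least)
    fix t :: real assume t: "t \<in> {0..}"
    have lt: "(l \<longlongrightarrow> l t) (at_right t)"
      using time_change_continuous[OF l] t
      by (auto simp: continuous_on_def intro: tendsto_within_subset)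
    have "((\<lambda>t. d (x (min t u)) (y (min (l t) u))) \<longlongrightarrow> d (x (min t u)) (y (min (l t) u))) (at_right t)"
      using t u time_change_nonneg[OF l] time_change_mono[OF l, of t]
      by (intro cadlag_dist_right_continuous[OF x] tendsto_intros lt) (auto simp: min.coboundedI1 min_le_iff_disj le_max_iff_disj)
    then have lim: "(?f \<longlongrightarrow> ?f t) (at_right t)" by (intro tendsto_intros)
    show "?f t \<le> ?R"
    proof (rule ccontr)
      assume "\<not> ?f t \<le> ?R"
      then have "\<forall>\<^sub>F s in at_right t. ?R < ?f s" by (intro order_tendstoD(1)[OF lim]) (simp only: not_le)
      then obtain b where b: "t < b" "\<And>s. t < s \<Longrightarrow> s < b \<Longrightarrow> ?R < ?f s"
        using eventually_at_right[of t "t + 1"] by auto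
      obtain s where s: "s \<in> \<rat>" "t < s" "s < b" using Rats_dense_in_real[OF b(1)] by auto
      then have "?f s \<le> ?R" using t by (intro cSUP_upper bdd) auto
      then show False using b(2)[OF s(2,3)] by simp
    qed
  qed auto
qed

lemma stopped_dist_measurable:
  assumes x: "x \<in> cadlag_paths M d" "y \<in> cadlag_paths M d" and l: "l \<in> time_changes"
  shows "(\<lambda>u. stopped_dist d x y l (max u 0)) \<in> borel_measurable borel"
proof -
  have "(\<lambda>u. SUP t\<in>{0..} \<inter> \<rat>. min (d (x (min t (max u 0))) (y (min (l t) (max u 0)))) 1) \<in> borel_measurable borel"
  proof (rule borel_measurable_cSUP)
    show "countable ({0..} \<inter> \<rat> :: real set)" using countable_rat by auto
    fix t :: real assume t: "t \<in> {0..} \<inter> \<rat>"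
    show "(\<lambda>u. min (d (x (min t (max u 0))) (y (min (l t) (max u 0)))) 1) \<in> borel_measurable borel"
    proof (rule right_continuous_measurable[where f = "\<lambda>u. min (d (x (min t u)) (y (min (l t) u))) 1"])
      fix u :: real assume "0 \<le> u"
      then show "((\<lambda>u. min (d (x (min t u)) (y (min (l t) u))) 1) \<longlongrightarrow> min (d (x (min t u)) (y (min (l t) u))) 1) (at_right u)"
        using t time_change_nonneg[OF l, of t]
        by (intro tendsto_min tendsto_const cadlag_dist_right_continuous[OF x] tendsto_intros) auto
    qed
  qed (auto intro!: bdd_aboveI[of _ 1])
  then show ?thesis using stopped_dist_rational[OF x l] by simp
qed

lemma stopped_dist_integrable:
  assumes x: "x \<in> cadlag_paths M d" "y \<in> cadlag_paths M d" and l: "l \<in> time_changes"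
  shows "set_integrable lborel {0..} (\<lambda>u. exp (- u) * stopped_dist d x y l u)"
proof (rule set_integrable_bound[OF exp_integrable_atLeast])
  have "(\<lambda>u. indicator {0..} u *\<^sub>R (exp (- u) * stopped_dist d x y l (max u 0))) \<in> borel_measurable lborel"
    using stopped_dist_measurable[OF assms] by measurable
  also have "(\<lambda>u. indicator {0..} u *\<^sub>R (exp (- u) * stopped_dist d x y l (max u 0))) =
      (\<lambda>u. indicator {0..} u *\<^sub>R (exp (- u) * stopped_dist d x y l u))"
    by (auto simp: indicator_def fun_eq_iff max_def)
  finally show "set_borel_measurable lborel {0..} (\<lambda>u. exp (- u) * stopped_dist d x y l u)"
    by (simp add: set_borel_measurable_def)
qed (use stopped_dist_bounds(1,2)[OF l] in \<open>auto simp: abs_mult intro!: AE_I2\<close>)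

section \<open>Metric axioms and estimates of the Skorohod distance\<close>

definition skorohod_cost :: "(real \<Rightarrow> 'a) \<Rightarrow> (real \<Rightarrow> 'a) \<Rightarrow> (real \<Rightarrow> real) \<Rightarrow> real" where
  "skorohod_cost x y l = max (Sup (log_slopes l)) (LINT u:{0..}|lborel. exp (- u) * stopped_dist d x y l u)"

lemma skorohod_dist_eq: "skorohod_dist d x y = (INF l\<in>time_changes. skorohod_cost x y l)"
  by (simp add: skorohod_dist_def skorohod_cost_def)

lemma skorohod_cost_nonneg: "l \<in> time_changes \<Longrightarrow> 0 \<le> skorohod_cost x y l"
  using Sup_log_slopes_nonneg by (auto simp: skorohod_cost_def le_max_iff_disj)

lemma skorohod_dist_le_cost: "l \<in> time_changes \<Longrightarrow> skorohod_dist d x y \<le> skorohod_cost x y l"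
  unfolding skorohod_dist_eq by (intro cINF_lower bdd_belowI[of _ 0]) (auto simp: skorohod_cost_nonneg)

lemma skorohod_dist_lessE:
  assumes "skorohod_dist d x y < e"
  obtains l where "l \<in> time_changes" "skorohod_cost x y l < e"
proof -
  have "bdd_below (skorohod_cost x y ` time_changes)"
    by (auto intro!: bdd_belowI[of _ 0] simp: skorohod_cost_nonneg)
  then show thesis
    using assms that id_time_change(1) unfolding skorohod_dist_eq by (subst (asm) cINF_less_iff) auto
qed

lemma skorohod_dist_nonneg: "0 \<le> skorohod_dist d x y"
  unfolding skorohod_dist_eq by (intro cINF_greatest) (use id_time_change skorohod_cost_nonneg in auto)

text \<open>The inverse time change costs no more: substituting \<open>l t\<close> for the time runs
  through the same pairs of points.\<close>

lemma skorohod_dist_commute_le: "skorohod_dist d y x \<le> skorohod_dist d x y"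
proof (rule field_le_epsilon)
  fix e :: real assume "0 < e"
  then obtain l where l: "l \<in> time_changes" "skorohod_cost x y l < skorohod_dist d x y + e"
    using skorohod_dist_lessE[of x y "skorohod_dist d x y + e"] by auto
  define l' where "l' = inv_into {0..} l"
  note inv = time_change_inverse[OF l(1), folded l'_def]
  have "stopped_dist d y x l' u = stopped_dist d x y l u" for u
  proof -
    have "(\<lambda>t. min (d (y (min t u)) (x (min (l' t) u))) 1) ` {0..} =
        (\<lambda>t. min (d (x (min t u)) (y (min (l t) u))) 1) ` {0..}"
    proof (intro equalityI subsetI)
      fix a assume "a \<in> (\<lambda>t. min (d (y (min t u)) (x (min (l' t) u))) 1) ` {0..}"
      then obtain t where t: "0 \<le> t" "a = min (d (y (min t u)) (x (min (l' t) u))) 1" by auto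
      then have "a = min (d (x (min (l' t) u)) (y (min (l (l' t)) u))) 1" using inv(3) commute by simp
      then show "a \<in> (\<lambda>t. min (d (x (min t u)) (y (min (l t) u))) 1) ` {0..}" using inv(5) t by auto
    next
      fix a assume "a \<in> (\<lambda>t. min (d (x (min t u)) (y (min (l t) u))) 1) ` {0..}"
      then obtain t where t: "0 \<le> t" "a = min (d (x (min t u)) (y (min (l t) u))) 1" by auto
      then have "a = min (d (y (min (l t) u)) (x (min (l' (l t)) u))) 1" using inv(4) commute by simp
      then show "a \<in> (\<lambda>t. min (d (y (min t u)) (x (min (l' t) u))) 1) ` {0..}"
        using time_change_nonneg[OF l(1)] t by auto
    qed
    then show ?thesis by (simp add: stopped_dist_def)
  qed
  then have "skorohod_cost y x l' \<le> skorohod_cost x y l" using inv(2) unfolding skorohod_cost_def by (intro max.mono) simp_all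
  then show "skorohod_dist d y x \<le> skorohod_dist d x y + e"
    using skorohod_dist_le_cost[OF inv(1), of y x] l(2) by linarith
qed

lemma skorohod_dist_triangle:
  assumes x: "x \<in> cadlag_paths M d" and y: "y \<in> cadlag_paths M d" and z: "z \<in> cadlag_paths M d"
  shows "skorohod_dist d x z \<le> skorohod_dist d x y + skorohod_dist d y z"
proof (rule field_le_epsilon)
  fix e :: real assume e: "0 < e"
  obtain l where l: "l \<in> time_changes" "skorohod_cost x y l < skorohod_dist d x y + e / 2"
    using skorohod_dist_lessE[of x y "skorohod_dist d x y + e / 2"] e by auto
  obtain l' where l': "l' \<in> time_changes" "skorohod_cost y z l' < skorohod_dist d y z + e / 2"
    using skorohod_dist_lessE[of y z "skorohod_dist d y z + e / 2"] e by auto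
  note c = time_change_comp[OF l(1) l'(1)]
  have min_add: "min a 1 \<le> min b 1 + min c 1" if "a \<le> b + c" "0 \<le> b" "0 \<le> c" for a b c :: real
    using that by (auto simp: min_def)
  have max_add: "max a b \<le> max p q + max r s" if "a \<le> p + r" "b \<le> q + s" for a b p q r s :: real
    using that by (auto simp: max_def)
  have st: "stopped_dist d x z (l' \<circ> l) u \<le> stopped_dist d x y l u + stopped_dist d y z l' u" if "0 \<le> u" for u
    unfolding stopped_dist_def[of _ x z]
  proof (rule cSUP_least)
    fix t :: real assume t: "t \<in> {0..}"
    have p: "0 \<le> l t" "0 \<le> l' (l t)" using t l(1) l'(1) time_change_nonneg by auto
    \<comment> \<open>Both clocks are stopped at the same level \<open>u\<close>, so the two stopped
      distances share the intermediate point \<open>y (min (l t) u)\<close>.\<close>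
    have "d (x (min t u)) (z (min ((l' \<circ> l) t) u)) \<le>
        d (x (min t u)) (y (min (l t) u)) + d (y (min (l t) u)) (z (min (l' (l t)) u))"
      unfolding comp_def using t p that by (intro triangle cadlag_in x y z) auto
    then show "min (d (x (min t u)) (z (min ((l' \<circ> l) t) u))) 1 \<le> stopped_dist d x y l u + stopped_dist d y z l' u"
      using stopped_dist_bounds(3)[OF l(1), of t x u y] stopped_dist_bounds(3)[OF l'(1), of "l t" y u z] t p
        min_add[of "d (x (min t u)) (z (min ((l' \<circ> l) t) u))"] nonneg
      by (meson add_mono atLeast_iff order_trans)
  qed auto
  have "(LINT u:{0..}|lborel. exp (- u) * stopped_dist d x z (l' \<circ> l) u) \<le>
      (LINT u:{0..}|lborel. exp (- u) * stopped_dist d x y l u + exp (- u) * stopped_dist d y z l' u)"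
  proof (intro set_integral_mono set_integral_add(1) stopped_dist_integrable x y z l l' c)
    fix u :: real assume "u \<in> {0..}"
    then show "exp (- u) * stopped_dist d x z (l' \<circ> l) u \<le>
        exp (- u) * stopped_dist d x y l u + exp (- u) * stopped_dist d y z l' u"
      using mult_left_mono[OF st[of u], of "exp (- u)"] by (simp add: distrib_left)
  qed
  also have "\<dots> = (LINT u:{0..}|lborel. exp (- u) * stopped_dist d x y l u) + (LINT u:{0..}|lborel. exp (- u) * stopped_dist d y z l' u)"
    by (intro set_integral_add stopped_dist_integrable x y z l l')
  finally have "skorohod_cost x z (l' \<circ> l) \<le> skorohod_cost x y l + skorohod_cost y z l'"
    unfolding skorohod_cost_def by (rule max_add[OF c(2)])
  then show "skorohod_dist d x z \<le> skorohod_dist d x y + skorohod_dist d y z + e"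
    using skorohod_dist_le_cost[OF c(1), of x z] l(2) l'(2) by linarith
qed

text \<open>If the paths differ at \<open>t\<close>, they stay apart just to the right of \<open>t\<close>, which bounds the stopped
  distance from below for every time change close to the identity.\<close>

lemma skorohod_dist_zero_imp_eq:
  assumes x: "x \<in> cadlag_paths M d" and y: "y \<in> cadlag_paths M d" and z: "skorohod_dist d x y = 0"
  shows "x = y"
proof
  fix t
  show "x t = y t"
  proof (cases "0 \<le> t")
    case False then show ?thesis using x y by (auto simp: cadlag_paths_def PiE_def extensional_def)
  next
    case t: True
    show ?thesis
    proof (rule ccontr)
      assume ne: "x t \<noteq> y t"
      define e where "e = min (d (x t) (y t) / 3) 1"
      have e: "0 < e" "e \<le> 1" "3 * e \<le> d (x t) (y t)"
        using ne zero[of "x t" "y t"] cadlag_in[OF x t] cadlag_in[OF y t] nonneg[of "x t" "y t"]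
        by (auto simp: e_def min_def less_le)
      obtain h1 where h1: "0 < h1" "\<And>s. t \<le> s \<Longrightarrow> s < t + h1 \<Longrightarrow> d (x s) (x t) < e" using cadlag_right[OF x t e(1)] by metis
      obtain h2 where h2: "0 < h2" "\<And>s. t \<le> s \<Longrightarrow> s < t + h2 \<Longrightarrow> d (y s) (y t) < e" using cadlag_right[OF y t e(1)] by metis
      define h where "h = min h1 h2"
      have h: "0 < h" using h1 h2 by (auto simp: h_def)
      \<comment> \<open>The midpoint leaves a margin of \<open>h / 2\<close> on both sides, so that
        \<open>l s\<close> stays in the window as soon as it is within \<open>h / 4\<close> of
        \<open>s\<close>.\<close>
      define s where "s = t + h / 2"
      have s: "t \<le> s" "0 < s" using h t by (auto simp: s_def)
      \<comment> \<open>The first bound keeps \<open>l s\<close> within \<open>h / 4\<close> of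
        \<open>s\<close>. The second is the integral, with weight \<open>exp (- u)\<close>, of a
        stopped distance of \<open>e\<close> at all levels beyond \<open>t + h\<close>; a cost below
        \<open>c\<close> has no room for it.\<close>
      define c where "c = min (ln (1 + h / (4 * s))) (e * exp (- (t + h)))"
      have "1 < 1 + h / (4 * s)" using h s by simp
      then have c: "0 < c" using e unfolding c_def by (intro min_less_iff_conj[THEN iffD2] conjI ln_gt_zero mult_pos_pos) simp_all
      obtain l where l: "l \<in> time_changes" "skorohod_cost x y l < c" using skorohod_dist_lessE[of x y c] z c by auto
      have "Sup (log_slopes l) \<le> ln (1 + h / (4 * s))" using l(2) by (auto simp: skorohod_cost_def c_def)
      then have "\<bar>l s - s\<bar> \<le> (exp (ln (1 + h / (4 * s))) - 1) * s" using time_change_approx[OF l(1), of _ s] s by auto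
      also have "\<dots> = h / 4"
      proof -
        have "0 < 1 + h / (4 * s)" using h s by (simp add: add_pos_pos)
        then show ?thesis using s by (simp add: field_simps)
      qed
      finally have "- (l s - s) \<le> h / 4" "l s - s \<le> h / 4" unfolding abs_le_iff by blast+
      then have ls: "t \<le> l s" "l s < t + h" "s < t + h" using h s_def by linarith+
      have low: "e \<le> stopped_dist d x y l u" if "t + h \<le> u" for u
      proof -
        have "d (x s) (x t) < e" "d (y (l s)) (y t) < e" using h1(2)[of s] h2(2)[of "l s"] s ls by (auto simp: h_def)
        moreover have "\<bar>d (x t) (y t) - d (x s) (y (l s))\<bar> \<le> d (x t) (x s) + d (y t) (y (l s))"
          using t s ls by (intro mdist_triangle_diff cadlag_in x y) auto
        ultimately have "e \<le> d (x s) (y (l s))" using e(3) commute[of "x t" "x s"] commute[of "y t" "y (l s)"] by linarith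
        then show ?thesis
          using stopped_dist_bounds(3)[OF l(1), of s x u y] that ls s e min_absorb1[of s u] min_absorb1[of "l s" u] by simp
      qed
      have int: "set_integrable lborel {t+h..} (\<lambda>u. exp (- u) * stopped_dist d x y l u)"
        by (rule set_integrable_subset[OF stopped_dist_integrable[OF x y l(1)]]) (use t h in auto)
      have "e * exp (- (t + h)) = (LINT u:{t+h..}|lborel. exp (- u) * e)"
        by (simp add: exp_integral_atLeast)
      also have "\<dots> \<le> (LINT u:{t+h..}|lborel. exp (- u) * stopped_dist d x y l u)"
      proof (rule set_integral_mono[OF _ int])
        show "set_integrable lborel {t+h..} (\<lambda>u. exp (- u) * e)"
          by (intro set_integrable_mult_left exp_integrable_atLeast)
        show "exp (- u) * e \<le> exp (- u) * stopped_dist d x y l u" if "u \<in> {t+h..}" for u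
          using low[of u] that by (intro mult_left_mono) simp_all
      qed
      also have "\<dots> \<le> (LINT u:{0..}|lborel. exp (- u) * stopped_dist d x y l u)"
        unfolding set_lebesgue_integral_def
      proof (rule integral_mono[OF int[unfolded set_integrable_def] stopped_dist_integrable[OF x y l(1), unfolded set_integrable_def]])
        show "indicator {t+h..} u *\<^sub>R (exp (- u) * stopped_dist d x y l u) \<le>
            indicator {0..} u *\<^sub>R (exp (- u) * stopped_dist d x y l u)" for u
          using stopped_dist_bounds(1)[OF l(1), of x y u] t h by (simp add: indicator_def)
      qed
      also have "\<dots> < c" using l(2) by (simp add: skorohod_cost_def)
      finally show False by (simp add: c_def)
    qed
  qed
qed

text \<open>\<open>W\<close> collects the levels at which one path is stopped before and the other
  after a jump. There the integrand is at most 1, so \<open>W\<close> contributes at most its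
  length, and the levels beyond \<open>T\<close> contribute at most
  \<open>exp (- T)\<close>.\<close>

lemma skorohod_dist_le:
  assumes x: "x \<in> cadlag_paths M d" "y \<in> cadlag_paths M d" and l: "l \<in> time_changes" "Sup (log_slopes l) \<le> c"
    and W: "W \<in> sets borel" "emeasure lborel W < \<infinity>" and e: "0 \<le> e"
    and b: "\<And>u t. 0 \<le> u \<Longrightarrow> u < T \<Longrightarrow> u \<notin> W \<Longrightarrow> 0 \<le> t \<Longrightarrow> d (x (min t u)) (y (min (l t) u)) \<le> e"
  shows "skorohod_dist d x y \<le> max c (e + measure lborel W + exp (- T))"
proof -
  have jW: "integrable lborel (indicator W :: real \<Rightarrow> real)" using W by simp
  have jT: "integrable lborel (\<lambda>u. indicator {T..} u *\<^sub>R exp (- u))"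
    using exp_integrable_atLeast[of T] by (simp only: set_integrable_def)
  have iW: "set_integrable lborel {0..} (\<lambda>u. indicator W u :: real)"
    unfolding set_integrable_def by (rule integrable_mult_indicator[OF _ jW]) simp
  have iT: "set_integrable lborel {0..} (\<lambda>u. indicator {T..} u *\<^sub>R exp (- u))"
    unfolding set_integrable_def by (rule integrable_mult_indicator[OF _ jT]) simp
  have ie: "set_integrable lborel {0..} (\<lambda>u. e * exp (- u))"
    by (intro set_integrable_mult_right exp_integrable_atLeast)
  have "(LINT u:{0..}|lborel. exp (- u) * stopped_dist d x y l u) \<le>
      (LINT u:{0..}|lborel. e * exp (- u) + indicator W u + indicator {T..} u *\<^sub>R exp (- u))"
  proof (rule set_integral_mono[OF stopped_dist_integrable[OF x l(1)] set_integral_add(1)[OF set_integral_add(1)[OF ie iW] iT]])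
    fix u :: real assume u: "u \<in> {0..}"
    have "stopped_dist d x y l u \<le> 1" by (rule stopped_dist_bounds[OF l(1)])
    then have m: "exp (- u) * stopped_dist d x y l u \<le> exp (- u) * 1" by (intro mult_left_mono) auto
    show "exp (- u) * stopped_dist d x y l u \<le> e * exp (- u) + indicator W u + indicator {T..} u *\<^sub>R exp (- u)"
    proof (cases "u \<in> W \<or> T \<le> u")
      case True
      have "exp (- u) \<le> 1" "0 \<le> e * exp (- u)" using u e by auto
      then have "exp (- u) \<le> indicator W u + indicator {T..} u *\<^sub>R exp (- u)"
        using True by (auto simp: indicator_def)
      then show ?thesis using m \<open>0 \<le> e * exp (- u)\<close> by linarith
    next
      case False
      then have "stopped_dist d x y l u \<le> e" using b u by (intro stopped_dist_bounds(4)[OF l(1)]) auto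
      then have "exp (- u) * stopped_dist d x y l u \<le> exp (- u) * e" by (intro mult_left_mono) auto
      then show ?thesis using False by (auto simp: mult.commute)
    qed
  qed
  also have "\<dots> = e * (LINT u:{0..}|lborel. exp (- u)) + (LINT u:{0..}|lborel. indicator W u) + (LINT u:{0..}|lborel. indicator {T..} u *\<^sub>R exp (- u))"
    by (simp only: set_integral_add(2)[OF set_integral_add(1)[OF ie iW] iT] set_integral_add(2)[OF ie iW] set_integral_mult_right)
  also have "\<dots> \<le> e + measure lborel W + exp (- T)"
  proof -
    have "(LINT u:{0..}|lborel. indicator W u) \<le> (LINT u|lborel. indicator W u :: real)"
      unfolding set_lebesgue_integral_def
      by (rule integral_mono[OF iW[unfolded set_integrable_def] jW]) (simp add: indicator_def)
    moreover have "(LINT u:{0..}|lborel. indicator {T..} u *\<^sub>R exp (- u)) \<le> (LINT u:{T..}|lborel. exp (- u))"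
      unfolding set_lebesgue_integral_def
      by (rule integral_mono[OF iT[unfolded set_integrable_def] jT]) (simp add: indicator_def)
    ultimately show ?thesis using W exp_integral_atLeast[of 0] exp_integral_atLeast[of T] by simp
  qed
  finally have "skorohod_cost x y l \<le> max c (e + measure lborel W + exp (- T))"
    using l(2) by (auto simp: skorohod_cost_def)
  then show ?thesis using skorohod_dist_le_cost[OF l(1), of x y] by linarith
qed

lemma skorohod_dist_le_uniform:
  assumes x: "x \<in> cadlag_paths M d" "y \<in> cadlag_paths M d" and e: "0 \<le> e"
    and b: "\<And>t. 0 \<le> t \<Longrightarrow> t < T \<Longrightarrow> d (x t) (y t) \<le> e"
  shows "skorohod_dist d x y \<le> e + exp (- T)"
proof -
  have "skorohod_dist d x y \<le> max 0 (e + measure lborel ({} :: real set) + exp (- T))"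
    by (rule skorohod_dist_le[OF x id_time_change _ _ e]) (use b in auto)
  then show ?thesis using e by (simp add: max_def add_nonneg_nonneg split: if_splits)
qed

lemma Metric_space_skorohod: "Metric_space (cadlag_paths M d) (skorohod_dist d)"
proof
  show "skorohod_dist d x y = skorohod_dist d y x" for x y
    by (rule antisym[OF skorohod_dist_commute_le skorohod_dist_commute_le])
  show "(skorohod_dist d x y = 0) = (x = y)" if xy: "x \<in> cadlag_paths M d" "y \<in> cadlag_paths M d" for x y
  proof
    assume "x = y"
    have "skorohod_dist d x x \<le> 0 + e" if "0 < e" for e
    proof -
      \<comment> \<open>The horizon \<open>- ln e\<close> makes the tail term equal to
        \<open>e\<close>.\<close>
      have "skorohod_dist d x x \<le> 0 + exp (- (- ln e))"
        by (rule skorohod_dist_le_uniform) (use xy cadlag_in in auto)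
      then show ?thesis using that by simp
    qed
    then have "skorohod_dist d x x \<le> 0" by (rule field_le_epsilon)
    then show "skorohod_dist d x y = 0" using skorohod_dist_nonneg[of x x] \<open>x = y\<close> by simp
  qed (use skorohod_dist_zero_imp_eq xy in auto)
qed (use skorohod_dist_nonneg skorohod_dist_triangle in auto)

text \<open>On \<open>[T, T + 1]\<close>, an interval of length one, the weight is at least
  \<open>exp (- (T + 1))\<close>; so a distance below the bound leaves a level \<open>u\<close> in
  it whose stopped distance is below \<open>e\<close>. Stopping at such a level does not touch the
  first path up to time \<open>T\<close>.\<close>

lemma skorohod_dist_continuous_limit:
  assumes T: "0 \<le> T" and e: "0 < e" "e \<le> 1"
    and x: "x \<in> cadlag_paths M d" "y \<in> cadlag_paths M d"
    and small: "skorohod_dist d x y < e * exp (- (T + 1))"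
  obtains l u where "l \<in> time_changes" "Sup (log_slopes l) \<le> e" "T \<le> u"
    "\<And>t. 0 \<le> t \<Longrightarrow> t \<le> T \<Longrightarrow> d (x t) (y (min (l t) u)) \<le> e"
proof -
  obtain l where l: "l \<in> time_changes" "skorohod_cost x y l < e * exp (- (T + 1))"
    using skorohod_dist_lessE[OF small] by auto
  have "exp (- (T + 1)) \<le> 1" using T by simp
  then have "e * exp (- (T + 1)) \<le> e * 1" using e by (intro mult_left_mono) auto
  then have sup: "Sup (log_slopes l) \<le> e" using l(2) by (auto simp: skorohod_cost_def)
  have "\<exists>u\<in>{T..T+1}. stopped_dist d x y l u < e"
  proof (rule ccontr)
    assume "\<not> (\<exists>u\<in>{T..T+1}. stopped_dist d x y l u < e)"
    then have ge: "e \<le> stopped_dist d x y l u" if "u \<in> {T..T+1}" for u using that by force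
    have "e * exp (- (T + 1)) = (LINT u:{T..T+1}|lborel. e * exp (- (T + 1)))"
      by (simp add: set_lebesgue_integral_def)
    also have "\<dots> \<le> (LINT u:{T..T+1}|lborel. exp (- u) * stopped_dist d x y l u)"
    proof (intro set_integral_mono)
      show "set_integrable lborel {T..T+1} (\<lambda>u. exp (- u) * stopped_dist d x y l u)"
        by (rule set_integrable_subset[OF stopped_dist_integrable[OF x l(1)]]) (use T in auto)
      fix u assume u: "u \<in> {T..T+1}"
      then have "exp (- (T + 1)) * e \<le> exp (- u) * stopped_dist d x y l u"
        using ge[OF u] e by (intro mult_mono) auto
      then show "e * exp (- (T + 1)) \<le> exp (- u) * stopped_dist d x y l u" by (simp add: mult.commute)
    qed (auto simp: set_integrable_def)
    also have "\<dots> \<le> (LINT u:{0..}|lborel. exp (- u) * stopped_dist d x y l u)"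
      unfolding set_lebesgue_integral_def
      using stopped_dist_integrable[OF x l(1)] set_integrable_subset[OF stopped_dist_integrable[OF x l(1)], of "{T..T+1}"] T
        stopped_dist_bounds(1)[OF l(1)]
      by (intro integral_mono) (auto simp: set_integrable_def indicator_def)
    finally show False using l(2) by (simp add: skorohod_cost_def)
  qed
  then obtain u where u: "T \<le> u" "u \<le> T + 1" "stopped_dist d x y l u < e" by auto
  have "d (x t) (y (min (l t) u)) \<le> e" if "0 \<le> t" "t \<le> T" for t
    using stopped_dist_bounds(3)[OF l(1) that(1), of x u y] u e that by (auto simp: min_def split: if_splits)
  then show thesis using that[OF l(1) sup u(1)] by auto
qed

end

section \<open>Measurability of random paths\<close>

lemma measurable_count_space_map:
  assumes "\<And>a. a \<in> set xs \<Longrightarrow> c a \<in> N \<rightarrow>\<^sub>M count_space (UNIV :: 'c::countable set)"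
  shows "(\<lambda>\<omega>. map (\<lambda>a. c a \<omega>) xs) \<in> N \<rightarrow>\<^sub>M count_space UNIV"
  using assms
proof (induction xs)
  case (Cons a xs)
  have m1: "c a \<in> N \<rightarrow>\<^sub>M count_space UNIV" using Cons.prems by auto
  have m2: "(\<lambda>\<omega>. map (\<lambda>a. c a \<omega>) xs) \<in> N \<rightarrow>\<^sub>M count_space UNIV" using Cons by auto
  have "(\<lambda>\<omega>. y # map (\<lambda>a. c a \<omega>) xs) \<in> N \<rightarrow>\<^sub>M count_space UNIV" for y
    by (rule measurable_compose[OF m2]) simp
  then have "(\<lambda>\<omega>. c a \<omega> # map (\<lambda>a. c a \<omega>) xs) \<in> N \<rightarrow>\<^sub>M count_space UNIV"
    by (rule measurable_compose_countable[OF _ m1])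
  then show ?case by simp
qed simp

text \<open>The index of the last grid point up to \<open>t\<close>, capped at \<open>m * m\<close>,
  that is at time \<open>m\<close>. The cap leaves finitely many values, so a step path is
  determined by a finite list.\<close>

definition grid :: "nat \<Rightarrow> real \<Rightarrow> nat" where
  "grid m t = min (nat \<lfloor>t * real m\<rfloor>) (m * m)"

lemma floor_right_limit: "\<forall>\<^sub>F s in at_right (t::real). \<lfloor>s * r\<rfloor> = \<lfloor>t * r\<rfloor>" if "0 < r"
proof -
  have tb: "t < (of_int \<lfloor>t * r\<rfloor> + 1) / r" using that by (simp add: field_simps) linarith
  show ?thesis
  proof (subst eventually_at_right[OF tb], intro exI conjI impI allI)
    show "(of_int \<lfloor>t * r\<rfloor> + 1) / r > t" by (rule tb)
    fix s assume s: "t < s" "s < (of_int \<lfloor>t * r\<rfloor> + 1) / r"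
    then have "s * r < of_int \<lfloor>t * r\<rfloor> + 1" "t * r \<le> s * r" using that by (auto simp: field_simps)
    then show "\<lfloor>s * r\<rfloor> = \<lfloor>t * r\<rfloor>" by linarith
  qed
qed

lemma floor_left_limit: "\<forall>\<^sub>F s in at_left (t::real). \<lfloor>s * r\<rfloor> = \<lceil>t * r\<rceil> - 1" if "0 < r"
proof -
  have tb: "(of_int \<lceil>t * r\<rceil> - 1) / r < t" using that by (simp add: field_simps) linarith
  show ?thesis
  proof (subst eventually_at_left[OF tb], intro exI conjI impI allI)
    show "(of_int \<lceil>t * r\<rceil> - 1) / r < t" by (rule tb)
    fix s assume s: "(of_int \<lceil>t * r\<rceil> - 1) / r < s" "s < t"
    then have "of_int \<lceil>t * r\<rceil> - 1 < s * r" "s * r < t * r" using that by (auto simp: field_simps)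
    then show "\<lfloor>s * r\<rfloor> = \<lceil>t * r\<rceil> - 1" by linarith
  qed
qed

context Metric_space
begin

lemma limitin_eventually_const:
  assumes "\<forall>\<^sub>F s in F. x s = a" "a \<in> M"
  shows "limitin mtopology x a F"
  unfolding limitin_metric using assms by (auto elim!: eventually_mono)

lemma cadlag_step:
  assumes f: "\<And>k. f k \<in> M" and m: "0 < m"
  shows "(\<lambda>t\<in>{0..}. f (grid m t)) \<in> cadlag_paths M d"
  unfolding cadlag_paths_def
proof (intro CollectI conjI allI impI)
  fix t :: real assume t: "0 \<le> t"
  have "\<forall>\<^sub>F s in at_right t. t < s" by (simp add: eventually_at_filter)
  moreover have "\<forall>\<^sub>F s in at_right t. \<lfloor>s * real m\<rfloor> = \<lfloor>t * real m\<rfloor>" using floor_right_limit m by simp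
  ultimately have "\<forall>\<^sub>F s in at_right t. (\<lambda>t\<in>{0..}. f (grid m t)) s = (\<lambda>t\<in>{0..}. f (grid m t)) t"
    by eventually_elim (use t in \<open>simp add: grid_def\<close>)
  then show "limitin mtopology (\<lambda>t\<in>{0..}. f (grid m t)) ((\<lambda>t\<in>{0..}. f (grid m t)) t) (at_right t)"
    by (rule limitin_eventually_const) (use f t in auto)
next
  fix t :: real assume t: "0 < t"
  let ?a = "f (min (nat (\<lceil>t * real m\<rceil> - 1)) (m * m))"
  have "\<forall>\<^sub>F s in at_left t. 0 < s" by (rule eventually_at_leftI[of 0]) (use t in auto)
  moreover have "\<forall>\<^sub>F s in at_left t. \<lfloor>s * real m\<rfloor> = \<lceil>t * real m\<rceil> - 1" using floor_left_limit m by simp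
  ultimately have "\<forall>\<^sub>F s in at_left t. (\<lambda>t\<in>{0..}. f (grid m t)) s = ?a"
    by eventually_elim (simp add: grid_def)
  then show "\<exists>l. limitin mtopology (\<lambda>t\<in>{0..}. f (grid m t)) l (at_left t)"
    by (intro exI[of _ ?a] limitin_eventually_const f)
qed (use f in auto)

text \<open>Compactness by bisection. Near a point, right continuity handles the pairs to its right,
  the left limit handles the pairs to its left, and the point itself is put into \<open>G\<close> to
  exclude the pairs that it separates.\<close>

lemma cadlag_partition:
  assumes x: "x \<in> cadlag_paths M d" and e: "0 < e" and T: "0 \<le> T"
  obtains G where "finite G" "G \<subseteq> {0..}" "0 \<in> G"
    "\<And>s t. 0 \<le> s \<Longrightarrow> s \<le> t \<Longrightarrow> t < T \<Longrightarrow> G \<inter> {s<..t} = {} \<Longrightarrow> d (x s) (x t) \<le> e"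
proof -
  let ?P = "\<lambda>a b. \<exists>G. finite G \<and> (\<forall>s t. 0 \<le> s \<and> a \<le> s \<and> s \<le> t \<and> t < b \<and> G \<inter> {s<..t} = {} \<longrightarrow> d (x s) (x t) \<le> e)"
  have "?P 0 T"
    using T
  proof (rule Bolzano[where P = ?P])
    fix a b c assume "?P a b" "?P b c" and ab: "a \<le> b" "b \<le> c"
    then obtain G1 G2 where G: "finite G1" "finite G2"
      "\<And>s t. 0 \<le> s \<Longrightarrow> a \<le> s \<Longrightarrow> s \<le> t \<Longrightarrow> t < b \<Longrightarrow> G1 \<inter> {s<..t} = {} \<Longrightarrow> d (x s) (x t) \<le> e"
      "\<And>s t. 0 \<le> s \<Longrightarrow> b \<le> s \<Longrightarrow> s \<le> t \<Longrightarrow> t < c \<Longrightarrow> G2 \<inter> {s<..t} = {} \<Longrightarrow> d (x s) (x t) \<le> e"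
      by metis
    show "?P a c"
    proof (intro exI[of _ "G1 \<union> G2 \<union> {b}"] conjI allI impI)
      fix s t assume st: "0 \<le> s \<and> a \<le> s \<and> s \<le> t \<and> t < c \<and> (G1 \<union> G2 \<union> {b}) \<inter> {s<..t} = {}"
      then have "\<not> (s < b \<and> b \<le> t)" "G1 \<inter> {s<..t} = {}" "G2 \<inter> {s<..t} = {}" by auto
      then show "d (x s) (x t) \<le> e" using G(3)[of s t] G(4)[of s t] st by (cases "t < b") auto
    qed (use G in auto)
  next
    fix r :: real assume r: "0 \<le> r" "r \<le> T"
    obtain h where h: "0 < h" "\<And>s. r \<le> s \<Longrightarrow> s < r + h \<Longrightarrow> d (x s) (x r) < e / 2"
      using cadlag_right[OF x r(1), of "e / 2"] e by auto
    have right: "d (x s) (x t) \<le> e" if "r \<le> s" "s < r + h" "r \<le> t" "t < r + h" for s t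
    proof -
      have "d (x s) (x t) \<le> d (x s) (x r) + d (x t) (x r)"
        using triangle[of "x s" "x r" "x t"] commute[of "x r" "x t"] cadlag_in[OF x] that r by auto
      then show ?thesis using h(2)[OF that(1,2)] h(2)[OF that(3,4)] by linarith
    qed
    obtain h' where h': "0 < h'" "\<And>s t. 0 \<le> s \<Longrightarrow> r - h' < s \<Longrightarrow> s < r \<Longrightarrow> r - h' < t \<Longrightarrow> t < r \<Longrightarrow> d (x s) (x t) \<le> e"
    proof (cases "r = 0")
      case False
      then obtain k where "0 < k" "\<And>s t. r - k < s \<Longrightarrow> s < r \<Longrightarrow> r - k < t \<Longrightarrow> t < r \<Longrightarrow> d (x s) (x t) < e"
        using cadlag_left[OF x _ e, of r] r by (metis less_le)
      then show thesis using that[of k] by (meson less_imp_le)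
    next
      case True then show thesis using that[of 1] by auto
    qed
    show "\<exists>dl>0. \<forall>a b. a \<le> r \<and> r \<le> b \<and> b - a < dl \<longrightarrow> ?P a b"
    proof (intro exI[of _ "min h h'"] conjI allI impI)
      fix a b assume ab: "a \<le> r \<and> r \<le> b \<and> b - a < min h h'"
      show "?P a b"
      proof (intro exI[of _ "{r}"] conjI allI impI)
        fix s t assume st: "0 \<le> s \<and> a \<le> s \<and> s \<le> t \<and> t < b \<and> {r} \<inter> {s<..t} = {}"
        show "d (x s) (x t) \<le> e"
        proof (cases "r \<le> s")
          case True then show ?thesis using right[of s t] st ab by auto
        next
          case False
          then have "t < r" using st by auto
          then show ?thesis using h'(2)[of s t] st ab False by auto
        qed
      qed auto
    qed (use h h' in auto)
  qed
  then obtain G where G: "finite G" "\<And>s t. 0 \<le> s \<Longrightarrow> s \<le> t \<Longrightarrow> t < T \<Longrightarrow> G \<inter> {s<..t} = {} \<Longrightarrow> d (x s) (x t) \<le> e"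
    by auto
  show thesis
  proof (rule that[of "insert 0 (G \<inter> {0..})"])
    fix s t assume st: "0 \<le> s" "s \<le> t" "t < T" "insert 0 (G \<inter> {0..}) \<inter> {s<..t} = {}"
    then have "G \<inter> {s<..t} = {}" by (auto simp: disjoint_iff)
    then show "d (x s) (x t) \<le> e" using G(2) st by auto
  qed (use G in auto)
qed

text \<open>The time change moves every point of the partition to the next grid point: it is the identity
  plus the largest Lipschitz extension of the displacements.\<close>

lemma skorohod_dist_step:
  assumes x: "x \<in> cadlag_paths M d" and e: "0 < e" and T: "0 \<le> T"
    and G: "finite G" "G \<subseteq> {0..}" "0 \<in> G"
      "\<And>s t. 0 \<le> s \<Longrightarrow> s \<le> t \<Longrightarrow> t < T \<Longrightarrow> G \<inter> {s<..t} = {} \<Longrightarrow> d (x s) (x t) \<le> e"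
    and gap: "\<And>g g'. g \<in> G \<Longrightarrow> g' \<in> G \<Longrightarrow> g \<noteq> g' \<Longrightarrow> \<delta> \<le> \<bar>g - g'\<bar>" "0 < \<delta>"
    and m: "0 < m" "T \<le> real m" "1 / (real m * \<delta>) \<le> 1 / 2"
  shows "skorohod_dist d x (\<lambda>t\<in>{0..}. x (real (grid m t) / real m)) \<le>
    max (2 / (real m * \<delta>)) (e + real (card G) / real m + exp (- T))"
proof -
  \<comment> \<open>Points of \<open>G\<close> move by less than \<open>1 / m\<close> and are at
    least \<open>\<delta>\<close> apart, so the displacements can be interpolated with slopes up to
    \<open>1 / (m * \<delta>)\<close>.\<close>
  define \<kappa> where "\<kappa> = 1 / (real m * \<delta>)"
  have \<kappa>: "0 < \<kappa>" "\<kappa> \<le> 1 / 2" "\<kappa> * \<delta> = 1 / real m" using m gap(2) by (auto simp: \<kappa>_def)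
  define up where "up g = of_int \<lceil>g * real m\<rceil> / real m" for g :: real
  have up: "g \<le> up g" "up g < g + 1 / real m" for g
  proof -
    have "g * real m \<le> of_int \<lceil>g * real m\<rceil>" "of_int \<lceil>g * real m\<rceil> < g * real m + 1" by linarith+
    then show "g \<le> up g" "up g < g + 1 / real m"
      using m(1) by (simp_all add: up_def pos_le_divide_eq pos_divide_less_eq distrib_right)
  qed
  define \<phi> where "\<phi> t = Min ((\<lambda>g. up g - g + \<kappa> * \<bar>t - g\<bar>) ` G)" for t
  have fin: "finite ((\<lambda>g. up g - g + \<kappa> * \<bar>t - g\<bar>) ` G)" "(\<lambda>g. up g - g + \<kappa> * \<bar>t - g\<bar>) ` G \<noteq> {}" for t
    using G by auto
  have \<phi>le: "\<phi> t \<le> up g - g + \<kappa> * \<bar>t - g\<bar>" if "g \<in> G" for t g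
    unfolding \<phi>_def using that fin by (intro Min_le) auto
  have \<phi>0: "0 \<le> \<phi> t" for t
    unfolding \<phi>_def using up(1) \<kappa> by (subst Min_ge_iff[OF fin]) (auto intro!: add_nonneg_nonneg)
  have \<phi>lip: "\<phi> s \<le> \<phi> t + \<kappa> * \<bar>s - t\<bar>" for s t
  proof -
    obtain g where g: "g \<in> G" "\<phi> t = up g - g + \<kappa> * \<bar>t - g\<bar>"
      using Min_in[OF fin, of t] unfolding \<phi>_def by auto
    have "\<kappa> * \<bar>s - g\<bar> \<le> \<kappa> * (\<bar>t - g\<bar> + \<bar>s - t\<bar>)" using \<kappa> by (intro mult_left_mono) auto
    then show ?thesis using \<phi>le[OF g(1), of s] g(2) by (simp add: distrib_left)
  qed
  \<comment> \<open>Here the gap enters: at distance at least \<open>\<delta>\<close> the cone of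
    another point has risen by \<open>1 / m\<close>, more than the displacement of
    \<open>g\<close>.\<close>
  have \<phi>G: "\<phi> g = up g - g" if g: "g \<in> G" for g
  proof (rule antisym)
    show "\<phi> g \<le> up g - g" using \<phi>le[OF g, of g] by simp
    show "up g - g \<le> \<phi> g"
      unfolding \<phi>_def
    proof (subst Min_ge_iff[OF fin], intro ballI)
      fix a assume "a \<in> (\<lambda>g'. up g' - g' + \<kappa> * \<bar>g - g'\<bar>) ` G"
      then obtain g' where g': "g' \<in> G" "a = up g' - g' + \<kappa> * \<bar>g - g'\<bar>" by auto
      show "up g - g \<le> a"
      proof (cases "g = g'")
        case False
        then have "\<kappa> * \<delta> \<le> \<kappa> * \<bar>g - g'\<bar>" using \<kappa> gap(1)[OF g g'(1)] by (intro mult_left_mono) auto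
        then show ?thesis using \<kappa>(3) g'(2) up[of g] up[of g'] by linarith
      qed (use g' \<kappa> in auto)
    qed
  qed
  define l where "l t = t + \<phi> t" for t
  have up0: "up 0 = 0" by (simp add: up_def)
  have l0: "l 0 = 0" using \<phi>G[OF G(3)] up0 by (simp add: l_def)
  have lG: "l g = up g" if "g \<in> G" for g using \<phi>G[OF that] by (simp add: l_def)
  \<comment> \<open>A change of slope by \<open>\<kappa>\<close> is at most
    \<open>2 * \<kappa>\<close> in logarithm as long as \<open>\<kappa> \<le> 1 / 2\<close>. This is
    the condition on \<open>m\<close> and the source of the 2 in the bound.\<close>
  have slope: "exp (- (2 * \<kappa>)) * (t - s) \<le> l t - l s \<and> l t - l s \<le> exp (2 * \<kappa>) * (t - s)" if st: "0 \<le> s" "s < t" for s t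
  proof -
    have a: "(1 - \<kappa>) * (t - s) \<le> l t - l s" "l t - l s \<le> (1 + \<kappa>) * (t - s)"
      using \<phi>lip[of s t] \<phi>lip[of t s] st by (auto simp: l_def algebra_simps)
    have "1 + \<kappa> \<le> exp (2 * \<kappa>)" using exp_ge_add_one_self[of "2 * \<kappa>"] \<kappa> by linarith
    moreover have "exp (- (2 * \<kappa>)) \<le> 1 - \<kappa>"
    proof -
      have "1 \<le> (1 - \<kappa>) * (1 + 2 * \<kappa>)" using mult_left_mono[OF \<kappa>(2), of "2 * \<kappa>"] \<kappa>(1) by (simp add: algebra_simps)
      also have "\<dots> \<le> (1 - \<kappa>) * exp (2 * \<kappa>)" using \<kappa> by (intro mult_left_mono exp_ge_add_one_self) auto
      finally show ?thesis by (simp add: exp_minus field_simps)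
    qed
    ultimately have "exp (- (2 * \<kappa>)) * (t - s) \<le> (1 - \<kappa>) * (t - s)" "(1 + \<kappa>) * (t - s) \<le> exp (2 * \<kappa>) * (t - s)"
      using st by (auto intro!: mult_right_mono)
    then show ?thesis using a by linarith
  qed
  note l = time_changeI[OF l0 slope]
  \<comment> \<open>At a level after a point of \<open>G\<close> and before the next grid point, the
    stopped path \<open>x\<close> is past the jump while the step path has not seen it yet.\<close>
  define W where "W = (\<Union>g\<in>G. {g..<g + 1 / real m})"
  have "emeasure lborel W < \<infinity>" unfolding W_def using G(1) by (intro emeasure_bounded_finite bounded_UN) auto
  moreover have Wm: "W \<in> sets borel" unfolding W_def using G(1) by auto
  moreover have step: "(\<lambda>t\<in>{0..}. x (real (grid m t) / real m)) \<in> cadlag_paths M d"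
    using cadlag_step[of "\<lambda>k. x (real k / real m)" m] cadlag_in[OF x] m(1) by auto
  moreover have "d (x (min t u)) ((\<lambda>t\<in>{0..}. x (real (grid m t) / real m)) (min (l t) u)) \<le> e"
    if u: "0 \<le> u" "u < T" "u \<notin> W" and t: "0 \<le> t" for u t
  proof -
    define a where "a = min t u"
    define b where "b = min (l t) u"
    have lt: "t \<le> l t" using \<phi>0 by (simp add: l_def)
    have ab: "0 \<le> a" "a \<le> u" "a \<le> t" "0 \<le> b" "b \<le> u" "b \<le> l t" "a = t \<or> a = u" "b = l t \<or> b = u"
      using u t lt by (auto simp: a_def b_def)
    have floor0: "0 \<le> \<lfloor>b * real m\<rfloor>" using ab by simp
    \<comment> \<open>Levels below \<open>T \<le> m\<close> are not touched by the cap in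
      \<open>grid\<close>.\<close>
    have "b * real m \<le> real m * real m" using ab u m by (intro mult_right_mono) auto
    then have "\<lfloor>b * real m\<rfloor> \<le> int (m * m)" by (simp add: floor_le_iff)
    then have "grid m b = nat \<lfloor>b * real m\<rfloor>" unfolding grid_def by (intro min_absorb1) (simp add: nat_le_iff)
    then have gr: "real (grid m b) = of_int \<lfloor>b * real m\<rfloor>" using floor0 by simp
    define p where "p = real (grid m b) / real m"
    have "of_int \<lfloor>b * real m\<rfloor> \<le> b * real m" by linarith
    then have "p \<le> b" using m(1) gr by (simp add: p_def pos_divide_le_eq)
    moreover have "0 \<le> p" unfolding p_def by (intro divide_nonneg_nonneg) simp_all
    ultimately have p: "0 \<le> p" "p \<le> b" by auto
    have pup: "up g \<le> p" if "up g \<le> b" for g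
    proof -
      have "of_int \<lceil>g * real m\<rceil> \<le> b * real m" using that m(1) by (simp add: up_def field_simps)
      then have "\<lceil>g * real m\<rceil> \<le> \<lfloor>b * real m\<rfloor>" by (simp add: le_floor_iff)
      then show ?thesis using m(1) by (simp add: up_def p_def gr divide_right_mono)
    qed
    have pup': "up g \<le> p" if "g \<le> p" for g
    proof -
      have "g * real m \<le> of_int \<lfloor>b * real m\<rfloor>" using that m(1) by (simp add: p_def gr field_simps)
      then have "\<lceil>g * real m\<rceil> \<le> \<lfloor>b * real m\<rfloor>" by (simp add: ceiling_le_iff)
      then show ?thesis using m(1) by (simp add: up_def p_def gr divide_right_mono)
    qed
    \<comment> \<open>\<open>p\<close> is the grid point at which the step path reads
      \<open>x\<close>. No point of \<open>G\<close> separates \<open>a\<close> from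
      \<open>p\<close>: the time change sends it exactly to its next grid point, and a level cutting
      in between lies in \<open>W\<close>.\<close>
    have "d (x a) (x p) \<le> e"
    proof (cases "a \<le> p")
      case True
      have "G \<inter> {a<..p} = {}"
      proof (rule ccontr)
        assume "G \<inter> {a<..p} \<noteq> {}"
        then obtain g where g: "g \<in> G" "a < g" "g \<le> p" by auto
        then have "a = t" using ab p by auto
        then have "l t < l g" using time_change_less[OF l(1) t] g(2) by auto
        then show False using lG[OF g(1)] pup'[OF g(3)] p ab by linarith
      qed
      then show ?thesis using G(4)[of a p] ab p u True by auto
    next
      case False
      have "G \<inter> {p<..a} = {}"
      proof (rule ccontr)
        assume "G \<inter> {p<..a} \<noteq> {}"
        then obtain g where g: "g \<in> G" "p < g" "g \<le> a" by auto
        have "0 \<le> g" using g G(2) by auto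
        then have "l g \<le> l t" using time_change_mono[OF l(1), of g t] g ab by linarith
        moreover have "g + 1 / real m \<le> u" using u(3) g ab by (auto simp: W_def)
        ultimately have "up g \<le> b" using lG[OF g(1)] up(2)[of g] ab(8) by auto
        then show False using pup[of g] up(1)[of g] g by linarith
      qed
      then show ?thesis using G(4)[of p a] ab p u False commute[of "x a" "x p"] by auto
    qed
    then show ?thesis using ab by (simp add: a_def b_def p_def)
  qed
  ultimately have "skorohod_dist d x (\<lambda>t\<in>{0..}. x (real (grid m t) / real m)) \<le>
      max (2 * \<kappa>) (e + measure lborel W + exp (- T))"
    using e by (intro skorohod_dist_le[OF x _ l]) auto
  moreover have "measure lborel W \<le> real (card G) / real m"
  proof -
    have "measure lborel W \<le> (\<Sum>g\<in>G. measure lborel {g..<g + 1 / real m})"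
      unfolding W_def using G(1) by (intro measure_UNION_le) auto
    then show ?thesis using m(1) by simp
  qed
  ultimately show ?thesis by (auto simp: \<kappa>_def max_def split: if_splits)
qed

lemma finite_gap:
  assumes "finite (G :: real set)"
  obtains \<delta> where "0 < \<delta>" "\<And>g g'. g \<in> G \<Longrightarrow> g' \<in> G \<Longrightarrow> g \<noteq> g' \<Longrightarrow> \<delta> \<le> \<bar>g - g'\<bar>"
proof -
  \<comment> \<open>The element 1 covers sets without two distinct points.\<close>
  let ?D = "insert 1 ((\<lambda>(g, g'). \<bar>g - g'\<bar>) ` {p \<in> G \<times> G. fst p \<noteq> snd p})"
  have fin: "finite ?D" using assms by auto
  show thesis
  proof (rule that[of "Min ?D"])
    show "0 < Min ?D" by (subst Min_gr_iff) (use fin in auto)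
    show "Min ?D \<le> \<bar>g - g'\<bar>" if "g \<in> G" "g' \<in> G" "g \<noteq> g'" for g g'
      by (rule Min_le[OF fin]) (use that in force)
  qed
qed

lemma skorohod_step_limit:
  assumes x: "x \<in> cadlag_paths M d"
  shows "(\<lambda>m. skorohod_dist d x (\<lambda>t\<in>{0..}. x (real (grid (Suc m) t) / real (Suc m)))) \<longlonglongrightarrow> 0"
proof (rule LIMSEQ_I)
  fix r :: real assume r: "0 < r"
  define T where "T = max 0 (- ln (r / 4))"
  have "exp (- T) \<le> exp (ln (r / 4))" by (subst exp_le_cancel_iff) (simp add: T_def)
  then have T: "0 \<le> T" "exp (- T) \<le> r / 4" using r by (auto simp: T_def)
  have r4: "0 < r / 4" using r by simp
  obtain G where G: "finite G" "G \<subseteq> {0..}" "0 \<in> G"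
    "\<And>s t. 0 \<le> s \<Longrightarrow> s \<le> t \<Longrightarrow> t < T \<Longrightarrow> G \<inter> {s<..t} = {} \<Longrightarrow> d (x s) (x t) \<le> r / 4"
    using cadlag_partition[OF x r4 T(1)] by blast
  obtain \<delta> where \<delta>: "0 < \<delta>" "\<And>g g'. g \<in> G \<Longrightarrow> g' \<in> G \<Longrightarrow> g \<noteq> g' \<Longrightarrow> \<delta> \<le> \<bar>g - g'\<bar>"
    using finite_gap[OF G(1)] by blast
  \<comment> \<open>One entry for each demand on the number of grid points: the horizon, the
    condition on the slopes, and the smallness of the slope bound and of the length of the
    exceptional set.\<close>
  define c where "c = max T (max (2 / \<delta>) (max (4 / (r * \<delta>)) (4 * real (card G) / r)))"
  obtain m0 :: nat where m0: "c < real m0" using reals_Archimedean2 by blast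
  have "norm (skorohod_dist d x (\<lambda>t\<in>{0..}. x (real (grid (Suc m) t) / real (Suc m))) - 0) < r" if "m0 \<le> m" for m
  proof -
    define n where "n = Suc m"
    have n: "0 < n" "c < real n" using m0 that by (auto simp: n_def)
    then have nn: "T \<le> real n" "2 / \<delta> < real n" "4 / (r * \<delta>) < real n" "4 * real (card G) / r < real n"
      unfolding c_def by auto
    have a: "1 / (real n * \<delta>) \<le> 1 / 2" "2 / (real n * \<delta>) < r / 2 + r / 4" "real (card G) / real n < r / 4"
      using nn(2-) n(1) r \<delta>(1) by (auto simp: field_simps)
    have "skorohod_dist d x (\<lambda>t\<in>{0..}. x (real (grid n t) / real n)) \<le>
        max (2 / (real n * \<delta>)) (r / 4 + real (card G) / real n + exp (- T))"
      by (rule skorohod_dist_step[OF x r4 T(1) G \<delta>(2,1) n(1) nn(1) a(1)])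
    also have "\<dots> < r"
      by (intro max_less_iff_conj[THEN iffD2] conjI) (use a T(2) r in linarith)+
    finally show ?thesis using skorohod_dist_nonneg by (simp add: n_def del: of_nat_Suc)
  qed
  then show "\<exists>m0. \<forall>m\<ge>m0. norm (skorohod_dist d x (\<lambda>t\<in>{0..}. x (real (grid (Suc m) t) / real (Suc m))) - 0) < r"
    by blast
qed

section \<open>Random elements of the path space\<close>

text \<open>The functions \<open>V m\<close> pull back every set to an event. For the limit
  \<open>Y\<close> this survives for open sets \<open>U\<close>, because \<open>Y\<close> lies in
  \<open>U\<close> exactly if the \<open>V m\<close> eventually lie inside \<open>U\<close> with a
  fixed margin.\<close>

lemma measurable_borel_of_topology_limit:
  assumes V: "\<And>m. V m \<in> N \<rightarrow>\<^sub>M count_space UNIV" "\<And>m \<omega>. \<omega> \<in> space N \<Longrightarrow> V m \<omega> \<in> M"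
    and Y: "\<And>\<omega>. \<omega> \<in> space N \<Longrightarrow> Y \<omega> \<in> M"
    and lim: "\<And>\<omega>. \<omega> \<in> space N \<Longrightarrow> (\<lambda>m. d (V m \<omega>) (Y \<omega>)) \<longlonglongrightarrow> 0"
  shows "Y \<in> N \<rightarrow>\<^sub>M borel_of_topology mtopology"
  unfolding borel_of_topology_def
proof (rule measurable_measure_of)
  fix U assume "U \<in> {U. openin mtopology U}"
  then have U: "U \<subseteq> M" "\<And>y. y \<in> U \<Longrightarrow> \<exists>r>0. mball y r \<subseteq> U" by (auto simp: openin_mtopology)
  \<comment> \<open>The points whose ball of radius \<open>1 / (k + 1)\<close> stays in
    \<open>U\<close>. These sets need not be Borel, but every set has a measurable preimage under
    \<open>V m\<close>.\<close>
  define In where "In k = {y \<in> M. \<forall>z\<in>M. d y z < 1 / real (Suc k) \<longrightarrow> z \<in> U}" for k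
  have "Y -` U \<inter> space N = (\<Union>k. \<Union>j. \<Inter>m\<in>{j..}. V m -` In k \<inter> space N)"
  proof (intro equalityI subsetI)
    fix \<omega> assume \<omega>: "\<omega> \<in> Y -` U \<inter> space N"
    then obtain r where r: "0 < r" "mball (Y \<omega>) r \<subseteq> U" using U(2) by auto
    obtain k where k: "1 / real (Suc k) < r / 2" using nat_approx_posE[of "r / 2"] r(1) by auto
    have "\<forall>\<^sub>F m in sequentially. d (V m \<omega>) (Y \<omega>) < r / 2"
      using order_tendstoD(2)[OF lim, of \<omega> "r / 2"] \<omega> r(1) by auto
    then obtain j where j: "\<And>m. j \<le> m \<Longrightarrow> d (V m \<omega>) (Y \<omega>) < r / 2" by (auto simp: eventually_sequentially)
    have "V m \<omega> \<in> In k" if "j \<le> m" for m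
      unfolding In_def
    proof (intro CollectI conjI ballI impI)
      fix z assume z: "z \<in> M" "d (V m \<omega>) z < 1 / real (Suc k)"
      have "d (Y \<omega>) z \<le> d (V m \<omega>) (Y \<omega>) + d (V m \<omega>) z"
        using triangle[of "Y \<omega>" "V m \<omega>" z] commute[of "Y \<omega>" "V m \<omega>"] z V(2) Y \<omega> by auto
      then have "d (Y \<omega>) z < r" using j[OF that] z k by linarith
      then show "z \<in> U" using r(2) z Y \<omega> by (auto simp: in_mball)
    qed (use V \<omega> in auto)
    then show "\<omega> \<in> (\<Union>k. \<Union>j. \<Inter>m\<in>{j..}. V m -` In k \<inter> space N)" using \<omega> by auto
  next
    fix \<omega> assume "\<omega> \<in> (\<Union>k. \<Union>j. \<Inter>m\<in>{j..}. V m -` In k \<inter> space N)"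
    then obtain k j where kj: "\<And>m. j \<le> m \<Longrightarrow> V m \<omega> \<in> In k" and \<omega>: "\<omega> \<in> space N" by auto
    have "\<forall>\<^sub>F m in sequentially. d (V m \<omega>) (Y \<omega>) < 1 / real (Suc k)"
      using order_tendstoD(2)[OF lim[OF \<omega>], of "1 / real (Suc k)"] by auto
    then obtain j' where "\<And>m. j' \<le> m \<Longrightarrow> d (V m \<omega>) (Y \<omega>) < 1 / real (Suc k)" by (auto simp: eventually_sequentially)
    then have "Y \<omega> \<in> U" using kj[of "max j j'"] Y[OF \<omega>] by (auto simp: In_def)
    then show "\<omega> \<in> Y -` U \<inter> space N" using \<omega> by auto
  qed
  also have "\<dots> \<in> sets N"
    by (intro sets.countable_UN'' sets.countable_INT' countableI_type) (auto intro: measurable_sets[OF V(1)])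
  finally show "Y -` U \<inter> space N \<in> sets N" .
qed (use Y in \<open>auto simp: openin_mtopology\<close>)

text \<open>A path read at finitely many grid times through a countable code is a function of a list
  of codes, hence measurable for all subsets. Grid and code are refined together; the grid error
  tends to zero for each path, the code error uniformly in time.\<close>

lemma measurable_random_path:
  fixes Y :: "real \<Rightarrow> 'w \<Rightarrow> 'a" and dec :: "nat \<Rightarrow> 'c::countable \<Rightarrow> 'a"
  assumes Y: "\<And>\<omega>. \<omega> \<in> space N \<Longrightarrow> (\<lambda>t\<in>{0..}. Y t \<omega>) \<in> cadlag_paths M d"
    and code: "\<And>m t. 0 \<le> t \<Longrightarrow> code m t \<in> N \<rightarrow>\<^sub>M count_space UNIV"
    and dec: "\<And>m t \<omega>. 0 \<le> t \<Longrightarrow> \<omega> \<in> space N \<Longrightarrow> dec m (code m t \<omega>) \<in> M"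
      "\<And>m t \<omega>. 0 \<le> t \<Longrightarrow> \<omega> \<in> space N \<Longrightarrow> d (dec m (code m t \<omega>)) (Y t \<omega>) \<le> 1 / real (Suc m)"
  shows "(\<lambda>\<omega>. \<lambda>t\<in>{0..}. Y t \<omega>) \<in> N \<rightarrow>\<^sub>M borel_of_topology (skorohod_topology M d)"
proof -
  interpret S: Metric_space "cadlag_paths M d" "skorohod_dist d" by (rule Metric_space_skorohod)
  define n where "n m = Suc m" for m :: nat
  have n0: "0 < n m" for m by (simp add: n_def)
  define V where "V m \<omega> = (\<lambda>t\<in>{0..}. dec m (code m (real (grid (n m) t) / real (n m)) \<omega>))" for m \<omega>
  show ?thesis
    unfolding skorohod_topology_def
  proof (rule S.measurable_borel_of_topology_limit[of V])
    fix m
    \<comment> \<open>\<open>grid\<close> takes values from 0 up to and including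
      \<open>n m * n m\<close>, hence the successor.\<close>
    let ?xs = "[0..<Suc (n m * n m)]"
    have "(\<lambda>\<omega>. map (\<lambda>k. code m (real k / real (n m)) \<omega>) ?xs) \<in> N \<rightarrow>\<^sub>M count_space UNIV"
      by (intro measurable_count_space_map code) auto
    then have "(\<lambda>\<omega>. \<lambda>t\<in>{0..}. dec m (map (\<lambda>k. code m (real k / real (n m)) \<omega>) ?xs ! grid (n m) t)) \<in> N \<rightarrow>\<^sub>M count_space UNIV"
      by (rule measurable_compose[where g = "\<lambda>ys. \<lambda>t\<in>{0..}. dec m (ys ! grid (n m) t)"]) simp
    moreover have "dec m (map (\<lambda>k. code m (real k / real (n m)) \<omega>) ?xs ! grid (n m) t) =
        dec m (code m (real (grid (n m) t) / real (n m)) \<omega>)" for t \<omega>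
    proof -
      have "grid (n m) t < length ?xs" by (simp add: grid_def del: upt_Suc)
      then show ?thesis by (simp only: nth_map nth_upt length_upt) simp
    qed
    ultimately show "V m \<in> N \<rightarrow>\<^sub>M count_space UNIV" unfolding V_def by (simp only:)
  next
    fix m \<omega> assume \<omega>: "\<omega> \<in> space N"
    show "V m \<omega> \<in> cadlag_paths M d"
      unfolding V_def by (rule cadlag_step) (use dec(1) \<omega> n0 in auto)
  next
    fix \<omega> assume \<omega>: "\<omega> \<in> space N"
    let ?Y = "\<lambda>t\<in>{0..}. Y t \<omega>"
    let ?S = "\<lambda>m. \<lambda>t\<in>{0..}. ?Y (real (grid (n m) t) / real (n m))"
    have Sc: "?S m \<in> cadlag_paths M d" for m
      by (rule cadlag_step[of "\<lambda>k. ?Y (real k / real (n m))", OF cadlag_in[OF Y[OF \<omega>]] n0]) simp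
    have Vc: "V m \<omega> \<in> cadlag_paths M d" for m
      unfolding V_def by (rule cadlag_step) (use dec(1) \<omega> n0 in auto)
    have le: "skorohod_dist d (V m \<omega>) ?Y \<le> (1 / real (Suc m) + exp (- real m)) + skorohod_dist d ?Y (?S m)" for m
    proof -
      have "skorohod_dist d (V m \<omega>) (?S m) \<le> 1 / real (Suc m) + exp (- real m)"
      proof (rule skorohod_dist_le_uniform[OF Vc Sc])
        fix t :: real assume t: "0 \<le> t"
        then have "V m \<omega> t = dec m (code m (real (grid (n m) t) / real (n m)) \<omega>)"
          "?S m t = Y (real (grid (n m) t) / real (n m)) \<omega>" by (simp_all add: V_def)
        then show "d (V m \<omega> t) (?S m t) \<le> 1 / real (Suc m)"
          by (simp only: dec(2)[OF _ \<omega>] divide_nonneg_nonneg of_nat_0_le_iff)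
      qed simp
      moreover have "skorohod_dist d (V m \<omega>) ?Y \<le> skorohod_dist d (V m \<omega>) (?S m) + skorohod_dist d (?S m) ?Y"
        by (rule S.triangle[OF Vc Sc Y[OF \<omega>]])
      moreover have "skorohod_dist d (?S m) ?Y = skorohod_dist d ?Y (?S m)" by (rule S.commute)
      ultimately show ?thesis by linarith
    qed
    have "(\<lambda>m. exp (- 1) ^ m :: real) \<longlonglongrightarrow> 0" by (rule LIMSEQ_realpow_zero) simp_all
    moreover have "exp (- 1) ^ m = exp (- real m)" for m by (simp flip: exp_of_nat_mult)
    ultimately have el: "(\<lambda>m. exp (- real m)) \<longlonglongrightarrow> 0" by (simp only:)
    have sl: "(\<lambda>m. skorohod_dist d ?Y (?S m)) \<longlonglongrightarrow> 0"
      unfolding n_def by (rule skorohod_step_limit[OF Y[OF \<omega>]])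
    have lim: "(\<lambda>m. (1 / real (Suc m) + exp (- real m)) + skorohod_dist d ?Y (?S m)) \<longlonglongrightarrow> 0"
      using tendsto_add[OF tendsto_add[OF LIMSEQ_inverse_real_of_nat[unfolded inverse_eq_divide] el] sl] by (simp only: add_0_right)
    show "(\<lambda>m. skorohod_dist d (V m \<omega>) ?Y) \<longlonglongrightarrow> 0"
      by (rule tendsto_sandwich[OF always_eventually[OF allI[OF S.nonneg]] always_eventually[OF allI[OF le]] tendsto_const lim])
  qed (use Y in auto)
qed

end

section \<open>The fluid equation\<close>

definition bounded_borel_upto :: "real \<Rightarrow> real \<Rightarrow> (real \<Rightarrow> real) \<Rightarrow> bool" where
  "bounded_borel_upto T C f \<longleftrightarrow> f \<in> borel_measurable borel \<and> (\<forall>u\<in>{0..T}. \<bar>f u\<bar> \<le> C)"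

lemma bounded_borel_upto_measurable: "bounded_borel_upto T C f \<Longrightarrow> f \<in> borel_measurable borel"
  by (simp add: bounded_borel_upto_def)

lemma bounded_borel_upto_bound: "bounded_borel_upto T C f \<Longrightarrow> 0 \<le> u \<Longrightarrow> u \<le> T \<Longrightarrow> \<bar>f u\<bar> \<le> C"
  by (simp add: bounded_borel_upto_def)

lemma bounded_borel_set_integrable:
  fixes f :: "real \<Rightarrow> real"
  assumes f: "f \<in> borel_measurable borel" and C: "\<And>u. u \<in> {a..b} \<Longrightarrow> \<bar>f u\<bar> \<le> C"
  shows "set_integrable lborel {a..b} f"
proof (rule set_integrable_bound)
  show "set_integrable lborel {a..b} (\<lambda>_. C)" by (intro borel_integrable_atLeastAtMost' continuous_intros)
  show "set_borel_measurable lborel {a..b} f" using f by (simp add: set_borel_measurable_def)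
  show "AE x in lborel. x \<in> {a..b} \<longrightarrow> norm (f x) \<le> norm C"
  proof (intro AE_I2 impI)
    fix x assume "x \<in> {a..b}"
    then show "norm (f x) \<le> norm C" using C[of x] by simp
  qed
qed

lemma bounded_borel_upto_integrable:
  assumes "bounded_borel_upto T C f" "0 \<le> a" "b \<le> T"
  shows "set_integrable lborel {a..b} f"
  using assms by (intro bounded_borel_set_integrable[of _ _ _ C]) (auto simp: bounded_borel_upto_def)

lemma set_integral_const_interval: "a \<le> b \<Longrightarrow> (LINT u:{a..b}|lborel. (c::real)) = c * (b - a)"
  by (simp add: set_lebesgue_integral_def)

lemma set_integral_atLeastAtMost_combine:
  fixes f :: "real \<Rightarrow> real"
  assumes "set_integrable lborel {a..c} f" "a \<le> b" "b \<le> c"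
  shows "(LINT u:{a..c}|lborel. f u) = (LINT u:{a..b}|lborel. f u) + (LINT u:{b..c}|lborel. f u)"
proof -
  have i: "set_integrable lborel {a..b} f" "set_integrable lborel {b..c} f"
    using assms by (auto intro: set_integrable_subset)
  show ?thesis
    using Henstock_Kurzweil_Integration.integral_combine[OF assms(2,3), of f]
      set_borel_integral_eq_integral[OF assms(1)] set_borel_integral_eq_integral[OF i(1)]
      set_borel_integral_eq_integral[OF i(2)] by simp
qed

lemma set_integral_abs_le:
  fixes f g :: "real \<Rightarrow> real"
  assumes "set_integrable lborel A f" "set_integrable lborel A g" "\<And>u. u \<in> A \<Longrightarrow> \<bar>f u\<bar> \<le> g u"
  shows "\<bar>LINT u:A|lborel. f u\<bar> \<le> (LINT u:A|lborel. g u)"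
proof -
  have "\<bar>LINT u:A|lborel. f u\<bar> \<le> (LINT u:A|lborel. \<bar>f u\<bar>)"
    using set_integral_norm_bound[OF assms(1)] by simp
  also have "\<dots> \<le> (LINT u:A|lborel. g u)"
    by (rule set_integral_mono[OF set_integrable_abs[OF assms(1)] assms(2,3)])
  finally show ?thesis .
qed

lemma set_integral_abs_const_le:
  fixes f :: "real \<Rightarrow> real"
  assumes "set_integrable lborel {a..b} f" "\<And>u. u \<in> {a..b} \<Longrightarrow> \<bar>f u\<bar> \<le> c" "a \<le> b"
  shows "\<bar>LINT u:{a..b}|lborel. f u\<bar> \<le> c * (b - a)"
proof -
  have "set_integrable lborel {a..b} (\<lambda>_. c)" by (intro borel_integrable_atLeastAtMost' continuous_intros)
  then show ?thesis
    using set_integral_abs_le[OF assms(1) _ assms(2)] set_integral_const_interval[OF assms(3), of c] by simp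
qed

lemma set_integral_subset_le:
  fixes f :: "real \<Rightarrow> real"
  assumes "set_integrable lborel B f" "A \<subseteq> B" "A \<in> sets borel" "\<And>u. u \<in> B \<Longrightarrow> 0 \<le> f u"
  shows "(LINT u:A|lborel. f u) \<le> (LINT u:B|lborel. f u)"
proof -
  have i: "set_integrable lborel A f" by (rule set_integrable_subset[OF assms(1)]) (use assms in auto)
  have "indicator A u *\<^sub>R f u \<le> indicator B u *\<^sub>R f u" for u
    using assms(2) assms(4)[of u] by (auto simp: indicator_def)
  then show ?thesis
    unfolding set_lebesgue_integral_def
    by (rule integral_mono[OF i[unfolded set_integrable_def] assms(1)[unfolded set_integrable_def]])
qed

text \<open>Increments of second order force a zero derivative. This yields a chain rule along
  accumulated work, which need not be differentiable everywhere.\<close>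

lemma quadratic_modulus_imp_const:
  fixes f :: "real \<Rightarrow> real"
  assumes q: "\<And>x y. s \<le> x \<Longrightarrow> x \<le> y \<Longrightarrow> y \<le> t \<Longrightarrow> \<bar>f x - f y\<bar> \<le> C * (y - x)\<^sup>2" and st: "s \<le> t"
  shows "f s = f t"
proof -
  have q': "\<bar>f x - f y\<bar> \<le> C * (y - x)\<^sup>2" if "x \<in> {s..t}" "y \<in> {s..t}" for x y
    using q[of x y] q[of y x] that by (cases "x \<le> y") (auto simp: abs_minus_commute power2_commute)
  have "(f has_field_derivative 0) (at x within {s..t})" if x: "x \<in> {s..t}" for x
    unfolding has_field_derivative_iff
  proof (rule Lim_null_comparison)
    have "\<forall>\<^sub>F y in at x within {s..t}. y \<in> {s..t} \<and> y \<noteq> x" by (simp add: eventually_at_filter)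
    then show "\<forall>\<^sub>F y in at x within {s..t}. norm ((f y - f x) / (y - x)) \<le> C * \<bar>y - x\<bar>"
    proof eventually_elim
      case (elim y)
      then have "\<bar>f y - f x\<bar> \<le> (C * \<bar>y - x\<bar>) * \<bar>y - x\<bar>"
        using q'[of y x] x by (simp add: power2_eq_square abs_mult_self_eq flip: power2_abs[of "x - y"]) (simp add: abs_minus_commute mult.assoc)
      then show ?case using elim by (simp add: pos_divide_le_eq)
    qed
    have "((\<lambda>y. C * \<bar>y - x\<bar>) \<longlongrightarrow> C * \<bar>x - x\<bar>) (at x within {s..t})" by (intro tendsto_intros)
    then show "((\<lambda>y. C * \<bar>y - x\<bar>) \<longlongrightarrow> 0) (at x within {s..t})" by simp
  qed
  then obtain c where "\<And>x. x \<in> {s..t} \<Longrightarrow> f x = c"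
    using has_field_derivative_zero_constant[of "{s..t}" f] by auto
  then show ?thesis using st by auto
qed

text \<open>With the weight \<open>exp (- (2 * C * u))\<close> the supremum \<open>N\<close> of the
  weighted function satisfies \<open>N \<le> e + N / 2\<close>. The argument runs on boundedness and
  measurability instead of continuity, which the paths of the queue lack.\<close>

lemma Gronwall_bound:
  fixes f :: "real \<Rightarrow> real"
  assumes f: "bounded_borel_upto T M f" and C: "0 < C" and e: "0 \<le> e" and T: "0 \<le> T"
    and ineq: "\<And>t. 0 \<le> t \<Longrightarrow> t \<le> T \<Longrightarrow> f t \<le> e + C * (LINT u:{0..t}|lborel. f u)"
    and t: "0 \<le> t" "t \<le> T"
  shows "f t \<le> 2 * e * exp (2 * C * T)"
proof -
  define N where "N = (SUP u\<in>{0..T}. exp (- (2 * C * u)) * f u)"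
  have bdd: "bdd_above ((\<lambda>u. exp (- (2 * C * u)) * f u) ` {0..T})"
  proof (rule bdd_aboveI2)
    fix u assume u: "u \<in> {0..T}"
    then have "\<bar>f u\<bar> \<le> M" using bounded_borel_upto_bound[OF f] by auto
    moreover have "exp (- (2 * C * u)) \<le> 1" using u C by auto
    ultimately have "exp (- (2 * C * u)) * \<bar>f u\<bar> \<le> 1 * M" by (intro mult_mono) auto
    moreover have "exp (- (2 * C * u)) * f u \<le> exp (- (2 * C * u)) * \<bar>f u\<bar>" by (intro mult_left_mono) auto
    ultimately show "exp (- (2 * C * u)) * f u \<le> M" by linarith
  qed
  have fN: "f u \<le> N * exp (2 * C * u)" if "u \<in> {0..T}" for u
  proof -
    have "exp (- (2 * C * u)) * f u \<le> N" unfolding N_def using that by (rule cSUP_upper[OF _ bdd])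
    then show ?thesis by (simp add: exp_minus field_simps)
  qed
  have hi: "((\<lambda>u. exp (2 * C * u)) has_integral (exp (2 * C * s) / (2 * C) - 1 / (2 * C))) {0..s}" if "0 \<le> s" for s
  proof -
    have "((\<lambda>u. exp (2 * C * u)) has_integral (exp (2 * C * s) / (2 * C) - exp (2 * C * 0) / (2 * C))) {0..s}"
      using that C
      by (intro fundamental_theorem_of_calculus) (auto intro!: derivative_eq_intros simp flip: has_real_derivative_iff_has_vector_derivative)
    then show ?thesis by simp
  qed
  have step: "exp (- (2 * C * s)) * f s \<le> e + N / 2 - exp (- (2 * C * s)) * (N / 2)" if s: "s \<in> {0..T}" for s
  proof -
    have ci: "set_integrable lborel {0..s} (\<lambda>u. exp (2 * C * u))"
      by (intro borel_integrable_atLeastAtMost' continuous_intros)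
    have "(LINT u:{0..s}|lborel. f u) \<le> (LINT u:{0..s}|lborel. N * exp (2 * C * u))"
      by (rule set_integral_mono[OF bounded_borel_upto_integrable[OF f] set_integrable_mult_right[OF ci] fN]) (use s in auto)
    also have "\<dots> = N * (exp (2 * C * s) / (2 * C) - 1 / (2 * C))"
      using set_borel_integral_eq_integral(2)[OF ci] integral_unique[OF hi[of s]] s by simp
    finally have "C * (LINT u:{0..s}|lborel. f u) \<le> C * (N * (exp (2 * C * s) / (2 * C) - 1 / (2 * C)))"
      using C by (intro mult_left_mono) auto
    also have "\<dots> = N * exp (2 * C * s) / 2 - N / 2" using C by (simp add: field_simps)
    finally have "f s \<le> e + N * exp (2 * C * s) / 2 - N / 2" using ineq[of s] s by auto
    then have "exp (- (2 * C * s)) * f s \<le> exp (- (2 * C * s)) * (e + N * exp (2 * C * s) / 2 - N / 2)"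
      by (intro mult_left_mono) auto
    also have "\<dots> = exp (- (2 * C * s)) * e + N / 2 - exp (- (2 * C * s)) * (N / 2)"
      by (simp add: algebra_simps flip: exp_add)
    also have "exp (- (2 * C * s)) * e \<le> 1 * e" using s C e by (intro mult_right_mono) auto
    finally show ?thesis by simp
  qed
  have N: "N \<le> 2 * e"
  proof (cases "0 \<le> N")
    case True
    have "exp (- (2 * C * u)) * f u \<le> e + N / 2" if "u \<in> {0..T}" for u
    proof -
      have "0 \<le> exp (- (2 * C * u)) * (N / 2)" using True by simp
      then show ?thesis using step[OF that] by linarith
    qed
    then have "N \<le> e + N / 2" unfolding N_def using T by (intro cSUP_least) auto
    then show ?thesis by simp
  qed (use e in auto)
  have "f t \<le> N * exp (2 * C * t)" using fN t by auto
  also have "\<dots> \<le> (2 * e) * exp (2 * C * t)" using N by (intro mult_right_mono) auto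
  also have "\<dots> \<le> (2 * e) * exp (2 * C * T)" using t C e by (intro mult_left_mono) auto
  finally show ?thesis .
qed

lemma Lipschitz_borel_measurable:
  fixes f :: "real \<Rightarrow> real"
  assumes "\<And>a b. \<bar>f a - f b\<bar> \<le> L * \<bar>a - b\<bar>"
  shows "f \<in> borel_measurable borel"
proof -
  have "0 \<le> L" using assms[of 0 1] by auto
  then have "L-lipschitz_on UNIV f" using assms by (intro lipschitz_onI) (auto simp: dist_real_def)
  then show ?thesis by (intro borel_measurable_continuous_onI lipschitz_on_continuous_on)
qed

text \<open>The data of the fluid equation, with all functions extended to the whole line: \<open>F\<close> and \<open>G\<close>
  are the tails of the initial measure and of the service law, \<open>g\<close> is the service density.\<close>

locale fluid_data =
  fixes lam Q0 K Lk Cg Lg LF :: real and F G g k :: "real \<Rightarrow> real"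
  assumes lam0: "0 \<le> lam" and Q0: "0 \<le> Q0"
    and k0: "\<And>y. 0 \<le> k y" and kK: "\<And>y. k y \<le> K" and kL: "\<And>a b. \<bar>k a - k b\<bar> \<le> Lk * \<bar>a - b\<bar>"
    and g0: "\<And>y. 0 \<le> g y" and gC: "\<And>y. g y \<le> Cg" and gL: "\<And>a b. \<bar>g a - g b\<bar> \<le> Lg * \<bar>a - b\<bar>"
    and FL: "\<And>a b. \<bar>F a - F b\<bar> \<le> LF * \<bar>a - b\<bar>" and F0: "\<And>y. 0 \<le> F y"
    and F_antimono: "\<And>a b. a \<le> b \<Longrightarrow> F b \<le> F a" and F_lim: "(F \<longlongrightarrow> 0) at_top"
    and G_range: "\<And>y. 0 \<le> G y" "\<And>y. G y \<le> 1" and G_0: "G 0 = 1" and G_lim: "(G \<longlongrightarrow> 0) at_top"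
    and GC: "\<And>a b. \<bar>G a - G b\<bar> \<le> Cg * \<bar>a - b\<bar>"
    and G_deriv: "\<And>a b. 0 \<le> a \<Longrightarrow> 0 \<le> b \<Longrightarrow> \<bar>G a - G b + g b * (a - b)\<bar> \<le> Lg * (a - b)\<^sup>2"
begin

lemma consts_nonneg: "0 \<le> K" "0 \<le> Lk" "0 \<le> Cg" "0 \<le> Lg" "0 \<le> LF"
  using k0[of 0] kK[of 0] g0[of 0] gC[of 0] kL[of 0 1] gL[of 0 1] FL[of 0 1] by auto

lemma g_measurable [measurable]: "g \<in> borel_measurable borel"
  by (rule Lipschitz_borel_measurable[OF gL])

lemma k_measurable [measurable]: "k \<in> borel_measurable borel"
  by (rule Lipschitz_borel_measurable[OF kL])

definition rate :: "(real \<Rightarrow> real) \<Rightarrow> bool" where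
  "rate \<kappa> \<longleftrightarrow> \<kappa> \<in> borel_measurable borel \<and> (\<forall>u. 0 \<le> \<kappa> u \<and> \<kappa> u \<le> K)"

lemma rateD:
  assumes "rate \<kappa>"
  shows "\<kappa> \<in> borel_measurable borel" "0 \<le> \<kappa> u" "\<kappa> u \<le> K" "\<bar>\<kappa> u\<bar> \<le> K"
  using assms by (auto simp: rate_def abs_le_iff intro: order_trans[of _ 0])

lemma rate_integrable: "rate \<kappa> \<Longrightarrow> set_integrable lborel {a..b} \<kappa>"
  by (rule bounded_borel_set_integrable[of _ _ _ K]) (auto simp: rateD)

lemma rate_k: "x \<in> borel_measurable borel \<Longrightarrow> rate (\<lambda>u. k (x u))"
  by (auto simp: rate_def k0 kK)

definition work :: "(real \<Rightarrow> real) \<Rightarrow> real \<Rightarrow> real \<Rightarrow> real" where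
  "work \<kappa> s t = (LINT u:{s..t}|lborel. \<kappa> u)"

lemma work_nonneg: "rate \<kappa> \<Longrightarrow> 0 \<le> work \<kappa> s t"
  unfolding work_def set_lebesgue_integral_def
  by (intro Bochner_Integration.integral_nonneg) (auto simp: rateD(2) indicator_def)

lemma work_le: "rate \<kappa> \<Longrightarrow> s \<le> t \<Longrightarrow> work \<kappa> s t \<le> K * (t - s)"
  using set_integral_abs_const_le[OF rate_integrable, of \<kappa> s t K] rateD(4)[of \<kappa>]
  by (auto simp: work_def)

lemma work_combine: "rate \<kappa> \<Longrightarrow> s \<le> u \<Longrightarrow> u \<le> t \<Longrightarrow> work \<kappa> s t = work \<kappa> s u + work \<kappa> u t"
  unfolding work_def by (rule set_integral_atLeastAtMost_combine[OF rate_integrable])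

text \<open>Beyond \<open>t\<close> the interval of integration is empty, so the bound holds for all
  \<open>u\<close> and yields measurability in \<open>u\<close> on the whole line.\<close>

lemma work_Lipschitz: "rate \<kappa> \<Longrightarrow> \<bar>work \<kappa> u t - work \<kappa> u' t\<bar> \<le> K * \<bar>u - u'\<bar>"
proof -
  assume r: "rate \<kappa>"
  have le: "\<bar>work \<kappa> u t - work \<kappa> u' t\<bar> \<le> K * (u' - u)" if "u \<le> u'" for u u'
  proof (cases "u' \<le> t")
    case True
    then show ?thesis using work_combine[OF r that True] work_le[OF r that] work_nonneg[OF r, of u u'] by simp
  next
    case False
    then have z: "work \<kappa> u' t = 0" by (simp add: work_def set_lebesgue_integral_def)
    show ?thesis
    proof (cases "u \<le> t")
      case True
      have "work \<kappa> u t \<le> K * (t - u)" by (rule work_le[OF r True])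
      also have "\<dots> \<le> K * (u' - u)" using False consts_nonneg by (intro mult_left_mono) auto
      finally show ?thesis using z work_nonneg[OF r, of u t] by simp
    next
      case False
      then have "work \<kappa> u t = 0" by (simp add: work_def set_lebesgue_integral_def)
      then show ?thesis using z that consts_nonneg by simp
    qed
  qed
  show ?thesis using le[of u u'] le[of u' u] by (cases "u \<le> u'") (auto simp: abs_minus_commute)
qed

lemma work_measurable [measurable]: "rate \<kappa> \<Longrightarrow> (\<lambda>u. work \<kappa> u t) \<in> borel_measurable borel"
  by (rule Lipschitz_borel_measurable[OF work_Lipschitz])

text \<open>The part of the tail at \<open>y\<close> that remains when the boundary term
  \<open>G y * D t\<close> of the integration by parts is split off. \<open>D\<close> occurs only
  under the integral, so this part is Lipschitz in time for every bounded measurable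
  \<open>D\<close>.\<close>

definition flow :: "(real \<Rightarrow> real) \<Rightarrow> (real \<Rightarrow> real) \<Rightarrow> real \<Rightarrow> real \<Rightarrow> real" where
  "flow D \<kappa> t y = F (y + work \<kappa> 0 t) - (LINT u:{0..t}|lborel. D u * g (y + work \<kappa> u t) * \<kappa> u)"

lemma flow_integrand:
  assumes D: "bounded_borel_upto T M D" and r: "rate \<kappa>"
  shows "bounded_borel_upto T (M * Cg * K) (\<lambda>u. D u * g (y + work \<kappa> u t) * \<kappa> u)"
  unfolding bounded_borel_upto_def
proof (intro conjI ballI)
  note [measurable] = rateD(1)[OF r] bounded_borel_upto_measurable[OF D] work_measurable[OF r]
  show "(\<lambda>u. D u * g (y + work \<kappa> u t) * \<kappa> u) \<in> borel_measurable borel" by measurable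
  fix u assume u: "u \<in> {0..T}"
  have M: "\<bar>D u\<bar> \<le> M" "0 \<le> M" using bounded_borel_upto_bound[OF D, of u] u by auto
  have "\<bar>D u\<bar> * g (y + work \<kappa> u t) * \<kappa> u \<le> M * Cg * K"
    using M g0 gC rateD(2,3)[OF r] consts_nonneg by (intro mult_mono) auto
  then show "\<bar>D u * g (y + work \<kappa> u t) * \<kappa> u\<bar> \<le> M * Cg * K"
    by (simp add: abs_mult abs_of_nonneg g0 rateD(2)[OF r])
qed

lemma rate_diff_integrable:
  assumes "rate \<kappa>" "rate \<kappa>'" shows "set_integrable lborel {a..b} (\<lambda>u. \<bar>\<kappa> u - \<kappa>' u\<bar>)"
  by (intro set_integrable_abs set_integral_diff(1) rate_integrable assms)

lemma work_diff_le:
  assumes r: "rate \<kappa>" "rate \<kappa>'" and s: "0 \<le> s"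
  shows "\<bar>work \<kappa> s t - work \<kappa>' s t\<bar> \<le> (LINT u:{0..t}|lborel. \<bar>\<kappa> u - \<kappa>' u\<bar>)"
proof -
  have "\<bar>work \<kappa> s t - work \<kappa>' s t\<bar> = \<bar>LINT u:{s..t}|lborel. \<kappa> u - \<kappa>' u\<bar>"
    unfolding work_def by (simp add: set_integral_diff(2) rate_integrable r)
  also have "\<dots> \<le> (LINT u:{s..t}|lborel. \<bar>\<kappa> u - \<kappa>' u\<bar>)"
    by (rule set_integral_abs_le[OF _ rate_diff_integrable[OF r]]) (auto intro: set_integral_diff(1) rate_integrable r)
  also have "\<dots> \<le> (LINT u:{0..t}|lborel. \<bar>\<kappa> u - \<kappa>' u\<bar>)"
    by (rule set_integral_subset_le[OF rate_diff_integrable[OF r]]) (use s in auto)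
  finally show ?thesis .
qed

text \<open>The three ways in which the rate acts: through the argument of \<open>F\<close>, through
  the argument of \<open>g\<close>, and as a factor of the integrand.\<close>

definition flow_const :: "real \<Rightarrow> real \<Rightarrow> real" where
  "flow_const T M = LF + M * Lg * K * T + M * Cg"

lemma flow_diff:
  assumes D: "bounded_borel_upto T M D" "bounded_borel_upto T M D'" and r: "rate \<kappa>" "rate \<kappa>'"
    and t: "0 \<le> t" "t \<le> T"
  shows "\<bar>flow D \<kappa> t y - flow D' \<kappa>' t y\<bar> \<le>
    flow_const T M * (LINT u:{0..t}|lborel. \<bar>\<kappa> u - \<kappa>' u\<bar>) + Cg * K * (LINT u:{0..t}|lborel. \<bar>D u - D' u\<bar>)"
proof -
  let ?d = "LINT u:{0..t}|lborel. \<bar>\<kappa> u - \<kappa>' u\<bar>"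
  let ?h = "\<lambda>D \<kappa> u. D u * g (y + work \<kappa> u t) * \<kappa> u"
  have M: "0 \<le> M" using bounded_borel_upto_bound[OF D(1), of 0] t by auto
  have d0: "0 \<le> ?d" using work_diff_le[OF r order_refl, of t] by linarith
  have Dint: "set_integrable lborel {0..t} D" "set_integrable lborel {0..t} D'"
    using bounded_borel_upto_integrable[OF D(1), of 0 t] bounded_borel_upto_integrable[OF D(2), of 0 t] t by auto
  have hint: "set_integrable lborel {0..t} (?h D \<kappa>)" "set_integrable lborel {0..t} (?h D' \<kappa>')"
    using bounded_borel_upto_integrable[OF flow_integrand[OF D(1) r(1)], of 0 t]
      bounded_borel_upto_integrable[OF flow_integrand[OF D(2) r(2)], of 0 t] t by auto
  have Dd: "set_integrable lborel {0..t} (\<lambda>u. \<bar>D u - D' u\<bar>)"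
    by (intro set_integrable_abs set_integral_diff(1) Dint)
  have ci: "set_integrable lborel {0..t} (\<lambda>u. M * Lg * K * ?d)"
    by (intro borel_integrable_atLeastAtMost' continuous_intros)
  note kd = rate_diff_integrable[OF r, of 0 t]
  have pt: "\<bar>?h D \<kappa> u - ?h D' \<kappa>' u\<bar> \<le> Cg * K * \<bar>D u - D' u\<bar> + M * Lg * K * ?d + M * Cg * \<bar>\<kappa> u - \<kappa>' u\<bar>"
    if u: "u \<in> {0..t}" for u
  proof -
    let ?a = "g (y + work \<kappa> u t)" and ?a' = "g (y + work \<kappa>' u t)"
    have Db: "\<bar>D' u\<bar> \<le> M" using bounded_borel_upto_bound[OF D(2), of u] u t by auto
    have "\<bar>?a - ?a'\<bar> \<le> Lg * \<bar>work \<kappa> u t - work \<kappa>' u t\<bar>" using gL[of "y + work \<kappa> u t" "y + work \<kappa>' u t"] by simp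
    also have "\<dots> \<le> Lg * ?d" using u consts_nonneg by (intro mult_left_mono work_diff_le r) auto
    finally have ga: "\<bar>?a - ?a'\<bar> \<le> Lg * ?d" .
    \<comment> \<open>One factor is changed at a time, so that each term contains a single
      difference.\<close>
    have "?h D \<kappa> u - ?h D' \<kappa>' u = (D u - D' u) * ?a * \<kappa> u + D' u * (?a - ?a') * \<kappa> u + D' u * ?a' * (\<kappa> u - \<kappa>' u)"
      by (simp add: algebra_simps)
    then have "\<bar>?h D \<kappa> u - ?h D' \<kappa>' u\<bar> \<le> \<bar>D u - D' u\<bar> * ?a * \<kappa> u + \<bar>D' u\<bar> * \<bar>?a - ?a'\<bar> * \<kappa> u + \<bar>D' u\<bar> * ?a' * \<bar>\<kappa> u - \<kappa>' u\<bar>"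
      using abs_triangle_ineq[of "(D u - D' u) * ?a * \<kappa> u + D' u * (?a - ?a') * \<kappa> u" "D' u * ?a' * (\<kappa> u - \<kappa>' u)"]
        abs_triangle_ineq[of "(D u - D' u) * ?a * \<kappa> u" "D' u * (?a - ?a') * \<kappa> u"]
      by (simp add: abs_mult abs_of_nonneg g0 rateD(2)[OF r(1)])
    moreover have "\<bar>D u - D' u\<bar> * ?a * \<kappa> u \<le> \<bar>D u - D' u\<bar> * Cg * K"
      using g0 gC rateD(2,3)[OF r(1)] consts_nonneg by (intro mult_mono) auto
    moreover have "\<bar>D' u\<bar> * \<bar>?a - ?a'\<bar> * \<kappa> u \<le> M * (Lg * ?d) * K"
      using Db ga M rateD(2,3)[OF r(1)] consts_nonneg d0 by (intro mult_mono mult_nonneg_nonneg) auto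
    moreover have "\<bar>D' u\<bar> * ?a' * \<bar>\<kappa> u - \<kappa>' u\<bar> \<le> M * Cg * \<bar>\<kappa> u - \<kappa>' u\<bar>"
      using Db g0 gC M consts_nonneg by (intro mult_mono) auto
    ultimately show ?thesis by (simp add: mult_ac)
  qed
  have bint: "set_integrable lborel {0..t} (\<lambda>u. Cg * K * \<bar>D u - D' u\<bar> + M * Lg * K * ?d + M * Cg * \<bar>\<kappa> u - \<kappa>' u\<bar>)"
    by (intro set_integral_add(1) set_integrable_mult_right Dd ci kd)
  have "\<bar>(LINT u:{0..t}|lborel. ?h D \<kappa> u) - (LINT u:{0..t}|lborel. ?h D' \<kappa>' u)\<bar> =
      \<bar>LINT u:{0..t}|lborel. ?h D \<kappa> u - ?h D' \<kappa>' u\<bar>"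
    by (simp add: set_integral_diff(2)[OF hint])
  also have "\<dots> \<le> (LINT u:{0..t}|lborel. Cg * K * \<bar>D u - D' u\<bar> + M * Lg * K * ?d + M * Cg * \<bar>\<kappa> u - \<kappa>' u\<bar>)"
    by (rule set_integral_abs_le[OF set_integral_diff(1)[OF hint] bint pt])
  also have "\<dots> = Cg * K * (LINT u:{0..t}|lborel. \<bar>D u - D' u\<bar>) + M * Lg * K * ?d * t + M * Cg * ?d"
    using t by (simp add: set_integral_add(2)[OF set_integral_add(1)[OF set_integrable_mult_right[OF Dd] ci] set_integrable_mult_right[OF kd]]
      set_integral_add(2)[OF set_integrable_mult_right[OF Dd] ci] set_integral_const_interval)
  finally have I: "\<bar>(LINT u:{0..t}|lborel. ?h D \<kappa> u) - (LINT u:{0..t}|lborel. ?h D' \<kappa>' u)\<bar> \<le>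
      Cg * K * (LINT u:{0..t}|lborel. \<bar>D u - D' u\<bar>) + M * Lg * K * ?d * t + M * Cg * ?d" .
  have "M * Lg * K * ?d * t \<le> M * Lg * K * ?d * T" using t M consts_nonneg d0 by (intro mult_left_mono mult_nonneg_nonneg) auto
  moreover have "\<bar>F (y + work \<kappa> 0 t) - F (y + work \<kappa>' 0 t)\<bar> \<le> LF * ?d"
  proof -
    have "\<bar>F (y + work \<kappa> 0 t) - F (y + work \<kappa>' 0 t)\<bar> \<le> LF * \<bar>work \<kappa> 0 t - work \<kappa>' 0 t\<bar>"
      using FL[of "y + work \<kappa> 0 t" "y + work \<kappa>' 0 t"] by simp
    also have "\<dots> \<le> LF * ?d" using consts_nonneg by (intro mult_left_mono work_diff_le r) auto
    finally show ?thesis .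
  qed
  moreover have "flow_const T M * ?d = LF * ?d + M * Lg * K * ?d * T + M * Cg * ?d"
    by (simp add: flow_const_def algebra_simps)
  ultimately show ?thesis using I unfolding flow_def by linarith
qed

lemma work_cong: "(\<And>u. s \<le> u \<Longrightarrow> u \<le> t \<Longrightarrow> \<kappa> u = \<kappa>' u) \<Longrightarrow> work \<kappa> s t = work \<kappa>' s t"
  unfolding work_def by (intro set_lebesgue_integral_cong) auto

lemma flow_cong:
  assumes "\<And>u. 0 \<le> u \<Longrightarrow> u \<le> t \<Longrightarrow> \<kappa> u = \<kappa>' u" "\<And>u. 0 \<le> u \<Longrightarrow> u \<le> t \<Longrightarrow> D u = D' u"
  shows "flow D \<kappa> t y = flow D' \<kappa>' t y"
proof -
  have "work \<kappa> s t = work \<kappa>' s t" if "0 \<le> s" for s using that assms(1) by (intro work_cong) auto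
  then show ?thesis
    unfolding flow_def using assms
    by (intro arg_cong2[where f = "(-)"] set_lebesgue_integral_cong) auto
qed

text \<open>Time increments are reduced to \<open>flow_diff\<close>: with the rate and
  \<open>D\<close> set to zero after \<open>t\<close>, the flow at time \<open>t'\<close> is the
  original flow at time \<open>t\<close>.\<close>

lemma flow_time:
  assumes D: "bounded_borel_upto T M D" and r: "rate \<kappa>" and t: "0 \<le> t" "t \<le> t'" "t' \<le> T"
  shows "\<bar>flow D \<kappa> t y - flow D \<kappa> t' y\<bar> \<le> (flow_const T M * K + Cg * K * M) * (t' - t)"
proof -
  define \<kappa>' where "\<kappa>' = (\<lambda>u. indicator {..t} u * \<kappa> u)"
  define D' where "D' = (\<lambda>u. indicator {..t} u * D u)"
  note [measurable] = rateD(1)[OF r] bounded_borel_upto_measurable[OF D]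
  have M: "0 \<le> M" using bounded_borel_upto_bound[OF D, of 0] t by auto
  have r': "rate \<kappa>'"
    using rateD(2,3)[OF r] consts_nonneg unfolding rate_def \<kappa>'_def by (auto simp: indicator_def)
  have "\<bar>D' u\<bar> \<le> M" if "u \<in> {0..T}" for u
    using bounded_borel_upto_bound[OF D, of u] that M by (auto simp: D'_def indicator_def)
  then have bD': "bounded_borel_upto T M D'" unfolding bounded_borel_upto_def D'_def by auto
  have w: "work \<kappa>' u t' = work \<kappa> u t" for u
    unfolding work_def set_lebesgue_integral_def \<kappa>'_def
    by (rule Bochner_Integration.integral_cong) (use t in \<open>auto simp: indicator_def\<close>)
  have "flow D' \<kappa>' t' y = flow D \<kappa> t y"
    unfolding flow_def w unfolding set_lebesgue_integral_def \<kappa>'_def D'_def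
    by (intro arg_cong2[where f = "(-)"] refl Bochner_Integration.integral_cong) (use t in \<open>auto simp: indicator_def\<close>)
  then have "\<bar>flow D \<kappa> t y - flow D \<kappa> t' y\<bar> \<le>
      flow_const T M * (LINT u:{0..t'}|lborel. \<bar>\<kappa>' u - \<kappa> u\<bar>) + Cg * K * (LINT u:{0..t'}|lborel. \<bar>D' u - D u\<bar>)"
    using flow_diff[OF bD' D r' r, of t' y] t by auto
  moreover have cut: "(LINT u:{0..t'}|lborel. \<bar>indicator {..t} u * f u - f u\<bar>) \<le> c * (t' - t)"
    if f: "bounded_borel_upto T c f" for f :: "real \<Rightarrow> real" and c
  proof -
    have c: "0 \<le> c" using bounded_borel_upto_bound[OF f, of 0] t by auto
    have m: "f \<in> borel_measurable borel" by (rule bounded_borel_upto_measurable[OF f])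
    have si: "set_integrable lborel {0..t'} (\<lambda>u. \<bar>indicator {..t} u * f u - f u\<bar>)"
    proof (rule bounded_borel_set_integrable[of _ _ _ c])
      show "(\<lambda>u. \<bar>indicator {..t} u * f u - f u\<bar>) \<in> borel_measurable borel" using m by measurable
      show "\<bar>\<bar>indicator {..t} u * f u - f u\<bar>\<bar> \<le> c" if "u \<in> {0..t'}" for u
        using bounded_borel_upto_bound[OF f, of u] that t c by (auto simp: indicator_def)
    qed
    have "(LINT u:{0..t'}|lborel. \<bar>indicator {..t} u * f u - f u\<bar>) =
        (LINT u:{0..t}|lborel. \<bar>indicator {..t} u * f u - f u\<bar>) + (LINT u:{t..t'}|lborel. \<bar>indicator {..t} u * f u - f u\<bar>)"
      by (rule set_integral_atLeastAtMost_combine[OF si t(1,2)])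
    moreover have "(LINT u:{0..t}|lborel. \<bar>indicator {..t} u * f u - f u\<bar>) = (LINT u:{0..t}|lborel. 0)"
      by (rule set_lebesgue_integral_cong) (auto simp: indicator_def)
    moreover have "\<bar>LINT u:{t..t'}|lborel. \<bar>indicator {..t} u * f u - f u\<bar>\<bar> \<le> c * (t' - t)"
    proof (rule set_integral_abs_const_le[OF set_integrable_subset[OF si] _ t(2)])
      show "\<bar>\<bar>indicator {..t} u * f u - f u\<bar>\<bar> \<le> c" if "u \<in> {t..t'}" for u
        using bounded_borel_upto_bound[OF f, of u] that t c by (auto simp: indicator_def)
    qed (use t in auto)
    ultimately show ?thesis by (simp add: set_lebesgue_integral_def)
  qed
  moreover have "bounded_borel_upto T K \<kappa>" using rateD(1,4)[OF r] by (simp add: bounded_borel_upto_def)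
  then have "flow_const T M * (LINT u:{0..t'}|lborel. \<bar>\<kappa>' u - \<kappa> u\<bar>) \<le> flow_const T M * (K * (t' - t))"
    using M t consts_nonneg unfolding \<kappa>'_def by (intro mult_left_mono cut) (auto simp: flow_const_def)
  moreover have "Cg * K * (LINT u:{0..t'}|lborel. \<bar>D' u - D u\<bar>) \<le> Cg * K * (M * (t' - t))"
    using consts_nonneg D unfolding D'_def by (intro mult_left_mono cut) auto
  ultimately show ?thesis by (simp add: algebra_simps)
qed

text \<open>The chain rule for \<open>G\<close> along the accumulated work, for a rate that is only
  measurable. Over a short interval both sides agree to second order: \<open>G_deriv\<close> handles
  the increment of \<open>G\<close>, and the Lipschitz bound of \<open>g\<close> the variation of
  the integrand.\<close>

lemma G_chain:
  assumes r: "rate \<kappa>" and y: "0 \<le> y" and st: "s \<le> t"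
  shows "G (y + work \<kappa> s t) = G y - (LINT u:{s..t}|lborel. g (y + work \<kappa> u t) * \<kappa> u)"
proof -
  let ?h = "\<lambda>u. g (y + work \<kappa> u t) * \<kappa> u"
  note [measurable] = rateD(1)[OF r] work_measurable[OF r]
  have hb: "\<bar>?h u\<bar> \<le> Cg * K" for u
    using g0 gC rateD(2,3)[OF r] consts_nonneg by (auto simp: abs_mult abs_of_nonneg intro!: mult_mono)
  have hi: "set_integrable lborel {a..b} ?h" for a b
    by (rule bounded_borel_set_integrable[of _ _ _ "Cg * K"]) (use hb in auto)
  define f where "f a = G (y + work \<kappa> a t) + (LINT u:{a..t}|lborel. ?h u)" for a
  have "f s = f t"
  proof (rule quadratic_modulus_imp_const[OF _ st])
    fix a b assume ab: "s \<le> a" "a \<le> b" "b \<le> t"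
    let ?A = "y + work \<kappa> a t" and ?B = "y + work \<kappa> b t"
    have AB: "?A - ?B = work \<kappa> a b" using work_combine[OF r ab(2,3)] by simp
    have w: "0 \<le> work \<kappa> a b" "work \<kappa> a b \<le> K * (b - a)" using work_nonneg[OF r] work_le[OF r ab(2)] by auto
    have "\<bar>G ?A - G ?B + g ?B * work \<kappa> a b\<bar> \<le> Lg * (work \<kappa> a b)\<^sup>2"
      using G_deriv[of ?A ?B] y work_nonneg[OF r] AB by auto
    also have "\<dots> \<le> Lg * (K * (b - a))\<^sup>2" using w consts_nonneg by (intro mult_left_mono power_mono) auto
    finally have 1: "\<bar>G ?A - G ?B + g ?B * work \<kappa> a b\<bar> \<le> Lg * (K * (b - a))\<^sup>2" .
    have gi: "set_integrable lborel {a..b} (\<lambda>u. g ?B * \<kappa> u)" by (intro set_integrable_mult_right rate_integrable r)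
    have "(LINT u:{a..b}|lborel. ?h u) - g ?B * work \<kappa> a b = (LINT u:{a..b}|lborel. ?h u - g ?B * \<kappa> u)"
      by (simp only: set_integral_diff(2)[OF hi gi] set_integral_mult_right) (simp only: work_def)
    moreover have "\<bar>LINT u:{a..b}|lborel. ?h u - g ?B * \<kappa> u\<bar> \<le> (Lg * (K * (b - a)) * K) * (b - a)"
    proof (rule set_integral_abs_const_le[OF set_integral_diff(1)[OF hi gi] _ ab(2)])
      fix u assume u: "u \<in> {a..b}"
      have "\<bar>g (y + work \<kappa> u t) - g ?B\<bar> \<le> Lg * \<bar>work \<kappa> u t - work \<kappa> b t\<bar>" using gL[of "y + work \<kappa> u t" ?B] by simp
      also have "\<dots> \<le> Lg * (K * \<bar>u - b\<bar>)" using consts_nonneg by (intro mult_left_mono work_Lipschitz r) auto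
      also have "\<dots> \<le> Lg * (K * (b - a))" using consts_nonneg u by (intro mult_left_mono) auto
      finally have "\<bar>g (y + work \<kappa> u t) - g ?B\<bar> * \<kappa> u \<le> (Lg * (K * (b - a))) * K"
        using rateD(2,3)[OF r] consts_nonneg ab by (intro mult_mono) auto
      then show "\<bar>?h u - g ?B * \<kappa> u\<bar> \<le> Lg * (K * (b - a)) * K"
        by (simp add: abs_mult rateD(2)[OF r] flip: left_diff_distrib)
    qed
    moreover have "f a - f b = G ?A - G ?B + (LINT u:{a..b}|lborel. ?h u)"
      using set_integral_atLeastAtMost_combine[OF hi ab(2,3)] by (simp add: f_def)
    ultimately have "\<bar>f a - f b\<bar> \<le> Lg * (K * (b - a))\<^sup>2 + (Lg * (K * (b - a)) * K) * (b - a)" using 1 by linarith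
    then show "\<bar>f a - f b\<bar> \<le> (2 * Lg * K\<^sup>2) * (b - a)\<^sup>2"
      by (simp add: power2_eq_square algebra_simps)
  qed
  moreover have "(LINT u:{t..t}|lborel. ?h u) = 0"
    using set_integral_abs_const_le[OF hi[of t t] hb order_refl] by simp
  moreover have "work \<kappa> t t = 0" using work_le[OF r, of t t] work_nonneg[OF r, of t t] by simp
  ultimately have "f s = G y" by (simp add: f_def)
  then show ?thesis by (simp add: f_def)
qed

section \<open>Approximate solutions of the head count equation\<close>

definition started :: "(real \<Rightarrow> real) \<Rightarrow> real \<Rightarrow> real" where
  "started x t = lam * t + Q0 - max (x t - 1) 0"

definition near_solution :: "real \<Rightarrow> real \<Rightarrow> (real \<Rightarrow> real) \<Rightarrow> bool" where
  "near_solution T e x \<longleftrightarrow> (\<forall>t\<in>{0..T}. \<bar>x t - (flow (started x) (\<lambda>u. k (x u)) t 0 + lam * t + Q0)\<bar> \<le> e)"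

lemma started_bounded:
  assumes x: "bounded_borel_upto T M x" and T: "0 \<le> T"
  shows "bounded_borel_upto T (lam * T + Q0 + M + 1) (started x)"
  unfolding bounded_borel_upto_def
proof (intro conjI ballI)
  have [measurable]: "x \<in> borel_measurable borel" by (rule bounded_borel_upto_measurable[OF x])
  show "started x \<in> borel_measurable borel" unfolding started_def[abs_def] by measurable
  fix t assume t: "t \<in> {0..T}"
  have "\<bar>x t\<bar> \<le> M" using bounded_borel_upto_bound[OF x, of t] t by auto
  moreover have "0 \<le> lam * t" "lam * t \<le> lam * T" using t lam0 by (auto intro: mult_left_mono)
  ultimately show "\<bar>started x t\<bar> \<le> lam * T + Q0 + M + 1" using Q0 unfolding started_def by linarith
qed

lemma set_integral_scaled_le:
  fixes f :: "real \<Rightarrow> real"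
  assumes "set_integrable lborel A f" "set_integrable lborel A h" "\<And>u. u \<in> A \<Longrightarrow> f u \<le> c * h u"
  shows "(LINT u:A|lborel. f u) \<le> c * (LINT u:A|lborel. h u)"
  using set_integral_mono[OF assms(1) set_integrable_mult_right[OF assms(2)] assms(3)] by simp

lemma flow_diff_state:
  assumes x: "bounded_borel_upto T M x" "bounded_borel_upto T M x'" and t: "0 \<le> t" "t \<le> T"
  shows "\<bar>flow (started x) (\<lambda>u. k (x u)) t y - flow (started x') (\<lambda>u. k (x' u)) t y\<bar> \<le>
    (flow_const T (lam * T + Q0 + M + 1) * Lk + Cg * K) * (LINT u:{0..t}|lborel. \<bar>x u - x' u\<bar>)"
proof -
  have T: "0 \<le> T" using t by simp
  let ?M = "lam * T + Q0 + M + 1"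
  have M: "0 \<le> M" using bounded_borel_upto_bound[OF x(1), of 0] T by auto
  note D = started_bounded[OF x(1) T] started_bounded[OF x(2) T]
  note r = rate_k[OF bounded_borel_upto_measurable[OF x(1)]] rate_k[OF bounded_borel_upto_measurable[OF x(2)]]
  have xi: "set_integrable lborel {0..t} (\<lambda>u. \<bar>x u - x' u\<bar>)"
    by (intro set_integrable_abs set_integral_diff(1) bounded_borel_upto_integrable[OF x(1)] bounded_borel_upto_integrable[OF x(2)]) (use t in auto)
  have Di: "set_integrable lborel {0..t} (\<lambda>u. \<bar>started x u - started x' u\<bar>)"
    by (intro set_integrable_abs set_integral_diff(1) bounded_borel_upto_integrable[OF D(1)] bounded_borel_upto_integrable[OF D(2)]) (use t in auto)
  have "(LINT u:{0..t}|lborel. \<bar>k (x u) - k (x' u)\<bar>) \<le> Lk * (LINT u:{0..t}|lborel. \<bar>x u - x' u\<bar>)"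
    by (rule set_integral_scaled_le[OF rate_diff_integrable[OF r] xi kL])
  moreover have "(LINT u:{0..t}|lborel. \<bar>started x u - started x' u\<bar>) \<le> 1 * (LINT u:{0..t}|lborel. \<bar>x u - x' u\<bar>)"
    by (rule set_integral_scaled_le[OF Di xi]) (auto simp: started_def)
  moreover have "0 \<le> flow_const T ?M"
    unfolding flow_const_def using consts_nonneg T lam0 Q0 M by (intro add_nonneg_nonneg mult_nonneg_nonneg) auto
  ultimately have "flow_const T ?M * (LINT u:{0..t}|lborel. \<bar>k (x u) - k (x' u)\<bar>) \<le> flow_const T ?M * (Lk * (LINT u:{0..t}|lborel. \<bar>x u - x' u\<bar>))"
    "Cg * K * (LINT u:{0..t}|lborel. \<bar>started x u - started x' u\<bar>) \<le> Cg * K * (1 * (LINT u:{0..t}|lborel. \<bar>x u - x' u\<bar>))"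
    using consts_nonneg by (auto intro!: mult_left_mono)
  then show ?thesis using flow_diff[OF D r t, of y] by (simp add: algebra_simps)
qed

definition stability_const :: "real \<Rightarrow> real \<Rightarrow> real" where
  "stability_const T M = flow_const T (lam * T + Q0 + M + 1) * Lk + Cg * K + 1"

lemma stability_const_ge:
  assumes "0 \<le> T" "0 \<le> M" shows "1 \<le> stability_const T M"
  unfolding stability_const_def flow_const_def using consts_nonneg assms lam0 Q0 by auto

text \<open>Gronwall's inequality for the difference. The truncation \<open>max (x t - 1) 0\<close>
  does not increase distances, and in this equation it stands under the integral only.\<close>

lemma near_solutions_close:
  assumes x: "bounded_borel_upto T M x" "bounded_borel_upto T M x'"
    and n: "near_solution T e x" "near_solution T e' x'" and t: "0 \<le> t" "t \<le> T"
  shows "\<bar>x t - x' t\<bar> \<le> 2 * (e + e') * exp (2 * stability_const T M * T)"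
proof -
  have T: "0 \<le> T" using t by simp
  have M: "0 \<le> M" using bounded_borel_upto_bound[OF x(1), of 0] T by auto
  have e: "0 \<le> e + e'" using n T unfolding near_solution_def by (force simp: intro: order_trans[OF abs_ge_zero])
  note [measurable] = bounded_borel_upto_measurable[OF x(1)] bounded_borel_upto_measurable[OF x(2)]
  have b: "bounded_borel_upto T (2 * M) (\<lambda>u. \<bar>x u - x' u\<bar>)"
    unfolding bounded_borel_upto_def
  proof (intro conjI ballI)
    fix u assume "u \<in> {0..T}"
    then show "\<bar>\<bar>x u - x' u\<bar>\<bar> \<le> 2 * M"
      using bounded_borel_upto_bound[OF x(1), of u] bounded_borel_upto_bound[OF x(2), of u] by auto
  qed measurable
  show ?thesis
  proof (rule Gronwall_bound[OF b _ e T _ t])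
    show "0 < stability_const T M" using stability_const_ge[OF T M] by simp
    fix s assume s: "0 \<le> s" "s \<le> T"
    have "0 \<le> (LINT u:{0..s}|lborel. \<bar>x u - x' u\<bar>)"
      unfolding set_lebesgue_integral_def by (intro Bochner_Integration.integral_nonneg) auto
    moreover have "\<bar>x s - (flow (started x) (\<lambda>u. k (x u)) s 0 + lam * s + Q0)\<bar> \<le> e"
      "\<bar>x' s - (flow (started x') (\<lambda>u. k (x' u)) s 0 + lam * s + Q0)\<bar> \<le> e'"
      using n s by (auto simp: near_solution_def)
    ultimately show "\<bar>x s - x' s\<bar> \<le> e + e' + stability_const T M * (LINT u:{0..s}|lborel. \<bar>x u - x' u\<bar>)"
      using flow_diff_state[OF x s, of 0] unfolding stability_const_def distrib_right by linarith
  qed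
qed

end

context fluid_data
begin

text \<open>The tail above \<open>y\<close> that the equation prescribes for the head count
  \<open>x\<close>. For a \<open>fluid_head\<close> it is required to be nonnegative and
  nonincreasing in \<open>y\<close>, so that it can be the tail function of a measure.\<close>

definition psi :: "(real \<Rightarrow> real) \<Rightarrow> real \<Rightarrow> real \<Rightarrow> real" where
  "psi x t y = flow (started x) (\<lambda>u. k (x u)) t y + G y * started x t"

lemma flow_state_close:
  assumes x: "bounded_borel_upto T M x" "bounded_borel_upto T M x'"
    and d: "\<And>u. 0 \<le> u \<Longrightarrow> u \<le> T \<Longrightarrow> \<bar>x u - x' u\<bar> \<le> d" and t: "0 \<le> t" "t \<le> T"
  shows "\<bar>flow (started x) (\<lambda>u. k (x u)) t y - flow (started x') (\<lambda>u. k (x' u)) t y\<bar> \<le> stability_const T M * T * d"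
proof -
  have T: "0 \<le> T" using t by simp
  have d0: "0 \<le> d" using d[of 0] T by auto
  have M: "0 \<le> M" using bounded_borel_upto_bound[OF x(1), of 0] T by auto
  have i: "set_integrable lborel {0..t} (\<lambda>u. \<bar>x u - x' u\<bar>)"
    by (intro set_integrable_abs set_integral_diff(1) bounded_borel_upto_integrable[OF x(1)] bounded_borel_upto_integrable[OF x(2)]) (use t in auto)
  have "\<bar>LINT u:{0..t}|lborel. \<bar>x u - x' u\<bar>\<bar> \<le> d * (t - 0)"
    by (rule set_integral_abs_const_le[OF i _ t(1)]) (use d t in auto)
  also have "\<dots> \<le> T * d" using mult_left_mono[OF t(2) d0] by (simp add: mult.commute)
  finally have I: "(LINT u:{0..t}|lborel. \<bar>x u - x' u\<bar>) \<le> T * d" by simp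
  have "0 \<le> (LINT u:{0..t}|lborel. \<bar>x u - x' u\<bar>)"
    unfolding set_lebesgue_integral_def by (intro Bochner_Integration.integral_nonneg) auto
  then have "(stability_const T M - 1) * (LINT u:{0..t}|lborel. \<bar>x u - x' u\<bar>) \<le> stability_const T M * (T * d)"
    using I stability_const_ge[OF T M] by (intro mult_mono) auto
  then show ?thesis using flow_diff_state[OF x t, of y] by (simp add: stability_const_def mult.assoc)
qed

lemma psi_close:
  assumes x: "bounded_borel_upto T M x" "bounded_borel_upto T M x'"
    and d: "\<And>u. 0 \<le> u \<Longrightarrow> u \<le> T \<Longrightarrow> \<bar>x u - x' u\<bar> \<le> d" and t: "0 \<le> t" "t \<le> T"
  shows "\<bar>psi x t y - psi x' t y\<bar> \<le> (stability_const T M * T + 1) * d"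
proof -
  have "\<bar>started x t - started x' t\<bar> \<le> d" using d[OF t] by (auto simp: started_def)
  then have "G y * \<bar>started x t - started x' t\<bar> \<le> 1 * d" using G_range by (intro mult_mono) auto
  then have "\<bar>G y * started x t - G y * started x' t\<bar> \<le> d" using G_range
    by (simp add: abs_mult flip: right_diff_distrib)
  then show ?thesis using flow_state_close[OF assms, of y] unfolding psi_def by (simp add: distrib_right)
qed

text \<open>The nondecreasing \<open>D\<close> and the tails \<open>\<zeta>\<close> make the limit of approximate solutions inherit the
  monotonicity of \<open>started\<close> and of the tails, which the equation for \<open>x\<close> alone does not give.\<close>

definition approximate_solution ::
  "real \<Rightarrow> real \<Rightarrow> (real \<Rightarrow> real) \<Rightarrow> (real \<Rightarrow> real) \<Rightarrow> (real \<Rightarrow> real \<Rightarrow> real) \<Rightarrow> bool" where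
  "approximate_solution T e x D \<zeta> \<longleftrightarrow>
     x \<in> borel_measurable borel \<and> (\<forall>u\<in>{0..T}. 0 \<le> x u \<and> x u \<le> lam * u + Q0 + 3) \<and> near_solution T e x \<and>
     mono_on {0..T} D \<and> D 0 = 0 \<and> (\<forall>t\<in>{0..T}. \<bar>started x t - D t\<bar> \<le> e) \<and>
     (\<forall>t\<in>{0..T}. \<forall>y\<ge>0. 0 \<le> \<zeta> t y \<and> (\<forall>y'\<ge>y. \<zeta> t y' \<le> \<zeta> t y) \<and> \<bar>\<zeta> t y - psi x t y\<bar> \<le> e)"

definition fluid_head :: "(real \<Rightarrow> real) \<Rightarrow> bool" where
  "fluid_head x \<longleftrightarrow> x \<in> borel_measurable borel \<and>
     (\<forall>t\<ge>0. 0 \<le> x t \<and> x t \<le> lam * t + Q0 + 3 \<and> x t = flow (started x) (\<lambda>u. k (x u)) t 0 + lam * t + Q0) \<and>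
     mono_on {0..} (started x) \<and> started x 0 = 0 \<and>
     (\<forall>t\<ge>0. \<forall>y\<ge>0. 0 \<le> psi x t y \<and> (\<forall>y'\<ge>y. psi x t y' \<le> psi x t y))"

lemma head_bounded:
  assumes "x \<in> borel_measurable borel" "\<And>u. u \<in> {0..T} \<Longrightarrow> 0 \<le> x u \<and> x u \<le> lam * u + Q0 + 3"
  shows "bounded_borel_upto T (lam * T + Q0 + 3) x"
  unfolding bounded_borel_upto_def
proof (intro conjI ballI assms(1))
  fix u assume u: "u \<in> {0..T}"
  then have "lam * u \<le> lam * T" using lam0 by (intro mult_left_mono) auto
  then show "\<bar>x u\<bar> \<le> lam * T + Q0 + 3" using assms(2)[OF u] by linarith
qed

lemma fluid_head_bounded: "fluid_head x \<Longrightarrow> bounded_borel_upto T (lam * T + Q0 + 3) x"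
  by (rule head_bounded) (auto simp: fluid_head_def)

lemma fluid_head_near: "fluid_head x \<Longrightarrow> near_solution T 0 x"
  by (auto simp: fluid_head_def near_solution_def)

text \<open>With error \<open>1 / (j + 1)\<close> on \<open>[0, j]\<close>, the stability estimate
  makes the head counts Cauchy, uniformly on bounded intervals. The equation and all weak
  inequalities, monotonicity included, pass to the limit.\<close>

lemma fluid_head_exists:
  assumes approx: "\<And>T e. 0 \<le> T \<Longrightarrow> 0 < e \<Longrightarrow> \<exists>x D \<zeta>. approximate_solution T e x D \<zeta>"
  obtains x where "fluid_head x"
proof -
  have "\<forall>j::nat. \<exists>x D \<zeta>. approximate_solution (real j) (1 / real (Suc j)) x D \<zeta>" using approx by simp
  then obtain x D \<zeta> where a: "\<And>j::nat. approximate_solution (real j) (1 / real (Suc j)) (x j) (D j) (\<zeta> j)" by metis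
  define B where "B T = lam * T + Q0 + 3" for T
  \<comment> \<open>The factor 2 of the stability estimate, times two errors that are each at most
    \<open>1 / (j + 1)\<close>.\<close>
  define C where "C T = 4 * exp (2 * stability_const T (B T) * T)" for T
  have xm: "x j \<in> borel_measurable borel" for j using a[of j] by (simp add: approximate_solution_def)
  have xb: "bounded_borel_upto T (B T) (x j)" if "T \<le> real j" for j T
    unfolding B_def by (rule head_bounded[OF xm]) (use a[of j] that in \<open>auto simp: approximate_solution_def\<close>)
  have xn: "near_solution T (1 / real (Suc j)) (x j)" if "T \<le> real j" for j T
    using a[of j] that by (auto simp: approximate_solution_def near_solution_def)
  have aD: "\<bar>D j t - started (x j) t\<bar> \<le> 1 * (1 / real (Suc j))" if "0 \<le> t" "t \<le> real j" for j t
    using a[of j] that by (auto simp: approximate_solution_def abs_minus_commute simp del: of_nat_Suc)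
  have a\<zeta>: "\<bar>\<zeta> j t y - psi (x j) t y\<bar> \<le> 1 * (1 / real (Suc j))" "0 \<le> \<zeta> j t y" "y \<le> y' \<Longrightarrow> \<zeta> j t y' \<le> \<zeta> j t y"
    if "0 \<le> t" "t \<le> real j" "0 \<le> y" for j t y y'
    using a[of j] that by (auto simp: approximate_solution_def simp del: of_nat_Suc)
  have anti: "1 / real (Suc i) \<le> 1 / real (Suc j)" if "j \<le> i" for i j using that by (simp add: frac_le)
  have cauchy: "\<bar>x i t - x j t\<bar> \<le> C T * (1 / real (Suc j))" if "T \<le> real j" "j \<le> i" "0 \<le> t" "t \<le> T" for i j t T
  proof -
    have "T \<le> real i" using that by (meson of_nat_le_iff order_trans)
    then have "\<bar>x i t - x j t\<bar> \<le> 2 * (1 / real (Suc i) + 1 / real (Suc j)) * exp (2 * stability_const T (B T) * T)"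
      using that by (intro near_solutions_close[of T "B T"] xb xn) auto
    also have "\<dots> \<le> (2 * (1 / real (Suc j) + 1 / real (Suc j))) * exp (2 * stability_const T (B T) * T)"
      using anti[OF that(2)] by (intro mult_right_mono) auto
    finally show ?thesis by (simp add: C_def)
  qed
  have zero: "(\<lambda>j. c * (1 / real (Suc j))) \<longlonglongrightarrow> 0" for c
    using tendsto_mult_right_zero[OF LIMSEQ_inverse_real_of_nat[unfolded inverse_eq_divide]] by simp
  have conv: "convergent (\<lambda>j. x j t)" if t: "0 \<le> t" for t
  proof -
    obtain N :: nat where N: "t \<le> real N" using real_arch_simple by blast
    have "Cauchy (\<lambda>j. x j t)"
    proof (rule metric_CauchyI)
      fix e :: real assume "0 < e"
      then have "\<forall>\<^sub>F j in sequentially. C t * (1 / real (Suc j)) < e / 2" by (intro order_tendstoD(2)[OF zero]) simp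
      then obtain j where j: "N \<le> j" "C t * (1 / real (Suc j)) < e / 2"
        by (metis (no_types, lifting) eventually_sequentially le_cases order_refl)
      have tj: "t \<le> real j" using N j by (meson of_nat_le_iff order_trans)
      have close: "\<bar>x i t - x j t\<bar> < e / 2" if "j \<le> i" for i using cauchy[OF tj that t order_refl] j(2) by linarith
      show "\<exists>M. \<forall>m\<ge>M. \<forall>n\<ge>M. dist (x m t) (x n t) < e"
      proof (intro exI[of _ j] allI impI)
        fix m n assume "j \<le> m" "j \<le> n"
        then show "dist (x m t) (x n t) < e" using close[of m] close[of n] unfolding dist_real_def by linarith
      qed
    qed
    then show ?thesis by (simp add: Cauchy_convergent_iff)
  qed
  \<comment> \<open>Convergence is known for nonnegative times only; freezing negative times at 0
    gives a limit that is measurable on the whole line.\<close>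
  define X where "X t = lim (\<lambda>j. x j (max t 0))" for t
  have lim: "(\<lambda>j. x j t) \<longlonglongrightarrow> X t" if "0 \<le> t" for t
    using conv[OF that] that by (simp add: X_def convergent_LIMSEQ_iff max_def)
  have Xm: "X \<in> borel_measurable borel"
  proof (rule borel_measurable_LIMSEQ_real[of _ "\<lambda>j t. x j (max t 0)"])
    show "(\<lambda>j. x j (max t 0)) \<longlonglongrightarrow> X t" for t using conv[of "max t 0"] by (simp add: X_def convergent_LIMSEQ_iff)
    show "(\<lambda>t. x j (max t 0)) \<in> borel_measurable borel" for j
      by (rule measurable_compose[OF _ xm]) measurable
  qed
  have close: "\<bar>x j t - X t\<bar> \<le> C T * (1 / real (Suc j))" if "T \<le> real j" "0 \<le> t" "t \<le> T" for j t T
  proof -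
    have "(\<lambda>i. \<bar>x i t - x j t\<bar>) \<longlonglongrightarrow> \<bar>X t - x j t\<bar>" by (intro tendsto_intros lim that)
    then have "\<bar>X t - x j t\<bar> \<le> C T * (1 / real (Suc j))"
      by (rule LIMSEQ_le_const2) (use cauchy that in blast)
    then show ?thesis by (simp add: abs_minus_commute)
  qed
  have range: "0 \<le> X t \<and> X t \<le> B t" if t: "0 \<le> t" for t
  proof -
    obtain N :: nat where N: "t \<le> real N" using real_arch_simple by blast
    have b: "0 \<le> x j t \<and> x j t \<le> B t" if "N \<le> j" for j
    proof -
      have "t \<le> real j" using N that by (meson of_nat_le_iff order_trans)
      then show ?thesis using a[of j] t by (auto simp: approximate_solution_def B_def)
    qed
    show ?thesis using LIMSEQ_le_const[OF lim[OF t], of 0] LIMSEQ_le_const2[OF lim[OF t], of "B t"] b by blast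
  qed
  have Xb: "bounded_borel_upto T (B T) X" for T
    unfolding B_def by (rule head_bounded[OF Xm]) (use range in \<open>auto simp: B_def\<close>)
  have limI: "f \<longlonglongrightarrow> l" if b: "\<And>j::nat. T \<le> real j \<Longrightarrow> \<bar>f j - l\<bar> \<le> c * (1 / real (Suc j))" for f :: "nat \<Rightarrow> real" and l c T
  proof (rule LIM_zero_cancel, rule Lim_null_comparison[OF _ zero[of c]])
    obtain N :: nat where N: "T \<le> real N" using real_arch_simple by blast
    then have "T \<le> real j" if "N \<le> j" for j using that by (meson of_nat_le_iff order_trans)
    then show "\<forall>\<^sub>F j in sequentially. norm (f j - l) \<le> c * (1 / real (Suc j))"
      using b by (auto simp: eventually_sequentially simp del: of_nat_Suc)
  qed
  have flim: "(\<lambda>j. flow (started (x j)) (\<lambda>u. k (x j u)) t y) \<longlonglongrightarrow> flow (started X) (\<lambda>u. k (X u)) t y" if t: "0 \<le> t" for t y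
  proof (rule limI)
    fix j :: nat assume j: "t \<le> real j"
    show "\<bar>flow (started (x j)) (\<lambda>u. k (x j u)) t y - flow (started X) (\<lambda>u. k (X u)) t y\<bar> \<le>
      (stability_const t (B t) * t * C t) * (1 / real (Suc j))"
      using flow_state_close[OF xb[OF j] Xb close[OF j] t order_refl, of y] by (simp add: mult.assoc)
  qed
  have slim: "(\<lambda>j. started (x j) t) \<longlonglongrightarrow> started X t" if "0 \<le> t" for t
    unfolding started_def by (intro tendsto_intros lim that)
  have plim: "(\<lambda>j. psi (x j) t y) \<longlonglongrightarrow> psi X t y" if "0 \<le> t" for t y
    unfolding psi_def by (intro tendsto_intros flim slim that)
  have eqn: "X t = flow (started X) (\<lambda>u. k (X u)) t 0 + lam * t + Q0" if t: "0 \<le> t" for t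
  proof -
    have "(\<lambda>j. x j t - (flow (started (x j)) (\<lambda>u. k (x j u)) t 0 + lam * t + Q0)) \<longlonglongrightarrow> 0"
    proof (rule limI[where T = t and c = 1])
      fix j :: nat assume "t \<le> real j"
      then show "\<bar>x j t - (flow (started (x j)) (\<lambda>u. k (x j u)) t 0 + lam * t + Q0) - 0\<bar> \<le> 1 * (1 / real (Suc j))"
        using xn[of t j] t by (simp add: near_solution_def del: of_nat_Suc)
    qed
    moreover have "(\<lambda>j. x j t - (flow (started (x j)) (\<lambda>u. k (x j u)) t 0 + lam * t + Q0)) \<longlonglongrightarrow>
        X t - (flow (started X) (\<lambda>u. k (X u)) t 0 + lam * t + Q0)" by (intro tendsto_intros lim flim t)
    ultimately have "0 = X t - (flow (started X) (\<lambda>u. k (X u)) t 0 + lam * t + Q0)" by (rule LIMSEQ_unique)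
    then show ?thesis by simp
  qed
  have Dlim: "(\<lambda>j. D j t) \<longlonglongrightarrow> started X t" if t: "0 \<le> t" for t
  proof -
    have "(\<lambda>j. D j t - started (x j) t) \<longlonglongrightarrow> 0"
      by (rule limI[where T = t and c = 1]) (simp only: diff_0_right aD[OF t])
    then show ?thesis using tendsto_add[OF _ slim[OF t], of "\<lambda>j. D j t - started (x j) t" 0] by simp
  qed
  have Zlim: "(\<lambda>j. \<zeta> j t y) \<longlonglongrightarrow> psi X t y" if t: "0 \<le> t" "0 \<le> y" for t y
  proof -
    have "(\<lambda>j. \<zeta> j t y - psi (x j) t y) \<longlonglongrightarrow> 0"
      by (rule limI[where T = t and c = 1]) (simp only: diff_0_right a\<zeta>(1)[OF t(1) _ t(2)])
    then show ?thesis using tendsto_add[OF _ plim[OF t(1), of y], of "\<lambda>j. \<zeta> j t y - psi (x j) t y" 0] by simp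
  qed
  have ev: "\<exists>N. \<forall>j\<ge>N. P j" if "\<And>j::nat. T \<le> real j \<Longrightarrow> P j" for T P
  proof -
    obtain N :: nat where N: "T \<le> real N" using real_arch_simple by blast
    then show ?thesis using that by (meson of_nat_le_iff order_trans)
  qed
  have mono: "mono_on {0..} (started X)"
  proof (rule mono_onI)
    fix s t :: real assume st: "s \<in> {0..}" "t \<in> {0..}" "s \<le> t"
    have DD: "D j s \<le> D j t" if "t \<le> real j" for j
      using a[of j] st that mono_onD[of "{0..real j}" "D j" s t] by (auto simp: approximate_solution_def)
    show "started X s \<le> started X t"
      by (rule LIMSEQ_le[OF Dlim Dlim ev[of t, OF DD]]) (use st in auto)
  qed
  have "D j 0 = 0" for j using a[of j] by (simp add: approximate_solution_def)
  then have "(\<lambda>j. D j 0) \<longlonglongrightarrow> 0" by simp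
  then have start: "started X 0 = 0" by (rule LIMSEQ_unique[OF Dlim[OF order_refl]])
  have pos: "0 \<le> psi X t y" if "0 \<le> t" "0 \<le> y" for t y
    by (rule LIMSEQ_le_const[OF Zlim[OF that] ev[of t, OF a\<zeta>(2)[OF that(1) _ that(2)]]])
  have anti: "psi X t y' \<le> psi X t y" if "0 \<le> t" "0 \<le> y" "y \<le> y'" for t y y'
  proof -
    have "0 \<le> y'" using that by simp
    show ?thesis
      by (rule LIMSEQ_le[OF Zlim[OF that(1) \<open>0 \<le> y'\<close>] Zlim[OF that(1,2)] ev[of t, OF a\<zeta>(3)[OF that(1) _ that(2,3)]]])
  qed
  have "fluid_head X"
    unfolding fluid_head_def
    by (intro conjI allI impI Xm mono start pos anti eqn range[THEN conjunct1] range[THEN conjunct2, unfolded B_def])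
  then show thesis by (rule that)
qed

end

text \<open>By Fubini on the triangle \<open>s \<le> u\<close>.\<close>

lemma interval_measure_integral_by_parts:
  fixes B f h :: "real \<Rightarrow> real"
  assumes B: "mono B" "\<And>s. continuous (at_right s) B" and t: "0 \<le> t"
    and h: "h \<in> borel_measurable borel" "\<And>u. u \<in> {0..t} \<Longrightarrow> \<bar>h u\<bar> \<le> C"
    and f: "\<And>s. s \<in> {0..t} \<Longrightarrow> f s = c - (LINT u:{s..t}|lborel. h u)"
  shows "set_integrable (interval_measure B) {0<..t} f"
    and "(LINT s:{0<..t}|interval_measure B. f s) = c * (B t - B 0) - (LINT u:{0..t}|lborel. h u * (B u - B 0))"
proof -
  let ?N = "interval_measure B"
  \<comment> \<open>Restricted to bounded intervals both measures are finite, so the bounded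
    function \<open>H\<close> is integrable for the product and Fubini applies.\<close>
  let ?A = "restrict_space ?N {0<..t}" and ?L = "restrict_space lborel {0..t}"
  have monoB: "B a \<le> B b" if "a \<le> b" for a b using B(1) that by (rule monoD)
  have em: "emeasure ?N {a<..b} = ennreal (B b - B a)" if "a \<le> b" for a b
    using that monoB B(2) by (rule emeasure_interval_measure_Ioc)
  have ms: "measure ?N {a<..b} = B b - B a" if "a \<le> b" for a b
    using em[OF that] monoB[OF that] by (simp add: measure_def)
  interpret A: finite_measure ?A
    by (rule finite_measureI) (use em[OF t] in \<open>simp add: space_restrict_space emeasure_restrict_space\<close>)
  interpret L: finite_measure ?L
    by (rule finite_measureI) (simp add: space_restrict_space emeasure_restrict_space t)
  interpret AL: pair_sigma_finite ?A ?L ..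
  interpret ALf: finite_measure "?A \<Otimes>\<^sub>M ?L"
  proof (rule finite_measureI)
    have "emeasure (?A \<Otimes>\<^sub>M ?L) (space ?A \<times> space ?L) = emeasure ?A (space ?A) * emeasure ?L (space ?L)"
      by (rule L.emeasure_pair_measure_Times) (rule sets.top)+
    then show "emeasure (?A \<Otimes>\<^sub>M ?L) (space (?A \<Otimes>\<^sub>M ?L)) \<noteq> \<infinity>"
      using A.emeasure_finite L.emeasure_finite by (simp add: space_pair_measure ennreal_mult_eq_top_iff)
  qed
  define H where "H = (\<lambda>(s, u). indicator {p. fst p \<le> snd p} (s, u) * h u :: real)"
  have idA: "(\<lambda>x. x) \<in> ?A \<rightarrow>\<^sub>M borel" and idL: "(\<lambda>x. x) \<in> ?L \<rightarrow>\<^sub>M borel"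
    by (auto intro!: measurable_restrict_space1)
  have [measurable]: "fst \<in> ?A \<Otimes>\<^sub>M ?L \<rightarrow>\<^sub>M borel" "snd \<in> ?A \<Otimes>\<^sub>M ?L \<rightarrow>\<^sub>M borel"
    using measurable_compose[OF measurable_fst idA] measurable_compose[OF measurable_snd idL] by auto
  have Hm: "H \<in> borel_measurable (?A \<Otimes>\<^sub>M ?L)"
  proof -
    note [measurable] = h(1)
    have "{p \<in> space (?A \<Otimes>\<^sub>M ?L). fst p \<le> (snd p :: real)} \<in> sets (?A \<Otimes>\<^sub>M ?L)" by measurable
    then have "(\<lambda>p. if fst p \<le> snd p then h (snd p) else 0) \<in> borel_measurable (?A \<Otimes>\<^sub>M ?L)" by measurable
    also have "(\<lambda>p. if fst p \<le> snd p then h (snd p) else 0) = H" by (auto simp: H_def fun_eq_iff)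
    finally show ?thesis .
  qed
  have C: "0 \<le> C" using h(2)[of 0] t by auto
  have Hi: "integrable (?A \<Otimes>\<^sub>M ?L) H"
  proof (rule ALf.integrable_const_bound[OF _ Hm, of C], rule AE_I2)
    fix p assume "p \<in> space (?A \<Otimes>\<^sub>M ?L)"
    then have "snd p \<in> {0..t}" by (auto simp: space_pair_measure space_restrict_space)
    then show "norm (H p) \<le> C" using h(2)[of "snd p"] C by (auto simp: H_def split: prod.splits) (auto simp: indicator_def)
  qed
  have inner: "(\<integral>u. H (s, u) \<partial>?L) = (LINT u:{s..t}|lborel. h u)" if "s \<in> {0<..t}" for s
  proof -
    have "(\<integral>u. H (s, u) \<partial>?L) = (LINT u|lborel. indicator {0..t} u *\<^sub>R H (s, u))"
      by (subst integral_restrict_space) auto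
    also have "\<dots> = (LINT u:{s..t}|lborel. h u)"
      unfolding set_lebesgue_integral_def
      by (rule Bochner_Integration.integral_cong) (use that in \<open>auto simp: H_def indicator_def\<close>)
    finally show ?thesis .
  qed
  \<comment> \<open>For fixed \<open>u\<close> the points \<open>s\<close> of \<open>(0, u]\<close>
    have mass \<open>B u - B 0\<close>; this is how the integrator becomes an ordinary
    factor.\<close>
  have outer: "(\<integral>s. H (s, u) \<partial>?A) = h u * (B u - B 0)" if u: "u \<in> {0..t}" for u
  proof -
    have "(\<integral>s. H (s, u) \<partial>?A) = (\<integral>s. indicator {0<..t} s *\<^sub>R H (s, u) \<partial>?N)"
      by (subst integral_restrict_space) auto
    also have "\<dots> = (\<integral>s. h u * indicator {0<..u} s \<partial>?N)"
      by (rule Bochner_Integration.integral_cong) (use u in \<open>auto simp: H_def indicator_def\<close>)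
    also have "\<dots> = h u * measure ?N {0<..u}" by simp
    finally show ?thesis using ms[of 0 u] u by simp
  qed
  have Ii: "integrable ?A (\<lambda>s. LINT u:{s..t}|lborel. h u)"
    using AL.integrable_fst'[OF Hi]
    by (rule Bochner_Integration.integrable_cong[THEN iffD1, rotated -1]) (use inner in \<open>auto simp: space_restrict_space\<close>)
  have fi: "integrable ?A (\<lambda>s. c - (LINT u:{s..t}|lborel. h u))"
    by (intro Bochner_Integration.integrable_diff A.integrable_const Ii)
  have fi': "integrable ?A f"
    using fi by (rule Bochner_Integration.integrable_cong[THEN iffD1, rotated -1]) (use f in \<open>auto simp: space_restrict_space\<close>)
  then show "set_integrable ?N {0<..t} f"
    by (simp add: set_integrable_eq)
  have "(LINT s:{0<..t}|?N. f s) = (\<integral>s. f s \<partial>?A)"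
    by (simp add: set_lebesgue_integral_def integral_restrict_space)
  also have "\<dots> = (\<integral>s. c - (LINT u:{s..t}|lborel. h u) \<partial>?A)"
    by (rule Bochner_Integration.integral_cong) (use f in \<open>auto simp: space_restrict_space\<close>)
  also have "\<dots> = (\<integral>s. c \<partial>?A) - (\<integral>s. (LINT u:{s..t}|lborel. h u) \<partial>?A)"
    by (intro Bochner_Integration.integral_diff A.integrable_const Ii)
  also have "(\<integral>s. c \<partial>?A) = c * (B t - B 0)"
    using ms[OF t] by (simp add: measure_restrict_space space_restrict_space)
  also have "(\<integral>s. (LINT u:{s..t}|lborel. h u) \<partial>?A) = (\<integral>s. (\<integral>u. H (s, u) \<partial>?L) \<partial>?A)"
    by (rule Bochner_Integration.integral_cong) (use inner in \<open>auto simp: space_restrict_space\<close>)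
  also have "\<dots> = (\<integral>u. (\<integral>s. H (s, u) \<partial>?A) \<partial>?L)"
    using AL.Fubini_integral[of "\<lambda>s u. H (s, u)"] Hi by (simp add: case_prod_eta)
  also have "\<dots> = (\<integral>u. h u * (B u - B 0) \<partial>?L)"
    by (rule Bochner_Integration.integral_cong) (use outer in \<open>auto simp: space_restrict_space\<close>)
  also have "\<dots> = (LINT u:{0..t}|lborel. h u * (B u - B 0))"
    by (simp add: set_lebesgue_integral_def integral_restrict_space)
  finally show "(LINT s:{0<..t}|?N. f s) = c * (B t - B 0) - (LINT u:{0..t}|lborel. h u * (B u - B 0))" .
qed

section \<open>The path of measures that belongs to a solution\<close>

context fluid_data
begin

lemma flow_Lipschitz:
  assumes D: "bounded_borel_upto T M D" and r: "rate \<kappa>" and t: "0 \<le> t" "t \<le> T"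
  shows "\<bar>flow D \<kappa> t y - flow D \<kappa> t y'\<bar> \<le> (LF + M * Lg * K * T) * \<bar>y - y'\<bar>"
proof -
  let ?h = "\<lambda>y u. D u * g (y + work \<kappa> u t) * \<kappa> u"
  have M: "0 \<le> M" using bounded_borel_upto_bound[OF D, of 0] t by auto
  have hi: "set_integrable lborel {0..t} (?h y)" for y
    using bounded_borel_upto_integrable[OF flow_integrand[OF D r], of 0 t] t by auto
  have "\<bar>LINT u:{0..t}|lborel. ?h y u - ?h y' u\<bar> \<le> (M * (Lg * \<bar>y - y'\<bar>) * K) * (t - 0)"
  proof (rule set_integral_abs_const_le[OF set_integral_diff(1)[OF hi hi] _ t(1)])
    fix u assume u: "u \<in> {0..t}"
    have Db: "\<bar>D u\<bar> \<le> M" using bounded_borel_upto_bound[OF D, of u] u t by auto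
    have "\<bar>g (y + work \<kappa> u t) - g (y' + work \<kappa> u t)\<bar> \<le> Lg * \<bar>y - y'\<bar>"
      using gL[of "y + work \<kappa> u t" "y' + work \<kappa> u t"] by simp
    then have "\<bar>D u\<bar> * \<bar>g (y + work \<kappa> u t) - g (y' + work \<kappa> u t)\<bar> * \<kappa> u \<le> M * (Lg * \<bar>y - y'\<bar>) * K"
      using Db M rateD(2,3)[OF r] consts_nonneg by (intro mult_mono mult_nonneg_nonneg) auto
    then show "\<bar>?h y u - ?h y' u\<bar> \<le> M * (Lg * \<bar>y - y'\<bar>) * K"
      by (simp add: abs_mult rateD(2)[OF r] flip: left_diff_distrib right_diff_distrib)
  qed
  also have "\<dots> \<le> (M * (Lg * \<bar>y - y'\<bar>) * K) * T"
    using t M consts_nonneg by (intro mult_left_mono mult_nonneg_nonneg) auto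
  finally have "\<bar>(LINT u:{0..t}|lborel. ?h y u) - (LINT u:{0..t}|lborel. ?h y' u)\<bar> \<le> (M * (Lg * \<bar>y - y'\<bar>) * K) * T"
    by (simp only: set_integral_diff(2)[OF hi hi])
  moreover have "\<bar>F (y + work \<kappa> 0 t) - F (y' + work \<kappa> 0 t)\<bar> \<le> LF * \<bar>y - y'\<bar>"
    using FL[of "y + work \<kappa> 0 t" "y' + work \<kappa> 0 t"] by simp
  moreover have "(LF + M * Lg * K * T) * \<bar>y - y'\<bar> = LF * \<bar>y - y'\<bar> + (M * (Lg * \<bar>y - y'\<bar>) * K) * T"
    by (simp add: algebra_simps)
  ultimately show ?thesis unfolding flow_def by linarith
qed

lemma flow_le_initial:
  assumes D: "bounded_borel_upto T M D" "\<And>u. 0 \<le> u \<Longrightarrow> u \<le> T \<Longrightarrow> 0 \<le> D u" and r: "rate \<kappa>" and t: "0 \<le> t" "t \<le> T"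
  shows "flow D \<kappa> t y \<le> F y"
proof -
  have "0 \<le> (LINT u:{0..t}|lborel. D u * g (y + work \<kappa> u t) * \<kappa> u)"
    unfolding set_lebesgue_integral_def
  proof (intro Bochner_Integration.integral_nonneg)
    fix u show "0 \<le> indicator {0..t} u *\<^sub>R (D u * g (y + work \<kappa> u t) * \<kappa> u)"
      using D(2)[of u] t g0 rateD(2)[OF r] by (auto simp: indicator_def)
  qed
  moreover have "F (y + work \<kappa> 0 t) \<le> F y" using work_nonneg[OF r, of 0 t] by (intro F_antimono) auto
  ultimately show ?thesis by (simp add: flow_def)
qed

context
  fixes x assumes x: "fluid_head x"
begin

lemma head_measurable: "x \<in> borel_measurable borel"
  and head_nonneg: "0 \<le> t \<Longrightarrow> 0 \<le> x t"
  and head_eq: "0 \<le> t \<Longrightarrow> x t = flow (started x) (\<lambda>u. k (x u)) t 0 + lam * t + Q0"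
  and started_mono: "mono_on {0..} (started x)"
  and started_0: "started x 0 = 0"
  and psi_nonneg: "0 \<le> t \<Longrightarrow> 0 \<le> y \<Longrightarrow> 0 \<le> psi x t y"
  and psi_antimono: "0 \<le> t \<Longrightarrow> 0 \<le> y \<Longrightarrow> y \<le> y' \<Longrightarrow> psi x t y' \<le> psi x t y"
  using x by (auto simp: fluid_head_def)

lemma started_nonneg: "0 \<le> t \<Longrightarrow> 0 \<le> started x t"
  using mono_onD[OF started_mono, of 0 t] started_0 by auto

lemma head_psi: "0 \<le> t \<Longrightarrow> x t = max (x t - 1) 0 + psi x t 0"
  using head_eq[of t] G_0 unfolding psi_def started_def by simp

definition head_bound :: "real \<Rightarrow> real" where
  "head_bound T = lam * T + Q0 + (lam * T + Q0 + 3) + 1"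

lemma started_bounded_upto: "0 \<le> T \<Longrightarrow> bounded_borel_upto T (head_bound T) (started x)"
  unfolding head_bound_def by (rule started_bounded[OF fluid_head_bounded[OF x]])

text \<open>The bound is uniform over \<open>[0, T]\<close> and tends to zero in \<open>y\<close>:
  this is the tightness that lets finitely many cells control the Prohorov distance.\<close>

lemma psi_le: assumes t: "0 \<le> t" "t \<le> T" shows "psi x t y \<le> F y + G y * head_bound T"
proof -
  have T: "0 \<le> T" using t by simp
  have "flow (started x) (\<lambda>u. k (x u)) t y \<le> F y"
    by (rule flow_le_initial[OF started_bounded_upto[OF T] started_nonneg rate_k[OF head_measurable] t])
  moreover have "G y * started x t \<le> G y * head_bound T"
    using bounded_borel_upto_bound[OF started_bounded_upto[OF T] t] G_range by (intro mult_left_mono) auto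
  ultimately show ?thesis by (simp add: psi_def)
qed

lemma psi_tail_lim: "((\<lambda>y. F y + G y * c) \<longlongrightarrow> 0) at_top"
  using tendsto_add[OF F_lim tendsto_mult_left[OF G_lim, of c]] by (simp add: mult.commute)

lemma psi_lim: assumes t: "0 \<le> t" shows "(psi x t \<longlongrightarrow> 0) at_top"
proof (rule tendsto_sandwich[OF _ _ tendsto_const psi_tail_lim[of "head_bound t"]])
  show "\<forall>\<^sub>F y in at_top. 0 \<le> psi x t y"
    using eventually_ge_at_top[of 0] by eventually_elim (rule psi_nonneg[OF t])
  show "\<forall>\<^sub>F y in at_top. psi x t y \<le> F y + G y * head_bound t"
    using psi_le[OF t order_refl] by simp
qed

lemma psi_Lipschitz:
  assumes t: "0 \<le> t"
  shows "\<bar>psi x t y - psi x t y'\<bar> \<le> (LF + head_bound t * Lg * K * t + Cg * head_bound t) * \<bar>y - y'\<bar>"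
proof -
  have b: "\<bar>started x t\<bar> \<le> head_bound t" by (rule bounded_borel_upto_bound[OF started_bounded_upto[OF t] t order_refl])
  have "\<bar>G y - G y'\<bar> * \<bar>started x t\<bar> \<le> (Cg * \<bar>y - y'\<bar>) * head_bound t"
    using GC[of y y'] b consts_nonneg by (intro mult_mono) auto
  then have "\<bar>G y * started x t - G y' * started x t\<bar> \<le> Cg * head_bound t * \<bar>y - y'\<bar>"
    by (simp add: abs_mult mult_ac flip: left_diff_distrib)
  then show ?thesis
    using flow_Lipschitz[OF started_bounded_upto[OF t] rate_k[OF head_measurable] t order_refl, of y y']
    unfolding psi_def distrib_right by linarith
qed

text \<open>The function is the distribution function to be: subtracting from
  \<open>psi x t 0\<close> turns the nonincreasing tail into a nondecreasing function, and
  \<open>max y 0\<close> makes it vanish on the negative half-line.\<close>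

definition tail_measure :: "real \<Rightarrow> real measure" where
  "tail_measure t = interval_measure (\<lambda>y. psi x t 0 - psi x t (max y 0))"

lemma tail_measure:
  assumes t: "0 \<le> t"
  shows "tail_measure t \<in> halfline_measures"
    and "0 \<le> y \<Longrightarrow> measure (tail_measure t) {y<..} = psi x t y"
    and "0 \<le> y \<Longrightarrow> measure (tail_measure t) {y} = 0"
    and "0 \<le> y \<Longrightarrow> measure (tail_measure t) {y..} = psi x t y"
proof -
  let ?H = "\<lambda>y. psi x t 0 - psi x t (max y 0)" and ?m = "tail_measure t"
  define L where "L = LF + head_bound t * Lg * K * t + Cg * head_bound t"
  have L: "\<bar>psi x t y - psi x t y'\<bar> \<le> L * \<bar>y - y'\<bar>" for y y' unfolding L_def by (rule psi_Lipschitz[OF t])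
  have L0: "0 \<le> L" using L[of 0 1] by (smt (verit) mult_cancel_left2)
  have mono: "?H a \<le> ?H b" if "a \<le> b" for a b
    using psi_antimono[OF t, of "max a 0" "max b 0"] that by auto
  have LH: "\<bar>?H a - ?H b\<bar> \<le> L * \<bar>a - b\<bar>" for a b
  proof -
    have "L * \<bar>max a 0 - max b 0\<bar> \<le> L * \<bar>a - b\<bar>" using L0 by (intro mult_left_mono) auto
    then show ?thesis using L[of "max b 0" "max a 0"] by (simp add: abs_minus_commute)
  qed
  have "continuous_on UNIV ?H"
    by (rule lipschitz_on_continuous_on[of L], rule lipschitz_onI) (use LH L0 in \<open>auto simp: dist_real_def\<close>)
  then have cont: "continuous (at_right a) ?H" for a
    by (auto simp: continuous_on_eq_continuous_at intro: continuous_within_subset)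
  have bot: "(?H \<longlongrightarrow> 0) at_bot"
  proof (rule tendsto_eventually)
    show "\<forall>\<^sub>F y in at_bot. ?H y = 0" using eventually_le_at_bot[of 0] by eventually_elim (simp add: max_def)
  qed
  have "(?H \<longlongrightarrow> psi x t 0 - 0) at_top"
  proof (intro tendsto_diff tendsto_const)
    show "((\<lambda>y. psi x t (max y 0)) \<longlongrightarrow> 0) at_top"
    proof (rule Lim_transform_eventually[OF psi_lim[OF t]])
      show "\<forall>\<^sub>F y in at_top. psi x t y = psi x t (max y 0)"
        using eventually_ge_at_top[of 0] by eventually_elim (simp add: max_def)
    qed
  qed
  then have top: "(?H \<longlongrightarrow> psi x t 0) at_top" by simp
  note p0 = psi_nonneg[OF t order_refl]
  have fin: "finite_borel_measure ?m"
    unfolding tail_measure_def by (rule finite_borel_measure_interval_measure[OF mono cont bot top p0])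
  then interpret finite_borel_measure ?m .
  have "emeasure ?m UNIV = psi x t 0"
    unfolding tail_measure_def by (rule interval_measure_UNIV[OF mono cont bot top p0])
  then have univ: "measure ?m UNIV = psi x t 0" using p0 by (simp add: measure_def)
  have cdf: "measure ?m {..y} = ?H y" for y
    using cdf_interval_measure[OF mono cont bot] by (simp add: tail_measure_def cdf_def fun_eq_iff)
  have tail: "measure ?m {y<..} = psi x t (max y 0)" for y
  proof -
    have "{y<..} = space ?m - {..y}" by (auto simp: borel_UNIV)
    then have "measure ?m {y<..} = measure ?m (space ?m) - measure ?m {..y}"
      using finite_measure_compl[of "{..y}"] by (simp add: tail_measure_def)
    then show ?thesis using univ cdf[of y] by (simp add: borel_UNIV)
  qed
  have atom: "measure ?m {y} = 0" for y
  proof (rule antisym[OF _ measure_nonneg], rule field_le_epsilon)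
    fix e :: real assume e: "0 < e"
    define d where "d = e / (L + 1)"
    have d: "0 < d" using e L0 by (simp add: d_def)
    have "{y} \<subseteq> {..y} - {..y - d}" using d by auto
    then have "measure ?m {y} \<le> measure ?m ({..y} - {..y - d})" by (intro finite_measure_mono) auto
    also have "\<dots> = ?H y - ?H (y - d)"
      using d by (subst finite_measure_Diff) (auto simp: cdf)
    also have "\<dots> \<le> L * d" using LH[of y "y - d"] d by auto
    also have "\<dots> \<le> e" using e L0 by (simp add: d_def field_simps)
    finally show "measure ?m {y} \<le> 0 + e" by simp
  qed
  have "measure ?m {..<0} \<le> measure ?m {..0}" by (intro finite_measure_mono) auto
  then have "measure ?m {..<0} = 0" using cdf[of 0] measure_nonneg[of ?m "{..<0}"] by simp
  then show "?m \<in> halfline_measures" using fin by (simp add: halfline_measures_def)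
  show "measure ?m {y} = 0" by (rule atom)
  show "0 \<le> y \<Longrightarrow> measure ?m {y<..} = psi x t y" using tail[of y] by simp
  have U: "{y..} = {y} \<union> {y<..}" by auto
  have "measure ?m {y..} = measure ?m {y} + measure ?m {y<..}"
    unfolding U by (rule finite_measure_Union) (auto simp: tail_measure_def)
  then show "0 \<le> y \<Longrightarrow> measure ?m {y..} = psi x t y" using tail[of y] atom[of y] by simp
qed

lemma tail_measure_close:
  assumes T: "0 \<le> T" and e: "0 < e"
  obtains d where "0 < d" "\<And>t m. 0 \<le> t \<Longrightarrow> t \<le> T \<Longrightarrow> m \<in> halfline_measures \<Longrightarrow> measure m {0} = 0 \<Longrightarrow>
    (\<And>y. 0 \<le> y \<Longrightarrow> \<bar>measure m {y<..} - psi x t y\<bar> \<le> d) \<Longrightarrow> prohorov_close m (tail_measure t) e"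
proof -
  have "\<forall>\<^sub>F y in at_top. F y + G y * head_bound T < e / 4"
    by (rule order_tendstoD(2)[OF psi_tail_lim]) (use e in simp)
  then obtain y0 where y0: "\<And>y. y0 \<le> y \<Longrightarrow> F y + G y * head_bound T < e / 4" by (auto simp: eventually_at_top_linorder)
  \<comment> \<open>Cells of length \<open>e / 2\<close> reach up to the point beyond which all
    tails on \<open>[0, T]\<close> are below \<open>e / 4\<close>; then \<open>d\<close> is chosen
    with \<open>(2 * N + 1) * d = e / 4\<close>.\<close>
  obtain N :: nat where N: "y0 / (e / 2) \<le> real N" using real_arch_simple by blast
  have Ny: "y0 \<le> real N * (e / 2)" using N e by (simp add: field_simps)
  define c where "c = 2 * real N + 1"
  have c: "0 < c" by (simp add: c_def add_nonneg_pos)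
  define d where "d = e / (4 * c)"
  have "c * d = e / 4" using c by (simp add: d_def)
  moreover have "2 * real N * d + d = c * d" by (simp add: c_def distrib_right)
  moreover have "0 < d" using e c by (simp add: d_def)
  ultimately have d: "0 < d" "2 * real N * d + d = e / 4" by simp_all
  show thesis
  proof (rule that[OF d(1)])
    fix t m assume t: "0 \<le> t" "t \<le> T" and m: "m \<in> halfline_measures" "measure m {0} = 0"
      and c: "\<And>y. 0 \<le> y \<Longrightarrow> \<bar>measure m {y<..} - psi x t y\<bar> \<le> d"
    note tm = tail_measure[OF t(1)]
    have far: "measure (tail_measure t) {real N * (e / 2)<..} \<le> e / 4"
      using tm(2)[of "real N * (e / 2)"] psi_le[OF t, of "real N * (e / 2)"] y0[OF Ny] e by simp
    show "prohorov_close m (tail_measure t) e"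
      by (rule prohorov_close_of_tails[OF m(1) tm(1) m(2) tm(3) _ far]) (use c tm(2) d e in auto)
  qed
qed

text \<open>The head count comes first, since its equation contains \<open>started\<close> only
  under the integral. Then \<open>started\<close>, a function of time and head count, is Lipschitz
  as well, and with it the boundary term of \<open>psi\<close>.\<close>

lemma head_time_Lipschitz:
  obtains L where "0 \<le> L" "\<And>t t' y. 0 \<le> t \<Longrightarrow> t \<le> t' \<Longrightarrow> t' \<le> T \<Longrightarrow> \<bar>psi x t y - psi x t' y\<bar> \<le> L * (t' - t)"
    "\<And>t t'. 0 \<le> t \<Longrightarrow> t \<le> t' \<Longrightarrow> t' \<le> T \<Longrightarrow> \<bar>x t - x t'\<bar> \<le> L * (t' - t)"
proof (cases "0 \<le> T")
  case False then show thesis using that[of 0] by force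
next
  case T: True
  define c where "c = flow_const T (head_bound T) * K + Cg * K * head_bound T"
  have fl: "\<bar>flow (started x) (\<lambda>u. k (x u)) t y - flow (started x) (\<lambda>u. k (x u)) t' y\<bar> \<le> c * (t' - t)"
    if "0 \<le> t" "t \<le> t'" "t' \<le> T" for t t' y
    unfolding c_def by (rule flow_time[OF started_bounded_upto[OF T] rate_k[OF head_measurable] that])
  have hb: "0 \<le> head_bound T" unfolding head_bound_def using T lam0 Q0 by simp
  have c0: "0 \<le> c" unfolding c_def flow_const_def using T hb consts_nonneg by simp
  have xl: "\<bar>x t - x t'\<bar> \<le> (c + lam) * (t' - t)" if "0 \<le> t" "t \<le> t'" "t' \<le> T" for t t'
    using fl[OF that, of 0] head_eq[of t] head_eq[of t'] that lam0 mult_left_mono[OF that(2) lam0]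
    by (simp add: algebra_simps abs_le_iff)
  show thesis
  proof (rule that[of "2 * c + 2 * lam"])
    fix t t' y assume t: "0 \<le> t" "t \<le> t'" "t' \<le> T"
    have "\<bar>max (x t - 1) 0 - max (x t' - 1) 0\<bar> \<le> \<bar>x t - x t'\<bar>" by auto
    moreover have "\<bar>lam * t - lam * t'\<bar> = lam * (t' - t)"
      using mult_left_mono[OF t(2) lam0] by (simp add: right_diff_distrib)
    ultimately have "\<bar>started x t - started x t'\<bar> \<le> lam * (t' - t) + (c + lam) * (t' - t)"
      using xl[OF t] unfolding started_def by linarith
    then have "G y * \<bar>started x t - started x t'\<bar> \<le> 1 * (lam * (t' - t) + (c + lam) * (t' - t))"
      using G_range by (intro mult_mono) auto
    then have "\<bar>G y * started x t - G y * started x t'\<bar> \<le> lam * (t' - t) + (c + lam) * (t' - t)"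
      using G_range by (simp add: abs_mult flip: right_diff_distrib)
    moreover have "(2 * c + 2 * lam) * (t' - t) = c * (t' - t) + (lam * (t' - t) + (c + lam) * (t' - t))"
      by (simp add: algebra_simps)
    ultimately show "\<bar>psi x t y - psi x t' y\<bar> \<le> (2 * c + 2 * lam) * (t' - t)"
      using fl[OF t, of y] unfolding psi_def by linarith
  next
    fix t t' assume t: "0 \<le> t" "t \<le> t'" "t' \<le> T"
    have "(c + lam) * (t' - t) \<le> (2 * c + 2 * lam) * (t' - t)" using c0 lam0 t by (intro mult_right_mono) auto
    then show "\<bar>x t - x t'\<bar> \<le> (2 * c + 2 * lam) * (t' - t)" using xl[OF t] by linarith
  qed (use c0 lam0 in auto)
qed

definition fluid_path :: "real \<Rightarrow> real measure \<times> real" where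
  "fluid_path = (\<lambda>t\<in>{0..}. (tail_measure t, max (x t - 1) 0))"

lemma fluid_path_state: "0 \<le> t \<Longrightarrow> fluid_path t \<in> state_space"
  using tail_measure(1)[of t] by (simp add: fluid_path_def state_space_def)

lemma fluid_path_head_count: "0 \<le> t \<Longrightarrow> fluid_head_count fluid_path t = x t"
  using tail_measure(2)[of t 0] head_psi[of t] by (simp add: fluid_head_count_def fluid_path_def)

lemma fluid_path_close:
  assumes T: "0 \<le> T" and e: "0 < e"
  obtains d where "0 < d" "\<And>t m q. 0 \<le> t \<Longrightarrow> t \<le> T \<Longrightarrow> m \<in> halfline_measures \<Longrightarrow> measure m {0} = 0 \<Longrightarrow>
    (\<And>y. 0 \<le> y \<Longrightarrow> \<bar>measure m {y<..} - psi x t y\<bar> \<le> d) \<Longrightarrow> \<bar>q - max (x t - 1) 0\<bar> \<le> d \<Longrightarrow>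
    state_dist (m, q) (fluid_path t) \<le> e"
proof -
  obtain d where d: "0 < d" "\<And>t m. 0 \<le> t \<Longrightarrow> t \<le> T \<Longrightarrow> m \<in> halfline_measures \<Longrightarrow> measure m {0} = 0 \<Longrightarrow>
    (\<And>y. 0 \<le> y \<Longrightarrow> \<bar>measure m {y<..} - psi x t y\<bar> \<le> d) \<Longrightarrow> prohorov_close m (tail_measure t) (e / 2)"
    using tail_measure_close[OF T, of "e / 2"] e by (metis half_gt_zero)
  show thesis
  proof (rule that[of "min d (e / 2)"])
    fix t m q assume t: "0 \<le> t" "t \<le> T" and m: "m \<in> halfline_measures" "measure m {0} = 0"
      and c: "\<And>y. 0 \<le> y \<Longrightarrow> \<bar>measure m {y<..} - psi x t y\<bar> \<le> min d (e / 2)"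
      and q: "\<bar>q - max (x t - 1) 0\<bar> \<le> min d (e / 2)"
    have cl: "prohorov_close m (tail_measure t) (e / 2)"
      by (rule d(2)[OF t m]) (use c in auto)
    have e2: "0 < e / 2" using e by simp
    have "\<bar>prohorov_dist m (tail_measure t)\<bar> \<le> e / 2"
      using prohorov_dist_le[OF e2 cl] prohorov_dist_nonneg[OF m(1) tail_measure(1)[OF t(1)]] by simp
    then have "state_dist (m, q) (tail_measure t, max (x t - 1) 0) \<le> e / 2 + e / 2"
      using q by (intro state_dist_le) auto
    then show "state_dist (m, q) (fluid_path t) \<le> e" using t by (simp add: fluid_path_def)
  qed (use d e in auto)
qed

lemma fluid_path_cadlag: "fluid_path \<in> cadlag_paths state_space state_dist"
proof -
  \<comment> \<open>One statement for both one-sided limits. The condition on \<open>S\<close>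
    excludes approaching time 0 from the left, where the path has no meaning.\<close>
  have lim: "limitin State.mtopology fluid_path (fluid_path t) (at t within S)" if t: "0 \<le> t" and S: "\<And>s. s \<in> S \<Longrightarrow> s < t \<Longrightarrow> 0 < t" for t S
    unfolding State.limitin_metric
  proof (intro conjI allI impI)
    fix e :: real assume e: "0 < e"
    have T: "0 \<le> t + 1" using t by simp
    have e2: "0 < e / 2" using e by simp
    obtain d where d: "0 < d" "\<And>t' m q. 0 \<le> t' \<Longrightarrow> t' \<le> t + 1 \<Longrightarrow> m \<in> halfline_measures \<Longrightarrow> measure m {0} = 0 \<Longrightarrow>
      (\<And>y. 0 \<le> y \<Longrightarrow> \<bar>measure m {y<..} - psi x t' y\<bar> \<le> d) \<Longrightarrow> \<bar>q - max (x t' - 1) 0\<bar> \<le> d \<Longrightarrow>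
      state_dist (m, q) (fluid_path t') \<le> e / 2"
      using fluid_path_close[OF T e2] by metis
    obtain L where L: "0 \<le> L" "\<And>s s' y. 0 \<le> s \<Longrightarrow> s \<le> s' \<Longrightarrow> s' \<le> t + 1 \<Longrightarrow> \<bar>psi x s y - psi x s' y\<bar> \<le> L * (s' - s)"
      "\<And>s s'. 0 \<le> s \<Longrightarrow> s \<le> s' \<Longrightarrow> s' \<le> t + 1 \<Longrightarrow> \<bar>x s - x s'\<bar> \<le> L * (s' - s)"
      using head_time_Lipschitz[of "t + 1"] by metis
    \<comment> \<open>The denominator \<open>L + 1\<close> is positive even for
      \<open>L = 0\<close>, and \<open>h \<le> t\<close> for positive \<open>t\<close> keeps nearby
      times nonnegative.\<close>
    define h where "h = min 1 (if t = 0 then d / (L + 1) else min t (d / (L + 1)))"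
    have h: "0 < h" "h \<le> 1" "L * h \<le> d" "0 < t \<Longrightarrow> h \<le> t"
    proof -
      have "0 < d / (L + 1)" using d(1) L(1) by simp
      then show "0 < h" "h \<le> 1" "0 < t \<Longrightarrow> h \<le> t" using t by (auto simp: h_def)
      have "L * h \<le> L * (d / (L + 1))" using L(1) by (intro mult_left_mono) (auto simp: h_def)
      also have "\<dots> \<le> d" using d(1) L(1) by (simp add: field_simps)
      finally show "L * h \<le> d" .
    qed
    have "\<forall>\<^sub>F s in at t within S. s \<in> S \<and> dist s t < h"
      using h(1) by (auto simp: eventually_at intro!: exI[of _ h])
    then show "\<forall>\<^sub>F s in at t within S. fluid_path s \<in> state_space \<and> state_dist (fluid_path s) (fluid_path t) < e"
    proof eventually_elim
      case (elim s)
      have s: "0 \<le> s" "s \<le> t + 1" "\<bar>s - t\<bar> \<le> h"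
        using elim S[of s] h t by (auto simp: dist_real_def abs_if split: if_splits)
      have Ls: "L * \<bar>s - t\<bar> \<le> d" using mult_left_mono[OF s(3) L(1)] h(3) by simp
      have "\<bar>psi x s y - psi x t y\<bar> \<le> L * \<bar>s - t\<bar>" for y
      proof (cases "s \<le> t")
        case True then show ?thesis using L(2)[of s t y] s t by simp
      next
        case False then show ?thesis using L(2)[of t s y] s t by (subst abs_minus_commute) simp
      qed
      then have "\<bar>psi x s y - psi x t y\<bar> \<le> d" for y using Ls order_trans by blast
      moreover have "\<bar>x s - x t\<bar> \<le> L * \<bar>s - t\<bar>"
      proof (cases "s \<le> t")
        case True then show ?thesis using L(3)[of s t] s t by simp
      next
        case False then show ?thesis using L(3)[of t s] s t by (subst abs_minus_commute) simp
      qed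
      then have "\<bar>max (x s - 1) 0 - max (x t - 1) 0\<bar> \<le> d" using Ls by linarith
      ultimately have "state_dist (tail_measure s, max (x s - 1) 0) (fluid_path t) \<le> e / 2"
        using tail_measure[OF s(1)] t by (intro d(2)) auto
      then have "state_dist (fluid_path s) (fluid_path t) \<le> e / 2" using s by (simp add: fluid_path_def)
      then show ?case using fluid_path_state[OF s(1)] e by simp
    qed
  qed (rule fluid_path_state[OF t])
  show ?thesis
    unfolding cadlag_paths_def
  proof (intro CollectI conjI allI impI)
    show "fluid_path \<in> {0..} \<rightarrow>\<^sub>E state_space" using fluid_path_state by (auto simp: fluid_path_def)
    show "limitin State.mtopology fluid_path (fluid_path t) (at_right t)" if "0 \<le> t" for t
      by (rule lim[OF that]) auto
    show "\<exists>l. limitin State.mtopology fluid_path l (at_left t)" if "0 < t" for t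
      by (rule exI, rule lim) (use that in auto)
  qed
qed

end

end

section \<open>The fluid problem: solutions and uniqueness\<close>

text \<open>The fluid equation speaks of closed tails. If these are Lipschitz in \<open>y\<close>,
  there are no atoms, and open and closed tails agree.\<close>

lemma halfline_tail_open:
  assumes m: "m \<in> halfline_measures" and f: "\<And>y. 0 \<le> y \<Longrightarrow> measure m {y..} = f y"
    and L: "\<And>y y'. \<bar>f y - f y'\<bar> \<le> L * \<bar>y - y'\<bar>" and y: "0 \<le> y"
  shows "measure m {y<..} = f y"
proof (rule antisym)
  have "measure m {y<..} \<le> measure m {y..}" by (rule halfline_measure_mono[OF m]) auto
  then show "measure m {y<..} \<le> f y" using f[OF y] by simp
  have L0: "0 \<le> L" using L[of 0 1] by auto
  show "f y \<le> measure m {y<..}"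
  proof (rule field_le_epsilon)
    fix e :: real assume e: "0 < e"
    define h where "h = e / (L + 1)"
    have h: "0 < h" using e L0 by (simp add: h_def)
    have "f (y + h) = measure m {y + h..}" using f[of "y + h"] y h by simp
    also have "\<dots> \<le> measure m {y<..}" by (rule halfline_measure_mono[OF m]) (use h in auto)
    finally have "f (y + h) \<le> measure m {y<..}" .
    moreover have "\<bar>f y - f (y + h)\<bar> \<le> L * h" using L[of y "y + h"] h by simp
    moreover have "L * h \<le> e" using e L0 by (simp add: h_def field_simps)
    ultimately show "f y \<le> measure m {y<..} + e" by linarith
  qed
qed

lemma halfline_measure_eqI_tails:
  assumes m: "m \<in> halfline_measures" "m' \<in> halfline_measures"
    and f: "\<And>y. 0 \<le> y \<Longrightarrow> measure m {y..} = f y" "\<And>y. 0 \<le> y \<Longrightarrow> measure m' {y..} = f y"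
    and L: "\<And>y y'. \<bar>f y - f y'\<bar> \<le> L * \<bar>y - y'\<bar>"
  shows "m = m'"
proof (rule halfline_measure_eqI[OF m])
  fix y :: real assume y: "0 \<le> y"
  have "measure n {0..y} = f 0 - f y" if n: "n \<in> halfline_measures" "\<And>y. 0 \<le> y \<Longrightarrow> measure n {y..} = f y" for n
  proof -
    have "{0..} = {0..y} \<union> {y<..}" "{0..y} \<inter> {y<..} = {}" using y by auto
    then have "measure n {0..} = measure n {0..y} + measure n {y<..}"
      using finite_measure.finite_measure_Union[OF halfline_measures_finite[OF n(1)], of "{0..y}" "{y<..}"]
      by (simp add: halfline_measures_sets[OF n(1)])
    then show ?thesis using n(2)[of 0] halfline_tail_open[OF n L y] by simp
  qed
  then show "measure m {0..y} = measure m' {0..y}" using m f by simp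
qed

text \<open>The infimal convolution of the tail function with a linear function is Lipschitz for the Prohorov
  distance and increases to the mass of the open half-line.\<close>

definition tail_hull :: "nat \<Rightarrow> real measure \<Rightarrow> real" where
  "tail_hull j m = (INF h\<in>{0..}. measure m {h<..} + real j * h)"

lemma tail_hull_le: "0 \<le> h \<Longrightarrow> tail_hull j m \<le> measure m {h<..} + real j * h"
  unfolding tail_hull_def by (intro cINF_lower bdd_belowI[of _ 0]) auto

lemma tail_hull_close:
  assumes H: "m \<in> halfline_measures" "m' \<in> halfline_measures" and c: "prohorov_close m m' e" and e: "0 \<le> e"
  shows "tail_hull j m \<le> tail_hull j m' + (real j + 1) * e"
proof -
  have "tail_hull j m - (real j + 1) * e \<le> tail_hull j m'"
    unfolding tail_hull_def[of j m']
  proof (rule cINF_greatest)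
    fix h :: real assume h: "h \<in> {0..}"
    \<comment> \<open>Shifting the argument by \<open>e\<close> costs \<open>j * e\<close>, and
      passing from one measure to the other costs \<open>e\<close>.\<close>
    have "tail_hull j m \<le> measure m {h + e<..} + real j * (h + e)" using h e by (intro tail_hull_le) auto
    also have "measure m {h + e<..} \<le> measure m {h + e..}" by (rule halfline_measure_mono[OF H(1)]) auto
    also have "measure m {h + e..} \<le> measure m' {h<..} + e" using prohorov_close_tail_le[OF H c, of "h + e"] h e by simp
    finally show "tail_hull j m - (real j + 1) * e \<le> measure m' {h<..} + real j * h" by (simp add: algebra_simps)
  qed auto
  then show ?thesis by simp
qed

lemma tail_hull_lim:
  assumes m: "m \<in> halfline_measures"
  shows "(\<lambda>j. tail_hull j m) \<longlonglongrightarrow> measure m {0<..}"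
proof (rule LIMSEQ_I)
  fix e :: real assume e: "0 < e"
  have "(\<lambda>i. measure m {1 / real (Suc i)<..}) \<longlonglongrightarrow> measure m (\<Union>i. {1 / real (Suc i)<..})"
  proof (rule finite_measure.finite_Lim_measure_incseq[OF halfline_measures_finite[OF m]])
    show "incseq (\<lambda>i. {1 / real (Suc i)<..})"
      unfolding incseq_def by (auto simp: frac_le intro: le_less_trans[rotated])
  qed (auto simp: halfline_measures_sets[OF m])
  moreover have "(\<Union>i. {1 / real (Suc i)<..}) = {0<..}"
  proof (intro equalityI subsetI)
    fix x :: real assume "x \<in> {0<..}"
    then obtain i where "1 / real (Suc i) < x" using nat_approx_posE by (metis greaterThan_iff)
    then show "x \<in> (\<Union>i. {1 / real (Suc i)<..})" by auto
  qed (auto intro: less_trans[rotated])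
  ultimately have "\<forall>\<^sub>F i in sequentially. measure m {0<..} - e < measure m {1 / real (Suc i)<..}"
    by (intro order_tendstoD(1)[of _ "measure m {0<..}"]) (use e in auto)
  then obtain i where i: "measure m {0<..} - e < measure m {1 / real (Suc i)<..}"
    by (auto simp: eventually_sequentially)
  define d where "d = 1 / real (Suc i)"
  have d: "0 < d" by (simp add: d_def)
  obtain N :: nat where N: "measure m {0<..} / d \<le> real N" using real_arch_simple by blast
  show "\<exists>N. \<forall>j\<ge>N. norm (tail_hull j m - measure m {0<..}) < e"
  proof (intro exI[of _ N] allI impI)
    fix j assume j: "N \<le> j"
    have "measure m {0<..} \<le> real j * d"
    proof -
      have "measure m {0<..} / d \<le> real j" using N j by (meson of_nat_le_iff order_trans)
      then show ?thesis using d by (simp add: pos_divide_le_eq)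
    qed
    \<comment> \<open>For \<open>h \<ge> d\<close> the linear term alone reaches the mass of the
      open half-line, because \<open>j\<close> is large; for \<open>h < d\<close> the tail at
      \<open>h\<close> is at least the tail at \<open>d\<close>.\<close>
    have "min (measure m {0<..}) (measure m {d<..}) \<le> tail_hull j m"
      unfolding tail_hull_def
    proof (rule cINF_greatest)
      fix h :: real assume h: "h \<in> {0..}"
      show "min (measure m {0<..}) (measure m {d<..}) \<le> measure m {h<..} + real j * h"
      proof (cases "d \<le> h")
        case True
        then have "real j * d \<le> real j * h" by (intro mult_left_mono) auto
        then show ?thesis using \<open>measure m {0<..} \<le> real j * d\<close> measure_nonneg[of m "{h<..}"] by linarith
      next
        case False
        then have "measure m {d<..} \<le> measure m {h<..}" by (intro halfline_measure_mono[OF m]) auto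
        moreover have "0 \<le> real j * h" using h by simp
        ultimately show ?thesis by linarith
      qed
    qed auto
    moreover have "tail_hull j m \<le> measure m {0<..}" using tail_hull_le[of 0 j m] by simp
    ultimately show "norm (tail_hull j m - measure m {0<..}) < e" using i e unfolding d_def real_norm_def by linarith
  qed
qed

text \<open>Mass can slide into 0, so the mass of the open half-line is not continuous for the
  Prohorov distance, and the head count of a cadlag path need not be right continuous. It is a
  pointwise limit of the functions \<open>tail_hull\<close>, which are right continuous along the
  path.\<close>

lemma fluid_head_count_measurable:
  assumes z: "z \<in> cadlag_paths state_space state_dist"
  shows "(\<lambda>t. fluid_head_count z (max t 0)) \<in> borel_measurable borel"
    and "(\<lambda>t. snd (z (max t 0))) \<in> borel_measurable borel"
proof -
  have near: "\<forall>\<^sub>F s in at_right t. z s \<in> state_space \<and> state_dist (z s) (z t) < e" if "0 \<le> t" "0 < e" for t e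
    using z that unfolding cadlag_paths_def by (auto simp: State.limitin_metric)
  show m2: "(\<lambda>t. snd (z (max t 0))) \<in> borel_measurable borel"
  proof (rule right_continuous_measurable)
    fix t :: real assume t: "0 \<le> t"
    show "((\<lambda>t. snd (z t)) \<longlongrightarrow> snd (z t)) (at_right t)"
      unfolding tendsto_iff
    proof (intro allI impI)
      fix e :: real assume "0 < e"
      show "\<forall>\<^sub>F s in at_right t. dist (snd (z s)) (snd (z t)) < e"
        using near[OF t \<open>0 < e\<close>]
      proof eventually_elim
        case (elim s)
        then show ?case
          using state_dist_ge(2)[of "snd (z s)" "snd (z t)" "fst (z s)" "fst (z t)"] by (simp add: dist_real_def)
      qed
    qed
  qed
  have m1: "(\<lambda>t. tail_hull j (fst (z (max t 0)))) \<in> borel_measurable borel" for j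
  proof (rule right_continuous_measurable)
    fix t :: real assume t: "0 \<le> t"
    show "((\<lambda>t. tail_hull j (fst (z t))) \<longlongrightarrow> tail_hull j (fst (z t))) (at_right t)"
      unfolding tendsto_iff
    proof (intro allI impI)
      fix e :: real assume e: "0 < e"
      define c where "c = real j + 1"
      have c: "0 < c" by (simp add: c_def add_nonneg_pos)
      define d where "d = e / (2 * c)"
      have "0 < d" "c * d < e" using e c by (simp_all add: d_def)
      then have d: "0 < d" "(real j + 1) * d < e" by (simp_all add: c_def)
      show "\<forall>\<^sub>F s in at_right t. dist (tail_hull j (fst (z s))) (tail_hull j (fst (z t))) < e"
        using near[OF t d(1)]
      proof eventually_elim
        case (elim s)
        have zt: "z t \<in> state_space" by (rule State.cadlag_in[OF z t])
        have H: "fst (z s) \<in> halfline_measures" "fst (z t) \<in> halfline_measures"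
          using zt elim by (auto simp: state_space_def)
        have "prohorov_dist (fst (z s)) (fst (z t)) < d"
          using state_dist_ge(1)[of "fst (z s)" "fst (z t)" "snd (z s)" "snd (z t)"] elim
          unfolding prod.collapse by linarith
        then have "prohorov_close (fst (z s)) (fst (z t)) d" by (rule prohorov_dist_less[OF H])
        then show ?case
          using tail_hull_close[OF H, of d j] tail_hull_close[OF H(2,1), of d j] d prohorov_close_commute
          by (auto simp: dist_real_def abs_less_iff)
      qed
    qed
  qed
  have "(\<lambda>t. measure (fst (z (max t 0))) {0<..}) \<in> borel_measurable borel"
  proof (rule borel_measurable_LIMSEQ_real[OF _ m1])
    fix t :: real
    have "z (max t 0) \<in> state_space" using State.cadlag_in[OF z, of "max t 0"] by simp
    then have "fst (z (max t 0)) \<in> halfline_measures" by (auto simp: state_space_def)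
    then show "(\<lambda>j. tail_hull j (fst (z (max t 0)))) \<longlonglongrightarrow> measure (fst (z (max t 0))) {0<..}" by (rule tail_hull_lim)
  qed
  then show "(\<lambda>t. fluid_head_count z (max t 0)) \<in> borel_measurable borel"
    using m2 unfolding fluid_head_count_def by measurable
qed

text \<open>Ties the functions of \<open>fluid_data\<close>, which live on the whole line, to the
  given measures and to the given rate \<open>k0\<close>, of which only the values at nonnegative
  arguments are prescribed.\<close>

locale fluid_problem = fluid_data +
  fixes Z0 \<nu> :: "real measure" and k0 :: "real \<Rightarrow> real"
  assumes Z0: "Z0 \<in> halfline_measures" and Z0_tail: "\<And>y. 0 \<le> y \<Longrightarrow> measure Z0 {y..} = F y"
    and \<nu>_tail: "\<And>y. 0 \<le> y \<Longrightarrow> 1 - measure \<nu> {0..y} = G y"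
    and k0_eq: "\<And>y. 0 \<le> y \<Longrightarrow> k0 y = k y"
begin

lemma integral_singleton:
  fixes f :: "real \<Rightarrow> real" shows "(LINT u:{t}|lborel. f u) = 0"
  unfolding set_lebesgue_integral_def
proof (rule integral_eq_zero_AE)
  show "AE u in lborel. indicator {t} u *\<^sub>R f u = 0"
    using AE_lborel_singleton[of t] by eventually_elim simp
qed

lemma psi_0: "started x 0 = 0 \<Longrightarrow> psi x 0 y = F y"
  by (simp add: psi_def flow_def work_def integral_singleton)

lemma fluid_service_work:
  assumes "\<And>u. 0 \<le> u \<Longrightarrow> fluid_head_count z u = x u" "\<And>u. 0 \<le> u \<Longrightarrow> 0 \<le> x u" "0 \<le> s"
  shows "fluid_service k0 z s t = work (\<lambda>u. k (x u)) s t"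
  unfolding fluid_service_def work_def using assms k0_eq by (intro set_lebesgue_integral_cong) auto

text \<open>Stated for an arbitrary nondecreasing right-continuous \<open>B\<close>, so that it
  applies to both parts of a decomposition of the integrator.\<close>

lemma stieltjes_term:
  assumes x: "x \<in> borel_measurable borel" and B: "mono B" "\<And>s. continuous (at_right s) B"
    and t: "0 \<le> t" and y: "0 \<le> y"
    and f: "\<And>s. s \<in> {0..t} \<Longrightarrow> f s = G (y + work (\<lambda>u. k (x u)) s t)"
  shows "set_integrable (interval_measure B) {0<..t} f"
    and "(LINT s:{0<..t}|interval_measure B. f s) =
      G y * (B t - B 0) - (LINT u:{0..t}|lborel. g (y + work (\<lambda>u. k (x u)) u t) * k (x u) * (B u - B 0))"
proof -
  let ?h = "\<lambda>u. g (y + work (\<lambda>u. k (x u)) u t) * k (x u)"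
  note r = rate_k[OF x]
  note [measurable] = rateD(1)[OF r] work_measurable[OF r]
  have hm: "?h \<in> borel_measurable borel" by measurable
  have hb: "\<bar>?h u\<bar> \<le> Cg * K" for u
    using g0 gC k0 kK consts_nonneg by (auto simp: abs_mult abs_of_nonneg intro!: mult_mono)
  have f': "f s = G y - (LINT u:{s..t}|lborel. ?h u)" if "s \<in> {0..t}" for s
    using f[OF that] G_chain[OF r y, of s t] that by simp
  show "set_integrable (interval_measure B) {0<..t} f"
    by (rule interval_measure_integral_by_parts(1)[OF B t hm hb f'])
  show "(LINT s:{0<..t}|interval_measure B. f s) = G y * (B t - B 0) - (LINT u:{0..t}|lborel. ?h u * (B u - B 0))"
    by (rule interval_measure_integral_by_parts(2)[OF B t hm hb f'])
qed

lemma fluid_path_solution: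
  assumes x: "fluid_head x"
  shows "fluid_solution lam \<nu> k0 Z0 Q0 (fluid_path x)"
proof -
  let ?z = "fluid_path x"
  note hc = fluid_path_head_count[OF x] and tm = tail_measure[OF x] and xm = head_measurable[OF x]
  have snd: "snd (?z t) = max (x t - 1) 0" "fst (?z t) = tail_measure x t" if "0 \<le> t" for t
    using that by (simp_all add: fluid_path_def[OF x])
  have st: "lam * s - snd (?z s) = started x s - Q0" if "0 \<le> s" for s using snd[OF that] by (simp add: started_def)
  have "tail_measure x 0 = Z0"
    by (rule halfline_measure_eqI_tails[OF tm(1) Z0, of _ F LF])
      (use tm(4) psi_0[OF started_0[OF x]] Z0_tail FL in auto)
  moreover have "max (x 0 - 1) 0 = Q0" using started_0[OF x] by (simp add: started_def)
  ultimately have init: "?z 0 = (Z0, Q0)" by (simp add: fluid_path_def[OF x])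
  have lbv: "locally_bounded_variation (\<lambda>s. lam * s - snd (?z s))"
    unfolding locally_bounded_variation_def
  proof (intro allI impI exI)
    fix t :: real and m and s :: "nat \<Rightarrow> real" assume t: "0 \<le> t" and s: "mono_on {..m} s \<and> s ` {..m} \<subseteq> {0..t}"
    have r: "s i \<in> {0..t}" if "i \<le> m" for i using s that by auto
    \<comment> \<open>\<open>started\<close> is nondecreasing, so the variation telescopes.\<close>
    have "(\<Sum>i<m. \<bar>(lam * s (Suc i) - snd (?z (s (Suc i)))) - (lam * s i - snd (?z (s i)))\<bar>) =
        (\<Sum>i<m. started x (s (Suc i)) - started x (s i))"
    proof (rule sum.cong[OF refl])
      fix i assume i: "i \<in> {..<m}"
      have "s i \<le> s (Suc i)" using s i by (auto intro!: mono_onD[of "{..m}" s])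
      then have "started x (s i) \<le> started x (s (Suc i))"
        using r[of i] r[of "Suc i"] i by (intro mono_onD[OF started_mono[OF x]]) auto
      then show "\<bar>(lam * s (Suc i) - snd (?z (s (Suc i)))) - (lam * s i - snd (?z (s i)))\<bar> = started x (s (Suc i)) - started x (s i)"
        using st[of "s i"] st[of "s (Suc i)"] r[of i] r[of "Suc i"] i by auto
    qed
    also have "\<dots> = started x (s m) - started x (s 0)" by (rule sum_lessThan_telescope)
    also have "\<dots> \<le> started x t"
      using mono_onD[OF started_mono[OF x], of "s m" t] started_nonneg[OF x, of "s 0"] r[of m] r[of 0] t by auto
    finally show "(\<Sum>i<m. \<bar>(lam * s (Suc i) - snd (?z (s (Suc i)))) - (lam * s i - snd (?z (s i)))\<bar>) \<le> started x t" .
  qed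
  have eqn: "\<exists>I. has_stieltjes_integral (\<lambda>s. 1 - measure \<nu> {0 .. y + fluid_service k0 ?z s t}) (\<lambda>s. lam * s - snd (?z s)) 0 t I \<and>
      measure (fst (?z t)) {y..} = measure Z0 {y + fluid_service k0 ?z 0 t ..} + I" if t: "0 \<le> t" and y: "0 \<le> y" for t y
  proof -
    let ?\<kappa> = "\<lambda>u. k (x u)"
    have fs: "fluid_service k0 ?z s t = work ?\<kappa> s t" if "0 \<le> s" for s
      by (rule fluid_service_work[OF hc head_nonneg[OF x] that])
    have w0: "0 \<le> work ?\<kappa> s t" for s by (rule work_nonneg[OF rate_k[OF xm]])
    have f: "1 - measure \<nu> {0 .. y + fluid_service k0 ?z s t} = G (y + work ?\<kappa> s t)" if "s \<in> {0..t}" for s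
      using fs[of s] \<nu>_tail[of "y + work ?\<kappa> s t"] w0[of s] that y by simp
    \<comment> \<open>The integrator on \<open>[0, t]\<close>, continued by constants:
      \<open>interval_measure\<close> is built from a function that is nondecreasing and right
      continuous on the whole line.\<close>
    define B where "B s = started x (max 0 (min s t)) - Q0" for s
    have B0: "B 0 = - Q0" "B t = started x t - Q0" using t started_0[OF x] by (simp_all add: B_def)
    have monoB: "mono B"
    proof (rule monoI)
      fix a b :: real assume "a \<le> b"
      then have "started x (max 0 (min a t)) \<le> started x (max 0 (min b t))"
        by (intro mono_onD[OF started_mono[OF x]]) auto
      then show "B a \<le> B b" by (simp add: B_def)
    qed
    obtain L where L: "0 \<le> L" "\<And>s s'. 0 \<le> s \<Longrightarrow> s \<le> s' \<Longrightarrow> s' \<le> t \<Longrightarrow> \<bar>x s - x s'\<bar> \<le> L * (s' - s)"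
      using head_time_Lipschitz[OF x, of t] by metis
    have Lx: "\<bar>B a - B b\<bar> \<le> (lam + L) * \<bar>a - b\<bar>" for a b
    proof -
      have le: "\<bar>B a - B b\<bar> \<le> (lam + L) * (b - a)" if ab: "a \<le> b" for a b
      proof -
        define a' b' where "a' = max 0 (min a t)" and "b' = max 0 (min b t)"
        have ab': "0 \<le> a'" "a' \<le> b'" "b' \<le> t" "b' - a' \<le> b - a" using t ab unfolding a'_def b'_def by linarith+
        have "\<bar>max (x a' - 1) 0 - max (x b' - 1) 0\<bar> \<le> \<bar>x a' - x b'\<bar>" by auto
        moreover have "\<bar>x a' - x b'\<bar> \<le> L * (b' - a')" by (rule L(2)[OF ab'(1-3)])
        moreover have "\<bar>lam * a' - lam * b'\<bar> = lam * (b' - a')"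
          using mult_left_mono[OF ab'(2) lam0] by (simp add: right_diff_distrib)
        moreover have "(lam + L) * (b' - a') \<le> (lam + L) * (b - a)" using ab' L(1) lam0 by (intro mult_left_mono) auto
        moreover have "(lam + L) * (b' - a') = lam * (b' - a') + L * (b' - a')" by (rule distrib_right)
        ultimately show ?thesis unfolding B_def started_def a'_def[symmetric] b'_def[symmetric] by linarith
      qed
      show ?thesis
      proof (cases "a \<le> b")
        case True then show ?thesis using le[of a b] by simp
      next
        case False then show ?thesis using le[of b a] by (subst abs_minus_commute) simp
      qed
    qed
    have "continuous_on UNIV B"
      by (rule lipschitz_on_continuous_on[of "lam + L"], rule lipschitz_onI) (use Lx L(1) lam0 in \<open>auto simp: dist_real_def\<close>)
    then have contB: "continuous (at_right s) B" for s
      by (auto simp: continuous_on_eq_continuous_at intro: continuous_within_subset)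
    let ?f = "\<lambda>s. 1 - measure \<nu> {0 .. y + fluid_service k0 ?z s t}"
    define I where "I = (LINT s:{0<..t}|interval_measure B. ?f s)"
    \<comment> \<open>The integrator is itself nondecreasing, so it is decomposed as
      \<open>B - 0\<close>.\<close>
    have "has_stieltjes_integral ?f (\<lambda>s. lam * s - snd (?z s)) 0 t I"
      unfolding has_stieltjes_integral_def
    proof (rule exI[of _ B], rule exI[of _ "\<lambda>_. 0"], intro conjI allI ballI)
      show "set_integrable (interval_measure B) {0<..t} ?f"
        by (rule stieltjes_term(1)[OF xm monoB contB t y f])
      show "set_integrable (interval_measure (\<lambda>_. 0)) {0<..t} ?f"
        by (rule stieltjes_term(1)[OF xm _ _ t y f]) (auto simp: mono_def)
      have "(LINT s:{0<..t}|interval_measure (\<lambda>_. 0). ?f s) = 0"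
        by (subst stieltjes_term(2)[OF xm _ _ t y f]) (auto simp: mono_def set_lebesgue_integral_def)
      then show "I = (LINT s:{0<..t}|interval_measure B. ?f s) - (LINT s:{0<..t}|interval_measure (\<lambda>_. 0). ?f s)"
        by (simp add: I_def)
      show "lam * s - snd (?z s) = B s - 0" if "s \<in> {0..t}" for s
        using that st[of s] by (simp add: B_def)
    qed (use monoB contB in \<open>auto simp: mono_def\<close>)
    moreover have "measure (fst (?z t)) {y..} = measure Z0 {y + fluid_service k0 ?z 0 t ..} + I"
    proof -
      have "I = G y * started x t - (LINT u:{0..t}|lborel. g (y + work ?\<kappa> u t) * k (x u) * (B u - B 0))"
        unfolding I_def using stieltjes_term(2)[OF xm monoB contB t y f] B0 by simp
      also have "(LINT u:{0..t}|lborel. g (y + work ?\<kappa> u t) * k (x u) * (B u - B 0)) =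
          (LINT u:{0..t}|lborel. started x u * g (y + work ?\<kappa> u t) * k (x u))"
        using B0 by (intro set_lebesgue_integral_cong) (auto simp: B_def)
      finally have "F (y + work ?\<kappa> 0 t) + I = psi x t y" by (simp add: psi_def flow_def)
      then show ?thesis using tm(4)[OF t y] snd[OF t] Z0_tail[of "y + work ?\<kappa> 0 t"] w0[of 0] y fs[of 0] by simp
    qed
    ultimately show ?thesis by blast
  qed
  show ?thesis
    unfolding fluid_solution_def
    using fluid_path_cadlag[OF x] init lbv eqn snd(1) hc by auto
qed

text \<open>Integration by parts, applied to whatever decomposition the solution comes with, shows
  that its head count satisfies the Volterra equation exactly. The stability estimate with error 0
  identifies the head count, and the tails then determine the measures.\<close>

lemma fluid_solution_unique:
  assumes x: "fluid_head x" and z: "fluid_solution lam \<nu> k0 Z0 Q0 z"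
  shows "z = fluid_path x"
proof -
  have zc: "z \<in> cadlag_paths state_space state_dist" and z0: "z 0 = (Z0, Q0)"
    and q: "\<And>t. 0 \<le> t \<Longrightarrow> snd (z t) = max (fluid_head_count z t - 1) 0"
    and lbv: "locally_bounded_variation (\<lambda>s. lam * s - snd (z s))"
    using z by (auto simp: fluid_solution_def)
  define X where "X t = fluid_head_count z (max t 0)" for t
  have zs: "fst (z t) \<in> halfline_measures" "0 \<le> snd (z t)" if "0 \<le> t" for t
    using State.cadlag_in[OF zc that] by (auto simp: state_space_def)
  have Xm: "X \<in> borel_measurable borel" unfolding X_def[abs_def] by (rule fluid_head_count_measurable[OF zc])
  have X: "fluid_head_count z t = X t" if "0 \<le> t" for t using that by (simp add: X_def max_def)
  have X0: "0 \<le> X t" if "0 \<le> t" for t using zs[OF that] X[OF that] by (simp add: fluid_head_count_def flip: X[OF that])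
  have qX: "snd (z t) = max (X t - 1) 0" if "0 \<le> t" for t using q[OF that] X[OF that] by simp
  have sX: "lam * t - snd (z t) + Q0 = started X t" if "0 \<le> t" for t using qX[OF that] by (simp add: started_def)
  \<comment> \<open>The stability estimate needs locally bounded head counts. The variation over the
    partition consisting of 0 and \<open>t\<close> bounds the queue, and the head count exceeds the
    queue by at most 1.\<close>
  have bdd: "\<exists>M. bounded_borel_upto T M X" if T: "0 \<le> T" for T
  proof -
    obtain C where C: "\<And>m (s :: nat \<Rightarrow> real). mono_on {..m} s \<and> s ` {..m} \<subseteq> {0..T} \<Longrightarrow>
        (\<Sum>i<m. \<bar>(lam * s (Suc i) - snd (z (s (Suc i)))) - (lam * s i - snd (z (s i)))\<bar>) \<le> C"
      using lbv T unfolding locally_bounded_variation_def by blast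
    have "\<bar>X t\<bar> \<le> C + lam * T + Q0 + 1" if t: "t \<in> {0..T}" for t
    proof -
      have "\<bar>(lam * t - snd (z t)) - (lam * 0 - snd (z 0))\<bar> \<le> C"
      proof -
        have "mono_on {..1} (\<lambda>i::nat. if i = 0 then 0 else t) \<and> (\<lambda>i::nat. if i = 0 then 0 else t) ` {..1} \<subseteq> {0..T}"
          using t by (auto simp: mono_on_def)
        from C[OF this] show ?thesis by simp
      qed
      moreover have "lam * t \<le> lam * T" using t lam0 by (intro mult_left_mono) auto
      ultimately have "snd (z t) \<le> C + lam * T + Q0" using z0 by simp
      then show ?thesis using qX[of t] X0[of t] t by auto
    qed
    then show ?thesis using Xm unfolding bounded_borel_upto_def by blast
  qed
  have tail: "measure (fst (z t)) {y..} = psi X t y" if t: "0 \<le> t" and y: "0 \<le> y" for t y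
  proof -
    let ?\<kappa> = "\<lambda>u. k (X u)"
    let ?h = "\<lambda>u. g (y + work ?\<kappa> u t) * k (X u)"
    have fs: "fluid_service k0 z s t = work ?\<kappa> s t" if "0 \<le> s" for s
      by (rule fluid_service_work[OF X X0 that])
    have w0: "0 \<le> work ?\<kappa> s t" for s by (rule work_nonneg[OF rate_k[OF Xm]])
    have f: "1 - measure \<nu> {0 .. y + fluid_service k0 z s t} = G (y + work ?\<kappa> s t)" if "s \<in> {0..t}" for s
      using fs[of s] \<nu>_tail[of "y + work ?\<kappa> s t"] w0[of s] that y by simp
    obtain I where I: "has_stieltjes_integral (\<lambda>s. 1 - measure \<nu> {0 .. y + fluid_service k0 z s t}) (\<lambda>s. lam * s - snd (z s)) 0 t I"
      "measure (fst (z t)) {y..} = measure Z0 {y + fluid_service k0 z 0 t ..} + I"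
      using z t y unfolding fluid_solution_def by blast
    obtain B1 B2 where B: "mono B1" "\<And>s. continuous (at_right s) B1" "mono B2" "\<And>s. continuous (at_right s) B2"
      "\<And>s. s \<in> {0..t} \<Longrightarrow> lam * s - snd (z s) = B1 s - B2 s"
      "I = (LINT s:{0<..t}|interval_measure B1. 1 - measure \<nu> {0 .. y + fluid_service k0 z s t})
        - (LINT s:{0<..t}|interval_measure B2. 1 - measure \<nu> {0 .. y + fluid_service k0 z s t})"
      using I(1) unfolding has_stieltjes_integral_def by blast
    note [measurable] = work_measurable[OF rate_k[OF Xm]] Xm borel_measurable_mono[OF B(1)] borel_measurable_mono[OF B(3)]
    have hb: "\<bar>?h u\<bar> \<le> Cg * K" for u
      using g0 gC k0 kK consts_nonneg by (auto simp: abs_mult abs_of_nonneg intro!: mult_mono)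
    have int: "set_integrable lborel {0..t} (\<lambda>u. ?h u * (B u - B 0))" if "mono B" for B
    proof (rule bounded_borel_set_integrable[of _ _ _ "Cg * K * (B t - B 0)"])
      note [measurable] = borel_measurable_mono[OF that]
      show "(\<lambda>u. ?h u * (B u - B 0)) \<in> borel_measurable borel" by measurable
      fix u assume u: "u \<in> {0..t}"
      then have "0 \<le> B u - B 0" "B u - B 0 \<le> B t - B 0" using monoD[OF that, of 0 u] monoD[OF that, of u t] by auto
      then have "\<bar>?h u\<bar> * (B u - B 0) \<le> Cg * K * (B t - B 0)" using hb[of u] consts_nonneg by (intro mult_mono) auto
      then show "\<bar>?h u * (B u - B 0)\<bar> \<le> Cg * K * (B t - B 0)" using \<open>0 \<le> B u - B 0\<close> by (simp add: abs_mult)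
    qed
    \<comment> \<open>The decomposition is not unique; only this difference of increments survives
      in the final formula.\<close>
    have Bd: "(B1 u - B1 0) - (B2 u - B2 0) = started X u" if "u \<in> {0..t}" for u
      using B(5)[OF that] B(5)[of 0] sX[of u] sX[of 0] z0 t that by simp
    have "I = G y * (B1 t - B1 0) - (LINT u:{0..t}|lborel. ?h u * (B1 u - B1 0)) -
        (G y * (B2 t - B2 0) - (LINT u:{0..t}|lborel. ?h u * (B2 u - B2 0)))"
      using B(6) stieltjes_term(2)[OF Xm B(1,2) t y f] stieltjes_term(2)[OF Xm B(3,4) t y f] by linarith
    also have "\<dots> = G y * ((B1 t - B1 0) - (B2 t - B2 0)) -
        (LINT u:{0..t}|lborel. ?h u * (B1 u - B1 0) - ?h u * (B2 u - B2 0))"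
      by (subst set_integral_diff(2)[OF int[OF B(1)] int[OF B(3)]]) (simp add: right_diff_distrib)
    also have "(LINT u:{0..t}|lborel. ?h u * (B1 u - B1 0) - ?h u * (B2 u - B2 0)) =
        (LINT u:{0..t}|lborel. started X u * g (y + work ?\<kappa> u t) * k (X u))"
    proof (rule set_lebesgue_integral_cong, simp, intro allI impI)
      fix u assume u: "u \<in> {0..t}"
      have "?h u * (B1 u - B1 0) - ?h u * (B2 u - B2 0) = ?h u * ((B1 u - B1 0) - (B2 u - B2 0))"
        by (rule right_diff_distrib[symmetric])
      also have "\<dots> = ?h u * started X u" by (simp only: Bd[OF u])
      finally show "?h u * (B1 u - B1 0) - ?h u * (B2 u - B2 0) = started X u * g (y + work ?\<kappa> u t) * k (X u)"
        by (simp only: mult_ac)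
    qed
    finally have "F (y + work ?\<kappa> 0 t) + I = psi X t y" using Bd[of t] t by (simp add: psi_def flow_def)
    then show ?thesis using I(2) fs[of 0] Z0_tail[of "y + work ?\<kappa> 0 t"] w0[of 0] y by simp
  qed
  \<comment> \<open>The head count involves the open tail at 0, the equation gives the closed one;
    they agree since \<open>psi\<close> is Lipschitz in \<open>y\<close>.\<close>
  have open_tail: "measure (fst (z t)) {0<..} = psi X t 0" if t: "0 \<le> t" for t
  proof -
    obtain M where M: "bounded_borel_upto t M X" using bdd[OF t] by blast
    define N where "N = lam * t + Q0 + M + 1"
    have D: "bounded_borel_upto t N (started X)" unfolding N_def by (rule started_bounded[OF M t])
    have b: "\<bar>started X t\<bar> \<le> N" by (rule bounded_borel_upto_bound[OF D t order_refl])
    show ?thesis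
    proof (rule halfline_tail_open[OF zs(1)[OF t] tail[OF t]])
      fix y y'
      have "\<bar>G y - G y'\<bar> * \<bar>started X t\<bar> \<le> (Cg * \<bar>y - y'\<bar>) * N"
        using GC[of y y'] b consts_nonneg by (intro mult_mono) auto
      then have "\<bar>G y * started X t - G y' * started X t\<bar> \<le> Cg * N * \<bar>y - y'\<bar>"
        by (simp add: abs_mult mult_ac flip: left_diff_distrib)
      then show "\<bar>psi X t y - psi X t y'\<bar> \<le> (LF + N * Lg * K * t + Cg * N) * \<bar>y - y'\<bar>"
        using flow_Lipschitz[OF D rate_k[OF Xm] t order_refl, of y y'] unfolding psi_def distrib_right by linarith
    qed simp_all
  qed
  have eqn: "X t = flow (started X) (\<lambda>u. k (X u)) t 0 + lam * t + Q0" if t: "0 \<le> t" for t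
    using open_tail[OF t] X[OF t] qX[OF t] G_0 by (simp add: fluid_head_count_def psi_def started_def)
  have same: "X t = x t" if t: "0 \<le> t" for t
  proof -
    obtain M where M: "bounded_borel_upto t M X" using bdd[OF t] by blast
    let ?M = "max M (lam * t + Q0 + 3)"
    have b: "bounded_borel_upto t ?M X" "bounded_borel_upto t ?M x"
      using M fluid_head_bounded[OF x, of t] by (force simp: bounded_borel_upto_def)+
    have "near_solution t 0 X" unfolding near_solution_def using eqn by simp
    then have "\<bar>X t - x t\<bar> \<le> 2 * (0 + 0) * exp (2 * stability_const t ?M * t)"
      by (rule near_solutions_close[OF b _ fluid_head_near[OF x] t order_refl])
    then show ?thesis by simp
  qed
  show ?thesis
  proof
    fix t
    show "z t = fluid_path x t"
    proof (cases "0 \<le> t")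
      case False
      then show ?thesis using zc by (auto simp: cadlag_paths_def fluid_path_def[OF x] PiE_def extensional_def)
    next
      case t: True
      have "started X u = started x u" if "0 \<le> u" for u using same[OF that] by (simp add: started_def)
      then have psi_eq: "psi X t y = psi x t y" for y
        unfolding psi_def using same t by (intro arg_cong2[where f = "(+)"] flow_cong) auto
      have "fst (z t) = tail_measure x t"
        by (rule halfline_measure_eqI_tails[OF zs(1)[OF t] tail_measure(1)[OF x t] _ _ psi_Lipschitz[OF x t]])
          (use tail[OF t] tail_measure(4)[OF x t] psi_eq in auto)
      then show ?thesis using qX[OF t] same[OF t] t by (simp add: fluid_path_def[OF x] prod_eq_iff)
    qed
  qed
qed

end

section \<open>Uniform laws of large numbers\<close>

text \<open>All sums start just above \<open>- N\<close>, so the union bound has only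
  \<open>2 * N + 1\<close> events per threshold; sums over other intervals are differences of two
  such sums.\<close>

lemma (in prob_space) empirical_tail_deviation:
  fixes v :: "int \<Rightarrow> 'a \<Rightarrow> real"
  assumes indep: "indep_vars (\<lambda>_. borel) v UNIV" and law: "\<And>i. distr M borel (v i) = \<nu>"
    and Y: "finite Y" and N: "0 < N" and c: "0 < c"
  defines "bad \<equiv> {\<omega> \<in> space M. \<exists>y\<in>Y. \<exists>b\<in>{- int N..int N}.
    c \<le> \<bar>(\<Sum>i\<in>{- int N<..b}. indicator {y<..} (v i \<omega>)) - of_int (b + int N) * measure \<nu> {y<..}\<bar>}"
  shows "bad \<in> events" "prob bad \<le> real (card Y) * (2 * real N + 1) * (2 * exp (- (c\<^sup>2 / real N)))"
proof -
  have vm [measurable]: "v i \<in> borel_measurable M" for i using indep unfolding indep_vars_def by auto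
  define A where "A y b = {\<omega> \<in> space M. c \<le> \<bar>(\<Sum>i\<in>{- int N<..b}. indicator {y<..} (v i \<omega>)) - of_int (b + int N) * measure \<nu> {y<..}\<bar>}" for y b
  have Am: "A y b \<in> events" for y b unfolding A_def by measurable
  have bad: "bad = (\<Union>y\<in>Y. \<Union>b\<in>{- int N..int N}. A y b)" by (auto simp: bad_def A_def)
  show "bad \<in> events" unfolding bad by (intro sets.finite_UN Y Am) auto
  have pA: "prob (A y b) \<le> 2 * exp (- (c\<^sup>2 / real N))" if b: "b \<in> {- int N..int N}" for y b
  proof (cases "b = - int N")
    case True
    \<comment> \<open>The empty sum has deviation 0, while Hoeffding's inequality would divide by
      the number of terms.\<close>
    then have "A y b = {}" using c by (auto simp: A_def)
    then show ?thesis by simp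
  next
    case False
    let ?I = "{- int N<..b}"
    let ?X = "\<lambda>i \<omega>. indicator {y<..} (v i \<omega>) :: real"
    have "indep_vars (\<lambda>_. borel) ?X UNIV" by (rule indep_vars_compose2[OF indep]) measurable
    then have ind: "indep_vars (\<lambda>_. borel) ?X ?I" by (rule indep_vars_subset) auto
    interpret H: Hoeffding_ineq M ?I ?X "\<lambda>_. 0" "\<lambda>_. 1" "\<Sum>i\<in>?I. expectation (?X i)"
      by unfold_locales (use ind in \<open>auto simp: indicator_def\<close>)
    have ex: "expectation (?X i) = measure \<nu> {y<..}" for i
    proof -
      have "expectation (?X i) = (\<integral>x. indicator {y<..} x \<partial>distr M borel (v i))"
        by (subst integral_distr) auto
      then show ?thesis using law[of i] by (metis (no_types) integral_indicator_finite_real law real_scaleR_def scaleR_one Bochner_Integration.integral_indicator[of \<nu> "{y<..}"] sets_distr inf_top_right space_distr space_borel)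
    qed
    have card: "real (card ?I) = of_int (b + int N)" using b by auto
    have pos: "0 < real (card ?I)" using b False by auto
    have le: "real (card ?I) \<le> 2 * real N" using b by auto
    have "prob {\<omega> \<in> space M. \<bar>(\<Sum>i\<in>?I. ?X i \<omega>) - (\<Sum>i\<in>?I. expectation (?X i))\<bar> \<ge> c} \<le>
        2 * exp (- 2 * c\<^sup>2 / (\<Sum>i\<in>?I. ((1::real) - 0)\<^sup>2))"
      by (rule H.Hoeffding_ineq_abs_ge) (use c pos in auto)
    also have "{\<omega> \<in> space M. \<bar>(\<Sum>i\<in>?I. ?X i \<omega>) - (\<Sum>i\<in>?I. expectation (?X i))\<bar> \<ge> c} = A y b"
      unfolding A_def ex using card by simp
    also have "- 2 * c\<^sup>2 / (\<Sum>i\<in>?I. ((1::real) - 0)\<^sup>2) = - (2 * c\<^sup>2 / real (card ?I))" by simp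
    \<comment> \<open>There are at most \<open>2 * N\<close> terms, which gives an exponent
      independent of \<open>b\<close>.\<close>
    also have "2 * exp (- (2 * c\<^sup>2 / real (card ?I))) \<le> 2 * exp (- (c\<^sup>2 / real N))"
    proof -
      have "2 * c\<^sup>2 / (2 * real N) \<le> 2 * c\<^sup>2 / real (card ?I)" using le pos by (intro divide_left_mono) auto
      then show ?thesis by simp
    qed
    finally show ?thesis .
  qed
  have "prob bad \<le> (\<Sum>y\<in>Y. prob (\<Union>b\<in>{- int N..int N}. A y b))"
    unfolding bad by (rule finite_measure_subadditive_finite[OF Y]) (auto intro!: sets.finite_UN Am)
  also have "\<dots> \<le> (\<Sum>y\<in>Y. \<Sum>b\<in>{- int N..int N}. prob (A y b))"
    by (intro sum_mono finite_measure_subadditive_finite) (auto intro: Am)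
  also have "\<dots> \<le> (\<Sum>y\<in>Y. \<Sum>b\<in>{- int N..int N}. 2 * exp (- (c\<^sup>2 / real N)))"
    by (intro sum_mono pA)
  also have "\<dots> = real (card Y) * (2 * real N + 1) * (2 * exp (- (c\<^sup>2 / real N)))" by simp
  finally show "prob bad \<le> real (card Y) * (2 * real N + 1) * (2 * exp (- (c\<^sup>2 / real N)))" .
qed

text \<open>A deviation of \<open>e * n\<close> among \<open>L * n\<close> customers has an exponent
  linear in \<open>n\<close>, which beats the linearly growing number of events.\<close>

lemma deviation_bound_lim:
  fixes L :: nat
  assumes "0 < L" "0 < e"
  shows "(\<lambda>n. C * (2 * real (L * n) + 1) * (2 * exp (- ((e * real n)\<^sup>2 / real (L * n))))) \<longlonglongrightarrow> 0"
proof -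
  define r where "r = e\<^sup>2 / real L"
  have r: "0 < r" using assms by (simp add: r_def)
  have p: "(\<lambda>n. real n * exp (- r) ^ n) \<longlonglongrightarrow> 0"
    using powser_times_n_limit_0[of "exp (- r)"] r by simp
  have q: "(\<lambda>n. exp (- r) ^ n) \<longlonglongrightarrow> 0" by (rule LIMSEQ_realpow_zero) (use r in auto)
  have "(\<lambda>n. 4 * C * real L * (real n * exp (- r) ^ n) + 2 * C * exp (- r) ^ n) \<longlonglongrightarrow> 4 * C * real L * 0 + 2 * C * 0"
    by (intro tendsto_intros p q)
  moreover have "C * (2 * real (L * n) + 1) * (2 * exp (- ((e * real n)\<^sup>2 / real (L * n)))) =
      4 * C * real L * (real n * exp (- r) ^ n) + 2 * C * exp (- r) ^ n" for n
  proof -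
    have "(e * real n)\<^sup>2 / real (L * n) = real n * r" using assms by (simp add: r_def power2_eq_square field_simps)
    then have "exp (- ((e * real n)\<^sup>2 / real (L * n))) = exp (- r) ^ n" by (simp flip: exp_of_nat_mult)
    then show ?thesis by (simp add: algebra_simps)
  qed
  ultimately show ?thesis by simp
qed

context fluid_data
begin

text \<open>The thresholds bracket every \<open>y\<close> so tightly that \<open>G\<close> changes
  by at most \<open>e\<close>. Above the largest one there is no upper neighbour, but there
  \<open>G\<close> itself is at most \<open>e\<close>.\<close>

lemma tail_thresholds:
  assumes e: "0 < e"
  obtains Y where "finite Y" "\<And>y. 0 \<le> y \<Longrightarrow> \<exists>y1\<in>Y. y1 \<le> y \<and> G y1 \<le> G y + e"
    "\<And>y. 0 \<le> y \<Longrightarrow> G y \<le> e \<or> (\<exists>y2\<in>Y. y \<le> y2 \<and> G y \<le> G y2 + e)"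
proof -
  have "\<forall>\<^sub>F y in at_top. G y < e" by (rule order_tendstoD(2)[OF G_lim e])
  then obtain y0 where y0: "\<And>y. y0 \<le> y \<Longrightarrow> G y < e" by (auto simp: eventually_at_top_linorder)
  \<comment> \<open>A mesh across which the Lipschitz function \<open>G\<close> varies by at most
    \<open>e\<close>; the added 1 keeps the denominator positive.\<close>
  define h where "h = e / (Cg + 1)"
  have h: "0 < h" "Cg * h \<le> e" using e consts_nonneg by (auto simp: h_def field_simps)
  obtain J :: nat where J: "y0 / h \<le> real J" using real_arch_simple by blast
  have Jy: "y0 \<le> real J * h" using J h by (simp add: field_simps)
  define Y where "Y = (\<lambda>j. real j * h) ` {..J}"
  have near: "G a \<le> G b + e" if "\<bar>a - b\<bar> \<le> h" for a b
  proof -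
    have "Cg * \<bar>a - b\<bar> \<le> Cg * h" using that consts_nonneg by (intro mult_left_mono) auto
    then show ?thesis using GC[of a b] h by linarith
  qed
  have cell: "\<exists>j<J. real j * h \<le> y \<and> y < real (Suc j) * h" if y: "0 \<le> y" "y < real J * h" for y
  proof -
    define j where "j = nat \<lfloor>y / h\<rfloor>"
    have "0 \<le> y / h" using y h by simp
    then have j: "real j \<le> y / h" "y / h < real j + 1" unfolding j_def by linarith+
    then have jj: "real j * h \<le> y" "y < (real j + 1) * h" using h by (auto simp: field_simps)
    then have "real j * h < real J * h" using y by linarith
    then have "j < J" using h by simp
    then show ?thesis using jj by (auto simp: add.commute)
  qed
  show thesis
  proof (rule that[of Y])
    fix y :: real assume y: "0 \<le> y"
    show "\<exists>y1\<in>Y. y1 \<le> y \<and> G y1 \<le> G y + e"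
    proof (cases "y < real J * h")
      case True
      then obtain j where j: "j < J" "real j * h \<le> y" "y < real (Suc j) * h" using cell[OF y] by auto
      then have "\<bar>real j * h - y\<bar> \<le> h" by (auto simp: distrib_right)
      then show ?thesis using near[of "real j * h" y] j by (auto simp: Y_def intro!: bexI[of _ "real j * h"])
    next
      case False
      then have "real J * h \<in> Y \<and> real J * h \<le> y \<and> G (real J * h) \<le> G y + e"
        using y0[OF Jy] G_range(1)[of y] unfolding Y_def by auto
      then show ?thesis by blast
    qed
    show "G y \<le> e \<or> (\<exists>y2\<in>Y. y \<le> y2 \<and> G y \<le> G y2 + e)"
    proof (cases "y < real J * h")
      case True
      then obtain j where j: "j < J" "real j * h \<le> y" "y < real (Suc j) * h" using cell[OF y] by auto
      then have "\<bar>y - real (Suc j) * h\<bar> \<le> h" by (auto simp: distrib_right)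
      moreover have "real (Suc j) * h \<in> Y" unfolding Y_def by (rule image_eqI[of _ _ "Suc j"]) (use j in auto)
      ultimately have "real (Suc j) * h \<in> Y \<and> y \<le> real (Suc j) * h \<and> G y \<le> G (real (Suc j) * h) + e"
        using near[of y "real (Suc j) * h"] j by auto
      then show ?thesis by blast
    next
      case False
      then have "y0 \<le> y" using Jy by linarith
      then show ?thesis using y0 by (auto intro: less_imp_le)
    qed
  qed (simp add: Y_def)
qed

text \<open>Monotonicity in the threshold extends the deviation bound from finitely many thresholds to all.\<close>

lemma uniform_tail_deviation:
  fixes v :: "int \<Rightarrow> real"
  assumes Y1: "\<And>y. 0 \<le> y \<Longrightarrow> \<exists>y1\<in>Y. y1 \<le> y \<and> G y1 \<le> G y + e"
    and Y2: "\<And>y. 0 \<le> y \<Longrightarrow> G y \<le> e \<or> (\<exists>y2\<in>Y. y \<le> y2 \<and> G y \<le> G y2 + e)"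
    and p: "\<And>y. y \<in> Y \<Longrightarrow> \<bar>p y - G y\<bar> \<le> e"
    and dev: "\<And>y b. y \<in> Y \<Longrightarrow> b \<in> {- int N..int N} \<Longrightarrow>
      \<bar>(\<Sum>i\<in>{- int N<..b}. indicator {y<..} (v i)) - of_int (b + int N) * p y\<bar> < c"
    and ab: "- int N \<le> a" "a \<le> b" "b \<le> int N" and y: "0 \<le> y" and e: "0 \<le> e"
  shows "\<bar>(\<Sum>i\<in>{a<..b}. indicator {y<..} (v i)) - of_int (b - a) * G y\<bar> \<le> 2 * c + 4 * real N * e"
proof -
  have c: "0 < c" using Y1[of 0] dev[of _ a] ab by force
  \<comment> \<open>The interval from \<open>a\<close> to \<open>b\<close> is a difference of two
    intervals starting at \<open>- N\<close>, hence \<open>2 * c\<close>.\<close>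
  have D: "\<bar>(\<Sum>i\<in>{a<..b}. indicator {z<..} (v i)) - of_int (b - a) * p z\<bar> \<le> 2 * c" if z: "z \<in> Y" for z
  proof -
    have "{- int N<..b} = {- int N<..a} \<union> {a<..b}" using ab by auto
    moreover have "(\<Sum>i\<in>{- int N<..a} \<union> {a<..b}. indicator {z<..} (v i)) =
        (\<Sum>i\<in>{- int N<..a}. indicator {z<..} (v i)) + (\<Sum>i\<in>{a<..b}. indicator {z<..} (v i) :: real)"
      by (rule sum.union_disjoint) auto
    ultimately have "(\<Sum>i\<in>{- int N<..b}. indicator {z<..} (v i)) =
        (\<Sum>i\<in>{- int N<..a}. indicator {z<..} (v i)) + (\<Sum>i\<in>{a<..b}. indicator {z<..} (v i) :: real)" by simp
    moreover have "of_int (b + int N) * p z = of_int (a + int N) * p z + of_int (b - a) * p z"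
      by (simp add: algebra_simps)
    ultimately show ?thesis using dev[OF z, of a] dev[OF z, of b] ab by auto
  qed
  define l where "l = real_of_int (b - a)"
  have l: "0 \<le> l" "l \<le> 2 * real N" using ab by (auto simp: l_def)
  have D': "\<bar>(\<Sum>i\<in>{a<..b}. indicator {z<..} (v i)) - l * p z\<bar> \<le> 2 * c" if "z \<in> Y" for z
    unfolding l_def by (rule D[OF that])
  \<comment> \<open>The interval has at most \<open>2 * N\<close> elements, each contributing an
    error \<open>2 * e\<close>: one \<open>e\<close> for moving to a threshold and one for replacing
    \<open>p\<close> by \<open>G\<close>.\<close>
  have e4: "2 * real N * (2 * e) = 4 * real N * e" by simp
  have le: "l * u \<le> 2 * real N * u" if "0 \<le> u" for u using l that by (intro mult_right_mono) auto
  obtain y1 where y1: "y1 \<in> Y" "y1 \<le> y" "G y1 \<le> G y + e" using Y1[OF y] by blast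
  have "(\<Sum>i\<in>{a<..b}. indicator {y<..} (v i)) \<le> (\<Sum>i\<in>{a<..b}. indicator {y1<..} (v i) :: real)"
    by (rule sum_mono) (use y1 in \<open>auto simp: indicator_def\<close>)
  moreover have "l * p y1 \<le> l * (G y + 2 * e)" using p[OF y1(1)] y1(3) l by (intro mult_left_mono) auto
  ultimately have up: "(\<Sum>i\<in>{a<..b}. indicator {y<..} (v i)) \<le> l * G y + (2 * c + 4 * real N * e)"
    using D'[OF y1(1)] le[of "2 * e"] e unfolding distrib_left abs_le_iff e4 by linarith
  have low: "l * G y - (2 * c + 4 * real N * e) \<le> (\<Sum>i\<in>{a<..b}. indicator {y<..} (v i))"
  proof (cases "G y \<le> e")
    case True
    then have "l * G y \<le> l * (2 * e)" using l e by (intro mult_left_mono) auto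
    moreover have "0 \<le> (\<Sum>i\<in>{a<..b}. indicator {y<..} (v i) :: real)" by (intro sum_nonneg) auto
    ultimately show ?thesis using le[of "2 * e"] e c unfolding e4 by linarith
  next
    case False
    then obtain y2 where y2: "y2 \<in> Y" "y \<le> y2" "G y \<le> G y2 + e" using Y2[OF y] by blast
    have "(\<Sum>i\<in>{a<..b}. indicator {y2<..} (v i)) \<le> (\<Sum>i\<in>{a<..b}. indicator {y<..} (v i) :: real)"
      by (rule sum_mono) (use y2 in \<open>auto simp: indicator_def\<close>)
    moreover have "l * (G y - 2 * e) \<le> l * p y2" using p[OF y2(1)] y2(3) l by (intro mult_left_mono) auto
    ultimately show ?thesis
      using D'[OF y2(1)] le[of "2 * e"] e unfolding right_diff_distrib abs_le_iff e4 by linarith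
  qed
  show ?thesis using up low unfolding l_def by (simp add: abs_le_iff)
qed

end

lemma sum_indicator_greaterThanAtMost_split:
  fixes f :: "int \<Rightarrow> real"
  assumes s: "\<And>j. j < m \<Longrightarrow> b j \<le> b (Suc j)"
  shows "b 0 \<le> b m \<and> (\<Sum>i\<in>{b 0<..b m}. f i) = (\<Sum>j<m. \<Sum>i\<in>{b j<..b (Suc j)}. f i)"
  using assms
proof (induction m)
  case (Suc m)
  then have IH: "b 0 \<le> b m" "(\<Sum>i\<in>{b 0<..b m}. f i) = (\<Sum>j<m. \<Sum>i\<in>{b j<..b (Suc j)}. f i)" by auto
  have le: "b m \<le> b (Suc m)" using Suc.prems by auto
  have "{b 0<..b (Suc m)} = {b 0<..b m} \<union> {b m<..b (Suc m)}" using IH(1) le by auto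
  moreover have "(\<Sum>i\<in>{b 0<..b m} \<union> {b m<..b (Suc m)}. f i) = (\<Sum>i\<in>{b 0<..b m}. f i) + (\<Sum>i\<in>{b m<..b (Suc m)}. f i)"
    by (rule sum.union_disjoint) auto
  ultimately show ?case using IH le by simp
qed simp

lemma sum_indicator_count:
  "a \<le> b \<Longrightarrow> b \<le> c \<Longrightarrow> (\<Sum>i\<in>{a<..c}. indicator {..b} i) = real_of_int (b - a)" for a b c :: int
proof -
  assume "a \<le> b" "b \<le> c"
  then have "(\<Sum>i\<in>{a<..c}. indicator {..b} i) = (\<Sum>i\<in>{a<..b}. 1 :: real)"
    by (intro sum.mono_neutral_cong_right) (auto simp: indicator_def)
  then show ?thesis using \<open>a \<le> b\<close> by simp
qed

section \<open>The work received by individual customers\<close>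

context fluid_data
begin

text \<open>Customer \<open>i\<close> has started service by time \<open>u\<close> exactly if
  \<open>i \<le> B u\<close>, so the indicator switches the rate on at the start of service without
  naming that time.\<close>

definition received :: "(real \<Rightarrow> int) \<Rightarrow> (real \<Rightarrow> real) \<Rightarrow> int \<Rightarrow> real \<Rightarrow> real" where
  "received B \<kappa> i t = (LINT u:{0..t}|lborel. indicator {..B u} i * \<kappa> u)"

context
  fixes B :: "real \<Rightarrow> int" and \<kappa> :: "real \<Rightarrow> real"
  assumes B: "mono B" and r: "rate \<kappa>"
begin

lemma B_le: "a \<le> b \<Longrightarrow> B a \<le> B b" using B by (rule monoD)

lemma rate_started: "rate (\<lambda>u. indicator {..B u} i * \<kappa> u)"
proof -
  have "mono (\<lambda>u. real_of_int (B u))" using B_le by (auto simp: mono_def)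
  then have "(\<lambda>u. real_of_int (B u)) \<in> borel_measurable borel" by (rule borel_measurable_mono)
  then have [measurable]: "{u. real_of_int i \<le> real_of_int (B u)} \<in> sets borel" by measurable
  have "(\<lambda>u. indicator {u. real_of_int i \<le> real_of_int (B u)} u * \<kappa> u) \<in> borel_measurable borel"
    using rateD(1)[OF r] by measurable
  also have "(\<lambda>u. indicator {u. real_of_int i \<le> real_of_int (B u)} u * \<kappa> u) = (\<lambda>u. indicator {..B u} i * \<kappa> u)"
    by (auto simp: indicator_def fun_eq_iff)
  finally show ?thesis
    using rateD(2,3)[OF r] consts_nonneg unfolding rate_def by (auto simp: indicator_def)
qed

lemma received_bounds:
  assumes s: "0 \<le> s" "s \<le> s'" "s' \<le> t" and i: "B s < i" "i \<le> B s'"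
  shows "work \<kappa> s' t \<le> received B \<kappa> i t" "received B \<kappa> i t \<le> work \<kappa> s t"
proof -
  have "(LINT u:{s'..t}|lborel. indicator {..B u} i * \<kappa> u) \<le> received B \<kappa> i t"
    unfolding received_def
    by (rule set_integral_subset_le[OF rate_integrable[OF rate_started]]) (use s rateD(2)[OF rate_started] in auto)
  moreover have "(LINT u:{s'..t}|lborel. indicator {..B u} i * \<kappa> u) = work \<kappa> s' t"
    unfolding work_def
  proof (rule set_lebesgue_integral_cong, simp, intro allI impI)
    fix u assume "u \<in> {s'..t}"
    then have "i \<le> B u" using i(2) B_le[of s' u] by auto
    then show "indicator {..B u} i * \<kappa> u = \<kappa> u" by simp
  qed
  ultimately show "work \<kappa> s' t \<le> received B \<kappa> i t" by simp
  have "received B \<kappa> i t = (LINT u:{0..s}|lborel. indicator {..B u} i * \<kappa> u) + (LINT u:{s..t}|lborel. indicator {..B u} i * \<kappa> u)"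
    unfolding received_def by (rule set_integral_atLeastAtMost_combine[OF rate_integrable[OF rate_started]]) (use s in auto)
  moreover have "(LINT u:{0..s}|lborel. indicator {..B u} i * \<kappa> u) = (LINT u:{0..s}|lborel. 0)"
  proof (rule set_lebesgue_integral_cong, simp, intro allI impI)
    fix u assume "u \<in> {0..s}"
    then have "B u < i" using i(1) B_le[of u s] by auto
    then show "indicator {..B u} i * \<kappa> u = 0" by simp
  qed
  moreover have "(LINT u:{s..t}|lborel. indicator {..B u} i * \<kappa> u) \<le> work \<kappa> s t"
    unfolding work_def
    by (rule set_integral_mono[OF rate_integrable[OF rate_started] rate_integrable[OF r]])
      (use rateD(2)[OF r] in \<open>auto simp: indicator_def\<close>)
  ultimately show "received B \<kappa> i t \<le> work \<kappa> s t" by (simp add: set_lebesgue_integral_def)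
qed

lemma received_initial:
  assumes "i \<le> B 0" shows "received B \<kappa> i t = work \<kappa> 0 t"
  unfolding received_def work_def
proof (rule set_lebesgue_integral_cong, simp, intro allI impI)
  fix u assume "u \<in> {0..t}"
  then have "i \<le> B u" using assms B_le[of 0 u] by auto
  then show "indicator {..B u} i * \<kappa> u = \<kappa> u" by simp
qed

text \<open>\<open>G_chain\<close> is applied to the rate seen by each single customer, and summing
  the indicators counts the customers started by time \<open>u\<close>. The identity is exact and
  has the form of the integrated equation, with the count in place of \<open>D\<close>.\<close>

lemma sum_G_received:
  assumes t: "0 \<le> t" and y: "0 \<le> y"
  shows "(\<Sum>i\<in>{B 0<..B t}. G (y + received B \<kappa> i t)) =
    G y * of_int (B t - B 0) - (LINT u:{0..t}|lborel. of_int (B u - B 0) * g (y + work \<kappa> u t) * \<kappa> u)"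
proof -
  let ?k = "\<lambda>i u. indicator {..B u} i * \<kappa> u"
  have B0t: "B 0 \<le> B t" using B_le[OF t] .
  have one: "G (y + received B \<kappa> i t) = G y - (LINT u:{0..t}|lborel. indicator {..B u} i * (g (y + work \<kappa> u t) * \<kappa> u))" for i
  proof -
    have "received B \<kappa> i t = work (?k i) 0 t" by (simp add: received_def work_def)
    then have "G (y + received B \<kappa> i t) = G y - (LINT u:{0..t}|lborel. g (y + work (?k i) u t) * ?k i u)"
      using G_chain[OF rate_started y t] by simp
    also have "(LINT u:{0..t}|lborel. g (y + work (?k i) u t) * ?k i u) =
        (LINT u:{0..t}|lborel. indicator {..B u} i * (g (y + work \<kappa> u t) * \<kappa> u))"
    proof (rule set_lebesgue_integral_cong, simp, intro allI impI)
      fix u assume u: "u \<in> {0..t}"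
      \<comment> \<open>Once started, a customer sees the full rate until \<open>t\<close>; before
        the start both sides are zero.\<close>
      show "g (y + work (?k i) u t) * ?k i u = indicator {..B u} i * (g (y + work \<kappa> u t) * \<kappa> u)"
      proof (cases "i \<le> B u")
        case True
        have "work (?k i) u t = work \<kappa> u t"
        proof (rule work_cong)
          fix u' assume "u \<le> u'" "u' \<le> t"
          then have "i \<le> B u'" using True B_le[of u u'] by auto
          then show "?k i u' = \<kappa> u'" by simp
        qed
        then show ?thesis by simp
      qed simp
    qed
    finally show ?thesis .
  qed
  note [measurable] = rateD(1)[OF r] work_measurable[OF r]
  have int: "set_integrable lborel {0..t} (\<lambda>u. indicator {..B u} i * (g (y + work \<kappa> u t) * \<kappa> u))" for i
  proof (rule bounded_borel_set_integrable[of _ _ _ "Cg * K"])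
    have "(\<lambda>u. g (y + work \<kappa> u t) * (indicator {..B u} i * \<kappa> u)) \<in> borel_measurable borel"
      using rateD(1)[OF rate_started[of i]] by measurable
    then show "(\<lambda>u. indicator {..B u} i * (g (y + work \<kappa> u t) * \<kappa> u)) \<in> borel_measurable borel"
      by (simp only: mult.left_commute)
    fix u
    have "\<bar>g (y + work \<kappa> u t) * \<kappa> u\<bar> \<le> Cg * K"
      using g0 gC rateD(2,3)[OF r] consts_nonneg by (auto simp: abs_mult abs_of_nonneg intro!: mult_mono)
    then show "\<bar>indicator {..B u} i * (g (y + work \<kappa> u t) * \<kappa> u)\<bar> \<le> Cg * K"
      using consts_nonneg by (auto simp: indicator_def)
  qed
  have "(\<Sum>i\<in>{B 0<..B t}. G (y + received B \<kappa> i t)) =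
      of_int (B t - B 0) * G y - (\<Sum>i\<in>{B 0<..B t}. LINT u:{0..t}|lborel. indicator {..B u} i * (g (y + work \<kappa> u t) * \<kappa> u))"
    unfolding one using B0t by (simp add: sum_subtractf)
  also have "(\<Sum>i\<in>{B 0<..B t}. LINT u:{0..t}|lborel. indicator {..B u} i * (g (y + work \<kappa> u t) * \<kappa> u)) =
      (LINT u:{0..t}|lborel. \<Sum>i\<in>{B 0<..B t}. indicator {..B u} i * (g (y + work \<kappa> u t) * \<kappa> u))"
    unfolding set_lebesgue_integral_def scaleR_sum_right
    by (rule Bochner_Integration.integral_sum[symmetric]) (rule int[unfolded set_integrable_def])
  also have "\<dots> = (LINT u:{0..t}|lborel. of_int (B u - B 0) * g (y + work \<kappa> u t) * \<kappa> u)"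
  proof (rule set_lebesgue_integral_cong, simp, intro allI impI)
    fix u assume u: "u \<in> {0..t}"
    then have "(\<Sum>i\<in>{B 0<..B t}. indicator {..B u} i) = real_of_int (B u - B 0)"
      using B_le[of 0 u] B_le[of u t] by (intro sum_indicator_count) auto
    then show "(\<Sum>i\<in>{B 0<..B t}. indicator {..B u} i * (g (y + work \<kappa> u t) * \<kappa> u)) = of_int (B u - B 0) * g (y + work \<kappa> u t) * \<kappa> u"
      by (simp only: mult.assoc flip: sum_distrib_right)
  qed
  finally show ?thesis by (simp add: mult.commute)
qed

text \<open>Time is cut into \<open>m\<close> blocks; customers that start service in the same block have received almost
  the same amount of service, so the uniform law of large numbers applies to each block.\<close>

lemma started_customers_estimate:
  fixes v :: "int \<Rightarrow> real"
  assumes N: "- int N \<le> B 0" "B T \<le> int N"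
    and dev: "\<And>a b y. - int N \<le> a \<Longrightarrow> a \<le> b \<Longrightarrow> b \<le> int N \<Longrightarrow> 0 \<le> y \<Longrightarrow>
      \<bar>(\<Sum>i\<in>{a<..b}. indicator {y<..} (v i)) - of_int (b - a) * G y\<bar> \<le> c"
    and m: "0 < m" and t: "0 \<le> t" "t \<le> T" and y: "0 \<le> y"
  shows "\<bar>(\<Sum>i\<in>{B 0<..B t}. indicator {y + received B \<kappa> i t<..} (v i)) -
      (G y * of_int (B t - B 0) - (LINT u:{0..t}|lborel. of_int (B u - B 0) * g (y + work \<kappa> u t) * \<kappa> u))\<bar>
    \<le> real m * c + 2 * real N * (Cg * K * T / real m)"
proof -
  define s where "s j = t * real j / real m" for j
  have s: "s 0 = 0" "s m = t" using m by (simp_all add: s_def)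
  have ss: "s j \<le> s (Suc j)" "s (Suc j) - s j = t / real m" "0 \<le> s j" for j
  proof -
    have "s (Suc j) = s j + t / real m" by (simp add: s_def distrib_left add_divide_distrib)
    then show "s j \<le> s (Suc j)" "s (Suc j) - s j = t / real m" using t by simp_all
    show "0 \<le> s j" using t by (simp add: s_def)
  qed
  have st: "s j \<le> t" if "j \<le> m" for j
    using that t m mult_left_mono[of "real j" "real m" t] by (simp add: s_def pos_divide_le_eq)
  let ?f = "\<lambda>i. indicator {y + received B \<kappa> i t<..} (v i) :: real" and ?G = "\<lambda>i. G (y + received B \<kappa> i t)"
  \<comment> \<open>The work done in one block is at most \<open>K * T / m\<close>, and
    \<open>Cg\<close> converts it into a variation of \<open>G\<close>.\<close>
  define d where "d = Cg * (K * (T / real m))"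
  have block: "\<bar>(\<Sum>i\<in>{B (s j)<..B (s (Suc j))}. ?f i) - (\<Sum>i\<in>{B (s j)<..B (s (Suc j))}. ?G i)\<bar> \<le>
      c + of_int (B (s (Suc j)) - B (s j)) * d" if j: "j < m" for j
  proof -
    let ?J = "{B (s j)<..B (s (Suc j))}"
    let ?lo = "y + work \<kappa> (s (Suc j)) t" and ?hi = "y + work \<kappa> (s j) t"
    have sj: "s (Suc j) \<le> t" using st j by simp
    have bj: "B (s j) \<le> B (s (Suc j))" by (rule B_le[OF ss(1)])
    have range: "- int N \<le> B (s j)" "B (s (Suc j)) \<le> int N"
      using N B_le[of 0 "s j"] ss(3)[of j] B_le[of "s (Suc j)" T] sj t by auto
    have rc: "?lo \<le> y + received B \<kappa> i t" "y + received B \<kappa> i t \<le> ?hi" if "i \<in> ?J" for i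
      using received_bounds[OF ss(3)[of j] ss(1)[of j] sj] that by auto
    have nonneg: "0 \<le> ?lo" "0 \<le> ?hi" using y work_nonneg[OF r] by auto
    have gap: "?hi - ?lo \<le> K * (T / real m)"
    proof -
      have "?hi - ?lo = work \<kappa> (s j) (s (Suc j))" using work_combine[OF r ss(1) sj] by simp
      also have "\<dots> \<le> K * (t / real m)" using work_le[OF r ss(1)[of j]] ss(2)[of j] by simp
      also have "\<dots> \<le> K * (T / real m)" using t consts_nonneg by (intro mult_left_mono divide_right_mono) auto
      finally show ?thesis .
    qed
    have Gd: "\<bar>G a - G b\<bar> \<le> d" if "?lo \<le> a" "a \<le> ?hi" "?lo \<le> b" "b \<le> ?hi" for a b
    proof -
      have "\<bar>G a - G b\<bar> \<le> Cg * \<bar>a - b\<bar>" by (rule GC)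
      also have "\<dots> \<le> Cg * (K * (T / real m))" using that gap consts_nonneg by (intro mult_left_mono) auto
      finally show ?thesis by (simp add: d_def)
    qed
    have lohi: "?lo \<le> ?hi" using work_combine[OF r ss(1) sj] work_nonneg[OF r, of "s j" "s (Suc j)"] by simp
    have card: "(\<Sum>i\<in>?J. z) = of_int (B (s (Suc j)) - B (s j)) * z" for z :: real using bj by simp
    \<comment> \<open>The thresholds \<open>y + received B \<kappa> i t\<close> vary with
      \<open>i\<close>; the common lower bound \<open>?lo\<close>, and below the common upper bound
      \<open>?hi\<close>, give a single threshold to which \<open>dev\<close> applies.\<close>
    have "(\<Sum>i\<in>?J. ?f i) \<le> (\<Sum>i\<in>?J. indicator {?lo<..} (v i))"
      by (rule sum_mono) (use rc(1) in \<open>fastforce simp: indicator_def\<close>)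
    also have "\<dots> \<le> of_int (B (s (Suc j)) - B (s j)) * G ?lo + c"
      using dev[OF range(1) bj range(2) nonneg(1)] by linarith
    also have "of_int (B (s (Suc j)) - B (s j)) * G ?lo = (\<Sum>i\<in>?J. G ?lo)" by (rule card[symmetric])
    also have "\<dots> \<le> (\<Sum>i\<in>?J. ?G i + d)"
    proof (rule sum_mono)
      fix i assume "i \<in> ?J"
      then show "G ?lo \<le> ?G i + d" using Gd[of ?lo "y + received B \<kappa> i t"] rc[of i] lohi by auto
    qed
    also have "\<dots> = (\<Sum>i\<in>?J. ?G i) + of_int (B (s (Suc j)) - B (s j)) * d" by (simp only: sum.distrib card)
    finally have up: "(\<Sum>i\<in>?J. ?f i) \<le> (\<Sum>i\<in>?J. ?G i) + of_int (B (s (Suc j)) - B (s j)) * d + c" by simp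
    have "(\<Sum>i\<in>?J. ?G i) \<le> (\<Sum>i\<in>?J. G ?hi + d)"
    proof (rule sum_mono)
      fix i assume "i \<in> ?J"
      then show "?G i \<le> G ?hi + d" using Gd[of ?hi "y + received B \<kappa> i t"] rc[of i] lohi by auto
    qed
    also have "\<dots> = of_int (B (s (Suc j)) - B (s j)) * G ?hi + of_int (B (s (Suc j)) - B (s j)) * d"
      by (simp only: sum.distrib card)
    also have "of_int (B (s (Suc j)) - B (s j)) * G ?hi \<le> (\<Sum>i\<in>?J. indicator {?hi<..} (v i)) + c"
      using dev[OF range(1) bj range(2) nonneg(2)] by linarith
    also have "(\<Sum>i\<in>?J. indicator {?hi<..} (v i)) \<le> (\<Sum>i\<in>?J. ?f i)"
      by (rule sum_mono) (use rc(2) in \<open>fastforce simp: indicator_def\<close>)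
    finally show ?thesis using up by linarith
  qed
  have mono: "B (s j) \<le> B (s (Suc j))" for j by (rule B_le[OF ss(1)])
  have split: "(\<Sum>i\<in>{B 0<..B t}. f i) = (\<Sum>j<m. \<Sum>i\<in>{B (s j)<..B (s (Suc j))}. f i)" for f :: "int \<Rightarrow> real"
    using sum_indicator_greaterThanAtMost_split[of m "\<lambda>j. B (s j)" f] mono s by simp
  have "\<bar>(\<Sum>i\<in>{B 0<..B t}. ?f i) - (\<Sum>i\<in>{B 0<..B t}. ?G i)\<bar> \<le>
      (\<Sum>j<m. \<bar>(\<Sum>i\<in>{B (s j)<..B (s (Suc j))}. ?f i) - (\<Sum>i\<in>{B (s j)<..B (s (Suc j))}. ?G i)\<bar>)"
    unfolding split sum_subtractf[symmetric] by (rule sum_abs)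
  also have "\<dots> \<le> (\<Sum>j<m. c + of_int (B (s (Suc j)) - B (s j)) * d)" by (rule sum_mono) (use block in auto)
  also have "\<dots> = real m * c + (\<Sum>j<m. of_int (B (s (Suc j)) - B (s j))) * d"
    by (simp add: sum.distrib sum_distrib_right)
  also have "(\<Sum>j<m. of_int (B (s (Suc j)) - B (s j))) = (of_int (B t - B 0) :: real)"
    using sum_lessThan_telescope[of "\<lambda>j. real_of_int (B (s j))" m] s by simp
  also have "of_int (B t - B 0) * d \<le> 2 * real N * d"
  proof (rule mult_right_mono)
    have "B t - B 0 \<le> 2 * int N" using N B_le[OF t(2)] by linarith
    then show "of_int (B t - B 0) \<le> 2 * real N" by linarith
    show "0 \<le> d" using consts_nonneg t by (simp add: d_def)
  qed
  finally show ?thesis unfolding sum_G_received[OF t(1) y] by (simp add: d_def)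
qed

end

end

section \<open>Paths of the queue\<close>

lemma cadlag_real_right_continuous:
  fixes x :: "real \<Rightarrow> real"
  assumes x: "(\<lambda>t\<in>{0..}. x t) \<in> cadlag_paths {0..} dist" and t: "0 \<le> t"
  shows "(x \<longlongrightarrow> x t) (at_right t)"
proof -
  interpret R: Metric_space "{0::real..}" dist by (rule Metric_space_nonneg_reals)
  show ?thesis
    unfolding tendsto_iff
  proof (intro allI impI)
    fix e :: real assume "0 < e"
    then obtain h where h: "0 < h" "\<And>s. t \<le> s \<Longrightarrow> s < t + h \<Longrightarrow> dist ((\<lambda>t\<in>{0..}. x t) s) ((\<lambda>t\<in>{0..}. x t) t) < e"
      using R.cadlag_right[OF x t] by metis
    have "\<forall>\<^sub>F s in at_right t. s \<in> {t<..<t + h}" using h(1) by (intro eventually_at_rightI[of t "t + h"]) auto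
    then show "\<forall>\<^sub>F s in at_right t. dist (x s) (x t) < e"
      by eventually_elim (use h(2) t in \<open>force\<close>)
  qed
qed

text \<open>Multiples of \<open>1 / n\<close> that differ by less than \<open>1 / n\<close> are
  equal, so right continuity means local constancy to the right.\<close>

lemma cadlag_discrete_right:
  fixes x :: "real \<Rightarrow> nat"
  assumes n: "0 < n" and x: "(\<lambda>t\<in>{0..}. real (x t) / real n) \<in> cadlag_paths {0..} dist" and t: "0 \<le> t"
  obtains h where "0 < h" "\<And>s. t \<le> s \<Longrightarrow> s < t + h \<Longrightarrow> x s = x t"
proof -
  interpret R: Metric_space "{0::real..}" dist by (rule Metric_space_nonneg_reals)
  obtain h where h: "0 < h" "\<And>s. t \<le> s \<Longrightarrow> s < t + h \<Longrightarrow> dist (real (x s) / real n) (real (x t) / real n) < 1 / real n"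
    using R.cadlag_right[OF x t, of "1 / real n"] n t by auto
  show thesis
  proof (rule that[OF h(1)])
    fix s assume "t \<le> s" "s < t + h"
    then have "\<bar>real (x s) - real (x t)\<bar> < 1"
      using h(2)[of s] n by (simp add: dist_real_def divide_less_cancel flip: diff_divide_distrib)
    then show "x s = x t" by linarith
  qed
qed

lemma cadlag_discrete_left:
  fixes x :: "real \<Rightarrow> nat"
  assumes n: "0 < n" and x: "(\<lambda>t\<in>{0..}. real (x t) / real n) \<in> cadlag_paths {0..} dist" and t: "0 < t"
  obtains h where "0 < h" "h \<le> t" "\<And>s s'. t - h < s \<Longrightarrow> s < t \<Longrightarrow> t - h < s' \<Longrightarrow> s' < t \<Longrightarrow> x s = x s'"
proof -
  interpret R: Metric_space "{0::real..}" dist by (rule Metric_space_nonneg_reals)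
  let ?x = "\<lambda>t\<in>{0..}. real (x t) / real n"
  have n1: "0 < 1 / real n" using n by simp
  obtain h where h: "0 < h" "h \<le> t" "\<And>s s'. t - h < s \<Longrightarrow> s < t \<Longrightarrow> t - h < s' \<Longrightarrow> s' < t \<Longrightarrow> dist (?x s) (?x s') < 1 / real n"
    using R.cadlag_left[OF x t n1] by metis
  show thesis
  proof (rule that[OF h(1,2)])
    fix s s' assume s: "t - h < s" "s < t" "t - h < s'" "s' < t"
    then have "dist (real (x s) / real n) (real (x s') / real n) < 1 / real n" using h(2) h(3)[of s s'] by simp
    then have "\<bar>real (x s) - real (x s')\<bar> < 1"
      using n by (simp add: dist_real_def divide_less_cancel flip: diff_divide_distrib)
    then show "x s = x s'" by linarith
  qed
qed

lemma (in Metric_space) limitin_at_within_real: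
  "limitin mtopology f l (at t within S) \<longleftrightarrow>
    l \<in> M \<and> (\<forall>e>0. \<exists>h>0. \<forall>s\<in>S. s \<noteq> t \<and> \<bar>s - t\<bar> < h \<longrightarrow> f s \<in> M \<and> d (f s) l < e)" for f :: "real \<Rightarrow> 'a"
  by (auto simp: limitin_metric eventually_at dist_real_def)

text \<open>The path property of the arrivals comes from their assumed convergence: random elements
  of the Skorohod space have their values in \<open>cadlag_paths\<close>.\<close>

locale cadlag_queue = many_server_queue +
  assumes servers: "0 < n"
    and arrivals_cadlag: "\<And>\<omega>. \<omega> \<in> space P \<Longrightarrow> (\<lambda>t\<in>{0..}. real (E t \<omega>) / real n) \<in> cadlag_paths {0..} dist"
begin

definition started_upto :: "'a \<Rightarrow> real \<Rightarrow> int" where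
  "started_upto \<omega> t = last_started E Q (max t 0) \<omega>"

text \<open>One family for initial and later customers, so that the two sums in
  \<open>in_service\<close> merge into a single count over \<open>alive\<close>.\<close>

definition requirement :: "'a \<Rightarrow> int \<Rightarrow> real" where
  "requirement \<omega> i = (if i \<le> - int (Q 0 \<omega>) then w i \<omega> else v i \<omega>)"

definition speed :: "'a \<Rightarrow> real \<Rightarrow> real" where
  "speed \<omega> u = k (real (X (max u 0) \<omega>) / real n)"

definition attained :: "'a \<Rightarrow> int \<Rightarrow> real \<Rightarrow> real" where
  "attained \<omega> i t = (LINT u:{0..t}|lborel. indicator {..started_upto \<omega> u} i * speed \<omega> u)"

definition alive :: "'a \<Rightarrow> real \<Rightarrow> int set" where
  "alive \<omega> t = {i. - int (X 0 \<omega>) < i \<and> i \<le> started_upto \<omega> t \<and> attained \<omega> i t < requirement \<omega> i}"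

lemma finite_alive: "finite (alive \<omega> t)"
  by (rule finite_subset[of _ "{- int (X 0 \<omega>)<..started_upto \<omega> t}"]) (auto simp: alive_def)

context
  fixes \<omega> assumes \<omega>: "\<omega> \<in> space P"
begin

lemma started_mono: "mono (started_upto \<omega>)"
  using first_come_first_served[OF \<omega>] by (auto simp: mono_def mono_on_def started_upto_def)

lemma arrivals_0: "E 0 \<omega> = 0"
proof -
  obtain \<xi> :: "nat \<Rightarrow> 'a \<Rightarrow> real" where \<xi>: "\<And>j. 0 < \<xi> j \<omega>" "E 0 \<omega> = card {j. (\<Sum>i\<le>j. \<xi> i \<omega>) \<le> 0}"
    using arrivals \<omega> unfolding renewal_process_def by (metis order_refl)
  have "0 < (\<Sum>i\<le>j. \<xi> i \<omega>)" for j by (intro sum_pos) (auto simp: \<xi>)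
  then have "{j. (\<Sum>i\<le>j. \<xi> i \<omega>) \<le> 0} = {}" by (auto simp: not_le)
  then show ?thesis using \<xi>(2) by simp
qed

lemma started_0: "started_upto \<omega> 0 = - int (Q 0 \<omega>)"
  by (simp add: started_upto_def last_started_def arrivals_0)

lemma queue_eq: "0 \<le> t \<Longrightarrow> Q t \<omega> = X t \<omega> - n"
  using work_conserving[OF _ \<omega>, of t] by (auto simp: max_def split: if_splits)

lemma head_count_cadlag': "(\<lambda>t\<in>{0..}. real (X t \<omega>) / real 1) \<in> cadlag_paths {0..} dist"
  using head_count_cadlag[OF \<omega>] by simp

lemma speed_rate:
  obtains C where "speed \<omega> \<in> borel_measurable borel" "\<And>u. 0 \<le> speed \<omega> u" "\<And>u. speed \<omega> u \<le> C"
proof -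
  obtain C where C: "\<And>y. 0 \<le> y \<Longrightarrow> k y \<le> C"
    using rate_function_bounded by (auto simp: bounded_iff dest: abs_le_D1)
  have "(\<lambda>u. real (X (max u 0) \<omega>)) \<in> borel_measurable borel"
    by (rule right_continuous_measurable[of "\<lambda>u. real (X u \<omega>)"])
      (rule cadlag_real_right_continuous[OF head_count_cadlag[OF \<omega>]])
  then have xm: "(\<lambda>u. real (X (max u 0) \<omega>) / real n) \<in> borel_measurable borel" by measurable
  have km: "(\<lambda>y. indicator {0..} y * k y) \<in> borel_measurable borel"
    using rate_function_measurable by (simp add: set_borel_measurable_def)
  have "(\<lambda>u. indicator {0..} (real (X (max u 0) \<omega>) / real n) * k (real (X (max u 0) \<omega>) / real n)) \<in> borel_measurable borel"
    by (rule measurable_compose[OF xm km])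
  then have "speed \<omega> \<in> borel_measurable borel" by (simp add: speed_def[abs_def])
  then show thesis
    by (rule that[of C]) (auto simp: speed_def intro!: rate_function_nonneg C)
qed

lemma attained_integrand:
  obtains C where "0 < C" "\<And>i a b. set_integrable lborel {a..b} (\<lambda>u. indicator {..started_upto \<omega> u} i * speed \<omega> u)"
    "\<And>i u. 0 \<le> indicator {..started_upto \<omega> u} i * speed \<omega> u" "\<And>i u. indicator {..started_upto \<omega> u} i * speed \<omega> u \<le> C"
proof -
  obtain C where C: "speed \<omega> \<in> borel_measurable borel" "\<And>u. 0 \<le> speed \<omega> u" "\<And>u. speed \<omega> u \<le> C"
    by (rule speed_rate) blast
  have b: "0 \<le> indicator {..started_upto \<omega> u} i * speed \<omega> u \<and> indicator {..started_upto \<omega> u} i * speed \<omega> u \<le> max C 1" for i u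
    using C(2)[of u] C(3)[of u] by (auto simp: indicator_def)
  have m: "(\<lambda>u. indicator {..started_upto \<omega> u} i * speed \<omega> u) \<in> borel_measurable borel" for i
  proof -
    have "mono (\<lambda>u. real_of_int (started_upto \<omega> u))" using started_mono by (auto simp: mono_def)
    then have "(\<lambda>u. real_of_int (started_upto \<omega> u)) \<in> borel_measurable borel" by (rule borel_measurable_mono)
    then have [measurable]: "{u. real_of_int i \<le> real_of_int (started_upto \<omega> u)} \<in> sets borel" by measurable
    have "(\<lambda>u. indicator {u. real_of_int i \<le> real_of_int (started_upto \<omega> u)} u * speed \<omega> u) \<in> borel_measurable borel"
      using C(1) by measurable
    then show ?thesis by (simp add: indicator_def of_bool_def)
  qed
  show thesis
  \<comment> \<open>\<open>C\<close> may be 0, whereas a positive constant is wanted, by which one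
    can divide.\<close>
  proof (rule that[of "max C 1"])
    show "set_integrable lborel {a..b} (\<lambda>u. indicator {..started_upto \<omega> u} i * speed \<omega> u)" for i a b
      by (rule bounded_borel_set_integrable[OF m, of _ _ _ "max C 1"]) (use b in \<open>auto simp: abs_le_iff intro: order_trans[of _ 0]\<close>)
  qed (use b in auto)
qed

lemma attained_mono_Lipschitz:
  obtains C where "0 < C" "\<And>i s t. 0 \<le> s \<Longrightarrow> s \<le> t \<Longrightarrow> attained \<omega> i s \<le> attained \<omega> i t \<and> attained \<omega> i t \<le> attained \<omega> i s + C * (t - s)"
proof -
  obtain C where C: "0 < C" "\<And>i a b. set_integrable lborel {a..b} (\<lambda>u. indicator {..started_upto \<omega> u} i * speed \<omega> u)"
    "\<And>i u. 0 \<le> indicator {..started_upto \<omega> u} i * speed \<omega> u" "\<And>i u. indicator {..started_upto \<omega> u} i * speed \<omega> u \<le> C"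
    by (rule attained_integrand) blast
  show thesis
  proof (rule that[OF C(1)])
    fix i and s t :: real assume st: "0 \<le> s" "s \<le> t"
    have "attained \<omega> i t = attained \<omega> i s + (LINT u:{s..t}|lborel. indicator {..started_upto \<omega> u} i * speed \<omega> u)"
      unfolding attained_def by (rule set_integral_atLeastAtMost_combine[OF C(2) st])
    moreover have "0 \<le> (LINT u:{s..t}|lborel. indicator {..started_upto \<omega> u} i * speed \<omega> u)"
      unfolding set_lebesgue_integral_def by (intro Bochner_Integration.integral_nonneg) (use C(3) in \<open>simp add: indicator_def\<close>)
    moreover have "\<bar>LINT u:{s..t}|lborel. indicator {..started_upto \<omega> u} i * speed \<omega> u\<bar> \<le> C * (t - s)"
      by (rule set_integral_abs_const_le[OF C(2) _ st(2)]) (simp only: abs_of_nonneg C(3,4))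
    ultimately show "attained \<omega> i s \<le> attained \<omega> i t \<and> attained \<omega> i t \<le> attained \<omega> i s + C * (t - s)" by linarith
  qed
qed

lemma attained_0: "attained \<omega> i 0 = 0"
  unfolding attained_def set_lebesgue_integral_def
proof (rule integral_eq_zero_AE)
  show "AE u in lborel. indicator {0..0} u *\<^sub>R (indicator {..started_upto \<omega> u} i * speed \<omega> u) = 0"
    using AE_lborel_singleton[of 0] by eventually_elim simp
qed

text \<open>The integral from the start of service and the integral over the times at which the customer has
  started differ by at most one point.\<close>

lemma attained_service_eq:
  assumes t: "0 \<le> t" and i: "i \<le> started_upto \<omega> t"
  shows "attained_service n k X (start_time E Q i \<omega>) t \<omega> = attained \<omega> i t"
proof -
  let ?S = "{t. 0 \<le> t \<and> i \<le> last_started E Q t \<omega>}"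
  define \<tau> where "\<tau> = start_time E Q i \<omega>"
  have tS: "t \<in> ?S" using t i by (simp add: started_upto_def)
  have bdd: "bdd_below ?S" by (rule bdd_belowI[of _ 0]) auto
  have \<tau>: "0 \<le> \<tau>" "\<tau> \<le> t"
    unfolding \<tau>_def start_time_def using tS by (auto intro!: cInf_greatest cInf_lower bdd)
  have before: "\<not> i \<le> started_upto \<omega> u" if "0 \<le> u" "u < \<tau>" for u
  proof
    assume "i \<le> started_upto \<omega> u"
    then have "\<tau> \<le> u" unfolding \<tau>_def start_time_def using that(1) by (intro cInf_lower bdd) (auto simp: started_upto_def)
    then show False using that by simp
  qed
  have after: "i \<le> started_upto \<omega> u" if "\<tau> < u" for u
  proof -
    have ne: "?S \<noteq> {}" by (rule notI) (use tS in \<open>simp only: empty_iff\<close>)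
    have lt: "Inf ?S < u" using that unfolding \<tau>_def start_time_def .
    obtain s where s: "s \<in> ?S" "s < u" by (rule bexE[OF cInf_lessD[OF ne lt]])
    then have "i \<le> started_upto \<omega> s" by (simp add: started_upto_def)
    also have "\<dots> \<le> started_upto \<omega> u" using s(2) by (intro monoD[OF started_mono]) auto
    finally show ?thesis .
  qed
  obtain C where sm: "speed \<omega> \<in> borel_measurable borel" "\<And>u. 0 \<le> speed \<omega> u" "\<And>u. speed \<omega> u \<le> C"
    by (rule speed_rate) blast
  obtain C' where C': "\<And>i a b. set_integrable lborel {a..b} (\<lambda>u. indicator {..started_upto \<omega> u} i * speed \<omega> u)"
    by (rule attained_integrand) blast
  have si: "set_integrable lborel {a..b} (speed \<omega>)" for a b
    by (rule bounded_borel_set_integrable[OF sm(1), of _ _ C]) (use sm(2,3) in \<open>simp add: abs_of_nonneg\<close>)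
  have "attained_service n k X \<tau> t \<omega> = (LINT u:{\<tau>..t}|lborel. speed \<omega> u)"
    unfolding attained_service_def by (rule set_lebesgue_integral_cong) (use \<tau> in \<open>auto simp: speed_def max_absorb1\<close>)
  also have "\<dots> = attained \<omega> i t"
    unfolding attained_def set_lebesgue_integral_def
  proof (rule integral_cong_AE)
    show "(\<lambda>u. indicator {\<tau>..t} u *\<^sub>R speed \<omega> u) \<in> borel_measurable lborel"
      using si[unfolded set_integrable_def] by (rule borel_measurable_integrable)
    show "(\<lambda>u. indicator {0..t} u *\<^sub>R (indicator {..started_upto \<omega> u} i * speed \<omega> u)) \<in> borel_measurable lborel"
      using C'[unfolded set_integrable_def] by (rule borel_measurable_integrable)
    show "AE u in lborel. indicator {\<tau>..t} u *\<^sub>R speed \<omega> u = indicator {0..t} u *\<^sub>R (indicator {..started_upto \<omega> u} i * speed \<omega> u)"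
      using AE_lborel_singleton[of \<tau>]
    proof eventually_elim
      case (elim u)
      then show ?case using before[of u] after[of u] \<tau> by (cases "u < \<tau>") (auto simp: indicator_def)
    qed
  qed
  finally show ?thesis by (simp add: \<tau>_def)
qed

lemma attained_service_initial:
  assumes t: "0 \<le> t" and i: "i \<le> - int (Q 0 \<omega>)"
  shows "attained_service n k X 0 t \<omega> = attained \<omega> i t"
  unfolding attained_service_def attained_def
proof (rule set_lebesgue_integral_cong, simp, intro allI impI)
  fix u assume u: "u \<in> {0..t}"
  then have "i \<le> started_upto \<omega> u" using i started_0 monoD[OF started_mono, of 0 u] by auto
  then show "k (real (X u \<omega>) / real n) = indicator {..started_upto \<omega> u} i * speed \<omega> u"
    using u by (simp add: speed_def max_absorb1)
qed

lemma initial_range: "- int (X 0 \<omega>) \<le> - int (Q 0 \<omega>)" "0 \<le> t \<Longrightarrow> - int (Q 0 \<omega>) \<le> started_upto \<omega> t"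
  using queue_eq[of 0] started_0 monoD[OF started_mono, of 0 t] by auto

lemma customers_split:
  assumes t: "0 \<le> t"
  shows "{- int (X 0 \<omega>)<..started_upto \<omega> t} = {- int (X 0 \<omega>) + 1 .. - int (Q 0 \<omega>)} \<union> {- int (Q 0 \<omega>) + 1 .. last_started E Q t \<omega>}"
    "{- int (X 0 \<omega>) + 1 .. - int (Q 0 \<omega>)} \<inter> {- int (Q 0 \<omega>) + 1 .. last_started E Q t \<omega>} = {}"
  using initial_range(1) initial_range(2)[OF t] t by (auto simp: started_upto_def)

lemma emeasure_in_service_alive:
  assumes t: "0 \<le> t" and C: "C \<in> sets borel"
  shows "emeasure (in_service n E v w k X Q t \<omega>) C = of_nat (card {i \<in> alive \<omega> t. requirement \<omega> i - attained \<omega> i t \<in> C})"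
proof -
  let ?f = "\<lambda>i. indicator C (requirement \<omega> i - attained \<omega> i t) * indicator {0<..} (requirement \<omega> i - attained \<omega> i t) :: ennreal"
  have ind: "indicator ((\<lambda>y. y + s) ` (A \<inter> {0<..})) x = (indicator A (x - s) * indicator {0<..} (x - s) :: ennreal)"
    for A :: "real set" and s x
    by (force simp: indicator_def image_iff algebra_simps)
  have "emeasure (in_service n E v w k X Q t \<omega>) C =
      (\<Sum>i\<in>{- int (X 0 \<omega>) + 1 .. - int (Q 0 \<omega>)}. ?f i) + (\<Sum>i\<in>{- int (Q 0 \<omega>) + 1 .. last_started E Q t \<omega>}. ?f i)"
    unfolding emeasure_in_service[OF C] ind
  proof (intro arg_cong2[where f = "(+)"] sum.cong refl)
    fix i assume "i \<in> {- int (X 0 \<omega>) + 1 .. - int (Q 0 \<omega>)}"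
    then show "indicator C (w i \<omega> - attained_service n k X 0 t \<omega>) * indicator {0<..} (w i \<omega> - attained_service n k X 0 t \<omega>) = ?f i"
      using attained_service_initial[OF t, of i] by (simp add: requirement_def)
  next
    fix i assume "i \<in> {- int (Q 0 \<omega>) + 1 .. last_started E Q t \<omega>}"
    then show "indicator C (v i \<omega> - attained_service n k X (start_time E Q i \<omega>) t \<omega>) *
        indicator {0<..} (v i \<omega> - attained_service n k X (start_time E Q i \<omega>) t \<omega>) = ?f i"
      using attained_service_eq[OF t, of i] t by (simp add: requirement_def started_upto_def)
  qed
  also have "\<dots> = (\<Sum>i\<in>{- int (X 0 \<omega>)<..started_upto \<omega> t}. ?f i)"
    unfolding customers_split(1)[OF t] by (rule sum.union_disjoint[symmetric]) (use customers_split(2)[OF t] in auto)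
  also have "\<dots> = (\<Sum>i\<in>{i \<in> alive \<omega> t. requirement \<omega> i - attained \<omega> i t \<in> C}. 1)"
    by (rule sum.mono_neutral_cong_right) (auto simp: alive_def indicator_def)
  finally show ?thesis by simp
qed

text \<open>In the form \<open>atoms\<close>, distances between the states at two times reduce to
  displacements of the remaining requirements.\<close>

lemma scaled_state_eq:
  assumes t: "0 \<le> t"
  shows "scaled_state n E v w k X Q t \<omega> =
    (atoms n (alive \<omega> t) (\<lambda>i. requirement \<omega> i - attained \<omega> i t), real (Q t \<omega>) / real n)"
proof -
  have "scale_measure (ennreal (1 / real n)) (in_service n E v w k X Q t \<omega>) =
      atoms n (alive \<omega> t) (\<lambda>i. requirement \<omega> i - attained \<omega> i t)"
    by (rule measure_eqI) (simp_all add: emeasure_in_service_alive[OF t] emeasure_atoms[OF finite_alive])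
  then show ?thesis by (simp add: scaled_state_def)
qed

lemma atoms_state:
  assumes "0 \<le> q" "I \<subseteq> alive \<omega> t" "\<And>i. i \<in> I \<Longrightarrow> 0 \<le> p i"
  shows "(atoms n I p, q) \<in> state_space"
  using assms finite_subset[OF assms(2) finite_alive] by (auto simp: state_space_def intro: atoms_halfline)

lemma scaled_state_in: "0 \<le> t \<Longrightarrow> scaled_state n E v w k X Q t \<omega> \<in> state_space"
  unfolding scaled_state_eq by (rule atoms_state[of _ _ t]) (auto simp: alive_def)

lemma state_dist_atoms:
  assumes "finite I" "\<And>i. i \<in> I \<Longrightarrow> 0 \<le> p i" "\<And>i. i \<in> I \<Longrightarrow> 0 \<le> p' i" "0 < e" "\<And>i. i \<in> I \<Longrightarrow> \<bar>p i - p' i\<bar> < e"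
  shows "state_dist (atoms n I p, q) (atoms n I p', q) \<le> e"
proof -
  have H: "atoms n I p \<in> halfline_measures" "atoms n I p' \<in> halfline_measures"
    using atoms_halfline[OF assms(1,2)] atoms_halfline[OF assms(1,3)] by auto
  have "prohorov_close (atoms n I p) (atoms n I p') e" by (rule prohorov_close_atoms[OF assms])
  then have "\<bar>prohorov_dist (atoms n I p) (atoms n I p')\<bar> \<le> e"
    using prohorov_dist_le[OF assms(4)] prohorov_dist_nonneg[OF H] by simp
  then show ?thesis using state_dist_le[of "atoms n I p" "atoms n I p'" e q q 0] by simp
qed

lemma started_const_right:
  assumes t: "0 \<le> t"
  obtains h where "0 < h" "\<And>s. t \<le> s \<Longrightarrow> s < t + h \<Longrightarrow> Q s \<omega> = Q t \<omega> \<and> started_upto \<omega> s = started_upto \<omega> t"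
proof -
  obtain h1 where h1: "0 < h1" "\<And>s. t \<le> s \<Longrightarrow> s < t + h1 \<Longrightarrow> X s \<omega> = X t \<omega>"
    using cadlag_discrete_right[OF _ head_count_cadlag' t] by auto
  obtain h2 where h2: "0 < h2" "\<And>s. t \<le> s \<Longrightarrow> s < t + h2 \<Longrightarrow> E s \<omega> = E t \<omega>"
    using cadlag_discrete_right[OF servers arrivals_cadlag[OF \<omega>] t] by auto
  show thesis
  proof (rule that[of "min h1 h2"])
    fix s assume s: "t \<le> s" "s < t + min h1 h2"
    then have "Q s \<omega> = Q t \<omega>" using h1(2)[of s] queue_eq[of s] queue_eq[OF t] t by simp
    then show "Q s \<omega> = Q t \<omega> \<and> started_upto \<omega> s = started_upto \<omega> t"
      using h2(2)[of s] s t by (simp add: started_upto_def last_started_def max_absorb1)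
  qed (use h1 h2 in auto)
qed

lemma started_const_left:
  assumes t: "0 < t"
  obtains h where "0 < h" "h \<le> t" "\<And>s s'. t - h < s \<Longrightarrow> s < t \<Longrightarrow> t - h < s' \<Longrightarrow> s' < t \<Longrightarrow> Q s \<omega> = Q s' \<omega> \<and> started_upto \<omega> s = started_upto \<omega> s'"
proof -
  obtain h1 where h1: "0 < h1" "h1 \<le> t" "\<And>s s'. t - h1 < s \<Longrightarrow> s < t \<Longrightarrow> t - h1 < s' \<Longrightarrow> s' < t \<Longrightarrow> X s \<omega> = X s' \<omega>"
    using cadlag_discrete_left[OF zero_less_one head_count_cadlag' t] by auto
  obtain h2 where h2: "0 < h2" "h2 \<le> t" "\<And>s s'. t - h2 < s \<Longrightarrow> s < t \<Longrightarrow> t - h2 < s' \<Longrightarrow> s' < t \<Longrightarrow> E s \<omega> = E s' \<omega>"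
    using cadlag_discrete_left[OF servers arrivals_cadlag[OF \<omega>] t] by auto
  show thesis
  proof (rule that[of "min h1 h2"])
    fix s s' assume s: "t - min h1 h2 < s" "s < t" "t - min h1 h2 < s'" "s' < t"
    then have p: "0 \<le> s" "0 \<le> s'" using h1(2) by auto
    have "Q s \<omega> = Q s' \<omega>" using h1(3)[of s s'] queue_eq[OF p(1)] queue_eq[OF p(2)] s by simp
    then show "Q s \<omega> = Q s' \<omega> \<and> started_upto \<omega> s = started_upto \<omega> s'"
      using h2(3)[of s s'] s p by (simp add: started_upto_def last_started_def max_absorb1)
  qed (use h1 h2 in auto)
qed

lemma finite_min_gap:
  assumes "finite I" "\<And>i. i \<in> I \<Longrightarrow> 0 < f i"
  obtains c :: real where "0 < c" "\<And>i. i \<in> I \<Longrightarrow> c \<le> f i"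
proof -
  let ?A = "insert 1 (f ` I)"
  have "0 < Min ?A" by (subst Min_gr_iff) (use assms in auto)
  moreover have "Min ?A \<le> f i" if "i \<in> I" for i by (rule Min_le) (use assms that in auto)
  ultimately show thesis using that by blast
qed

text \<open>Between starts and departures the atoms move continuously. So two things have to be
  seen: just after \<open>t\<close> nobody starts or leaves, and just before \<open>t\<close> the
  set of customers in service is eventually constant.\<close>

lemma path_cadlag: "(\<lambda>t\<in>{0..}. scaled_state n E v w k X Q t \<omega>) \<in> cadlag_paths state_space state_dist"
proof -
  let ?Z = "\<lambda>t\<in>{0..}. scaled_state n E v w k X Q t \<omega>"
  let ?p = "\<lambda>t i. requirement \<omega> i - attained \<omega> i t"
  obtain C where C: "0 < C" "\<And>i s t. 0 \<le> s \<Longrightarrow> s \<le> t \<Longrightarrow> attained \<omega> i s \<le> attained \<omega> i t \<and> attained \<omega> i t \<le> attained \<omega> i s + C * (t - s)"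
    by (rule attained_mono_Lipschitz) blast
  have zs: "?Z t = (atoms n (alive \<omega> t) (?p t), real (Q t \<omega>) / real n)" if "0 \<le> t" for t
    using scaled_state_eq[OF that] that by simp
  have Zin: "?Z t \<in> state_space" if "0 \<le> t" for t using scaled_state_in[OF that] that by simp
  show ?thesis
    unfolding cadlag_paths_def
  proof (intro CollectI conjI allI impI)
    show "?Z \<in> {0..} \<rightarrow>\<^sub>E state_space" using scaled_state_in by auto
  next
    fix t :: real assume t: "0 \<le> t"
    obtain h where h: "0 < h" "\<And>s. t \<le> s \<Longrightarrow> s < t + h \<Longrightarrow> Q s \<omega> = Q t \<omega> \<and> started_upto \<omega> s = started_upto \<omega> t"
      by (rule started_const_right[OF t]) blast
    \<comment> \<open>The least remaining requirement: nobody leaves before an amount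
      \<open>c\<close> of work has been done.\<close>
    obtain c where c: "0 < c" "\<And>i. i \<in> alive \<omega> t \<Longrightarrow> c \<le> ?p t i"
      by (rule finite_min_gap[OF finite_alive[of \<omega> t], of "?p t"]) (auto simp: alive_def)
    show "limitin State.mtopology ?Z (?Z t) (at_right t)"
      unfolding State.limitin_at_within_real
    proof (intro conjI allI impI)
      fix e :: real assume e: "0 < e"
      define h' where "h' = min h (min (c / C) (e / (2 * C)))"
      have h': "0 < h'" "h' \<le> h" "C * h' \<le> c" "C * h' \<le> e / 2"
      proof -
        have "h' \<le> c / C" "h' \<le> e / (2 * C)" by (auto simp: h'_def)
        then have "C * h' \<le> C * (c / C)" "C * h' \<le> C * (e / (2 * C))" using C(1) by (auto simp only: intro!: mult_left_mono)
        then show "C * h' \<le> c" "C * h' \<le> e / 2" using C(1) by auto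
      qed (use h c C e in \<open>auto simp: h'_def\<close>)
      show "\<exists>h>0. \<forall>s\<in>{t<..}. s \<noteq> t \<and> \<bar>s - t\<bar> < h \<longrightarrow> ?Z s \<in> state_space \<and> state_dist (?Z s) (?Z t) < e"
      proof (rule exI[of _ h'], intro conjI ballI impI h'(1))
        fix s assume s': "s \<in> {t<..}" "s \<noteq> t \<and> \<bar>s - t\<bar> < h'"
        then have s: "t \<le> s" "s < t + h'" "0 \<le> s" using t by auto
        then show "?Z s \<in> state_space" using Zin by blast
        have q: "Q s \<omega> = Q t \<omega>" "started_upto \<omega> s = started_upto \<omega> t" using h(2)[of s] s h'(2) by auto
        have Cs: "C * (s - t) < C * h'" using C(1) s by auto
        have al: "alive \<omega> s = alive \<omega> t"
        proof (intro equalityI subsetI)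
          fix i assume "i \<in> alive \<omega> s"
          then show "i \<in> alive \<omega> t" using q C(2)[OF t s(1), of i] by (auto simp: alive_def)
        next
          fix i assume i: "i \<in> alive \<omega> t"
          then show "i \<in> alive \<omega> s" using q C(2)[OF t s(1), of i] c(2)[OF i] Cs h'(3) by (auto simp: alive_def)
        qed
        have "state_dist (atoms n (alive \<omega> t) (?p s), real (Q t \<omega>) / real n) (atoms n (alive \<omega> t) (?p t), real (Q t \<omega>) / real n) \<le> e / 2"
        proof (rule state_dist_atoms[OF finite_alive])
          show "0 \<le> ?p s i" if "i \<in> alive \<omega> t" for i using that unfolding al[symmetric] by (simp add: alive_def)
          show "0 \<le> ?p t i" if "i \<in> alive \<omega> t" for i using that by (simp add: alive_def)
          show "\<bar>?p s i - ?p t i\<bar> < e / 2" for i using C(2)[OF t s(1), of i] Cs h'(4) by linarith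
        qed (use e in simp)
        then show "state_dist (?Z s) (?Z t) < e" using zs[OF s(3)] zs[OF t] al q e by simp
      qed
    qed (rule Zin[OF t])
  next
    fix t :: real assume t: "0 < t"
    obtain h where h: "0 < h" "h \<le> t" "\<And>s s'. t - h < s \<Longrightarrow> s < t \<Longrightarrow> t - h < s' \<Longrightarrow> s' < t \<Longrightarrow> Q s \<omega> = Q s' \<omega> \<and> started_upto \<omega> s = started_upto \<omega> s'"
      by (rule started_const_left[OF t]) blast
    define s0 where "s0 = t - h / 2"
    have s0: "t - h < s0" "s0 < t" "0 \<le> s0" using h by (auto simp: s0_def)
    \<comment> \<open>Nobody starts in this window, so the set of customers in service can only
      shrink; being finite, it becomes constant before \<open>t\<close>.\<close>
    have dec: "alive \<omega> s' \<subseteq> alive \<omega> s" if s: "s0 \<le> s" "s \<le> s'" "s' < t" for s s'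
    proof
      fix i assume i: "i \<in> alive \<omega> s'"
      have "started_upto \<omega> s = started_upto \<omega> s'" using h(3)[of s s'] s s0 by auto
      moreover have "attained \<omega> i s \<le> attained \<omega> i s'" using C(2)[of s s' i] s s0 by auto
      ultimately show "i \<in> alive \<omega> s" using i by (auto simp: alive_def)
    qed
    define J where "J = {i \<in> alive \<omega> s0. \<forall>s. s0 \<le> s \<and> s < t \<longrightarrow> i \<in> alive \<omega> s}"
    have Jfin: "finite J" "J \<subseteq> alive \<omega> s0" using finite_alive[of \<omega> s0] by (auto simp: J_def)
    have "\<exists>s. s0 \<le> s \<and> s < t \<and> alive \<omega> s \<subseteq> J"
    proof -
      have "\<forall>i\<in>alive \<omega> s0 - J. \<exists>s. s0 \<le> s \<and> s < t \<and> i \<notin> alive \<omega> s" by (auto simp: J_def)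
      then obtain f where f: "\<And>i. i \<in> alive \<omega> s0 - J \<Longrightarrow> s0 \<le> f i \<and> f i < t \<and> i \<notin> alive \<omega> (f i)" by metis
      define s where "s = Max (insert s0 (f ` (alive \<omega> s0 - J)))"
      have fin: "finite (insert s0 (f ` (alive \<omega> s0 - J)))" using finite_alive[of \<omega> s0] by auto
      have s: "s0 \<le> s" "\<And>i. i \<in> alive \<omega> s0 - J \<Longrightarrow> f i \<le> s" unfolding s_def using fin by auto
      have "s < t" unfolding s_def by (subst Max_less_iff[OF fin]) (use f s0 in auto)
      moreover have "alive \<omega> s \<subseteq> J"
      proof
        fix i assume i: "i \<in> alive \<omega> s"
        then have "i \<in> alive \<omega> s0" using dec[OF order_refl s(1) \<open>s < t\<close>] by auto
        show "i \<in> J"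
        proof (rule ccontr)
          assume "i \<notin> J"
          then have "i \<in> alive \<omega> s0 - J" using \<open>i \<in> alive \<omega> s0\<close> by auto
          then show False using f[of i] s(2)[of i] dec[of "f i" s] \<open>s < t\<close> i by auto
        qed
      qed
      ultimately show ?thesis using s(1) by blast
    qed
    then obtain s1 where s1: "s0 \<le> s1" "s1 < t" "alive \<omega> s1 \<subseteq> J" by blast
    have alJ: "alive \<omega> s = J" if "s1 \<le> s" "s < t" for s
      using dec[OF s1(1) that] s1(3) that s1(1) by (auto simp: J_def)
    \<comment> \<open>Customers leaving exactly at \<open>t\<close> have remaining requirement 0 in
      the left limit, so only the weak inequality holds and the limit may have an atom at 0.\<close>
    have pJ: "0 \<le> ?p t i" if i: "i \<in> J" for i
    proof (rule field_le_epsilon)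
      fix e :: real assume e: "0 < e"
      define s where "s = max s1 (t - e / C)"
      have s: "s1 \<le> s" "s < t" "0 \<le> s" "t - s \<le> e / C" using s1 s0 e C(1) by (auto simp: s_def)
      have "attained \<omega> i s < requirement \<omega> i" using alJ[OF s(1,2)] i by (auto simp: alive_def)
      moreover have "C * (t - s) \<le> e" using mult_left_mono[OF s(4), of C] C(1) by simp
      ultimately show "0 \<le> ?p t i + e" using C(2)[OF s(3), of t i] s(2) by auto
    qed
    show "\<exists>l. limitin State.mtopology ?Z l (at_left t)"
    proof (rule exI[of _ "(atoms n J (?p t), real (Q s0 \<omega>) / real n)"], unfold State.limitin_at_within_real, intro conjI allI impI)
      show "(atoms n J (?p t), real (Q s0 \<omega>) / real n) \<in> state_space"
        by (rule atoms_state[OF _ Jfin(2) pJ]) auto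
      fix e :: real assume e: "0 < e"
      define h' where "h' = min (t - s1) (e / (2 * C))"
      have h': "0 < h'" "h' \<le> t - s1" using s1 e C by (auto simp: h'_def)
      have "C * h' \<le> C * (e / (2 * C))" using C(1) by (intro mult_left_mono) (auto simp: h'_def)
      then have Ch: "C * h' \<le> e / 2" using C(1) by simp
      show "\<exists>h>0. \<forall>s\<in>{..<t}. s \<noteq> t \<and> \<bar>s - t\<bar> < h \<longrightarrow>
          ?Z s \<in> state_space \<and> state_dist (?Z s) (atoms n J (?p t), real (Q s0 \<omega>) / real n) < e"
      proof (rule exI[of _ h'], intro conjI ballI impI h'(1))
        fix s assume s': "s \<in> {..<t}" "s \<noteq> t \<and> \<bar>s - t\<bar> < h'"
        then have s: "s1 \<le> s" "s < t" "0 \<le> s" "t - s < h'" using h' s1 s0 by auto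
        then show "?Z s \<in> state_space" using Zin by blast
        have q: "Q s \<omega> = Q s0 \<omega>" using h(3)[of s s0] s s1 s0 by auto
        have Cs: "C * (t - s) < C * h'" using C(1) s by auto
        have "state_dist (atoms n J (?p s), real (Q s0 \<omega>) / real n) (atoms n J (?p t), real (Q s0 \<omega>) / real n) \<le> e / 2"
        proof (rule state_dist_atoms[OF Jfin(1) _ pJ])
          show "0 \<le> ?p s i" if "i \<in> J" for i using that unfolding alJ[OF s(1,2), symmetric] by (simp add: alive_def)
          show "\<bar>?p s i - ?p t i\<bar> < e / 2" for i using C(2)[OF s(3), of t i] s(2) Cs Ch by linarith
          show "0 < e / 2" by (rule half_gt_zero[OF e])
        qed
        then show "state_dist (?Z s) (atoms n J (?p t), real (Q s0 \<omega>) / real n) < e"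
          using zs[OF s(3)] alJ[OF s(1,2)] q e by simp
      qed
    qed
  qed
qed

end

end

section \<open>Measurability of the state of the queue\<close>

text \<open>A finite initial segment of the naturals is described by its cardinality. For the
  arrival epochs this turns the count \<open>E t\<close> into comparisons of partial sums with
  \<open>t\<close>.\<close>

lemma finite_downclosed_nat:
  assumes "finite A" "\<And>i j :: nat. j \<in> A \<Longrightarrow> i \<le> j \<Longrightarrow> i \<in> A"
  shows "j < card A \<longleftrightarrow> j \<in> A"
proof -
  obtain m where m: "A = {..<m}"
  proof (cases "A = {}")
    case True then show ?thesis using that[of 0] by simp
  next
    case False
    have "A = {..<Suc (Max A)}"
    proof (intro equalityI subsetI)
      fix i assume "i \<in> A" then show "i \<in> {..<Suc (Max A)}" using Max_ge[OF assms(1)] by (simp add: less_Suc_eq_le)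
    next
      fix i assume "i \<in> {..<Suc (Max A)}"
      then show "i \<in> A" using assms(2)[OF Max_in[OF assms(1) False], of i] by simp
    qed
    then show ?thesis by (rule that)
  qed
  then show ?thesis by simp
qed

lemma right_grid_limit:
  fixes u h :: real assumes "0 < h"
  obtains N where "\<And>m. N \<le> m \<Longrightarrow> u < (of_int \<lfloor>u * real (Suc m)\<rfloor> + 1) / real (Suc m) \<and> (of_int \<lfloor>u * real (Suc m)\<rfloor> + 1) / real (Suc m) < u + h"
proof -
  obtain N where N: "1 / real (Suc N) < h" using nat_approx_posE[OF assms] by auto
  show thesis
  proof (rule that[of N])
    fix m assume m: "N \<le> m"
    define r where "r = real (Suc m)"
    have r: "0 < r" "1 / r < h" using N m frac_le[of 1 1 "real (Suc N)" r] by (auto simp: r_def)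
    define z where "z = real_of_int \<lfloor>u * r\<rfloor>"
    have z: "z \<le> u * r" "u * r < z + 1" unfolding z_def by linarith+
    have "u < (z + 1) / r" using z(2) r(1) by (simp add: pos_less_divide_eq)
    moreover have "(z + 1) / r \<le> (u * r + 1) / r" using z(1) r(1) by (intro divide_right_mono) auto
    moreover have "(u * r + 1) / r = u + 1 / r" using r(1) by (simp add: add_divide_distrib)
    ultimately show "u < (of_int \<lfloor>u * real (Suc m)\<rfloor> + 1) / real (Suc m) \<and> (of_int \<lfloor>u * real (Suc m)\<rfloor> + 1) / real (Suc m) < u + h"
      using r(2) unfolding z_def r_def by linarith
  qed
qed

text \<open>The process is sampled at the next grid point, which depends on \<open>u\<close> through
  an integer only; local constancy to the right makes the samples equal to the value from some index
  on.\<close>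

lemma right_constant_jointly_measurable:
  fixes Y :: "real \<Rightarrow> 'w \<Rightarrow> 'c::countable"
  assumes Y: "\<And>u. Y u \<in> N \<rightarrow>\<^sub>M count_space UNIV"
    and rc: "\<And>\<omega> u. \<omega> \<in> space N \<Longrightarrow> \<exists>h>0. \<forall>s. u \<le> s \<and> s < u + h \<longrightarrow> Y s \<omega> = Y u \<omega>"
  shows "(\<lambda>(\<omega>, u). Y u \<omega>) \<in> N \<Otimes>\<^sub>M borel \<rightarrow>\<^sub>M count_space UNIV"
proof (subst measurable_count_space_eq_countable, simp, intro conjI ballI)
  let ?p = "\<lambda>m u. (of_int \<lfloor>u * real (Suc m)\<rfloor> + 1) / real (Suc m)"
  fix c
  have A: "{p \<in> space (N \<Otimes>\<^sub>M borel). Y (?p m (snd p)) (fst p) = c} \<in> sets (N \<Otimes>\<^sub>M borel)" for m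
  proof -
    have "{p \<in> space (N \<Otimes>\<^sub>M borel). Y (?p m (snd p)) (fst p) = c} =
        (\<Union>z. {\<omega> \<in> space N. Y ((of_int z + 1) / real (Suc m)) \<omega> = c} \<times> {u \<in> space borel. \<lfloor>u * real (Suc m)\<rfloor> = z})"
      by (auto simp: space_pair_measure)
    moreover have "{\<omega> \<in> space N. Y ((of_int z + 1) / real (Suc m)) \<omega> = c} \<in> sets N" for z
    proof -
      have "Y ((of_int z + 1) / real (Suc m)) -` {c} \<inter> space N \<in> sets N" by (rule measurable_sets[OF Y]) simp
      then show ?thesis by (simp add: vimage_def Int_def conj_commute)
    qed
    moreover have "{u \<in> space borel. \<lfloor>u * real (Suc m)\<rfloor> = z} \<in> sets borel" for z by measurable
    ultimately show ?thesis by (auto intro!: sets.countable_UN'')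
  qed
  have "(\<lambda>(\<omega>, u). Y u \<omega>) -` {c} \<inter> space (N \<Otimes>\<^sub>M borel) =
      (\<Union>j. \<Inter>m\<in>{j..}. {p \<in> space (N \<Otimes>\<^sub>M borel). Y (?p m (snd p)) (fst p) = c})"
  proof (intro equalityI subsetI)
    fix p assume p: "p \<in> (\<lambda>(\<omega>, u). Y u \<omega>) -` {c} \<inter> space (N \<Otimes>\<^sub>M borel)"
    obtain \<omega> u where pu: "p = (\<omega>, u)" by (cases p)
    then have \<omega>: "\<omega> \<in> space N" "Y u \<omega> = c" using p by (auto simp: space_pair_measure)
    obtain h where h: "0 < h" "\<And>s. u \<le> s \<Longrightarrow> s < u + h \<Longrightarrow> Y s \<omega> = Y u \<omega>" using rc[OF \<omega>(1), of u] by blast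
    obtain j where "\<And>m. j \<le> m \<Longrightarrow> u < ?p m u \<and> ?p m u < u + h" using right_grid_limit[OF h(1)] by blast
    then have "Y (?p m u) \<omega> = c" if "j \<le> m" for m using h(2)[of "?p m u"] \<omega>(2) that by (simp add: less_imp_le del: of_nat_Suc)
    then show "p \<in> (\<Union>j. \<Inter>m\<in>{j..}. {p \<in> space (N \<Otimes>\<^sub>M borel). Y (?p m (snd p)) (fst p) = c})"
      using p pu by (auto simp del: of_nat_Suc)
  next
    fix p assume "p \<in> (\<Union>j. \<Inter>m\<in>{j..}. {p \<in> space (N \<Otimes>\<^sub>M borel). Y (?p m (snd p)) (fst p) = c})"
    then obtain j where j: "\<And>m. j \<le> m \<Longrightarrow> p \<in> space (N \<Otimes>\<^sub>M borel) \<and> Y (?p m (snd p)) (fst p) = c" by blast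
    obtain \<omega> u where pu: "p = (\<omega>, u)" by (cases p)
    then have \<omega>: "\<omega> \<in> space N" using j[of j] by (auto simp: space_pair_measure)
    obtain h where h: "0 < h" "\<And>s. u \<le> s \<Longrightarrow> s < u + h \<Longrightarrow> Y s \<omega> = Y u \<omega>" using rc[OF \<omega>(1), of u] by blast
    obtain j' where j': "\<And>m. j' \<le> m \<Longrightarrow> u < ?p m u \<and> ?p m u < u + h" using right_grid_limit[OF h(1)] by blast
    have "Y (?p (max j j') u) \<omega> = Y u \<omega>" using h(2)[of "?p (max j j') u"] j'[of "max j j'"] by (simp add: less_imp_le del: of_nat_Suc)
    then have "Y u \<omega> = c" using j[of "max j j'"] pu by (simp del: of_nat_Suc)
    then show "p \<in> (\<lambda>(\<omega>, u). Y u \<omega>) -` {c} \<inter> space (N \<Otimes>\<^sub>M borel)" using j[of j] pu by auto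
  qed
  also have "\<dots> \<in> sets (N \<Otimes>\<^sub>M borel)"
    by (intro sets.countable_UN'' sets.countable_INT' countableI_type) (use A in auto)
  finally show "(\<lambda>(\<omega>, u). Y u \<omega>) -` {c} \<inter> space (N \<Otimes>\<^sub>M borel) \<in> sets (N \<Otimes>\<^sub>M borel)" .
qed simp

context cadlag_queue
begin

lemma arrivals_measurable: assumes t: "0 \<le> t" shows "E t \<in> P \<rightarrow>\<^sub>M count_space UNIV"
proof -
  obtain \<xi> :: "nat \<Rightarrow> 'a \<Rightarrow> real" where \<xi>: "indep_vars (\<lambda>_. borel) \<xi> UNIV" "\<And>j \<omega>. \<omega> \<in> space P \<Longrightarrow> 0 < \<xi> j \<omega>"
    "\<And>\<omega>. \<omega> \<in> space P \<Longrightarrow> finite {j. (\<Sum>i\<le>j. \<xi> i \<omega>) \<le> t}" "\<And>\<omega>. \<omega> \<in> space P \<Longrightarrow> E t \<omega> = card {j. (\<Sum>i\<le>j. \<xi> i \<omega>) \<le> t}"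
    using arrivals t unfolding renewal_process_def by blast
  have [measurable]: "\<xi> i \<in> borel_measurable P" for i using \<xi>(1) by (auto simp: indep_vars_def)
  have lt: "j < E t \<omega> \<longleftrightarrow> (\<Sum>i\<le>j. \<xi> i \<omega>) \<le> t" if \<omega>: "\<omega> \<in> space P" for j \<omega>
  proof -
    have "(\<Sum>i\<le>i'. \<xi> i \<omega>) \<le> (\<Sum>i\<le>j. \<xi> i \<omega>)" if "i' \<le> j" for i' j
      by (rule sum_mono2) (use that \<xi>(2)[OF \<omega>] in \<open>auto intro: less_imp_le\<close>)
    then have "j < card {j. (\<Sum>i\<le>j. \<xi> i \<omega>) \<le> t} \<longleftrightarrow> j \<in> {j. (\<Sum>i\<le>j. \<xi> i \<omega>) \<le> t}"
      by (intro finite_downclosed_nat[OF \<xi>(3)[OF \<omega>]]) (auto intro: order_trans)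
    then show ?thesis using \<xi>(4)[OF \<omega>] by simp
  qed
  show ?thesis
  proof (subst measurable_count_space_eq_countable, simp, intro conjI ballI)
    fix m
    have "E t -` {m} \<inter> space P = {\<omega> \<in> space P. \<not> (\<Sum>i\<le>m. \<xi> i \<omega>) \<le> t \<and> (\<forall>j<m. (\<Sum>i\<le>j. \<xi> i \<omega>) \<le> t)}"
      using lt by (auto simp: not_less) (metis less_irrefl linorder_neqE_nat not_less)
    also have "\<dots> \<in> sets P" by measurable
    finally show "E t -` {m} \<inter> space P \<in> sets P" .
  qed simp
qed

lemma queue_measurable: assumes t: "0 \<le> t" shows "Q t \<in> P \<rightarrow>\<^sub>M count_space UNIV"
proof -
  have "(\<lambda>\<omega>. X t \<omega> - n) \<in> P \<rightarrow>\<^sub>M count_space UNIV"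
    by (rule measurable_compose[OF head_count_measurable[OF t]]) simp
  then show ?thesis by (rule measurable_cong[THEN iffD1, rotated]) (simp add: queue_eq[OF _ t])
qed

lemma started_measurable: "(\<lambda>\<omega>. started_upto \<omega> t) \<in> P \<rightarrow>\<^sub>M count_space UNIV"
proof -
  have "(\<lambda>\<omega>. int (E (max t 0) \<omega>) - int q) \<in> P \<rightarrow>\<^sub>M count_space UNIV" for q
    by (rule measurable_compose[OF arrivals_measurable]) simp_all
  then have "(\<lambda>\<omega>. int (E (max t 0) \<omega>) - int (Q (max t 0) \<omega>)) \<in> P \<rightarrow>\<^sub>M count_space UNIV"
    by (rule measurable_compose_countable[OF _ queue_measurable]) simp
  then show ?thesis by (simp add: started_upto_def last_started_def)
qed

text \<open>The integrand is a function of the head count and of the last started index, a jointly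
  measurable process with countably many states. The integral over time is then measurable in the
  sample point.\<close>

lemma attained_measurable: "(\<lambda>\<omega>. attained \<omega> i t) \<in> borel_measurable P"
proof -
  define Y where "Y u \<omega> = (X (max u 0) \<omega>, started_upto \<omega> u)" for u \<omega>
  have Ym: "Y u \<in> P \<rightarrow>\<^sub>M count_space UNIV" for u
  proof -
    have "(\<lambda>\<omega>. (x, started_upto \<omega> u)) \<in> P \<rightarrow>\<^sub>M count_space UNIV" for x
      by (rule measurable_compose[OF started_measurable]) simp
    then show ?thesis unfolding Y_def
      by (rule measurable_compose_countable[where f = "\<lambda>x \<omega>. (x, started_upto \<omega> u)", OF _ head_count_measurable]) simp
  qed
  have Yr: "\<exists>h>0. \<forall>s. u \<le> s \<and> s < u + h \<longrightarrow> Y s \<omega> = Y u \<omega>" if \<omega>: "\<omega> \<in> space P" for \<omega> u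
  proof (cases "0 \<le> u")
    case True
    obtain h1 where h1: "0 < h1" "\<And>s. u \<le> s \<Longrightarrow> s < u + h1 \<Longrightarrow> X s \<omega> = X u \<omega>"
      using cadlag_discrete_right[OF zero_less_one head_count_cadlag'[OF \<omega>] True] by blast
    obtain h2 where h2: "0 < h2" "\<And>s. u \<le> s \<Longrightarrow> s < u + h2 \<Longrightarrow> Q s \<omega> = Q u \<omega> \<and> started_upto \<omega> s = started_upto \<omega> u"
      by (rule started_const_right[OF \<omega> True]) blast
    show ?thesis
    proof (rule exI[of _ "min h1 h2"], intro conjI allI impI)
      show "0 < min h1 h2" using h1(1) h2(1) by simp
      fix s assume s: "u \<le> s \<and> s < u + min h1 h2"
      then have "X s \<omega> = X u \<omega>" "started_upto \<omega> s = started_upto \<omega> u"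
        by (auto intro!: h1(2) h2(2)[THEN conjunct2])
      then show "Y s \<omega> = Y u \<omega>" using s True by (simp add: Y_def max_absorb1)
    qed
  next
    case False
    show ?thesis
    proof (rule exI[of _ "- u"], intro conjI allI impI)
      show "0 < - u" using False by simp
      fix s assume "u \<le> s \<and> s < u + - u"
      then have "max s 0 = 0" "max u 0 = 0" by (simp_all add: max_absorb2)
      then show "Y s \<omega> = Y u \<omega>" by (simp only: Y_def started_upto_def)
    qed
  qed
  \<comment> \<open>\<open>F\<close> lives on a countable discrete space, where every function is
    measurable; in particular the composition with \<open>k\<close> is.\<close>
  define F where "F = (\<lambda>(x :: nat, b). indicator {..b} i * k (real x / real n))"
  have Yj: "(\<lambda>(\<omega>, u). Y u \<omega>) \<in> P \<Otimes>\<^sub>M borel \<rightarrow>\<^sub>M count_space UNIV"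
    by (rule right_constant_jointly_measurable[OF Ym Yr])
  have Fm: "(\<lambda>p. F ((\<lambda>(\<omega>, u). Y u \<omega>) p)) \<in> borel_measurable (P \<Otimes>\<^sub>M borel)"
    by (rule measurable_compose[OF Yj]) simp
  have im: "(\<lambda>p. indicator {0..t} (snd p) :: real) \<in> borel_measurable (P \<Otimes>\<^sub>M borel)"
    by (rule measurable_compose[OF measurable_snd borel_measurable_indicator]) simp
  have "(\<lambda>p. indicator {0..t} (snd p) * F ((\<lambda>(\<omega>, u). Y u \<omega>) p)) \<in> borel_measurable (P \<Otimes>\<^sub>M borel)"
    by (rule borel_measurable_times[OF im Fm])
  also have "(\<lambda>p. indicator {0..t} (snd p) * F ((\<lambda>(\<omega>, u). Y u \<omega>) p)) =
      (\<lambda>(\<omega>, u). indicator {0..t} u *\<^sub>R (indicator {..started_upto \<omega> u} i * speed \<omega> u))"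
    by (simp add: fun_eq_iff F_def Y_def speed_def)
  also have "borel_measurable (P \<Otimes>\<^sub>M borel) = borel_measurable (P \<Otimes>\<^sub>M lborel)"
    by (rule measurable_cong_sets[OF sets_pair_measure_cong refl]) simp_all
  finally show ?thesis
    unfolding attained_def set_lebesgue_integral_def by (rule lborel.borel_measurable_lebesgue_integral)
qed

lemma requirement_measurable: "(\<lambda>\<omega>. requirement \<omega> i) \<in> borel_measurable P"
proof -
  have [measurable]: "v i \<in> borel_measurable P" using requirements_indep by (auto simp: indep_vars_def)
  have [measurable]: "w i \<in> borel_measurable P" by (rule residuals_measurable)
  have "(\<lambda>\<omega>. if i \<le> - int q then w i \<omega> else v i \<omega>) \<in> borel_measurable P" for q by measurable
  then show ?thesis unfolding requirement_def
    by (rule measurable_compose_countable[where f = "\<lambda>q \<omega>. if i \<le> - int q then w i \<omega> else v i \<omega>", OF _ queue_measurable]) simp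
qed

text \<open>The state at a fixed time is approximated by finitely many integers: the customers in service
  together with their remaining requirements rounded up to multiples of \<open>1 / (m + 1)\<close>.\<close>

definition code_item :: "nat \<Rightarrow> real \<Rightarrow> 'a \<Rightarrow> int \<Rightarrow> (int \<times> int) list" where
  "code_item m t \<omega> i = (if attained \<omega> i t < requirement \<omega> i
     then [(i, \<lceil>(requirement \<omega> i - attained \<omega> i t) * real (Suc m)\<rceil>)] else [])"

definition code :: "nat \<Rightarrow> real \<Rightarrow> 'a \<Rightarrow> (int \<times> int) list \<times> nat" where
  "code m t \<omega> = (concat (map (code_item m t \<omega>) [- int (X 0 \<omega>) + 1 .. started_upto \<omega> t]), Q t \<omega>)"

definition decode :: "nat \<Rightarrow> (int \<times> int) list \<times> nat \<Rightarrow> real measure \<times> real" where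
  "decode m c = (atoms n (fst ` set (fst c)) (\<lambda>i. of_int (the (map_of (fst c) i)) / real (Suc m)), real (snd c) / real n)"

lemma code_measurable: assumes t: "0 \<le> t" shows "code m t \<in> P \<rightarrow>\<^sub>M count_space UNIV"
proof -
  note [measurable] = attained_measurable requirement_measurable
  have item: "(\<lambda>\<omega>. code_item m t \<omega> i) \<in> P \<rightarrow>\<^sub>M count_space UNIV" for i
  proof -
    have "(\<lambda>\<omega>. \<lceil>(requirement \<omega> i - attained \<omega> i t) * real (Suc m)\<rceil>) \<in> P \<rightarrow>\<^sub>M count_space UNIV" by measurable
    then have [measurable]: "(\<lambda>\<omega>. [(i, \<lceil>(requirement \<omega> i - attained \<omega> i t) * real (Suc m)\<rceil>)]) \<in> P \<rightarrow>\<^sub>M count_space UNIV"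
      by (rule measurable_compose) simp
    show ?thesis unfolding code_item_def by measurable
  qed
  have one: "(\<lambda>\<omega>. (concat (map (code_item m t \<omega>) xs), q)) \<in> P \<rightarrow>\<^sub>M count_space UNIV" for xs and q :: nat
    by (rule measurable_compose[OF measurable_count_space_map[OF item]]) simp
  have two: "(\<lambda>\<omega>. (concat (map (code_item m t \<omega>) xs), Q t \<omega>)) \<in> P \<rightarrow>\<^sub>M count_space UNIV" for xs
    by (rule measurable_compose_countable[OF one queue_measurable[OF t]])
  have three: "(\<lambda>\<omega>. (concat (map (code_item m t \<omega>) [a .. started_upto \<omega> t]), Q t \<omega>)) \<in> P \<rightarrow>\<^sub>M count_space UNIV" for a
    by (rule measurable_compose_countable[OF two started_measurable])
  show ?thesis
    unfolding code_def[abs_def]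
    by (rule measurable_compose_countable[OF three head_count_measurable, of 0 "\<lambda>x. - int x + 1"]) simp
qed

lemma decode_code:
  assumes t: "0 \<le> t" and \<omega>: "\<omega> \<in> space P"
  shows "decode m (code m t \<omega>) \<in> state_space"
    and "state_dist (decode m (code m t \<omega>)) (scaled_state n E v w k X Q t \<omega>) \<le> 1 / real (Suc m)"
proof -
  let ?p = "\<lambda>i. requirement \<omega> i - attained \<omega> i t"
  let ?c = "\<lambda>i. \<lceil>?p i * real (Suc m)\<rceil>"
  define L where "L = fst (code m t \<omega>)"
  have L: "L = map (\<lambda>i. (i, ?c i)) (filter (\<lambda>i. attained \<omega> i t < requirement \<omega> i) [- int (X 0 \<omega>) + 1 .. started_upto \<omega> t])"
  proof -
    have "concat (map (code_item m t \<omega>) xs) = map (\<lambda>i. (i, ?c i)) (filter (\<lambda>i. attained \<omega> i t < requirement \<omega> i) xs)" for xs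
      by (induction xs) (simp_all add: code_item_def)
    then show ?thesis by (simp add: L_def code_def)
  qed
  have dom: "fst ` set L = alive \<omega> t" unfolding L alive_def by (auto simp: image_image)
  have val: "map_of L i = Some (?c i)" if "i \<in> alive \<omega> t" for i
    using that unfolding L by (auto simp: map_of_map_restrict alive_def restrict_map_def)
  define p' where "p' i = real_of_int (the (map_of L i)) / real (Suc m)" for i
  have dec: "decode m (code m t \<omega>) = (atoms n (alive \<omega> t) p', real (Q t \<omega>) / real n)"
    unfolding decode_def p'_def L_def[symmetric] dom by (simp add: code_def)
  have pos: "0 < ?p i" if "i \<in> alive \<omega> t" for i using that by (simp add: alive_def)
  have p': "0 \<le> p' i \<and> \<bar>p' i - ?p i\<bar> < 1 / real (Suc m)" if i: "i \<in> alive \<omega> t" for i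
  proof -
    define r where "r = real (Suc m)"
    have r: "0 < r" by (simp add: r_def)
    have "p' i = of_int \<lceil>?p i * r\<rceil> / r" unfolding p'_def val[OF i] r_def by simp
    moreover have "?p i * r \<le> of_int \<lceil>?p i * r\<rceil>" "of_int \<lceil>?p i * r\<rceil> < ?p i * r + 1" by linarith+
    ultimately have "?p i \<le> p' i" "p' i < ?p i + 1 / r"
      using r by (simp_all add: pos_le_divide_eq pos_divide_less_eq distrib_right)
    then show ?thesis using pos[OF i] unfolding r_def by auto
  qed
  show "decode m (code m t \<omega>) \<in> state_space"
    unfolding dec by (rule atoms_state[OF \<omega>, of _ _ t]) (use p' in auto)
  show "state_dist (decode m (code m t \<omega>)) (scaled_state n E v w k X Q t \<omega>) \<le> 1 / real (Suc m)"
    unfolding dec scaled_state_eq[OF \<omega> t]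
    by (rule state_dist_atoms[OF \<omega> finite_alive]) (use p' pos in \<open>auto intro: less_imp_le simp del: of_nat_Suc\<close>)
qed

lemma path_measurable:
  "(\<lambda>\<omega>. \<lambda>t\<in>{0..}. scaled_state n E v w k X Q t \<omega>) \<in> P \<rightarrow>\<^sub>M borel_of_topology (skorohod_topology state_space state_dist)"
  by (rule State.measurable_random_path[where dec = decode and code = code])
    (use path_cadlag code_measurable decode_code in auto)

end

section \<open>Paths of the queue as approximate solutions\<close>

context fluid_data
begin

text \<open>The 3 is twice the error \<open>e\<close> from \<open>D\<close> in the boundary term and
  once from the initial tail. The other terms are the bound of \<open>flow_diff\<close> for a rate
  that is off by \<open>e\<close> and a \<open>D\<close> that is off by \<open>2 * e\<close>, over a
  time \<open>T\<close>.\<close>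

definition approximation_const :: "real \<Rightarrow> real" where
  "approximation_const T = 3 + flow_const T (lam * T + Q0 + (lam * T + Q0 + 3) + 1) * T + 2 * Cg * K * T"

text \<open>A statement about a single sample path: everything random has been put into hypotheses
  that hold on an event of high probability.\<close>

lemma queue_path_approximates:
  fixes P :: "'w measure" and N m n :: nat
  assumes queue: "cadlag_queue P n lam' E \<nu>' v w k' X Q" and \<omega>: "\<omega> \<in> space P"
    and T: "0 \<le> T" and e: "0 < e" "e \<le> 1"
    and initial_tail: "\<And>y. 0 \<le> y \<Longrightarrow> \<bar>measure (fst (scaled_state n E v w k' X Q 0 \<omega>)) {y<..} - F y\<bar> \<le> e"
    and initial_queue: "\<bar>real (Q 0 \<omega>) / real n - Q0\<bar> \<le> e"
    and arr: "\<And>t. 0 \<le> t \<Longrightarrow> t \<le> T \<Longrightarrow> \<bar>real (E t \<omega>) / real n - lam * t\<bar> \<le> e"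
    and k': "\<And>y. 0 \<le> y \<Longrightarrow> y \<le> lam * T + Q0 + 3 \<Longrightarrow> \<bar>k' y - k y\<bar> \<le> e" and kK1: "\<And>y. k y + 1 \<le> K"
    and N: "(lam * T + Q0 + 1) * real n \<le> real N"
    and dev: "\<And>a b y. - int N \<le> a \<Longrightarrow> a \<le> b \<Longrightarrow> b \<le> int N \<Longrightarrow> 0 \<le> y \<Longrightarrow>
      \<bar>(\<Sum>i\<in>{a<..b}. indicator {y<..} (v i \<omega>)) - of_int (b - a) * G y\<bar> \<le> c"
    and m: "0 < m" and c: "0 \<le> c"
  shows "approximate_solution T (approximation_const T * e + (real m * c + 2 * real N * (Cg * K * T / real m)) / real n)
    (\<lambda>t. real (X (max t 0) \<omega>) / real n)
    (\<lambda>t. of_int (last_started E Q (max t 0) \<omega> - last_started E Q 0 \<omega>) / real n)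
    (\<lambda>t y. measure (fst (scaled_state n E v w k' X Q t \<omega>)) {y<..})"
proof -
  interpret q: cadlag_queue P n lam' E \<nu>' v w k' X Q by (rule queue)
  define B where "B = q.started_upto \<omega>"
  define x where "x t = real (X (max t 0) \<omega>) / real n" for t
  define D where "D t = of_int (B t - B 0) / real n" for t
  define \<zeta> where "\<zeta> t y = measure (fst (scaled_state n E v w k' X Q t \<omega>)) {y<..}" for t y
  define M where "M = lam * T + Q0 + (lam * T + Q0 + 3) + 1"
  define r where "r = (real m * c + 2 * real N * (Cg * K * T / real m)) / real n"
  define e' where "e' = approximation_const T * e + r"
  have n: "0 < real n" using q.servers by simp
  have B: "mono B" unfolding B_def by (rule q.started_mono[OF \<omega>])
  have B0: "B 0 = - int (Q 0 \<omega>)" unfolding B_def by (rule q.started_0[OF \<omega>])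
  have Bt: "B t = int (E t \<omega>) - int (Q t \<omega>)" if "0 \<le> t" for t
    using that by (simp add: B_def q.started_upto_def last_started_def max_absorb1)
  have Bge: "B 0 \<le> B t" if "0 \<le> t" for t using monoD[OF B that] .
  have Qx: "real (Q t \<omega>) / real n = max (x t - 1) 0" if t: "0 \<le> t" for t
  proof -
    have "real (Q t \<omega>) / real n = max (real (X t \<omega>) - real n) 0 / real n"
      using q.work_conserving[OF t \<omega>] by simp
    also have "\<dots> = max (x t - 1) 0" using n t by (simp add: x_def max_absorb1 max_def field_simps)
    finally show ?thesis .
  qed
  have Deq: "D t = real (E t \<omega>) / real n - max (x t - 1) 0 + real (Q 0 \<omega>) / real n" if t: "0 \<le> t" for t
    using Qx[OF t] by (simp add: D_def Bt[OF t] B0 add_divide_distrib diff_divide_distrib)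
  \<comment> \<open>\<open>D\<close> and \<open>started x\<close> contain the same truncated head
    count, so they differ only by the errors of the arrivals and of the initial queue.\<close>
  have Dst: "\<bar>started x t - D t\<bar> \<le> 2 * e" if t: "0 \<le> t" "t \<le> T" for t
    using arr[OF t] initial_queue unfolding started_def Deq[OF t(1)] by linarith
  have lamt: "lam * t \<le> lam * T" "0 \<le> lam * t" if "0 \<le> t" "t \<le> T" for t
    using that lam0 by (auto intro: mult_left_mono)
  have x0: "0 \<le> x t" for t by (simp add: x_def)
  have D0: "0 \<le> D t" if "0 \<le> t" for t using Bge[OF that] n by (simp add: D_def)
  \<comment> \<open>\<open>D\<close> is nonnegative, so the queue is at most the arrivals plus the
    initial queue. The 3 consists of the scaled number of servers and two errors of at most
    1.\<close>
  have xle: "x t \<le> lam * t + Q0 + 3" if t: "0 \<le> t" "t \<le> T" for t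
  proof -
    have "max (x t - 1) 0 \<le> real (E t \<omega>) / real n + real (Q 0 \<omega>) / real n" using D0[OF t(1)] Deq[OF t(1)] by linarith
    then show ?thesis using arr[OF t] initial_queue e by linarith
  qed
  have xm: "x \<in> borel_measurable borel"
  proof -
    have "(\<lambda>u. real (X (max u 0) \<omega>)) \<in> borel_measurable borel"
      by (rule right_continuous_measurable[of "\<lambda>u. real (X u \<omega>)"])
        (rule cadlag_real_right_continuous[OF q.head_count_cadlag[OF \<omega>]])
    then show ?thesis unfolding x_def[abs_def] by measurable
  qed
  have xb: "bounded_borel_upto T (lam * T + Q0 + 3) x"
    by (rule head_bounded[OF xm]) (use x0 xle in auto)
  have sb: "bounded_borel_upto T M (started x)" unfolding M_def by (rule started_bounded[OF xb T])
  have Db: "bounded_borel_upto T M D"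
    unfolding bounded_borel_upto_def
  proof (intro conjI ballI)
    have "mono D" unfolding D_def using B n by (auto simp: mono_def divide_right_mono)
    then show "D \<in> borel_measurable borel" by (rule borel_measurable_mono)
    fix t assume t: "t \<in> {0..T}"
    then have t: "0 \<le> t" "t \<le> T" by auto
    have "0 \<le> max (x t - 1) 0" by simp
    then show "\<bar>D t\<bar> \<le> M"
      using D0[OF t(1)] Deq[OF t(1)] arr[OF t] initial_queue e lamt[OF t] Q0 unfolding M_def by linarith
  qed
  obtain C where sp: "q.speed \<omega> \<in> borel_measurable borel" "\<And>u. 0 \<le> q.speed \<omega> u" "\<And>u. q.speed \<omega> u \<le> C"
    by (rule q.speed_rate[OF \<omega>]) blast
  \<comment> \<open>The rate is known to be close to \<open>k\<close>, and hence at most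
    \<open>K\<close>, on \<open>[0, T]\<close> only; outside it is set to zero.\<close>
  define \<kappa> where "\<kappa> u = indicator {0..T} u * q.speed \<omega> u" for u
  have \<kappa>k: "\<bar>\<kappa> u - k (x u)\<bar> \<le> e" if u: "0 \<le> u" "u \<le> T" for u
  proof -
    have "\<kappa> u = k' (x u)" using u by (simp add: \<kappa>_def q.speed_def x_def)
    moreover have "x u \<le> lam * T + Q0 + 3" using xle[OF u] lamt[OF u] by linarith
    ultimately show ?thesis using k'[OF x0, of u] by simp
  qed
  have rk: "rate \<kappa>"
    unfolding rate_def
  proof (intro conjI allI)
    show "\<kappa> \<in> borel_measurable borel" unfolding \<kappa>_def[abs_def] using sp(1) by measurable
    fix u show "0 \<le> \<kappa> u" using sp(2) by (simp add: \<kappa>_def)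
    show "\<kappa> u \<le> K"
    proof (cases "u \<in> {0..T}")
      case True then show ?thesis using \<kappa>k[of u] kK1[of "x u"] e by auto
    next
      case False then show ?thesis using consts_nonneg by (simp add: \<kappa>_def)
    qed
  qed
  note rkx = rate_k[OF xm]
  have att: "q.attained \<omega> i t = received B \<kappa> i t" if t: "0 \<le> t" "t \<le> T" for i t
    unfolding q.attained_def received_def B_def[symmetric]
    by (rule set_lebesgue_integral_cong) (use t in \<open>auto simp: \<kappa>_def\<close>)
  have rec0: "0 \<le> received B \<kappa> i t" for i t
    unfolding received_def set_lebesgue_integral_def
    by (intro Bochner_Integration.integral_nonneg) (use rateD(2)[OF rk] in \<open>simp add: indicator_def\<close>)
  have \<zeta>card: "\<zeta> t y = (\<Sum>i\<in>{- int (X 0 \<omega>)<..B 0}. indicator {y + received B \<kappa> i t<..} (w i \<omega>)) / real n +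
      (\<Sum>i\<in>{B 0<..B t}. indicator {y + received B \<kappa> i t<..} (v i \<omega>)) / real n"
    if t: "0 \<le> t" "t \<le> T" and y: "0 \<le> y" for t y
  proof -
    let ?p = "\<lambda>i. q.requirement \<omega> i - q.attained \<omega> i t"
    have "\<zeta> t y = real (card {i \<in> q.alive \<omega> t. ?p i \<in> {y<..}}) / real n"
      unfolding \<zeta>_def q.scaled_state_eq[OF \<omega> t(1)] fst_conv by (rule measure_atoms[OF q.finite_alive]) simp
    also have "real (card {i \<in> q.alive \<omega> t. ?p i \<in> {y<..}}) =
        (\<Sum>i\<in>{- int (X 0 \<omega>)<..B t}. indicator {y + received B \<kappa> i t<..} (q.requirement \<omega> i))"
    proof -
      have "{i \<in> q.alive \<omega> t. ?p i \<in> {y<..}} = {- int (X 0 \<omega>)<..B t} \<inter> {i. y + received B \<kappa> i t < q.requirement \<omega> i}"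
        using y att[OF t] by (auto simp: q.alive_def B_def[symmetric])
      then show ?thesis by (simp only:) (simp add: indicator_def)
    qed
    also have "{- int (X 0 \<omega>)<..B t} = {- int (X 0 \<omega>)<..B 0} \<union> {B 0<..B t}"
      using q.initial_range(1)[OF \<omega>] B0 Bge[OF t(1)] by auto
    also have "(\<Sum>i\<in>{- int (X 0 \<omega>)<..B 0} \<union> {B 0<..B t}. indicator {y + received B \<kappa> i t<..} (q.requirement \<omega> i)) =
        (\<Sum>i\<in>{- int (X 0 \<omega>)<..B 0}. indicator {y + received B \<kappa> i t<..} (q.requirement \<omega> i)) +
        (\<Sum>i\<in>{B 0<..B t}. indicator {y + received B \<kappa> i t<..} (q.requirement \<omega> i) :: real)"
      by (rule sum.union_disjoint) auto
    also have "(\<Sum>i\<in>{- int (X 0 \<omega>)<..B 0}. indicator {y + received B \<kappa> i t<..} (q.requirement \<omega> i)) =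
        (\<Sum>i\<in>{- int (X 0 \<omega>)<..B 0}. indicator {y + received B \<kappa> i t<..} (w i \<omega>) :: real)"
      by (rule sum.cong) (auto simp: q.requirement_def B0)
    also have "(\<Sum>i\<in>{B 0<..B t}. indicator {y + received B \<kappa> i t<..} (q.requirement \<omega> i)) =
        (\<Sum>i\<in>{B 0<..B t}. indicator {y + received B \<kappa> i t<..} (v i \<omega>) :: real)"
      by (rule sum.cong) (auto simp: q.requirement_def B0)
    finally show ?thesis by (simp add: add_divide_distrib)
  qed
  have w0: "0 \<le> work \<kappa> 0 t" for t by (rule work_nonneg[OF rk])
  \<comment> \<open>All customers initially in service have received the same work, so their tail at
    time \<open>t\<close> is the initial tail, shifted.\<close>
  have initial: "(\<Sum>i\<in>{- int (X 0 \<omega>)<..B 0}. indicator {y + received B \<kappa> i t<..} (w i \<omega>)) / real n = \<zeta> 0 (y + work \<kappa> 0 t)"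
    if t: "0 \<le> t" "t \<le> T" and y: "0 \<le> y" for t y
  proof -
    have "received B \<kappa> i 0 = 0" if "i \<le> B 0" for i
      using att[OF order_refl T, of i] q.attained_0[OF \<omega>] by simp
    moreover have "received B \<kappa> i t = work \<kappa> 0 t" if "i \<le> B 0" for i by (rule received_initial[OF B rk that])
    ultimately have "(\<Sum>i\<in>{- int (X 0 \<omega>)<..B 0}. indicator {y + received B \<kappa> i t<..} (w i \<omega>)) =
        (\<Sum>i\<in>{- int (X 0 \<omega>)<..B 0}. indicator {(y + work \<kappa> 0 t) + received B \<kappa> i 0<..} (w i \<omega>) :: real)"
      by (intro sum.cong) auto
    then show ?thesis using \<zeta>card[OF order_refl T, of "y + work \<kappa> 0 t"] y w0[of t] by simp
  qed
  \<comment> \<open>The customers that start service up to time \<open>T\<close> have indices above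
    \<open>- int (Q 0 \<omega>)\<close> and at most \<open>E T \<omega>\<close>; this decides how
    large \<open>N\<close> has to be.\<close>
  have NB: "- int N \<le> B 0" "B T \<le> int N"
  proof -
    have Q0b: "real (Q 0 \<omega>) \<le> (Q0 + 1) * real n" "real (E T \<omega>) \<le> (lam * T + 1) * real n"
      using initial_queue arr[OF T order_refl] e n by (auto simp: pos_divide_le_eq[symmetric] abs_le_iff)
    have "(Q0 + 1) * real n \<le> (lam * T + Q0 + 1) * real n" "(lam * T + 1) * real n \<le> (lam * T + Q0 + 1) * real n"
      using lam0 T Q0 n by (auto intro!: mult_right_mono)
    then have "real (Q 0 \<omega>) \<le> real N" "real (E T \<omega>) \<le> real N" using Q0b N by linarith+
    then show "- int N \<le> B 0" "B T \<le> int N" using B0 Bt[OF T] by auto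
  qed
  have est: "\<bar>\<zeta> t y - (flow D \<kappa> t y + G y * D t)\<bar> \<le> e + r" if t: "0 \<le> t" "t \<le> T" and y: "0 \<le> y" for t y
  proof -
    let ?I = "LINT u:{0..t}|lborel. of_int (B u - B 0) * g (y + work \<kappa> u t) * \<kappa> u"
    let ?S = "\<Sum>i\<in>{B 0<..B t}. indicator {y + received B \<kappa> i t<..} (v i \<omega>) :: real"
    have "\<bar>?S - (G y * of_int (B t - B 0) - ?I)\<bar> \<le> real m * c + 2 * real N * (Cg * K * T / real m)"
      by (rule started_customers_estimate[OF B rk NB dev m t y])
    then have "\<bar>?S - (G y * of_int (B t - B 0) - ?I)\<bar> / real n \<le> r"
      unfolding r_def using n by (intro divide_right_mono) auto
    then have scaled: "\<bar>(?S - (G y * of_int (B t - B 0) - ?I)) / real n\<bar> \<le> r"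
      by (simp only: abs_divide abs_of_nat)
    have DI: "(LINT u:{0..t}|lborel. D u * g (y + work \<kappa> u t) * \<kappa> u) = ?I / real n"
      unfolding D_def by (simp flip: set_integral_divide_zero)
    have "(?S - (G y * of_int (B t - B 0) - ?I)) / real n = ?S / real n - (G y * D t - ?I / real n)"
      by (simp only: D_def diff_divide_distrib times_divide_eq_right)
    then have "(?S - (G y * of_int (B t - B 0) - ?I)) / real n =
        ?S / real n - (G y * D t - (LINT u:{0..t}|lborel. D u * g (y + work \<kappa> u t) * \<kappa> u))"
      by (simp only: DI)
    with scaled have "\<bar>?S / real n - (G y * D t - (LINT u:{0..t}|lborel. D u * g (y + work \<kappa> u t) * \<kappa> u))\<bar> \<le> r"
      by (rule back_subst[of "\<lambda>z. \<bar>z\<bar> \<le> r"])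
    moreover have "\<bar>\<zeta> 0 (y + work \<kappa> 0 t) - F (y + work \<kappa> 0 t)\<bar> \<le> e"
      unfolding \<zeta>_def using y w0[of t] by (intro initial_tail) simp
    ultimately show ?thesis unfolding \<zeta>card[OF t y] initial[OF t y] flow_def by linarith
  qed
  have flowd: "\<bar>flow D \<kappa> t y - flow (started x) (\<lambda>u. k (x u)) t y\<bar> \<le> flow_const T M * (T * e) + Cg * K * (2 * T * e)"
    if t: "0 \<le> t" "t \<le> T" for t y
  proof -
    have M0: "0 \<le> M" unfolding M_def using lam0 T Q0 by simp
    have te: "t * e \<le> T * e" using t e by (intro mult_right_mono) auto
    have "\<bar>LINT u:{0..t}|lborel. \<bar>\<kappa> u - k (x u)\<bar>\<bar> \<le> e * (t - 0)"
      by (rule set_integral_abs_const_le[OF rate_diff_integrable[OF rk rkx] _ t(1)]) (use \<kappa>k t in auto)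
    then have 1: "(LINT u:{0..t}|lborel. \<bar>\<kappa> u - k (x u)\<bar>) \<le> T * e" using te by (simp add: mult.commute)
    have i: "set_integrable lborel {0..t} (\<lambda>u. \<bar>D u - started x u\<bar>)"
      by (intro set_integrable_abs set_integral_diff(1) bounded_borel_upto_integrable[OF Db] bounded_borel_upto_integrable[OF sb]) (use t in auto)
    have "\<bar>LINT u:{0..t}|lborel. \<bar>D u - started x u\<bar>\<bar> \<le> (2 * e) * (t - 0)"
    proof (rule set_integral_abs_const_le[OF i _ t(1)])
      fix u assume "u \<in> {0..t}"
      then have "\<bar>started x u - D u\<bar> \<le> 2 * e" using t by (intro Dst) auto
      then show "\<bar>\<bar>D u - started x u\<bar>\<bar> \<le> 2 * e" by linarith
    qed
    then have 2: "(LINT u:{0..t}|lborel. \<bar>D u - started x u\<bar>) \<le> 2 * T * e" using te by (simp add: mult_ac)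
    have "flow_const T M * (LINT u:{0..t}|lborel. \<bar>\<kappa> u - k (x u)\<bar>) \<le> flow_const T M * (T * e)"
      "Cg * K * (LINT u:{0..t}|lborel. \<bar>D u - started x u\<bar>) \<le> Cg * K * (2 * T * e)"
      using 1 2 consts_nonneg M0 T unfolding flow_const_def by (auto intro!: mult_left_mono)
    then show ?thesis using flow_diff[OF Db sb rk rkx t, of y] by linarith
  qed
  have close: "\<bar>\<zeta> t y - psi x t y\<bar> \<le> e'" if t: "0 \<le> t" "t \<le> T" and y: "0 \<le> y" for t y
  proof -
    have "G y * \<bar>started x t - D t\<bar> \<le> 1 * (2 * e)" using Dst[OF t] G_range by (intro mult_mono) auto
    then have "\<bar>G y * started x t - G y * D t\<bar> \<le> 2 * e" using G_range by (simp add: abs_mult flip: right_diff_distrib)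
    moreover have "e' = 3 * e + (flow_const T M * (T * e) + Cg * K * (2 * T * e)) + r"
      by (simp add: e'_def approximation_const_def M_def algebra_simps)
    ultimately show ?thesis using est[OF t y] flowd[OF t, of y] unfolding psi_def by linarith
  qed
  have e2: "2 * e \<le> e'"
  proof -
    have "0 \<le> flow_const T M * (T * e) + Cg * K * (2 * T * e)"
      by (rule order_trans[OF abs_ge_zero flowd[OF order_refl T, of 0]])
    moreover have "0 \<le> r" unfolding r_def using c consts_nonneg T n m by (intro divide_nonneg_nonneg add_nonneg_nonneg mult_nonneg_nonneg) auto
    moreover have "e' = 3 * e + (flow_const T M * (T * e) + Cg * K * (2 * T * e)) + r"
      by (simp add: e'_def approximation_const_def M_def algebra_simps)
    ultimately show ?thesis using e by linarith
  qed
  have head: "x t = max (x t - 1) 0 + \<zeta> t 0" if t: "0 \<le> t" for t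
  proof -
    let ?c = "card {i \<in> q.alive \<omega> t. q.requirement \<omega> i - q.attained \<omega> i t \<in> {0<..}}"
    have "measure (in_service n E v w k' X Q t \<omega>) {0<..} = real ?c"
      using q.emeasure_in_service_alive[OF \<omega> t, of "{0<..}"] by (simp add: measure_def)
    then have "real (X t \<omega>) = real (Q t \<omega>) + real ?c" using q.head_count[OF t \<omega>] by simp
    moreover have "\<zeta> t 0 = real ?c / real n"
      unfolding \<zeta>_def q.scaled_state_eq[OF \<omega> t] fst_conv by (rule measure_atoms[OF q.finite_alive]) simp
    ultimately have "real (X t \<omega>) / real n = real (Q t \<omega>) / real n + \<zeta> t 0" by (simp add: add_divide_distrib)
    then show ?thesis using Qx[OF t] t by (simp add: x_def max_absorb1)
  qed
  have near: "near_solution T e' x"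
    unfolding near_solution_def
  proof
    fix t assume t: "t \<in> {0..T}"
    \<comment> \<open>The queue part of \<open>x\<close> is contained exactly in
      \<open>started x\<close>, so the head count inherits the error of the tail at 0.\<close>
    have "x t - (flow (started x) (\<lambda>u. k (x u)) t 0 + lam * t + Q0) = \<zeta> t 0 - psi x t 0"
      using head[of t] t unfolding psi_def started_def G_0 by auto
    then show "\<bar>x t - (flow (started x) (\<lambda>u. k (x u)) t 0 + lam * t + Q0)\<bar> \<le> e'" using close[of t 0] t by simp
  qed
  have \<zeta>mono: "\<zeta> t y' \<le> \<zeta> t y" if "0 \<le> t" "y \<le> y'" for t y y'
  proof -
    have "fst (scaled_state n E v w k' X Q t \<omega>) \<in> halfline_measures"
      using q.scaled_state_in[OF \<omega> that(1)] by (auto simp: state_space_def)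
    then show ?thesis unfolding \<zeta>_def by (rule halfline_measure_mono) (use that in auto)
  qed
  have "approximate_solution T e' x D \<zeta>"
    unfolding approximate_solution_def
  proof (intro conjI ballI allI impI xm near)
    show "mono_on {0..T} D" by (rule mono_onI) (use B n in \<open>auto simp: D_def mono_def divide_right_mono\<close>)
    fix t assume t: "t \<in> {0..T}"
    show "0 \<le> x t" "x t \<le> lam * t + Q0 + 3" using x0 xle t by auto
    show "\<bar>started x t - D t\<bar> \<le> e'" using Dst[of t] e2 t by auto
    fix y :: real assume y: "0 \<le> y"
    show "0 \<le> \<zeta> t y" by (simp add: \<zeta>_def)
    show "\<bar>\<zeta> t y - psi x t y\<bar> \<le> e'" using close t y by auto
    show "\<zeta> t y' \<le> \<zeta> t y" if "y \<le> y'" for y' using \<zeta>mono t that by auto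
  qed (simp add: D_def)
  moreover have "x = (\<lambda>t. real (X (max t 0) \<omega>) / real n)" by (rule ext) (rule x_def)
  moreover have "D = (\<lambda>t. of_int (last_started E Q (max t 0) \<omega> - last_started E Q 0 \<omega>) / real n)"
    by (rule ext) (simp only: D_def B_def q.started_upto_def max.idem)
  moreover have "\<zeta> = (\<lambda>t y. measure (fst (scaled_state n E v w k' X Q t \<omega>)) {y<..})" by (intro ext) (rule \<zeta>_def)
  ultimately show ?thesis by (simp only: e'_def r_def)
qed

lemma approximate_solution_close:
  assumes X: "fluid_head X" and T: "0 \<le> T"
  obtains C where "0 < C" "\<And>e x D \<zeta> t. approximate_solution T e x D \<zeta> \<Longrightarrow> 0 \<le> t \<Longrightarrow> t \<le> T \<Longrightarrow>
    \<bar>x t - X t\<bar> \<le> C * e \<and> (\<forall>y\<ge>0. \<bar>\<zeta> t y - psi X t y\<bar> \<le> C * e)"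
proof -
  define M where "M = lam * T + Q0 + 3"
  define A where "A = 2 * exp (2 * stability_const T M * T)"
  define S where "S = stability_const T M * T + 1"
  have M: "0 \<le> M" using lam0 Q0 T by (simp add: M_def)
  have A: "0 < A" by (simp add: A_def)
  have S: "1 \<le> S" using stability_const_ge[OF T M] T by (simp add: S_def)
  show thesis
  \<comment> \<open>The sum of three errors: that of the head count, the one it causes in
    \<open>psi\<close>, and that of the tails relative to \<open>psi\<close>. One constant then
    serves both claims.\<close>
  proof (rule that[of "A + S * A + 1"])
    show "0 < A + S * A + 1" using A S by (simp add: add_pos_pos)
    fix e x D \<zeta> t assume a: "approximate_solution T e x D \<zeta>" and t: "0 \<le> t" "t \<le> T"
    have e: "0 \<le> e" using a T unfolding approximate_solution_def by (force intro: order_trans[OF abs_ge_zero])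
    have xb: "bounded_borel_upto T M x"
      unfolding M_def by (rule head_bounded) (use a in \<open>auto simp: approximate_solution_def\<close>)
    have Xb: "bounded_borel_upto T M X" unfolding M_def by (rule fluid_head_bounded[OF X])
    have near: "near_solution T e x" using a by (simp add: approximate_solution_def)
    have d: "\<bar>x u - X u\<bar> \<le> A * e" if "0 \<le> u" "u \<le> T" for u
      using near_solutions_close[OF xb Xb near fluid_head_near[OF X] that] by (simp add: A_def mult_ac)
    have "\<bar>psi x t y - psi X t y\<bar> \<le> S * (A * e)" for y
      unfolding S_def by (rule psi_close[OF xb Xb d t])
    moreover have "\<bar>\<zeta> t y - psi x t y\<bar> \<le> e" if "0 \<le> y" for y using a t that by (auto simp: approximate_solution_def)
    moreover have "(A + S * A + 1) * e = A * e + S * (A * e) + e" by (simp add: algebra_simps)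
    moreover have "0 \<le> A * e" "0 \<le> S * (A * e)" using A S e by (auto intro!: mult_nonneg_nonneg)
    ultimately show "\<bar>x t - X t\<bar> \<le> (A + S * A + 1) * e \<and> (\<forall>y\<ge>0. \<bar>\<zeta> t y - psi X t y\<bar> \<le> (A + S * A + 1) * e)"
      using d[OF t] e by (smt (verit))
  qed
qed

end

section \<open>Convergence to a constant\<close>

context Metric_space
begin

lemma continuous_map_measurable:
  assumes "continuous_map T euclideanreal f"
  shows "f \<in> borel_measurable (borel_of_topology T)"
proof (rule borel_measurableI)
  fix S :: "real set" assume "open S"
  then have "openin T {x \<in> topspace T. f x \<in> S}" using assms by (intro openin_continuous_map_preimage) auto
  then have "{x \<in> topspace T. f x \<in> S} \<in> sigma_sets (topspace T) {U. openin T U}" by (intro sigma_sets.Basic) auto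
  moreover have "f -` S \<inter> topspace T = {x \<in> topspace T. f x \<in> S}" by auto
  moreover have "{U. openin T U} \<subseteq> Pow (topspace T)" by (auto dest: openin_subset)
  ultimately show "f -` S \<inter> space (borel_of_topology T) \<in> sets (borel_of_topology T)"
    by (simp add: borel_of_topology_def space_measure_of sets_measure_of)
qed

lemma continuous_map_dist:
  assumes "a \<in> M"
  shows "continuous_map mtopology euclideanreal (\<lambda>y. d y a)"
    and "continuous_map mtopology euclideanreal (\<lambda>y. min (d y a) 1)"
proof -
  show c: "continuous_map mtopology euclideanreal (\<lambda>y. d y a)"
    using continuous_map_mdist[of mtopology "metric (M, d)" "\<lambda>y. y" "\<lambda>_. a"] assms by simp
  show "continuous_map mtopology euclideanreal (\<lambda>y. min (d y a) 1)"
    by (intro continuous_map_real_min c) auto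
qed

text \<open>The test function \<open>min (d y a) 1\<close> is continuous and bounded and vanishes at
  \<open>a\<close>; Markov's inequality turns its integral into a probability.\<close>

lemma converges_to_constant_imp_prob:
  assumes conv: "converges_to_constant mtopology P X a" and e: "0 < e"
  shows "\<And>n. 1 \<le> n \<Longrightarrow> {\<omega> \<in> space (P n). d (X n \<omega>) a < e} \<in> sets (P n)"
    and "(\<lambda>n. measure (P n) {\<omega> \<in> space (P n). d (X n \<omega>) a < e}) \<longlonglongrightarrow> 1"
    and "\<And>n \<omega>. 1 \<le> n \<Longrightarrow> \<omega> \<in> space (P n) \<Longrightarrow> X n \<omega> \<in> M"
proof -
  have a: "a \<in> M" using conv by simp
  let ?B = "borel_of_topology mtopology"
  have spB: "space ?B = M" using openin_subset[of mtopology] by (auto simp: borel_of_topology_def space_measure_of_conv)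
  have ps: "prob_space (P n)" and Xm: "X n \<in> P n \<rightarrow>\<^sub>M ?B" if "1 \<le> n" for n
    using conv that by (auto simp: converges_in_distribution_def)
  show XM: "X n \<omega> \<in> M" if "1 \<le> n" "\<omega> \<in> space (P n)" for n \<omega>
    using measurable_space[OF Xm[OF that(1)] that(2)] spB by simp
  define f where "f y = min (d y a) 1" for y
  have fc: "continuous_map mtopology euclideanreal f" unfolding f_def[abs_def] by (rule continuous_map_dist(2)[OF a])
  have fm: "f \<in> borel_measurable ?B" by (rule continuous_map_measurable[OF fc])
  have f01: "0 \<le> f y" "f y \<le> 1" for y by (auto simp: f_def)
  have "bounded (f ` topspace mtopology)" unfolding bounded_iff using f01 by (intro exI[of _ 1]) (auto simp: abs_of_nonneg)
  then have "(\<lambda>n. \<integral>\<omega>. f (X n \<omega>) \<partial>P n) \<longlonglongrightarrow> (\<integral>x. f x \<partial>return ?B a)"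
    using conv fc by (auto simp: converges_in_distribution_def)
  also have "(\<integral>x. f x \<partial>return ?B a) = f a" using a spB by (intro integral_return fm) simp
  also have "f a = 0" using a by (simp add: f_def)
  finally have lim: "(\<lambda>n. \<integral>\<omega>. f (X n \<omega>) \<partial>P n) \<longlonglongrightarrow> 0" .
  \<comment> \<open>Below 1 the truncated distance is the true one, so \<open>f y < c\<close>
    implies \<open>d y a < e\<close>.\<close>
  define c where "c = min e 1"
  have c: "0 < c" using e by (simp add: c_def)
  have fX: "(\<lambda>\<omega>. f (X n \<omega>)) \<in> borel_measurable (P n)" if "1 \<le> n" for n by (rule measurable_compose[OF Xm[OF that] fm])
  have lt: "{\<omega> \<in> space (P n). f (X n \<omega>) < c} \<in> sets (P n)" if "1 \<le> n" for n using fX[OF that] by measurable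
  have eq: "d y a < e \<longleftrightarrow> f y < c \<or> d y a < e \<and> 1 \<le> d y a" for y by (auto simp: f_def c_def)
  show em: "{\<omega> \<in> space (P n). d (X n \<omega>) a < e} \<in> sets (P n)" if n: "1 \<le> n" for n
  proof -
    have "(\<lambda>y. d y a) \<in> borel_measurable ?B" by (rule continuous_map_measurable[OF continuous_map_dist(1)[OF a]])
    then have "(\<lambda>\<omega>. d (X n \<omega>) a) \<in> borel_measurable (P n)" by (rule measurable_compose[OF Xm[OF n]])
    then show ?thesis by measurable
  qed
  have "1 - (\<integral>\<omega>. f (X n \<omega>) \<partial>P n) / c \<le> measure (P n) {\<omega> \<in> space (P n). d (X n \<omega>) a < e}" if n: "1 \<le> n" for n
  proof -
    interpret prob_space "P n" by (rule ps[OF n])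
    have "integrable (P n) (\<lambda>\<omega>. f (X n \<omega>))" by (rule integrable_const_bound[of _ 1]) (use fX[OF n] f01 in \<open>auto simp: abs_of_nonneg\<close>)
    then have "prob {\<omega> \<in> space (P n). c \<le> f (X n \<omega>)} \<le> (\<integral>\<omega>. f (X n \<omega>) \<partial>P n) / c"
      by (rule integral_Markov_inequality_measure[where A = "{}"]) (use f01 c in auto)
    moreover have "prob {\<omega> \<in> space (P n). c \<le> f (X n \<omega>)} = 1 - prob {\<omega> \<in> space (P n). f (X n \<omega>) < c}"
    proof -
      have "{\<omega> \<in> space (P n). c \<le> f (X n \<omega>)} = space (P n) - {\<omega> \<in> space (P n). f (X n \<omega>) < c}" by auto
      then show ?thesis using prob_compl[OF lt[OF n]] by simp
    qed
    moreover have "prob {\<omega> \<in> space (P n). f (X n \<omega>) < c} \<le> prob {\<omega> \<in> space (P n). d (X n \<omega>) a < e}"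
      by (rule finite_measure_mono[OF _ em[OF n]]) (use eq in auto)
    ultimately show ?thesis by linarith
  qed
  then have ev: "\<forall>\<^sub>F n in sequentially. 1 - (\<integral>\<omega>. f (X n \<omega>) \<partial>P n) / c \<le> measure (P n) {\<omega> \<in> space (P n). d (X n \<omega>) a < e}"
    by (auto simp: eventually_sequentially)
  have up: "\<forall>\<^sub>F n in sequentially. measure (P n) {\<omega> \<in> space (P n). d (X n \<omega>) a < e} \<le> 1"
    using eventually_ge_at_top[of 1] by eventually_elim (rule prob_space.prob_le_1[OF ps])
  have "(\<lambda>n. 1 - (\<integral>\<omega>. f (X n \<omega>) \<partial>P n) / c) \<longlonglongrightarrow> 1 - 0 / c" by (intro tendsto_intros lim) (use c in simp)
  then have "(\<lambda>n. 1 - (\<integral>\<omega>. f (X n \<omega>) \<partial>P n) / c) \<longlonglongrightarrow> 1" by simp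
  then show "(\<lambda>n. measure (P n) {\<omega> \<in> space (P n). d (X n \<omega>) a < e}) \<longlonglongrightarrow> 1"
    by (rule tendsto_sandwich[OF ev up _ tendsto_const])
qed

text \<open>On \<open>A n\<close> a continuous function is close to its value at \<open>a\<close>,
  and off \<open>A n\<close> boundedness suffices. The events are left open, so that they can be
  assembled from conditions on arrivals, initial state and requirements.\<close>

lemma converges_to_constantI:
  assumes a: "a \<in> M" and ps: "\<And>n. 1 \<le> n \<Longrightarrow> prob_space (P n)"
    and Xm: "\<And>n. 1 \<le> n \<Longrightarrow> X n \<in> P n \<rightarrow>\<^sub>M borel_of_topology mtopology"
    and good: "\<And>e. 0 < e \<Longrightarrow> \<exists>A. (\<forall>n\<ge>1. A n \<in> sets (P n)) \<and> (\<lambda>n. measure (P n) (A n)) \<longlonglongrightarrow> 1 \<and>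
      (\<forall>\<^sub>F n in sequentially. \<forall>\<omega>\<in>A n. d (X n \<omega>) a < e)"
  shows "converges_to_constant mtopology P X a"
proof -
  let ?B = "borel_of_topology mtopology"
  have spB: "space ?B = M" using openin_subset[of mtopology] by (auto simp: borel_of_topology_def space_measure_of_conv)
  have lim: "(\<lambda>n. \<integral>\<omega>. f (X n \<omega>) \<partial>P n) \<longlonglongrightarrow> (\<integral>x. f x \<partial>return ?B a)"
    if f: "continuous_map mtopology euclideanreal f" "bounded (f ` topspace mtopology)" for f
  proof -
    have fm: "f \<in> borel_measurable ?B" by (rule continuous_map_measurable[OF f(1)])
    have ra: "(\<integral>x. f x \<partial>return ?B a) = f a" using a spB by (intro integral_return fm) simp
    obtain C where C: "\<And>y. y \<in> M \<Longrightarrow> \<bar>f y\<bar> \<le> C" using f(2) by (auto simp: bounded_iff)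
    have C0: "0 \<le> C" using C[OF a] by linarith
    show ?thesis
      unfolding ra
    proof (rule LIMSEQ_I)
      fix r :: real assume r: "0 < r"
      have "openin mtopology {y \<in> topspace mtopology. f y \<in> ball (f a) (r / 2)}"
        using f(1) by (intro openin_continuous_map_preimage) auto
      then obtain \<delta> where \<delta>: "0 < \<delta>" "mball a \<delta> \<subseteq> {y \<in> topspace mtopology. f y \<in> ball (f a) (r / 2)}"
        using a r unfolding openin_mtopology by fastforce
      obtain A where A: "\<And>n. 1 \<le> n \<Longrightarrow> A n \<in> sets (P n)" "(\<lambda>n. measure (P n) (A n)) \<longlonglongrightarrow> 1"
        "\<forall>\<^sub>F n in sequentially. \<forall>\<omega>\<in>A n. d (X n \<omega>) a < \<delta>" using good[OF \<delta>(1)] by blast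
      have "\<forall>\<^sub>F n in sequentially. 1 - r / (4 * (C + 1)) < measure (P n) (A n)"
        by (rule order_tendstoD(1)[OF A(2)]) (use r C0 in simp)
      then have "\<forall>\<^sub>F n in sequentially. norm ((\<integral>\<omega>. f (X n \<omega>) \<partial>P n) - f a) < r"
        using A(3) eventually_ge_at_top[of 1]
      proof eventually_elim
        case (elim n)
        interpret prob_space "P n" by (rule ps[OF elim(3)])
        have XM: "X n \<omega> \<in> M" if "\<omega> \<in> space (P n)" for \<omega> using measurable_space[OF Xm[OF elim(3)] that] spB by simp
        have fX: "(\<lambda>\<omega>. f (X n \<omega>)) \<in> borel_measurable (P n)" by (rule measurable_compose[OF Xm[OF elim(3)] fm])
        have i: "integrable (P n) (\<lambda>\<omega>. f (X n \<omega>))" by (rule integrable_const_bound[of _ C]) (use fX C XM in auto)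
        have An: "A n \<in> sets (P n)" by (rule A(1)[OF elim(3)])
        \<comment> \<open>Off \<open>A n\<close> the difference is at most \<open>2 * C\<close>, and
          this set has probability below \<open>r / (4 * (C + 1))\<close>, so it contributes less
          than the second half of \<open>r\<close>.\<close>
        let ?b = "\<lambda>\<omega>. r / 2 + 2 * C * indicator (space (P n) - A n) \<omega>"
        have bi: "integrable (P n) ?b" using An by (intro Bochner_Integration.integrable_add) (auto simp: emeasure_eq_measure)
        have "\<bar>(\<integral>\<omega>. f (X n \<omega>) \<partial>P n) - f a\<bar> = \<bar>\<integral>\<omega>. f (X n \<omega>) - f a \<partial>P n\<bar>"
          using i by (simp add: Bochner_Integration.integral_diff prob_space)
        also have "\<dots> \<le> (\<integral>\<omega>. \<bar>f (X n \<omega>) - f a\<bar> \<partial>P n)" by (rule integral_abs_bound)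
        also have "\<dots> \<le> (\<integral>\<omega>. ?b \<omega> \<partial>P n)"
        proof (rule integral_mono[OF _ bi])
          show "integrable (P n) (\<lambda>\<omega>. \<bar>f (X n \<omega>) - f a\<bar>)" using i by simp
          fix \<omega> assume \<omega>: "\<omega> \<in> space (P n)"
          show "\<bar>f (X n \<omega>) - f a\<bar> \<le> ?b \<omega>"
          proof (cases "\<omega> \<in> A n")
            case True
            then have "X n \<omega> \<in> mball a \<delta>" using elim(2) XM[OF \<omega>] a by (simp add: in_mball commute)
            then have "f (X n \<omega>) \<in> ball (f a) (r / 2)" using \<delta>(2) by blast
            then show ?thesis using True by (simp add: dist_real_def abs_minus_commute)
          next
            case False
            then show ?thesis using C[OF XM[OF \<omega>]] C[OF a] r \<omega> by simp
          qed
        qed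
        also have "\<dots> = r / 2 + 2 * C * (1 - prob (A n))"
          using An by (subst Bochner_Integration.integral_add) (auto simp: emeasure_eq_measure prob_space prob_compl)
        also have "\<dots> \<le> r / 2 + 2 * C * (r / (4 * (C + 1)))"
          using elim(1) C0 by (intro add_left_mono mult_left_mono) auto
        also have "\<dots> < r"
        proof -
          have "2 * C * (r / (4 * (C + 1))) < r / 2" using r C0 by (simp add: field_simps)
          then show ?thesis by simp
        qed
        finally show ?case by simp
      qed
      then show "\<exists>no. \<forall>n\<ge>no. norm ((\<integral>\<omega>. f (X n \<omega>) \<partial>P n) - f a) < r" by (auto simp: eventually_sequentially)
    qed
  qed
  have "prob_space (return ?B a)" using a spB by (intro prob_space_return) simp
  then show ?thesis unfolding converges_in_distribution_def using a ps Xm lim by simp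
qed

end

text \<open>The union has probability at most 1, so the intersection has at least the sum of the two
  probabilities minus 1.\<close>

lemma measure_Int_lim_1:
  assumes ps: "\<And>n. 1 \<le> n \<Longrightarrow> prob_space (P n)"
    and A: "\<And>n. 1 \<le> n \<Longrightarrow> A n \<in> sets (P n)" "(\<lambda>n. measure (P n) (A n)) \<longlonglongrightarrow> 1"
    and B: "\<And>n. 1 \<le> n \<Longrightarrow> B n \<in> sets (P n)" "(\<lambda>n. measure (P n) (B n)) \<longlonglongrightarrow> 1"
  shows "(\<lambda>n. measure (P n) (A n \<inter> B n)) \<longlonglongrightarrow> 1"
proof -
  have "measure (P n) (A n) + measure (P n) (B n) - 1 \<le> measure (P n) (A n \<inter> B n) \<and> measure (P n) (A n \<inter> B n) \<le> 1" if n: "1 \<le> n" for n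
  proof -
    interpret prob_space "P n" by (rule ps[OF n])
    have "prob (A n \<union> B n) = prob (A n) + prob (B n) - prob (A n \<inter> B n)"
      by (rule measure_Un3) (use A(1)[OF n] B(1)[OF n] in \<open>simp_all add: fmeasurable_eq_sets\<close>)
    then show ?thesis using prob_le_1[of "A n \<union> B n"] prob_le_1[of "A n \<inter> B n"] by linarith
  qed
  then have ev: "\<forall>\<^sub>F n in sequentially. measure (P n) (A n) + measure (P n) (B n) - 1 \<le> measure (P n) (A n \<inter> B n)"
    "\<forall>\<^sub>F n in sequentially. measure (P n) (A n \<inter> B n) \<le> 1"
    by (auto simp: eventually_sequentially)
  have "(\<lambda>n. measure (P n) (A n) + measure (P n) (B n) - 1) \<longlonglongrightarrow> 1 + 1 - 1" by (intro tendsto_intros A B)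
  then show ?thesis by (intro tendsto_sandwich[OF ev _ tendsto_const]) simp
qed

text \<open>Since the limit path is Lipschitz, closeness in \<open>J_1\<close> is uniform closeness:
  the time change moves \<open>t\<close> by at most \<open>(exp c - 1) * T\<close>, and the linear
  path changes by \<open>lam\<close> times that.\<close>

lemma skorohod_dist_linear_imp_uniform:
  fixes x :: "real \<Rightarrow> real"
  assumes lam: "0 \<le> lam" and T: "0 \<le> T" and e: "0 < e"
  obtains \<delta> where "0 < \<delta>" "\<And>x t. (\<lambda>t\<in>{0..}. x t) \<in> cadlag_paths {0..} dist \<Longrightarrow>
    skorohod_dist dist (\<lambda>t\<in>{0..}. x t) (\<lambda>t\<in>{0..}. lam * t) < \<delta> \<Longrightarrow> (\<lambda>t\<in>{0..}. lam * t) \<in> cadlag_paths {0..} dist \<Longrightarrow>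
    0 \<le> t \<Longrightarrow> t \<le> T \<Longrightarrow> \<bar>x t - lam * t\<bar> \<le> e"
proof -
  interpret R: Metric_space "{0::real..}" dist by (rule Metric_space_nonneg_reals)
  \<comment> \<open>Half of \<open>e\<close> is for the distance of the paths at matched times, half
    for the displacement of time; the 1 in the denominator covers
    \<open>lam * T = 0\<close>.\<close>
  define c where "c = min 1 (min (e / 2) (ln (1 + e / (2 * (lam * T + 1)))))"
  have lT: "0 \<le> lam * T" using lam T by simp
  have "1 < 1 + e / (2 * (lam * T + 1))" using lT e by simp
  then have c: "0 < c" "c \<le> 1" "c \<le> e / 2" "c \<le> ln (1 + e / (2 * (lam * T + 1)))" using e by (auto simp: c_def ln_gt_zero)
  have "exp c \<le> exp (ln (1 + e / (2 * (lam * T + 1))))" using c(4) by simp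
  also have "\<dots> = 1 + e / (2 * (lam * T + 1))" using \<open>1 < _\<close> by simp
  finally have ec: "exp c - 1 \<le> e / (2 * (lam * T + 1))" by simp
  have ec2: "lam * ((exp c - 1) * T) \<le> e / 2"
  proof -
    have "lam * T * (exp c - 1) \<le> lam * T * (e / (2 * (lam * T + 1)))" by (rule mult_left_mono[OF ec lT])
    also have "\<dots> \<le> (lam * T + 1) * (e / (2 * (lam * T + 1)))" using lT e by (intro mult_right_mono) auto
    also have "\<dots> = e / 2"
    proof -
      have "b * (e / (2 * b)) = e / 2" if "0 < b" for b using that by simp
      then show ?thesis by this (use lT in linarith)
    qed
    finally show ?thesis by (simp add: mult_ac)
  qed
  show thesis
  proof (rule that[of "c * exp (- (T + 1))"])
    show "0 < c * exp (- (T + 1))" using c by simp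
    fix x :: "real \<Rightarrow> real" and t :: real
    assume x: "(\<lambda>t\<in>{0..}. x t) \<in> cadlag_paths {0..} dist" and y: "(\<lambda>t\<in>{0..}. lam * t) \<in> cadlag_paths {0..} dist"
      and s: "skorohod_dist dist (\<lambda>t\<in>{0..}. x t) (\<lambda>t\<in>{0..}. lam * t) < c * exp (- (T + 1))" and t: "0 \<le> t" "t \<le> T"
    obtain l u where l: "l \<in> time_changes" "Sup (log_slopes l) \<le> c" "T \<le> u"
      "\<And>t. 0 \<le> t \<Longrightarrow> t \<le> T \<Longrightarrow> dist ((\<lambda>t\<in>{0..}. x t) t) ((\<lambda>t\<in>{0..}. lam * t) (min (l t) u)) \<le> c"
      by (rule R.skorohod_dist_continuous_limit[OF T c(1,2) x y s]) blast
    define b where "b = min (l t) u"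
    have b0: "0 \<le> b" using time_change_nonneg[OF l(1) t(1)] l(3) T by (simp add: b_def)
    have "\<bar>l t - t\<bar> \<le> (exp c - 1) * t" by (rule time_change_approx[OF l(1,2) t(1)])
    also have "\<dots> \<le> (exp c - 1) * T" using t c(1) by (intro mult_left_mono) auto
    finally have "\<bar>b - t\<bar> \<le> (exp c - 1) * T" using t l(3) unfolding b_def by linarith
    then have "lam * \<bar>b - t\<bar> \<le> lam * ((exp c - 1) * T)" using lam by (rule mult_left_mono)
    then have "\<bar>lam * b - lam * t\<bar> \<le> e / 2" using ec2 lam by (simp add: abs_mult flip: right_diff_distrib)
    moreover have "\<bar>x t - lam * b\<bar> \<le> c" using l(4)[OF t] t b0 by (simp add: dist_real_def b_def)
    ultimately show "\<bar>x t - lam * t\<bar> \<le> e" using c(3) by linarith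
  qed
qed

text \<open>Prohorov closeness permits a shift of the tails and a change of mass by
  \<open>\<eta>\<close>; the Lipschitz bound of the limiting tail pays for the shift.\<close>

lemma halfline_measure_initial_tail:
  assumes H: "\<mu> \<in> halfline_measures" "Z0 \<in> halfline_measures" and c: "prohorov_close \<mu> Z0 \<eta>"
    and F: "\<And>y. 0 \<le> y \<Longrightarrow> measure Z0 {y..} = F y" and FL: "\<And>a b. \<bar>F a - F b\<bar> \<le> LF * \<bar>a - b\<bar>"
    and \<eta>: "0 < \<eta>" and y: "0 \<le> y"
  shows "\<bar>measure \<mu> {y<..} - F y\<bar> \<le> \<eta> + 2 * (LF * \<eta>)"
proof -
  interpret Z0: finite_measure Z0 using H(2) by (simp add: halfline_measures_def finite_borel_measure_def)
  have sZ: "sets Z0 = sets borel"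
    using H(2) by (simp add: halfline_measures_def finite_borel_measure_def finite_borel_measure_axioms_def)
  have LF: "0 \<le> LF" using FL[of 0 1] by simp
  have "measure \<mu> {y<..} \<le> measure \<mu> {y..}" by (rule halfline_measure_mono[OF H(1)]) auto
  also have "\<dots> \<le> measure Z0 {y - \<eta><..} + \<eta>" by (rule prohorov_close_tail_le[OF H c y])
  \<comment> \<open>\<open>y - \<eta>\<close> may be negative, where \<open>F\<close> says nothing
    about the tails; but the negative half-line is a null set.\<close>
  also have "measure Z0 {y - \<eta><..} \<le> measure Z0 ({..<0} \<union> {max (y - \<eta>) 0..})"
    by (rule halfline_measure_mono[OF H(2)]) auto
  also have "\<dots> \<le> measure Z0 {..<0} + measure Z0 {max (y - \<eta>) 0..}"
    by (rule measure_Un_le) (simp_all add: sZ)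
  also have "\<dots> = F (max (y - \<eta>) 0)" using H(2) F[of "max (y - \<eta>) 0"] by (simp add: halfline_measures_def)
  finally have u: "measure \<mu> {y<..} \<le> F (max (y - \<eta>) 0) + \<eta>" by simp
  have "LF * \<bar>max (y - \<eta>) 0 - y\<bar> \<le> LF * \<eta>" using LF y \<eta> by (intro mult_left_mono) auto
  then have u': "measure \<mu> {y<..} \<le> F y + LF * \<eta> + \<eta>" using u FL[of "max (y - \<eta>) 0" y] by linarith
  have "F (y + 2 * \<eta>) = measure Z0 {y + 2 * \<eta>..}" using F[of "y + 2 * \<eta>"] y \<eta> by simp
  also have "\<dots> \<le> measure \<mu> {y + 2 * \<eta> - \<eta><..} + \<eta>"
    by (rule prohorov_close_tail_le[OF H(2,1)]) (use c y \<eta> in \<open>auto simp: prohorov_close_commute\<close>)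
  also have "measure \<mu> {y + 2 * \<eta> - \<eta><..} \<le> measure \<mu> {y<..}"
    by (rule halfline_measure_mono[OF H(1)]) (use \<eta> in auto)
  finally have "F (y + 2 * \<eta>) \<le> measure \<mu> {y<..} + \<eta>" by simp
  moreover have "\<bar>F (y + 2 * \<eta>) - F y\<bar> \<le> 2 * (LF * \<eta>)" using FL[of "y + 2 * \<eta>" y] \<eta> by simp
  moreover have "0 \<le> LF * \<eta>" using LF \<eta> by simp
  ultimately show ?thesis using u' by linarith
qed

lemma (in fluid_data) approximate_solution_mono:
  assumes "approximate_solution T e x D \<zeta>" "e \<le> e'"
  shows "approximate_solution T e' x D \<zeta>"
  using assms unfolding approximate_solution_def near_solution_def by (meson order_trans)

lemma measure_scaled_state_singleton_0: "measure (fst (scaled_state n E v w k X Q t \<omega>)) {0} = 0"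
  by (simp add: scaled_state_def measure_def emeasure_in_service)

section \<open>Events of high probability and the fluid limit\<close>

text \<open>\<open>kK1\<close> leaves a unit of room in the bound \<open>K\<close>, so that prelimit
  rates within 1 of \<open>k\<close> obey it too.\<close>

locale fluid_scaling = fluid_problem +
  fixes P :: "nat \<Rightarrow> 'w measure" and lam\<^sub>n :: "nat \<Rightarrow> real" and E X Q :: "nat \<Rightarrow> real \<Rightarrow> 'w \<Rightarrow> nat"
    and \<nu>\<^sub>n :: "nat \<Rightarrow> real measure" and v w :: "nat \<Rightarrow> int \<Rightarrow> 'w \<Rightarrow> real" and k\<^sub>n :: "nat \<Rightarrow> real \<Rightarrow> real"
  assumes kK1: "\<And>y. k y + 1 \<le> K"
    and queue: "\<And>n. 1 \<le> n \<Longrightarrow> cadlag_queue (P n) n (lam\<^sub>n n) (E n) (\<nu>\<^sub>n n) (v n) (w n) (k\<^sub>n n) (X n) (Q n)"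
    and arrival_limit: "converges_to_constant (skorohod_topology {0..} dist) P
      (\<lambda>n \<omega>. \<lambda>t\<in>{0..}. real (E n t \<omega>) / real n) (\<lambda>t\<in>{0..}. lam * t)"
    and initial_limit: "converges_to_constant State.mtopology P
      (\<lambda>n \<omega>. scaled_state n (E n) (v n) (w n) (k\<^sub>n n) (X n) (Q n) 0 \<omega>) (Z0, Q0)"
    and law_limit: "\<And>y. (\<lambda>n. measure (\<nu>\<^sub>n n) {y<..}) \<longlonglongrightarrow> G y"
    and rate_limit: "\<And>M e. 0 < e \<Longrightarrow> \<forall>\<^sub>F n in sequentially. \<forall>y\<in>{0..M}. \<bar>k\<^sub>n n y - k y\<bar> \<le> e"
begin

definition scaled :: "nat \<Rightarrow> real \<Rightarrow> 'w \<Rightarrow> real measure \<times> real" where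
  "scaled n = scaled_state n (E n) (v n) (w n) (k\<^sub>n n) (X n) (Q n)"

definition scaled_head :: "nat \<Rightarrow> 'w \<Rightarrow> real \<Rightarrow> real" where
  "scaled_head n \<omega> t = real (X n (max t 0) \<omega>) / real n"

definition scaled_started :: "nat \<Rightarrow> 'w \<Rightarrow> real \<Rightarrow> real" where
  "scaled_started n \<omega> t =
    of_int (last_started (E n) (Q n) (max t 0) \<omega> - last_started (E n) (Q n) 0 \<omega>) / real n"

definition scaled_tail :: "nat \<Rightarrow> 'w \<Rightarrow> real \<Rightarrow> real \<Rightarrow> real" where
  "scaled_tail n \<omega> t y = measure (fst (scaled n t \<omega>)) {y<..}"

lemma prob_space_P: "1 \<le> n \<Longrightarrow> prob_space (P n)"
  using queue unfolding cadlag_queue_def many_server_queue_def by blast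

lemma arrivals_close_event:
  assumes T: "0 \<le> T" and e: "0 < e"
  obtains A where "\<And>n. 1 \<le> n \<Longrightarrow> A n \<in> sets (P n)" "(\<lambda>n. measure (P n) (A n)) \<longlonglongrightarrow> 1"
    "\<And>n \<omega> t. 1 \<le> n \<Longrightarrow> \<omega> \<in> A n \<Longrightarrow> 0 \<le> t \<Longrightarrow> t \<le> T \<Longrightarrow> \<bar>real (E n t \<omega>) / real n - lam * t\<bar> \<le> e"
proof -
  interpret R: Metric_space "{0::real..}" dist by (rule Metric_space_nonneg_reals)
  interpret S: Metric_space "cadlag_paths {0::real..} dist" "skorohod_dist dist" by (rule R.Metric_space_skorohod)
  note lim = arrival_limit[unfolded skorohod_topology_def]
  obtain \<delta> where \<delta>: "0 < \<delta>" "\<And>x t. (\<lambda>t\<in>{0..}. x t) \<in> cadlag_paths {0..} dist \<Longrightarrow>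
    skorohod_dist dist (\<lambda>t\<in>{0..}. x t) (\<lambda>t\<in>{0..}. lam * t) < \<delta> \<Longrightarrow> (\<lambda>t\<in>{0..}. lam * t) \<in> cadlag_paths {0..} dist \<Longrightarrow>
    0 \<le> t \<Longrightarrow> t \<le> T \<Longrightarrow> \<bar>x t - lam * t\<bar> \<le> e"
    by (rule skorohod_dist_linear_imp_uniform[OF lam0 T e]) blast
  note ev = S.converges_to_constant_imp_prob[OF lim \<delta>(1)]
  have lin: "(\<lambda>t\<in>{0..}. lam * t) \<in> cadlag_paths {0::real..} dist" using lim by simp
  show thesis
  proof (rule that[OF ev(1) ev(2)])
    fix n \<omega> t assume n: "1 \<le> n" and t: "0 \<le> t" "t \<le> T"
      and "\<omega> \<in> {\<omega> \<in> space (P n). skorohod_dist dist (\<lambda>t\<in>{0..}. real (E n t \<omega>) / real n) (\<lambda>t\<in>{0..}. lam * t) < \<delta>}"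
    then have "\<omega> \<in> space (P n)" "skorohod_dist dist (\<lambda>t\<in>{0..}. real (E n t \<omega>) / real n) (\<lambda>t\<in>{0..}. lam * t) < \<delta>" by auto
    then show "\<bar>real (E n t \<omega>) / real n - lam * t\<bar> \<le> e" by (intro \<delta>(2) ev(3) n lin t)
  qed
qed

lemma initial_close_event:
  assumes e: "0 < e"
  obtains A where "\<And>n. 1 \<le> n \<Longrightarrow> A n \<in> sets (P n)" "(\<lambda>n. measure (P n) (A n)) \<longlonglongrightarrow> 1"
    "\<And>n \<omega> y. 1 \<le> n \<Longrightarrow> \<omega> \<in> A n \<Longrightarrow> 0 \<le> y \<Longrightarrow> \<bar>measure (fst (scaled n 0 \<omega>)) {y<..} - F y\<bar> \<le> e"
    "\<And>n \<omega>. 1 \<le> n \<Longrightarrow> \<omega> \<in> A n \<Longrightarrow> \<bar>real (Q n 0 \<omega>) / real n - Q0\<bar> \<le> e"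
proof -
  \<comment> \<open>Solves \<open>\<eta> + 2 * (LF * \<eta>) = e\<close>, where the left side is the
    bound for the initial tails.\<close>
  define \<eta> where "\<eta> = e / (1 + 2 * LF)"
  have LF: "0 < 1 + 2 * LF" using consts_nonneg by simp
  have \<eta>: "0 < \<eta>" using e LF by (simp add: \<eta>_def)
  have "\<eta> * (1 + 2 * LF) = e" using LF by (simp add: \<eta>_def)
  then have \<eta>e: "\<eta> + 2 * (LF * \<eta>) = e" by (simp add: algebra_simps)
  have \<eta>le: "\<eta> \<le> e" using \<eta>e \<eta> consts_nonneg mult_nonneg_nonneg[of LF \<eta>] by linarith
  note ev = State.converges_to_constant_imp_prob[OF initial_limit \<eta>]
  have close: "state_dist (scaled n 0 \<omega>) (Z0, Q0) < \<eta>" "scaled n 0 \<omega> \<in> state_space"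
    if "1 \<le> n" "\<omega> \<in> {\<omega> \<in> space (P n). state_dist (scaled_state n (E n) (v n) (w n) (k\<^sub>n n) (X n) (Q n) 0 \<omega>) (Z0, Q0) < \<eta>}" for n \<omega>
    using that ev(3)[of n \<omega>] by (auto simp: scaled_def)
  show thesis
  proof (rule that[OF ev(1) ev(2)])
    fix n \<omega> and y :: real
    assume a: "1 \<le> n" "\<omega> \<in> {\<omega> \<in> space (P n). state_dist (scaled_state n (E n) (v n) (w n) (k\<^sub>n n) (X n) (Q n) 0 \<omega>) (Z0, Q0) < \<eta>}"
    obtain m q where mq: "scaled n 0 \<omega> = (m, q)" by fastforce
    have m: "m \<in> halfline_measures" using close(2)[OF a] by (simp add: mq state_space_def)
    have "prohorov_dist m Z0 < \<eta>" "\<bar>q - Q0\<bar> < \<eta>"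
      using close(1)[OF a] state_dist_ge(1)[of m Z0 q Q0] state_dist_ge(2)[of q Q0 m Z0] by (auto simp: mq)
    moreover have "q = real (Q n 0 \<omega>) / real n" using mq by (simp add: scaled_def scaled_state_def)
    ultimately show "\<bar>real (Q n 0 \<omega>) / real n - Q0\<bar> \<le> e" using \<eta>le by simp
    assume y: "0 \<le> y"
    have "\<bar>measure m {y<..} - F y\<bar> \<le> \<eta> + 2 * (LF * \<eta>)"
      using halfline_measure_initial_tail[OF m Z0 prohorov_dist_less[OF m Z0] Z0_tail FL \<eta> y] \<open>prohorov_dist m Z0 < \<eta>\<close> by blast
    then show "\<bar>measure (fst (scaled n 0 \<omega>)) {y<..} - F y\<bar> \<le> e" using \<eta>e by (simp add: mq)
  qed
qed

lemma empirical_close_event: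
  fixes L :: nat
  assumes L: "0 < L" and e: "0 < e"
  obtains A where "\<And>n. 1 \<le> n \<Longrightarrow> A n \<in> sets (P n)" "(\<lambda>n. measure (P n) (A n)) \<longlonglongrightarrow> 1"
    "\<forall>\<^sub>F n in sequentially. \<forall>\<omega>\<in>A n. \<forall>a b y. - int (L * n) \<le> a \<longrightarrow> a \<le> b \<longrightarrow> b \<le> int (L * n) \<longrightarrow> 0 \<le> y \<longrightarrow>
      \<bar>(\<Sum>i\<in>{a<..b}. indicator {y<..} (v n i \<omega>)) - of_int (b - a) * G y\<bar> \<le> e * real n"
proof -
  \<comment> \<open>In the final bound the terms \<open>2 * c n\<close> and
    \<open>4 * real (L * n) * e1\<close> are each half of \<open>e * real n\<close>.\<close>
  define e1 where "e1 = e / (8 * real L)"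
  define c where "c n = e / 4 * real n" for n :: nat
  have e1: "0 < e1" using L e by (simp add: e1_def)
  obtain Y where Y: "finite Y" "\<And>y. 0 \<le> y \<Longrightarrow> \<exists>y1\<in>Y. y1 \<le> y \<and> G y1 \<le> G y + e1"
    "\<And>y. 0 \<le> y \<Longrightarrow> G y \<le> e1 \<or> (\<exists>y2\<in>Y. y \<le> y2 \<and> G y \<le> G y2 + e1)"
    by (rule tail_thresholds[OF e1]) blast
  define bad where "bad n = {\<omega> \<in> space (P n). \<exists>y\<in>Y. \<exists>b\<in>{- int (L * n)..int (L * n)}.
    c n \<le> \<bar>(\<Sum>i\<in>{- int (L * n)<..b}. indicator {y<..} (v n i \<omega>)) - of_int (b + int (L * n)) * measure (\<nu>\<^sub>n n) {y<..}\<bar>}" for n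
  have bad: "bad n \<in> sets (P n)"
    "measure (P n) (bad n) \<le> real (card Y) * (2 * real (L * n) + 1) * (2 * exp (- ((c n)\<^sup>2 / real (L * n))))"
    if n: "1 \<le> n" for n
  proof -
    interpret q: cadlag_queue "P n" n "lam\<^sub>n n" "E n" "\<nu>\<^sub>n n" "v n" "w n" "k\<^sub>n n" "X n" "Q n" by (rule queue[OF n])
    have "0 < L * n" "0 < c n" using L n e by (auto simp: c_def)
    note * = q.empirical_tail_deviation[OF q.requirements_indep q.requirements_law Y(1) this, folded bad_def]
    show "bad n \<in> sets (P n)" by (rule *(1))
    show "measure (P n) (bad n) \<le> real (card Y) * (2 * real (L * n) + 1) * (2 * exp (- ((c n)\<^sup>2 / real (L * n))))"
      by (rule *(2))
  qed
  have "(\<lambda>n. real (card Y) * (2 * real (L * n) + 1) * (2 * exp (- ((c n)\<^sup>2 / real (L * n))))) \<longlonglongrightarrow> 0"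
    unfolding c_def by (rule deviation_bound_lim[OF L]) (use e in simp)
  then have bad0: "(\<lambda>n. measure (P n) (bad n)) \<longlonglongrightarrow> 0"
    by (rule tendsto_0_le[where K = 1]) (use bad(2) in \<open>auto intro!: eventually_sequentiallyI[of 1]\<close>)
  show thesis
  proof (rule that[of "\<lambda>n. space (P n) - bad n"])
    show "space (P n) - bad n \<in> sets (P n)" if "1 \<le> n" for n using bad(1)[OF that] by simp
    have "(\<lambda>n. 1 - measure (P n) (bad n)) \<longlonglongrightarrow> 1 - 0" by (intro tendsto_intros bad0)
    moreover have "\<forall>\<^sub>F n in sequentially. 1 - measure (P n) (bad n) = measure (P n) (space (P n) - bad n)"
      by (rule eventually_sequentiallyI[of 1]) (simp add: prob_space.prob_compl[OF prob_space_P bad(1)])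
    ultimately show "(\<lambda>n. measure (P n) (space (P n) - bad n)) \<longlonglongrightarrow> 1" using Lim_transform_eventually by fastforce
    have "\<forall>\<^sub>F n in sequentially. \<forall>y\<in>Y. dist (measure (\<nu>\<^sub>n n) {y<..}) (G y) < e1"
      by (rule eventually_ball_finite[OF Y(1)]) (use tendstoD[OF law_limit e1] in blast)
    then show "\<forall>\<^sub>F n in sequentially. \<forall>\<omega>\<in>space (P n) - bad n. \<forall>a b y.
      - int (L * n) \<le> a \<longrightarrow> a \<le> b \<longrightarrow> b \<le> int (L * n) \<longrightarrow> 0 \<le> y \<longrightarrow>
      \<bar>(\<Sum>i\<in>{a<..b}. indicator {y<..} (v n i \<omega>)) - of_int (b - a) * G y\<bar> \<le> e * real n"
    proof eventually_elim
      case (elim n)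
      show ?case
      proof (intro ballI allI impI)
        fix \<omega> a b and y :: real
        assume \<omega>: "\<omega> \<in> space (P n) - bad n" and ab: "- int (L * n) \<le> a" "a \<le> b" "b \<le> int (L * n)" and y: "0 \<le> y"
        have "\<bar>(\<Sum>i\<in>{a<..b}. indicator {y<..} (v n i \<omega>)) - of_int (b - a) * G y\<bar> \<le> 2 * c n + 4 * real (L * n) * e1"
        proof (rule uniform_tail_deviation[where p = "\<lambda>y. measure (\<nu>\<^sub>n n) {y<..}", OF Y(2,3) _ _ ab y])
          show "\<bar>measure (\<nu>\<^sub>n n) {y<..} - G y\<bar> \<le> e1" if "y \<in> Y" for y using elim that by (force simp: dist_real_def)
          show "\<bar>(\<Sum>i\<in>{- int (L * n)<..b}. indicator {y<..} (v n i \<omega>)) - of_int (b + int (L * n)) * measure (\<nu>\<^sub>n n) {y<..}\<bar> < c n"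
            if "y \<in> Y" "b \<in> {- int (L * n)..int (L * n)}" for y b
            using \<omega> that unfolding bad_def by (auto simp: not_le)
        qed (use e1 in auto)
        also have "2 * c n + 4 * real (L * n) * e1 = e * real n" using L by (simp add: c_def e1_def)
        finally show "\<bar>(\<Sum>i\<in>{a<..b}. indicator {y<..} (v n i \<omega>)) - of_int (b - a) * G y\<bar> \<le> e * real n" .
      qed
    qed
  qed
qed

lemma approximate_solution_event:
  assumes T: "0 \<le> T" and e: "0 < e"
  obtains A where "\<And>n. 1 \<le> n \<Longrightarrow> A n \<in> sets (P n)" "(\<lambda>n. measure (P n) (A n)) \<longlonglongrightarrow> 1"
    "\<forall>\<^sub>F n in sequentially. \<forall>\<omega>\<in>A n. approximate_solution T e (scaled_head n \<omega>) (scaled_started n \<omega>) (scaled_tail n \<omega>)"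
proof -
  \<comment> \<open>A third of \<open>e\<close> each goes to the errors of arrivals, initial state
    and rate together, to the law of large numbers, and to the width of the blocks.\<close>
  define c0 where "c0 = \<bar>approximation_const T\<bar> + 1"
  define e0 where "e0 = min 1 (e / (3 * c0))"
  obtain L' :: nat where L': "lam * T + Q0 + 1 \<le> real L'" using real_arch_simple by blast
  \<comment> \<open>Up to time \<open>T\<close> all relevant indices are at most
    \<open>L * n\<close> in absolute value; \<open>Suc\<close> makes \<open>L\<close>
    positive.\<close>
  define L where "L = Suc L'"
  have L: "0 < L" "lam * T + Q0 + 1 \<le> real L" using L' by (auto simp: L_def)
  obtain m' :: nat where m': "6 * real L * (Cg * K * T) / e \<le> real m'" using real_arch_simple by blast
  define m where "m = Suc m'"
  have m: "0 < m" "6 * real L * (Cg * K * T) / e \<le> real m" using m' by (auto simp: m_def)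
  \<comment> \<open>The number \<open>m\<close> of blocks is fixed before the precision of the law
    of large numbers, since that error occurs once per block.\<close>
  define \<epsilon> where "\<epsilon> = e / (3 * real m)"
  have c0: "0 < c0" "approximation_const T \<le> c0" by (auto simp: c0_def)
  have e0: "0 < e0" "e0 \<le> 1" "e0 \<le> e / (3 * c0)" using c0 e by (auto simp: e0_def)
  have \<epsilon>: "0 < \<epsilon>" using e m by (simp add: \<epsilon>_def)
  obtain A1 where A1: "\<And>n. 1 \<le> n \<Longrightarrow> A1 n \<in> sets (P n)" "(\<lambda>n. measure (P n) (A1 n)) \<longlonglongrightarrow> 1"
    "\<And>n \<omega> t. 1 \<le> n \<Longrightarrow> \<omega> \<in> A1 n \<Longrightarrow> 0 \<le> t \<Longrightarrow> t \<le> T \<Longrightarrow> \<bar>real (E n t \<omega>) / real n - lam * t\<bar> \<le> e0"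
    by (rule arrivals_close_event[OF T e0(1)]) blast
  obtain A2 where A2: "\<And>n. 1 \<le> n \<Longrightarrow> A2 n \<in> sets (P n)" "(\<lambda>n. measure (P n) (A2 n)) \<longlonglongrightarrow> 1"
    "\<And>n \<omega> y. 1 \<le> n \<Longrightarrow> \<omega> \<in> A2 n \<Longrightarrow> 0 \<le> y \<Longrightarrow> \<bar>measure (fst (scaled n 0 \<omega>)) {y<..} - F y\<bar> \<le> e0"
    "\<And>n \<omega>. 1 \<le> n \<Longrightarrow> \<omega> \<in> A2 n \<Longrightarrow> \<bar>real (Q n 0 \<omega>) / real n - Q0\<bar> \<le> e0"
    by (rule initial_close_event[OF e0(1)]) blast
  obtain A3 where A3: "\<And>n. 1 \<le> n \<Longrightarrow> A3 n \<in> sets (P n)" "(\<lambda>n. measure (P n) (A3 n)) \<longlonglongrightarrow> 1"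
    "\<forall>\<^sub>F n in sequentially. \<forall>\<omega>\<in>A3 n. \<forall>a b y. - int (L * n) \<le> a \<longrightarrow> a \<le> b \<longrightarrow> b \<le> int (L * n) \<longrightarrow> 0 \<le> y \<longrightarrow>
      \<bar>(\<Sum>i\<in>{a<..b}. indicator {y<..} (v n i \<omega>)) - of_int (b - a) * G y\<bar> \<le> \<epsilon> * real n"
    by (rule empirical_close_event[OF L(1) \<epsilon>]) blast
  show thesis
  proof (rule that[of "\<lambda>n. A1 n \<inter> A2 n \<inter> A3 n"])
    show "A1 n \<inter> A2 n \<inter> A3 n \<in> sets (P n)" if "1 \<le> n" for n using A1(1) A2(1) A3(1) that by blast
    have "(\<lambda>n. measure (P n) (A1 n \<inter> A2 n)) \<longlonglongrightarrow> 1"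
      by (rule measure_Int_lim_1[OF prob_space_P A1(1,2) A2(1,2)])
    then show "(\<lambda>n. measure (P n) (A1 n \<inter> A2 n \<inter> A3 n)) \<longlonglongrightarrow> 1"
      by (intro measure_Int_lim_1[OF prob_space_P _ _ A3(1,2)]) (use A1(1) A2(1) in auto)
    show "\<forall>\<^sub>F n in sequentially. \<forall>\<omega>\<in>A1 n \<inter> A2 n \<inter> A3 n.
      approximate_solution T e (scaled_head n \<omega>) (scaled_started n \<omega>) (scaled_tail n \<omega>)"
      using A3(3) rate_limit[OF e0(1), of "lam * T + Q0 + 3"] eventually_ge_at_top[of 1]
    proof eventually_elim
      case (elim n)
      show ?case
      proof
        fix \<omega> assume \<omega>: "\<omega> \<in> A1 n \<inter> A2 n \<inter> A3 n"
        have \<omega>P: "\<omega> \<in> space (P n)" using \<omega> sets.sets_into_space[OF A1(1)[OF elim(3)]] by blast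
        have n: "0 < real n" using elim(3) by simp
        define err where "err = approximation_const T * e0 + (real m * (\<epsilon> * real n) + 2 * real (L * n) * (Cg * K * T / real m)) / real n"
        have "approximate_solution T err (scaled_head n \<omega>) (scaled_started n \<omega>) (scaled_tail n \<omega>)"
          unfolding err_def scaled_head_def[abs_def] scaled_started_def[abs_def] scaled_tail_def[abs_def] scaled_def
        proof (rule queue_path_approximates[OF queue[OF elim(3)] \<omega>P T e0(1,2) _ _ _ _ kK1])
          show "\<bar>measure (fst (scaled_state n (E n) (v n) (w n) (k\<^sub>n n) (X n) (Q n) 0 \<omega>)) {y<..} - F y\<bar> \<le> e0" if "0 \<le> y" for y
            using A2(3)[OF elim(3) _ that, of \<omega>] \<omega> by (simp add: scaled_def)
          show "\<bar>real (Q n 0 \<omega>) / real n - Q0\<bar> \<le> e0" using A2(4)[OF elim(3)] \<omega> by blast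
          show "\<bar>real (E n t \<omega>) / real n - lam * t\<bar> \<le> e0" if "0 \<le> t" "t \<le> T" for t using A1(3)[OF elim(3) _ that] \<omega> by blast
          show "\<bar>k\<^sub>n n y - k y\<bar> \<le> e0" if "0 \<le> y" "y \<le> lam * T + Q0 + 3" for y using elim(2) that by simp
          show "(lam * T + Q0 + 1) * real n \<le> real (L * n)" using L n by simp
          show "\<bar>(\<Sum>i\<in>{a<..b}. indicator {y<..} (v n i \<omega>)) - of_int (b - a) * G y\<bar> \<le> \<epsilon> * real n"
            if "- int (L * n) \<le> a" "a \<le> b" "b \<le> int (L * n)" "0 \<le> y" for a b y
            using elim(1) \<omega> that by blast
        qed (use m \<epsilon> in auto)
        moreover have "err \<le> e"
        proof -
          have "approximation_const T * e0 \<le> c0 * (e / (3 * c0))" using c0 e0 by (intro mult_mono) auto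
          also have "\<dots> = e / 3" using c0 by simp
          finally have 1: "approximation_const T * e0 \<le> e / 3" .
          have "(real m * (\<epsilon> * real n) + 2 * real (L * n) * (Cg * K * T / real m)) / real n =
              real m * \<epsilon> + 2 * real L * (Cg * K * T) / real m" using n by (simp add: field_simps)
          moreover have "real m * \<epsilon> = e / 3" using m by (simp add: \<epsilon>_def)
          moreover have "2 * real L * (Cg * K * T) / real m \<le> e / 3"
            using m e by (simp add: field_simps)
          ultimately show ?thesis using 1 unfolding err_def by linarith
        qed
        ultimately show "approximate_solution T e (scaled_head n \<omega>) (scaled_started n \<omega>) (scaled_tail n \<omega>)"
          by (rule approximate_solution_mono)
      qed
    qed
  qed
qed

text \<open>An event of positive probability is nonempty, and any sample point in it provides an
  approximate solution; so the limit is constructed from the queues themselves.\<close>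

lemma fluid_head_obtain: obtains x where "fluid_head x"
proof (rule fluid_head_exists)
  fix T e :: real assume "0 \<le> T" "0 < e"
  then obtain A where A: "(\<lambda>n. measure (P n) (A n)) \<longlonglongrightarrow> 1"
    "\<forall>\<^sub>F n in sequentially. \<forall>\<omega>\<in>A n. approximate_solution T e (scaled_head n \<omega>) (scaled_started n \<omega>) (scaled_tail n \<omega>)"
    by (rule approximate_solution_event) blast
  have "\<forall>\<^sub>F n in sequentially. 0 < measure (P n) (A n)" by (rule order_tendstoD(1)[OF A(1)]) simp
  then have "\<forall>\<^sub>F n in sequentially. 0 < measure (P n) (A n) \<and>
      (\<forall>\<omega>\<in>A n. approximate_solution T e (scaled_head n \<omega>) (scaled_started n \<omega>) (scaled_tail n \<omega>))"
    using A(2) by eventually_elim simp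
  then obtain n where n: "0 < measure (P n) (A n)"
    "\<forall>\<omega>\<in>A n. approximate_solution T e (scaled_head n \<omega>) (scaled_started n \<omega>) (scaled_tail n \<omega>)"
    unfolding eventually_sequentially by blast
  then have "A n \<noteq> {}" by auto
  then show "\<exists>x D \<zeta>. approximate_solution T e x D \<zeta>" using n(2) by blast
qed (rule that)

lemma converges_to_fluid_path:
  assumes x: "fluid_head x"
  shows "converges_to_constant (skorohod_topology state_space state_dist) P (\<lambda>n \<omega>. \<lambda>t\<in>{0..}. scaled n t \<omega>) (fluid_path x)"
proof -
  interpret S: Metric_space "cadlag_paths state_space state_dist" "skorohod_dist state_dist"
    by (rule State.Metric_space_skorohod)
  note zc = fluid_path_cadlag[OF x]
  show ?thesis
    unfolding skorohod_topology_def
  proof (rule S.converges_to_constantI[OF zc prob_space_P])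
    fix n :: nat assume n: "1 \<le> n"
    show "(\<lambda>\<omega>. \<lambda>t\<in>{0..}. scaled n t \<omega>) \<in> P n \<rightarrow>\<^sub>M borel_of_topology S.mtopology"
      using cadlag_queue.path_measurable[OF queue[OF n]] unfolding skorohod_topology_def scaled_def .
  next
    fix e :: real assume e: "0 < e"
    \<comment> \<open>A horizon beyond which the weight is at most \<open>e / 3\<close>; the
      \<open>max\<close> keeps it nonnegative for large \<open>e\<close>.\<close>
    define T where "T = max 0 (ln (3 / e))"
    have T: "0 \<le> T" by (simp add: T_def)
    have "exp (- T) \<le> exp (- ln (3 / e))" by (simp add: T_def)
    also have "\<dots> = e / 3" using e by (simp add: exp_minus)
    finally have eT: "exp (- T) \<le> e / 3" .
    have e3: "0 < e / 3" using e by simp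
    obtain d where d: "0 < d" "\<And>t m q. 0 \<le> t \<Longrightarrow> t \<le> T \<Longrightarrow> m \<in> halfline_measures \<Longrightarrow> measure m {0} = 0 \<Longrightarrow>
      (\<And>y. 0 \<le> y \<Longrightarrow> \<bar>measure m {y<..} - psi x t y\<bar> \<le> d) \<Longrightarrow> \<bar>q - max (x t - 1) 0\<bar> \<le> d \<Longrightarrow>
      state_dist (m, q) (fluid_path x t) \<le> e / 3"
      by (rule fluid_path_close[OF x T e3]) blast
    obtain C where C: "0 < C" "\<And>e \<xi> D \<zeta> t. approximate_solution T e \<xi> D \<zeta> \<Longrightarrow> 0 \<le> t \<Longrightarrow> t \<le> T \<Longrightarrow>
      \<bar>\<xi> t - x t\<bar> \<le> C * e \<and> (\<forall>y\<ge>0. \<bar>\<zeta> t y - psi x t y\<bar> \<le> C * e)"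
      by (rule approximate_solution_close[OF x T]) blast
    \<comment> \<open>Dividing by the stability constant brings head count and tails within the
      tolerance \<open>d\<close> of \<open>fluid_path_close\<close>.\<close>
    have dC: "0 < d / C" "C * (d / C) = d" using d(1) C(1) by auto
    obtain A where A: "\<And>n. 1 \<le> n \<Longrightarrow> A n \<in> sets (P n)" "(\<lambda>n. measure (P n) (A n)) \<longlonglongrightarrow> 1"
      "\<forall>\<^sub>F n in sequentially. \<forall>\<omega>\<in>A n. approximate_solution T (d / C) (scaled_head n \<omega>) (scaled_started n \<omega>) (scaled_tail n \<omega>)"
      by (rule approximate_solution_event[OF T dC(1)]) blast
    have "\<forall>\<^sub>F n in sequentially. \<forall>\<omega>\<in>A n. skorohod_dist state_dist (\<lambda>t\<in>{0..}. scaled n t \<omega>) (fluid_path x) < e"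
      using A(3) eventually_ge_at_top[of 1]
    proof eventually_elim
      case (elim n)
      interpret q: cadlag_queue "P n" n "lam\<^sub>n n" "E n" "\<nu>\<^sub>n n" "v n" "w n" "k\<^sub>n n" "X n" "Q n" by (rule queue[OF elim(2)])
      show ?case
      proof
        fix \<omega> assume \<omega>: "\<omega> \<in> A n"
        have \<omega>P: "\<omega> \<in> space (P n)" using \<omega> sets.sets_into_space[OF A(1)[OF elim(2)]] by blast
        have ap: "approximate_solution T (d / C) (scaled_head n \<omega>) (scaled_started n \<omega>) (scaled_tail n \<omega>)" using elim(1) \<omega> by blast
        have "skorohod_dist state_dist (\<lambda>t\<in>{0..}. scaled n t \<omega>) (fluid_path x) \<le> e / 3 + exp (- T)"
        proof (rule State.skorohod_dist_le_uniform[OF _ zc])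
          show "(\<lambda>t\<in>{0..}. scaled n t \<omega>) \<in> cadlag_paths state_space state_dist"
            unfolding scaled_def by (rule q.path_cadlag[OF \<omega>P])
          fix t assume t: "0 \<le> t" "t < T"
          then have tT: "t \<le> T" by simp
          note cl = C(2)[OF ap t(1) tT, unfolded dC(2)]
          have eq: "scaled n t \<omega> = (fst (scaled n t \<omega>), real (Q n t \<omega>) / real n)" by (simp add: scaled_def scaled_state_def)
          have "state_dist (fst (scaled n t \<omega>), real (Q n t \<omega>) / real n) (fluid_path x t) \<le> e / 3"
          proof (rule d(2)[OF t(1) tT])
            show "fst (scaled n t \<omega>) \<in> halfline_measures"
              using q.scaled_state_in[OF \<omega>P t(1)] by (auto simp: state_space_def scaled_def)
            show "measure (fst (scaled n t \<omega>)) {0} = 0" unfolding scaled_def by (rule measure_scaled_state_singleton_0)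
            show "\<bar>measure (fst (scaled n t \<omega>)) {y<..} - psi x t y\<bar> \<le> d" if "0 \<le> y" for y
              using cl that by (simp add: scaled_tail_def)
            have "real (Q n t \<omega>) / real n = max (real (X n t \<omega>) - real n) 0 / real n"
              using q.work_conserving[OF t(1) \<omega>P] by simp
            also have "\<dots> = max (scaled_head n \<omega> t - 1) 0"
              using elim(2) t by (simp add: scaled_head_def max_absorb1 max_def field_simps)
            finally show "\<bar>real (Q n t \<omega>) / real n - max (x t - 1) 0\<bar> \<le> d" using cl by linarith
          qed
          then show "state_dist ((\<lambda>t\<in>{0..}. scaled n t \<omega>) t) (fluid_path x t) \<le> e / 3" using eq t(1) by simp
        qed (use e in simp)
        then show "skorohod_dist state_dist (\<lambda>t\<in>{0..}. scaled n t \<omega>) (fluid_path x) < e" using eT e by linarith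
      qed
    qed
    then show "\<exists>A. (\<forall>n\<ge>1. A n \<in> sets (P n)) \<and> (\<lambda>n. measure (P n) (A n)) \<longlonglongrightarrow> 1 \<and>
      (\<forall>\<^sub>F n in sequentially. \<forall>\<omega>\<in>A n. skorohod_dist state_dist (\<lambda>t\<in>{0..}. scaled n t \<omega>) (fluid_path x) < e)"
      using A(1,2) by blast
  qed
qed

lemma fluid_limit:
  "\<exists>z. fluid_solution lam \<nu> k0 Z0 Q0 z \<and> (\<forall>z'. fluid_solution lam \<nu> k0 Z0 Q0 z' \<longrightarrow> z' = z) \<and>
    converges_to_constant (skorohod_topology state_space state_dist) P
      (\<lambda>n \<omega>. \<lambda>t\<in>{0..}. scaled_state n (E n) (v n) (w n) (k\<^sub>n n) (X n) (Q n) t \<omega>) z"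
proof -
  obtain x where x: "fluid_head x" by (rule fluid_head_obtain)
  show ?thesis
    using fluid_path_solution[OF x] fluid_solution_unique[OF x] converges_to_fluid_path[OF x] unfolding scaled_def by blast
qed

end

section \<open>Tails of the initial measure and of the service law\<close>

lemma Lipschitz_max_0:
  fixes f :: "real \<Rightarrow> real"
  assumes "L-lipschitz_on {0..} f"
  shows "\<bar>f (max a 0) - f (max b 0)\<bar> \<le> L * \<bar>a - b\<bar>"
proof -
  have "\<bar>f (max a 0) - f (max b 0)\<bar> \<le> L * \<bar>max a 0 - max b 0\<bar>"
    using lipschitz_onD[OF assms, of "max a 0" "max b 0"] by (simp add: dist_real_def)
  also have "\<dots> \<le> L * \<bar>a - b\<bar>" using lipschitz_on_nonneg[OF assms] by (intro mult_left_mono) auto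
  finally show ?thesis .
qed

lemma halfline_measure_tail_lim:
  assumes "m \<in> halfline_measures"
  shows "((\<lambda>y. measure m {max y 0..}) \<longlongrightarrow> 0) at_top"
proof -
  interpret finite_borel_measure m using assms by (simp add: halfline_measures_def)
  have sm: "sets m = sets borel"
    using assms by (simp add: halfline_measures_def finite_borel_measure_def finite_borel_measure_axioms_def)
  \<comment> \<open>The closed tail at \<open>y\<close> lies in the complement of
    \<open>{..y - 1}\<close>, so the distribution function is taken at the shifted argument.\<close>
  have shift: "filterlim (\<lambda>y::real. y - 1) at_top at_top"
    unfolding filterlim_at_top
  proof
    show "\<forall>\<^sub>F y in at_top. Z \<le> y - 1" for Z :: real
      using eventually_ge_at_top[of "Z + 1"] by eventually_elim simp
  qed
  have "((\<lambda>y. cdf m (y - 1)) \<longlongrightarrow> measure m UNIV) at_top"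
    using filterlim_compose[OF cdf_lim_at_top shift] by (simp add: borel_UNIV)
  then have lim: "((\<lambda>y. measure m UNIV - cdf m (y - 1)) \<longlongrightarrow> 0) at_top"
    using tendsto_diff[OF tendsto_const, of "\<lambda>y. cdf m (y - 1)" "measure m UNIV" at_top "measure m UNIV"] by simp
  have le: "measure m {max y 0..} \<le> measure m UNIV - cdf m (y - 1)" for y
  proof -
    have "measure m (UNIV - {..y - 1}) = measure m UNIV - measure m {..y - 1}"
      using finite_measure_compl[of "{..y - 1}"] sm by (simp add: borel_UNIV)
    moreover have "measure m {max y 0..} \<le> measure m (UNIV - {..y - 1})" by (rule finite_measure_mono) auto
    ultimately show ?thesis by (simp add: cdf_def)
  qed
  show ?thesis
    by (rule tendsto_sandwich[OF _ _ tendsto_const lim]) (simp_all add: le)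
qed

lemma measure_density_halfline:
  fixes g :: "real \<Rightarrow> real"
  assumes \<nu>: "\<nu> = density lborel (\<lambda>x. ennreal (g x) * indicator {0..} x)"
    and g0: "\<And>x. 0 \<le> x \<Longrightarrow> 0 \<le> g x" and L: "L-lipschitz_on {0..} g" and ab: "0 \<le> a"
  shows "measure \<nu> {a..b} = integral {a..b} (\<lambda>x. g (max x 0))"
    and "(\<lambda>x. g (max x 0)) integrable_on {a..b}"
proof -
  have cont: "continuous_on UNIV (\<lambda>x. g (max x 0))"
    by (rule continuous_on_compose2[OF lipschitz_on_continuous_on[OF L]]) (auto intro!: continuous_intros)
  then show "(\<lambda>x. g (max x 0)) integrable_on {a..b}"
    by (intro integrable_continuous_real) (rule continuous_on_subset, auto)
  have meas [measurable]: "(\<lambda>x. g (max x 0)) \<in> borel_measurable borel"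
    by (rule borel_measurable_continuous_onI[OF cont])
  have eq: "ennreal (g x) * indicator {0..} x = ennreal (g (max x 0)) * indicator {0..} x" for x
    by (auto simp: indicator_def max_absorb1)
  have "emeasure \<nu> {a..b} = (\<integral>\<^sup>+x. ennreal (g (max x 0)) * indicator {0..} x * indicator {a..b} x \<partial>lborel)"
    unfolding \<nu> eq by (rule emeasure_density) auto
  also have "\<dots> = (\<integral>\<^sup>+x. ennreal (indicator {a..b} x * g (max x 0)) \<partial>lborel)"
    by (rule nn_integral_cong) (use ab in \<open>auto simp: indicator_def\<close>)
  also have "\<dots> = ennreal (LINT x:{a..b}|lborel. g (max x 0))"
  proof -
    have "set_integrable lborel {a..b} (\<lambda>x. g (max x 0))"
      by (rule borel_integrable_atLeastAtMost') (rule continuous_on_subset[OF cont], auto)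
    then have "integrable lborel (\<lambda>x. indicator {a..b} x * g (max x 0))" by (simp add: set_integrable_def)
    then show ?thesis using g0
      by (subst nn_integral_eq_integral) (auto simp: set_lebesgue_integral_def)
  qed
  also have "(LINT x:{a..b}|lborel. g (max x 0)) = integral {a..b} (\<lambda>x. g (max x 0))"
    by (intro set_borel_integral_eq_integral borel_integrable_atLeastAtMost') (rule continuous_on_subset[OF cont], auto)
  finally have "emeasure \<nu> {a..b} = ennreal (integral {a..b} (\<lambda>x. g (max x 0)))" .
  moreover have "0 \<le> integral {a..b} (\<lambda>x. g (max x 0))" using g0 by (intro integral_nonneg \<open>_ integrable_on _\<close>) auto
  ultimately show "measure \<nu> {a..b} = integral {a..b} (\<lambda>x. g (max x 0))" by (simp add: measure_def)
qed

text \<open>\<open>G\<close> is a primitive of \<open>- g\<close> on the half-line, and a Lipschitz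
  \<open>g\<close> gives the first-order expansion with quadratic remainder that
  \<open>fluid_data\<close> asks for.\<close>

lemma survival_density_bounds:
  fixes g :: "real \<Rightarrow> real"
  assumes \<nu>: "\<nu> = density lborel (\<lambda>x. ennreal (g x) * indicator {0..} x)"
    and g0: "\<And>x. 0 \<le> x \<Longrightarrow> 0 \<le> g x" and L: "L-lipschitz_on {0..} g" and C: "\<And>x. 0 \<le> x \<Longrightarrow> g x \<le> C"
  defines "G \<equiv> \<lambda>y. 1 - measure \<nu> {0..max y 0}"
  shows "\<bar>G a - G b\<bar> \<le> C * \<bar>a - b\<bar>"
    and "0 \<le> a \<Longrightarrow> 0 \<le> b \<Longrightarrow> \<bar>G a - G b + g (max b 0) * (a - b)\<bar> \<le> L * (a - b)\<^sup>2"
proof -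
  let ?g = "\<lambda>x. g (max x 0)"
  have I: "measure \<nu> {a..b} = integral {a..b} ?g" "?g integrable_on {a..b}" if "0 \<le> a" for a b
    using measure_density_halfline[of \<nu> g L a b] \<nu> g0 L that by blast+
  have C0: "0 \<le> C" using g0[of 0] C[of 0] by linarith
  have L0: "0 \<le> L" by (rule lipschitz_on_nonneg[OF L])
  have diff: "G a - G b = integral {a..b} ?g" if "0 \<le> a" "a \<le> b" for a b
    using Henstock_Kurzweil_Integration.integral_combine[of 0 a b ?g] I(1)[of 0] I(2)[of 0] that by (simp add: G_def max_absorb1)
  have nonneg: "0 \<le> integral {a..b} ?g" if "0 \<le> a" for a b using g0 by (intro integral_nonneg I(2) that) auto
  have up: "\<bar>G a - G b\<bar> \<le> C * (b - a)" if ab: "0 \<le> a" "a \<le> b" for a b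
  proof -
    have "integral {a..b} ?g \<le> integral {a..b} (\<lambda>_. C)" by (rule integral_le[OF I(2)[OF ab(1)]]) (use C in auto)
    then show ?thesis using ab nonneg[OF ab(1), of b] diff[OF ab] by (simp add: mult.commute)
  qed
  have Gm: "G y = G (max y 0)" for y by (simp add: G_def)
  have "\<bar>G (max a 0) - G (max b 0)\<bar> \<le> C * \<bar>max a 0 - max b 0\<bar>"
    using up[of "max a 0" "max b 0"] up[of "max b 0" "max a 0"] by (cases "a \<le> b") (auto simp: abs_minus_commute max_def)
  also have "\<dots> \<le> C * \<bar>a - b\<bar>" using C0 by (intro mult_left_mono) auto
  finally show "\<bar>G a - G b\<bar> \<le> C * \<bar>a - b\<bar>" using Gm by simp
  \<comment> \<open>The reference point \<open>c\<close> is free because the expansion is about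
    \<open>b\<close>, which may be either end of the interval.\<close>
  have lin: "\<bar>integral {a..b} ?g - ?g c * (b - a)\<bar> \<le> L * (b - a)\<^sup>2" if ab: "0 \<le> a" "a \<le> b" and c: "c \<in> {a..b}" for a b c
  proof -
    have "integral {a..b} (\<lambda>x. ?g x - ?g c) = integral {a..b} ?g - integral {a..b} (\<lambda>x. ?g c)"
      by (rule Henstock_Kurzweil_Integration.integral_diff[OF I(2)[OF ab(1)]]) auto
    then have eq: "integral {a..b} ?g - ?g c * (b - a) = integral {a..b} (\<lambda>x. ?g x - ?g c)" using ab by (simp add: mult.commute)
    have "norm (integral {a..b} (\<lambda>x. ?g x - ?g c)) \<le> integral {a..b} (\<lambda>x. L * (b - a))"
    proof (rule integral_norm_bound_integral)
      show "(\<lambda>x. ?g x - ?g c) integrable_on {a..b}" by (intro integrable_diff I(2) ab) auto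
      fix x assume x: "x \<in> {a..b}"
      have "\<bar>?g x - ?g c\<bar> \<le> L * \<bar>x - c\<bar>" by (rule Lipschitz_max_0[OF L])
      also have "\<dots> \<le> L * (b - a)" using x c L0 by (intro mult_left_mono) auto
      finally show "norm (?g x - ?g c) \<le> L * (b - a)" by simp
    qed auto
    also have "\<dots> = L * (b - a)\<^sup>2" using ab by (simp add: power2_eq_square)
    finally show ?thesis using eq by simp
  qed
  show "\<bar>G a - G b + g (max b 0) * (a - b)\<bar> \<le> L * (a - b)\<^sup>2" if "0 \<le> a" "0 \<le> b"
  proof (cases "a \<le> b")
    case True
    then show ?thesis using lin[OF that(1) True, of b] diff[OF that(1) True] by (simp add: power2_commute algebra_simps)
  next
    case False
    then have "b \<le> a" by simp
    then show ?thesis using lin[OF that(2) \<open>b \<le> a\<close>, of b] diff[OF that(2) \<open>b \<le> a\<close>]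
      by (simp add: abs_minus_commute algebra_simps)
  qed
qed

text \<open>A law with a density has no atoms, so its distribution function is continuous
  everywhere, and weak convergence gives convergence of the tails at every threshold.\<close>

lemma survival_limits:
  fixes g :: "real \<Rightarrow> real"
  assumes ps: "prob_space \<nu>" and \<nu>: "\<nu> = density lborel (\<lambda>x. ennreal (g x) * indicator {0..} x)"
    and g0: "\<And>x. 0 \<le> x \<Longrightarrow> 0 \<le> g x" and L: "L-lipschitz_on {0..} g"
  shows "measure \<nu> {0} = 0" and "isCont (cdf \<nu>) y"
    and "((\<lambda>y. 1 - measure \<nu> {0..max y 0}) \<longlongrightarrow> 0) at_top" and "1 - measure \<nu> {0..max y 0} = 1 - cdf \<nu> y"
proof -
  interpret prob_space \<nu> by (rule ps)
  have s: "sets \<nu> = sets borel" unfolding \<nu> by simp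
  interpret real_distribution \<nu> by standard (simp_all add: s sets_eq_imp_space_eq[OF s])
  have meas: "(\<lambda>x. ennreal (g x) * indicator {0..} x) \<in> borel_measurable lborel"
  proof -
    have "continuous_on UNIV (\<lambda>x. g (max x 0))"
      by (rule continuous_on_compose2[OF lipschitz_on_continuous_on[OF L]]) (auto intro!: continuous_intros)
    then have [measurable]: "(\<lambda>x. g (max x 0)) \<in> borel_measurable borel" by (rule borel_measurable_continuous_onI)
    have "(\<lambda>x. ennreal (g x) * indicator {0..} x) = (\<lambda>x. ennreal (g (max x 0)) * indicator {0..} x)"
      by (rule ext) (auto simp: indicator_def max_absorb1)
    then show ?thesis by simp
  qed
  have "emeasure \<nu> {..<0} = 0" unfolding \<nu> using meas
    by (subst emeasure_density) (auto intro!: nn_integral_zero' AE_I2 simp: indicator_def)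
  then have neg: "measure \<nu> {..<0} = 0" by (simp add: measure_def)
  have sing: "measure \<nu> {y} = 0" for y
  proof -
    have "emeasure \<nu> {y} = (\<integral>\<^sup>+x. ennreal (g x) * indicator {0..} x * indicator {y} x \<partial>lborel)"
      unfolding \<nu> using meas by (subst emeasure_density) auto
    also have "\<dots> = 0" using AE_lborel_singleton[of y] by (intro nn_integral_zero') (auto simp: indicator_def elim: eventually_mono)
    finally show ?thesis by (simp add: measure_def)
  qed
  then show "measure \<nu> {0} = 0" .
  show "isCont (cdf \<nu>) y" by (simp add: isCont_cdf sing)
  show eq: "1 - measure \<nu> {0..max y 0} = 1 - cdf \<nu> y" for y
  proof (cases "0 \<le> y")
    case True
    have "measure \<nu> ({..<0} \<union> {0..y}) = measure \<nu> {..<0} + measure \<nu> {0..y}" by (rule finite_measure_Union) auto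
    moreover have "{..<0} \<union> {0..y} = {..y}" using True by auto
    ultimately show ?thesis using True neg by (simp add: cdf_def max_absorb1)
  next
    case False
    have "measure \<nu> {..y} \<le> measure \<nu> {..<0}" by (rule finite_measure_mono) (use False in auto)
    then have "cdf \<nu> y = 0" using neg measure_nonneg[of \<nu> "{..y}"] by (simp add: cdf_def)
    then show ?thesis using False sing[of 0] by (simp add: max_def)
  qed
  have "((\<lambda>y. 1 - cdf \<nu> y) \<longlongrightarrow> 1 - 1) at_top" by (intro tendsto_intros cdf_lim_at_top_prob)
  then show "((\<lambda>y. 1 - measure \<nu> {0..max y 0}) \<longlongrightarrow> 0) at_top" by (simp add: eq)
qed

theorem theorem1:
  fixes P :: "nat \<Rightarrow> 'w measure"
    and lam\<^sub>n :: "nat \<Rightarrow> real" and lam :: real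
    and E X Q :: "nat \<Rightarrow> real \<Rightarrow> 'w \<Rightarrow> nat"
    and \<nu>\<^sub>n :: "nat \<Rightarrow> real measure" and \<nu> :: "real measure" and g :: "real \<Rightarrow> real"
    and v w :: "nat \<Rightarrow> int \<Rightarrow> 'w \<Rightarrow> real"
    and k\<^sub>n :: "nat \<Rightarrow> real \<Rightarrow> real" and k :: "real \<Rightarrow> real"
    and Z0 :: "real measure" and Q0 :: real
  assumes model: "\<And>n. 1 \<le> n \<Longrightarrow>
      many_server_queue (P n) n (lam\<^sub>n n) (E n) (\<nu>\<^sub>n n) (v n) (w n) (k\<^sub>n n) (X n) (Q n)"
    and arrival_rate: "0 \<le> lam" "(\<lambda>n. lam\<^sub>n n / real n) \<longlonglongrightarrow> lam"
    and arrival_limit: "converges_to_constant (skorohod_topology {0..} dist) P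
      (\<lambda>n \<omega>. \<lambda>t\<in>{0..}. real (E n t \<omega>) / real n) (\<lambda>t\<in>{0..}. lam * t)"
    and density: "prob_space \<nu>" "\<nu> = density lborel (\<lambda>x. ennreal (g x) * indicator {0..} x)"
      "\<And>x. 0 \<le> x \<Longrightarrow> 0 \<le> g x" "bounded (g ` {0..})" "\<exists>L. L-lipschitz_on {0..} g"
    and requirement_limit: "weak_conv_m \<nu>\<^sub>n \<nu>"
    and initial: "(Z0, Q0) \<in> state_space" "\<exists>L. L-lipschitz_on {0..} (\<lambda>x. measure Z0 {x..})"
    and initial_limit:
      "converges_to_constant (Metric_space.mtopology state_space state_dist) P
        (\<lambda>n \<omega>. scaled_state n (E n) (v n) (w n) (k\<^sub>n n) (X n) (Q n) 0 \<omega>) (Z0, Q0)"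
    and rate_function: "\<And>x. 0 \<le> x \<Longrightarrow> 0 \<le> k x" "bounded (k ` {0..})" "\<exists>L. L-lipschitz_on {0..} k"
    and rate_limit: "\<And>K. compact K \<Longrightarrow> K \<subseteq> {0..} \<Longrightarrow> uniform_limit K k\<^sub>n k sequentially"
  shows "\<exists>z. fluid_solution lam \<nu> k Z0 Q0 z \<and>
    (\<forall>z'. fluid_solution lam \<nu> k Z0 Q0 z' \<longrightarrow> z' = z) \<and>
    converges_to_constant (skorohod_topology state_space state_dist) P
      (\<lambda>n \<omega>. \<lambda>t\<in>{0..}. scaled_state n (E n) (v n) (w n) (k\<^sub>n n) (X n) (Q n) t \<omega>) z"
proof -
  obtain Lk where Lk: "Lk-lipschitz_on {0..} k" using rate_function(3) by blast
  obtain Lg where Lg: "Lg-lipschitz_on {0..} g" using density(5) by blast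
  obtain LF where LF: "LF-lipschitz_on {0..} (\<lambda>x. measure Z0 {x..})" using initial(2) by blast
  obtain Ck where Ck: "\<And>y. 0 \<le> y \<Longrightarrow> k y \<le> Ck"
    using rate_function(2) unfolding bounded_iff by (force dest: abs_le_D1)
  obtain Cg where Cg: "\<And>y. 0 \<le> y \<Longrightarrow> g y \<le> Cg"
    using density(4) unfolding bounded_iff by (force dest: abs_le_D1)
  have Z0: "Z0 \<in> halfline_measures" and Q0: "0 \<le> Q0" using initial(1) by (auto simp: state_space_def)
  interpret \<nu>: prob_space \<nu> by (rule density(1))
  have lims: "measure \<nu> {0} = 0" "isCont (cdf \<nu>) y"
    "((\<lambda>y. 1 - measure \<nu> {0..max y 0}) \<longlongrightarrow> 0) at_top" "1 - measure \<nu> {0..max y 0} = 1 - cdf \<nu> y" for y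
    using survival_limits[of \<nu> g Lg] density(1-3) Lg by blast+
  have bounds: "\<bar>(1 - measure \<nu> {0..max a 0}) - (1 - measure \<nu> {0..max b 0})\<bar> \<le> Cg * \<bar>a - b\<bar>"
    "0 \<le> a \<Longrightarrow> 0 \<le> b \<Longrightarrow>
      \<bar>(1 - measure \<nu> {0..max a 0}) - (1 - measure \<nu> {0..max b 0}) + g (max b 0) * (a - b)\<bar> \<le> Lg * (a - b)\<^sup>2" for a b
    using survival_density_bounds[of \<nu> g Lg Cg a b] density(2,3) Lg Cg by blast+
  \<comment> \<open>All functions are extended to the line by \<open>max y 0\<close>, which keeps
    the Lipschitz constants; the bound \<open>Ck + 1\<close> contains the room required by
    \<open>kK1\<close>.\<close>
  have data: "fluid_data lam Q0 (Ck + 1) Lk Cg Lg LF (\<lambda>y. measure Z0 {max y 0..})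
    (\<lambda>y. 1 - measure \<nu> {0..max y 0}) (\<lambda>y. g (max y 0)) (\<lambda>y. k (max y 0))"
  proof (rule fluid_data.intro)
    show "\<bar>k (max a 0) - k (max b 0)\<bar> \<le> Lk * \<bar>a - b\<bar>" for a b by (rule Lipschitz_max_0[OF Lk])
    show "\<bar>g (max a 0) - g (max b 0)\<bar> \<le> Lg * \<bar>a - b\<bar>" for a b by (rule Lipschitz_max_0[OF Lg])
    show "\<bar>measure Z0 {max a 0..} - measure Z0 {max b 0..}\<bar> \<le> LF * \<bar>a - b\<bar>" for a b
      using Lipschitz_max_0[OF LF, of a b] .
    show "measure Z0 {max b 0..} \<le> measure Z0 {max a 0..}" if "a \<le> b" for a b
      by (rule halfline_measure_mono[OF Z0]) (use that in auto)
    show "((\<lambda>y. measure Z0 {max y 0..}) \<longlongrightarrow> 0) at_top" by (rule halfline_measure_tail_lim[OF Z0])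
    show "k (max y 0) \<le> Ck + 1" for y using Ck[of "max y 0"] by simp
    show "1 - measure \<nu> {0..max 0 0} = (1 :: real)" using lims(1) by simp
  qed (use arrival_rate(1) Q0 rate_function(1) density(3) Cg lims(3) bounds in simp_all)
  have problem: "fluid_problem lam Q0 (Ck + 1) Lk Cg Lg LF (\<lambda>y. measure Z0 {max y 0..})
    (\<lambda>y. 1 - measure \<nu> {0..max y 0}) (\<lambda>y. g (max y 0)) (\<lambda>y. k (max y 0)) Z0 \<nu> k"
    by (rule fluid_problem.intro[OF data], rule fluid_problem_axioms.intro) (simp_all add: Z0 max_absorb1)
  interpret R: Metric_space "{0::real..}" dist by (rule Metric_space_nonneg_reals)
  interpret S: Metric_space "cadlag_paths {0::real..} dist" "skorohod_dist dist" by (rule R.Metric_space_skorohod)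
  have queue: "cadlag_queue (P n) n (lam\<^sub>n n) (E n) (\<nu>\<^sub>n n) (v n) (w n) (k\<^sub>n n) (X n) (Q n)" if n: "1 \<le> n" for n
  proof (rule cadlag_queue.intro[OF model[OF n]], rule cadlag_queue_axioms.intro)
    show "0 < n" using n by simp
    show "(\<lambda>t\<in>{0..}. real (E n t \<omega>) / real n) \<in> cadlag_paths {0..} dist" if "\<omega> \<in> space (P n)" for \<omega>
      by (rule S.converges_to_constant_imp_prob(3)[OF arrival_limit[unfolded skorohod_topology_def] zero_less_one n that])
  qed
  \<comment> \<open>The laws are known to be probability measures for \<open>n \<ge> 1\<close> only,
    hence the detour through an eventual equality.\<close>
  have law: "(\<lambda>n. measure (\<nu>\<^sub>n n) {y<..}) \<longlonglongrightarrow> 1 - measure \<nu> {0..max y 0}" for y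
  proof -
    have "1 - cdf (\<nu>\<^sub>n n) y = measure (\<nu>\<^sub>n n) {y<..}" if n: "1 \<le> n" for n
    proof -
      interpret q: many_server_queue "P n" n "lam\<^sub>n n" "E n" "\<nu>\<^sub>n n" "v n" "w n" "k\<^sub>n n" "X n" "Q n" by (rule model[OF n])
      have "v n 0 \<in> borel_measurable (P n)" using q.requirements_indep unfolding q.indep_vars_def by auto
      then have "prob_space (\<nu>\<^sub>n n)" using q.prob_space_distr q.requirements_law by metis
      moreover have "sets (\<nu>\<^sub>n n) = sets borel" "space (\<nu>\<^sub>n n) = UNIV"
        unfolding q.requirements_law[of 0, symmetric] by simp_all
      ultimately have "measure (\<nu>\<^sub>n n) (UNIV - {..y}) = 1 - measure (\<nu>\<^sub>n n) {..y}"
        using prob_space.prob_compl[of "\<nu>\<^sub>n n" "{..y}"] by simp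
      moreover have "UNIV - {..y} = {y<..}" by auto
      ultimately show ?thesis by (simp add: cdf_def)
    qed
    then have "\<forall>\<^sub>F n in sequentially. 1 - cdf (\<nu>\<^sub>n n) y = measure (\<nu>\<^sub>n n) {y<..}" by (rule eventually_sequentiallyI)
    moreover have "(\<lambda>n. 1 - cdf (\<nu>\<^sub>n n) y) \<longlonglongrightarrow> 1 - cdf \<nu> y"
      using requirement_limit lims(2) unfolding weak_conv_m_def weak_conv_def by (intro tendsto_intros) auto
    ultimately show ?thesis unfolding lims(4) by (rule Lim_transform_eventually[rotated])
  qed
  have rate: "\<forall>\<^sub>F n in sequentially. \<forall>y\<in>{0..M}. \<bar>k\<^sub>n n y - k (max y 0)\<bar> \<le> e" if "0 < e" for M e
  proof -
    have "uniform_limit {0..M} k\<^sub>n k sequentially" by (rule rate_limit) auto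
    from uniform_limitD[OF this that] show ?thesis
      by (rule eventually_mono) (auto simp: dist_real_def max_absorb1 less_imp_le)
  qed
  show ?thesis
  proof (rule fluid_scaling.fluid_limit, rule fluid_scaling.intro[OF problem], rule fluid_scaling_axioms.intro)
    show "k (max y 0) + 1 \<le> Ck + 1" for y using Ck[of "max y 0"] by simp
  qed (fact queue arrival_limit initial_limit law rate)+
qed

end
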